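(* Let $d,m\ge 1$ be integers and $T>0$, $M>0$. Let $f:\mathbb R^d\times[0,T]\to\mathbb R^d$ and $G:\mathbb R^d\times[0,T]\to\mathbb R^{d\times m}$ be continuous in $t$ and such that there are constants $L_f,L_G>0$ with $$\|f(x,t)-f(y,t)\|\le L_f\|x-y\|,\qquad \|G(x,t)-G(y,t)\|\le L_G\|x-y\|\qquad\text{for all }x,y\in\mathbb R^d,\ t\in[0,T].$$ Assume moreover that there exists $k>\frac{d+1}{2}+2$ such that $f\in H^k_{\mathrm{loc}}(\mathbb R^d\times[0,T];\mathbb R^d)$ and $G\in H^k_{\mathrm{loc}}(\mathbb R^d\times[0,T];\mathbb R^{d\times m})$. Let $K\subset\mathbb R^d$ be compact and let $\mathcal U_M=\{u\in L^\infty(0,T;\mathbb R^m):\|u\|_{L^\infty}\le M\}$. For $z_0\in\mathbb R^d$ and $u\in\mathcal U_M$ let $z_{z_0,u}$ be the solution of $$\dot z(t)=f(z(t),t)+G(z(t),t)u(t),\qquad z(0)=z_0 .$$ Then there exists a constant $C=C(T,M,K,f,G)>0$ such that for every pair of integers $P,Q\ge3$ there exist SA-NODE parameters $(\Theta,\Phi)$ of widths $(P,Q)$ such that, for all $z_0\in K$ and $u\in\mathcal U_M$, the solution $y_{z_0,u}$ of the controlled SA-NODE $$\dot y(t)=f_\Theta(y(t),t)+G_\Phi(y(t),t)u(t),\qquad y(0)=z_0,$$ satisfies $$\sup_{t\in[0,T]}\|z_{z_0,u}(t)-y_{z_0,u}(t)\|\le C\left(\frac1{\sqrt P}+\frac1{\sqrt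 Q}\right).$$
   Context: Vectors carry the Euclidean norm; matrices in $\mathbb R^{d\times m}$ carry the operator norm induced by the Euclidean norms on $\mathbb R^m$ and $\mathbb R^d$. Solutions of ODEs with controls $u\in L^\infty$ are absolutely continuous functions on $[0,T]$ satisfying the equation for almost every $t$ (they exist uniquely under the stated Lipschitz hypotheses). $k$ is an integer and $H^k$ is the usual $L^2$-based Sobolev space of order $k$ in the $d+1$ variables $(x,t)$; vector- or matrix-valued functions belong to it if all components do. $H^k_{\mathrm{loc}}(\mathbb R^d\times[0,T])$ denotes functions whose restriction to $[-R,R]^d\times[0,T]$ is in $H^k$ for every $R>0$. $\sigma(s)=\max\{s,0\}$ is the ReLU function and $\boldsymbol\sigma(x)=(\sigma(x_1),\dots,\sigma(x_d))$ for $x\in\mathbb R^d$. SA-NODE parameters of widths $(P,Q)$ are time-independent: $\Theta=(W_i,A_i^1,A_i^2,B_i)_{i=1}^P$ with $W_i\in\mathbb R^d$, $A_i^1\in\mathbb R^{d\times d}$, $A_i^2\in\mathbb R^d$, $B_i\in\mathbb R^d$, and $\Phi=(\widetilde W_j,\widetilde A_j^1,\widetilde A_j^2,\widetilde B_j)_{j=1}^Q$ with $\widetilde W_j\in\mathbb R^{d\times m}$, $\widetilde A_j^1\in\mathbb R^{d\times d}$, $\widetilde A_j^2\in\mathbb R^d$, $\widetilde B_j\in\mathbb R^d$. The associated networks are $$f_\Theta(y,t)=\sum_{i=1}^P W_i\circ\boldsymbol\sigma(A_i^1y+A_i^2t+B_i)\in\mathbb R^d,\qquad G_\Phi(y,t)=\sum_{j=1}^Q\widetilde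 W_j\circ\boldsymbol\sigma(\widetilde A_j^1y+\widetilde A_j^2t+\widetilde B_j)\in\mathbb R^{d\times m}.$$ For vectors $v,w\in\mathbb R^d$, $v\circ w$ is the entrywise (Hadamard) product; for a matrix $W\in\mathbb R^{d\times m}$ and a vector $v\in\mathbb R^d$, $W\circ v\in\mathbb R^{d\times m}$ is the row-wise product $(W\circ v)_{k\ell}=W_{k\ell}v_k$. *)

theory Defs
  imports "HOL-Analysis.Analysis" "HOL-Probability.Essential_Supremum"
begin

section \<open>Sobolev spaces\<close>

definition partial_deriv :: "'a::euclidean_space \<Rightarrow> ('a \<Rightarrow> real) \<Rightarrow> 'a \<Rightarrow> real" where
  "partial_deriv b \<phi> x = frechet_derivative \<phi> (at x) b"

text \<open>A multi-index of order \<open>n\<close> is encoded as a list of \<open>n\<close> coordinate directions (elements of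
  \<open>Basis\<close>). Several lists encode the same multi-index, but this is harmless because the
  partial derivatives of a smooth function commute.\<close>

fun iter_partial :: "'a::euclidean_space list \<Rightarrow> ('a \<Rightarrow> real) \<Rightarrow> 'a \<Rightarrow> real" where
  "iter_partial [] \<phi> = \<phi>"
| "iter_partial (b # bs) \<phi> = partial_deriv b (iter_partial bs \<phi>)"

definition smooth :: "('a::euclidean_space \<Rightarrow> real) \<Rightarrow> bool" where
  "smooth \<phi> \<longleftrightarrow> (\<forall>bs. set bs \<subseteq> Basis \<longrightarrow> (\<forall>x. iter_partial bs \<phi> differentiable (at x)))"

definition test_functions :: "'a::euclidean_space set \<Rightarrow> ('a \<Rightarrow> real) set" where
  "test_functions \<Omega> =
     {\<phi>. smooth \<phi> \<and> compact (closure {x. \<phi> x \<noteq> 0}) \<and> closure {x. \<phi> x \<noteq> 0} \<subseteq> \<Omega>}"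

definition square_integrable_on :: "('a::euclidean_space \<Rightarrow> real) \<Rightarrow> 'a set \<Rightarrow> bool"
    (infix "square'_integrable'_on" 50) where
  "u square_integrable_on \<Omega> \<longleftrightarrow>
     u \<in> borel_measurable (lebesgue_on \<Omega>) \<and> integrable (lebesgue_on \<Omega>) (\<lambda>x. (u x)\<^sup>2)"

definition has_weak_deriv ::
    "('a::euclidean_space \<Rightarrow> real) \<Rightarrow> 'a list \<Rightarrow> ('a \<Rightarrow> real) \<Rightarrow> 'a set \<Rightarrow> bool" where
  "has_weak_deriv u bs v \<Omega> \<longleftrightarrow>
     (\<forall>\<phi>\<in>test_functions \<Omega>.
        (LINT x|lebesgue_on \<Omega>. u x * iter_partial bs \<phi> x) =
        (-1) ^ length bs * (LINT x|lebesgue_on \<Omega>. v x * \<phi> x))"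

definition sobolev_H :: "nat \<Rightarrow> 'a::euclidean_space set \<Rightarrow> ('a \<Rightarrow> real) set" where
  "sobolev_H k \<Omega> = {u. u square_integrable_on \<Omega> \<and>
     (\<forall>bs. set bs \<subseteq> Basis \<and> length bs \<le> k \<longrightarrow>
        (\<exists>v. v square_integrable_on \<Omega> \<and> has_weak_deriv u bs v \<Omega>))}"

text \<open>The Sobolev space of a closed box is that of its interior, so the test functions are
  supported in the open box \<open>(-R, R)\<^sup>d \<times> (0, T)\<close> (\<open>box\<close> is the open box).\<close>

definition sobolev_H_loc :: "nat \<Rightarrow> real \<Rightarrow> ((real ^ 'd) \<Rightarrow> real \<Rightarrow> real) set" where
  "sobolev_H_loc k T = {g. \<forall>R>0.
     (\<lambda>(x, t). g x t) \<in> sobolev_H k (box ((\<chi> i. - R), 0) ((\<chi> i. R), T))}"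

section \<open>Controlled differential equations\<close>

definition abs_continuous_on :: "real set \<Rightarrow> (real \<Rightarrow> 'a::real_normed_vector) \<Rightarrow> bool" where
  "abs_continuous_on S z \<longleftrightarrow>
     (\<forall>\<epsilon>>0. \<exists>\<delta>>0. \<forall>D. finite D \<and> (\<forall>(a, b)\<in>D. a \<le> b \<and> {a..b} \<subseteq> S) \<and>
        pairwise (\<lambda>(a, b) (a', b'). {a<..<b} \<inter> {a'<..<b'} = {}) D \<and>
        (\<Sum>(a, b)\<in>D. b - a) < \<delta>
        \<longrightarrow> (\<Sum>(a, b)\<in>D. norm (z b - z a)) < \<epsilon>)"

definition controls :: "real \<Rightarrow> real \<Rightarrow> (real \<Rightarrow> real ^ 'm) set" where
  "controls T M = {u. u \<in> borel_measurable (lebesgue_on {0<..<T}) \<and>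
     esssup (lebesgue_on {0<..<T}) (\<lambda>t. ereal (norm (u t))) \<le> ereal M}"

definition solves :: "real \<Rightarrow> ('a::real_normed_vector \<Rightarrow> real \<Rightarrow> 'a) \<Rightarrow> 'a \<Rightarrow> (real \<Rightarrow> 'a) \<Rightarrow> bool" where
  "solves T F z0 z \<longleftrightarrow> abs_continuous_on {0..T} z \<and> z 0 = z0 \<and>
     (AE t in lebesgue_on {0..T}. (z has_vector_derivative F (z t) t) (at t within {0..T}))"

text \<open>Expresses that \<open>z\<close> is \<^emph>\<open>the\<close> solution; since functions are total, uniqueness refers
  to the values on \<open>[0, T]\<close> only.\<close>

definition is_the_solution ::
    "real \<Rightarrow> ('a::real_normed_vector \<Rightarrow> real \<Rightarrow> 'a) \<Rightarrow> 'a \<Rightarrow> (real \<Rightarrow> 'a) \<Rightarrow> bool" where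
  "is_the_solution T F z0 z \<longleftrightarrow> solves T F z0 z \<and>
     (\<forall>z'. solves T F z0 z' \<longrightarrow> (\<forall>t\<in>{0..T}. z' t = z t))"

definition controlled_field ::
    "((real ^ 'd) \<Rightarrow> real \<Rightarrow> real ^ 'd) \<Rightarrow> ((real ^ 'd) \<Rightarrow> real \<Rightarrow> real ^ 'm ^ 'd) \<Rightarrow>
     (real \<Rightarrow> real ^ 'm) \<Rightarrow> (real ^ 'd) \<Rightarrow> real \<Rightarrow> real ^ 'd" where
  "controlled_field f G u x t = f x t + G x t *v u t"

definition op_norm :: "real ^ 'm ^ 'd \<Rightarrow> real" where
  "op_norm A = onorm (\<lambda>v. A *v v)"

section \<open>SA-NODE networks\<close>

definition relu :: "real ^ 'd \<Rightarrow> real ^ 'd" where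
  "relu x = (\<chi> i. max (x $ i) 0)"

definition hadamard_rows :: "real ^ 'm ^ 'd \<Rightarrow> real ^ 'd \<Rightarrow> real ^ 'm ^ 'd" where
  "hadamard_rows W v = (\<chi> k l. W $ k $ l * v $ k)"

text \<open>A neuron is a tuple \<open>(W, A\<^sup>1, A\<^sup>2, B)\<close>; the parameters of a network of width \<open>P\<close> are a
  list of \<open>P\<close> neurons. Multiplication on the vector type is the entrywise
  product.\<close>

type_synonym ('w, 'd) neuron = "'w \<times> (real ^ 'd ^ 'd) \<times> (real ^ 'd) \<times> (real ^ 'd)"

definition sa_node_f ::
    "(real ^ 'd, 'd) neuron list \<Rightarrow> (real ^ 'd) \<Rightarrow> real \<Rightarrow> real ^ 'd" where
  "sa_node_f \<Theta> y t =
     (\<Sum>(W, A1, A2, B)\<leftarrow>\<Theta>. W * relu (A1 *v y + t *\<^sub>R A2 + B))"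

definition sa_node_G ::
    "(real ^ 'm ^ 'd, 'd) neuron list \<Rightarrow> (real ^ 'd) \<Rightarrow> real \<Rightarrow> real ^ 'm ^ 'd" where
  "sa_node_G \<Phi> y t =
     (\<Sum>(W, A1, A2, B)\<leftarrow>\<Phi>. hadamard_rows W (relu (A1 *v y + t *\<^sub>R A2 + B)))"

end

theory Submission
  imports Defs
begin

text \<open>The networks replace the field uniformly on a compact set and
  have Lipschitz constants that do not depend on their width, so Gronwall's inequality transfers the
  approximation rate to the trajectories.

  The rate \<open>1 / sqrt N\<close> for \<open>N\<close> neurons comes from Maurey's argument: a function in the closed hull of
  ReLU ridge functions with total weight \<open>C\<close> is uniformly within \<open>O(C / sqrt N)\<close> of an average of \<open>N\<close> of
  them. Random signs halve such a combination repeatedly, and the error of each halving is a Rademacher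
  average, bounded without a logarithm by the contraction principle.

  A cosine of frequency \<open>\<xi>\<close> is in this hull with weight \<open>O(1 + |\<xi>|^2)\<close>, so it remains to write each
  component, near the compact set, as a Fourier series with \<open>\<Sum> (1 + |\<xi>|^2) |c(\<xi>)| < \<infinity>\<close>. By
  Cauchy--Schwarz this follows for \<open>k > (d + 1) / 2 + 2\<close> if the component has an extension of
  class \<open>H^k\<close> with compact support. The function is only given for times in \<open>[0, T]\<close>, hence it is
  cut off near one end of the interval and reflected across the other; the Fourier coefficients of the
  extension are integrals of the function against combinations of exponentials that vanish
  to order \<open>k\<close> on the boundary, which justifies the integration by parts.\<close>

text \<open>The total weight, the sum of |c| |v| over the ridge functions, gives both the uniform
  rate and the Lipschitz constant of a network. The rate is needed only in a fixed ball that
  contains the exact trajectories; the network's own trajectory may leave it.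

  The threshold on \<open>k\<close> is the convergence of \<Sum> (1 + |\<xi>|^2)^(2 - k) over a
  lattice of dimension d + 1, that is 2 (k - 2) > d + 1. Pure derivatives in the coordinate
  directions suffice, as |\<xi>|^(2k) is dominated by the sum of the k-th powers of the squared
  coordinates.

  The obstacle is the end of the time interval: weak derivatives are tested only with functions
  supported inside the open box, but exponentials do not vanish at time 0. The reflection uses the
  factors 1 - 2j because they are integers: dilated exponentials keep the period, so Bessel's
  inequality still applies. The binomial weights form a k-th finite difference, whence the vanishing
  to order \<open>k\<close>.

  In the network for \<open>G\<close> the columns share the activations of a neuron, so they divide
  the width \<open>Q\<close> among themselves. A share may be 0, hence error bounds of the form D /
  sqrt (N + 1).\<close>

section \<open>Absolutely continuous functions\<close>

lemma abs_continuous_onE: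
  assumes "abs_continuous_on S z" and "e > 0"
  obtains d where "d > 0" "\<And>D. finite D \<and> (\<forall>(a, b)\<in>D. a \<le> b \<and> {a..b} \<subseteq> S) \<and>
        pairwise (\<lambda>(a, b) (a', b'). {a<..<b} \<inter> {a'<..<b'} = {}) D \<and> (\<Sum>(a, b)\<in>D. b - a) < d
        \<Longrightarrow> (\<Sum>(a, b)\<in>D. norm (z b - z a)) < e"
proof -
  note * = mp[OF spec[OF assms(1)[unfolded abs_continuous_on_def], of e] assms(2)]
  show thesis
    by (rule exE[OF *], elim conjE, rule that, assumption, drule spec, erule mp)
qed

lemma abs_continuous_on_imp_continuous_on:
  assumes "abs_continuous_on S z" and "convex S"
  shows "continuous_on S z"
  unfolding continuous_on_iff
proof (intro ballI allI impI)
  fix x e :: real assume x: "x \<in> S" and e: "e > 0"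
  obtain d where d: "d > 0" "\<And>D. finite D \<and> (\<forall>(a, b)\<in>D. a \<le> b \<and> {a..b} \<subseteq> S) \<and>
        pairwise (\<lambda>(a, b) (a', b'). {a<..<b} \<inter> {a'<..<b'} = {}) D \<and> (\<Sum>(a, b)\<in>D. b - a) < d
        \<Longrightarrow> (\<Sum>(a, b)\<in>D. norm (z b - z a)) < e"
    by (rule abs_continuous_onE[OF assms(1) e]) (rule that)
  have "dist (z y) (z x) < e" if y: "y \<in> S" "dist y x < d" for y
  proof -
    have "{min x y..max x y} \<subseteq> S"
      using assms(2) x y(1)
      by (auto simp: min_def max_def convex_contains_segment closed_segment_eq_real_ivl split: if_splits)
    then have "(\<Sum>(a, b)\<in>{(min x y, max x y)}. norm (z b - z a)) < e"
      using y(2) by (intro d(2)) (auto simp: pairwise_def dist_real_def)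
    then show ?thesis by (auto simp: min_def max_def dist_norm norm_minus_commute split: if_splits)
  qed
  then show "\<exists>d>0. \<forall>y\<in>S. dist y x < d \<longrightarrow> dist (z y) (z x) < e" using d(1) by blast
qed

text \<open>On the exceptional null set the gauge forces the intervals into an open set of small measure,
  where absolute continuity bounds the increments directly.\<close>

lemma abs_continuous_on_has_integral:
  fixes z :: "real \<Rightarrow> 'a::banach"
  assumes ac: "abs_continuous_on {a..b} z" and ab: "a \<le> b" and N: "negligible N"
    and deriv: "\<And>t. t \<in> {a..b} - N \<Longrightarrow> (z has_vector_derivative g t) (at t within {a..b})"
  shows "(g has_integral (z b - z a)) {a..b}"
proof -
  \<comment> \<open>The value 0 on \<open>N\<close> removes tags in the exceptional set from the
    Riemann sums; the integral does not see this change.\<close>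
  define h where "h t = (if t \<in> N then 0 else g t)" for t
  have "(h has_integral (z b - z a)) {a..b}"
    unfolding has_integral_real
  proof (intro allI impI)
    fix e :: real assume e: "e > 0"
    obtain d where d: "d > 0" "\<And>D. finite D \<and> (\<forall>(u, v)\<in>D. u \<le> v \<and> {u..v} \<subseteq> {a..b}) \<and>
        pairwise (\<lambda>(u, v) (u', v'). {u<..<v} \<inter> {u'<..<v'} = {}) D \<and> (\<Sum>(u, v)\<in>D. v - u) < d
        \<Longrightarrow> (\<Sum>(u, v)\<in>D. norm (z v - z u)) < e / 2"
      by (rule abs_continuous_onE[OF ac half_gt_zero[OF e]]) (rule that)
    obtain U where U: "open U" "N \<subseteq> U" "U - N \<in> lmeasurable" "emeasure lebesgue (U - N) < ennreal d"
      using sets_lebesgue_outer_open[OF negligible_imp_sets[OF N] d(1)] by metis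
    have U': "U \<in> lmeasurable" "measure lebesgue U < d"
    proof -
      have U_eq: "U = (U - N) \<union> N" using U(2) by auto
      show m: "U \<in> lmeasurable"
        by (subst U_eq) (intro fmeasurable.Un U(3) negligible_imp_measurable N)
      have "measure lebesgue U = measure lebesgue (U - N)"
        by (rule measure_negligible_symdiff[OF U(3), symmetric, THEN sym])
          (use N U(2) in \<open>auto intro: negligible_subset\<close>)
      also have "\<dots> < d"
        using U(3,4) d(1) by (simp add: emeasure_eq_measure2 ennreal_less_iff)
      finally show "measure lebesgue U < d" .
    qed
    \<comment> \<open>A slope error \<open>c\<close> costs \<open>c * (b - a) < e / 2\<close> over a
      whole division; the added 1 covers \<open>a = b\<close>.\<close>
    define c where "c = e / (2 * (b - a + 1))"
    have c: "c > 0" using e ab by (simp add: c_def)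
    have "\<exists>r>0. (t \<in> N \<longrightarrow> ball t r \<subseteq> U) \<and> (t \<in> {a..b} - N \<longrightarrow>
      (\<forall>y\<in>{a..b}. \<bar>y - t\<bar> < r \<longrightarrow> norm (z y - z t - (y - t) *\<^sub>R g t) \<le> c * \<bar>y - t\<bar>))" for t
    proof (cases "t \<in> N")
      case True
      then show ?thesis using U(1,2) open_contains_ball by blast
    next
      case False
      show ?thesis
      proof (cases "t \<in> {a..b}")
        case True
        then have "(z has_vector_derivative g t) (at t within {a..b})" using deriv False by blast
        then show ?thesis using False c
          unfolding has_vector_derivative_def has_derivative_within_alt by auto
      qed (use False in \<open>auto intro: exI[of _ 1]\<close>)
    qed
    then obtain r where r: "\<And>t. r t > 0" "\<And>t. t \<in> N \<Longrightarrow> ball t (r t) \<subseteq> U"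
      "\<And>t y. t \<in> {a..b} - N \<Longrightarrow> y \<in> {a..b} \<Longrightarrow> \<bar>y - t\<bar> < r t \<Longrightarrow> norm (z y - z t - (y - t) *\<^sub>R g t) \<le> c * \<bar>y - t\<bar>"
      by metis
    have "norm ((\<Sum>(x, k)\<in>p. measure lborel k *\<^sub>R h x) - (z b - z a)) < e"
      if p: "p tagged_division_of {a..b}" and fine: "(\<lambda>t. ball t (r t)) fine p" for p
    proof -
      note pD = tagged_division_ofD[OF p]
      have iv: "\<exists>u v. k = {u..v} \<and> u \<le> x \<and> x \<le> v \<and> a \<le> u \<and> v \<le> b \<and> Inf k = u \<and> Sup k = v \<and> measure lborel k = v - u"
        if "(x, k) \<in> p" for x k
      proof -
        have "\<exists>u v. k = cbox u v" by (rule pD(4)[OF that])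
        then obtain u v where k: "k = cbox u v" by blast
        have "x \<in> k" "k \<subseteq> {a..b}" using pD(2,3)[OF that] by auto
        then show ?thesis using k by (intro exI[of _ u] exI[of _ v]) auto
      qed
      define err where "err = (\<lambda>(x, k). measure lborel k *\<^sub>R h x - (z (Sup k) - z (Inf k)))"
      \<comment> \<open>Degenerate intervals are left out: they contribute nothing, and positive
        length makes the map from tagged intervals to pairs of endpoints injective.\<close>
      define pN where "pN = {(x, k) \<in> p. x \<in> N \<and> measure lborel k > 0}"
      have fin: "finite p" by (rule pD(1))
      have "(\<Sum>(x, k)\<in>p. measure lborel k *\<^sub>R h x) - (z b - z a) = (\<Sum>(x, k)\<in>p. measure lborel k *\<^sub>R h x) - (\<Sum>(x, k)\<in>p. z (Sup k) - z (Inf k))"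
        by (simp only: additive_tagged_division_1[OF ab p])
      also have "\<dots> = (\<Sum>xk\<in>p. err xk)"
        unfolding err_def sum_subtractf[symmetric] by (intro sum.cong) auto
      also have "\<dots> = sum err (p - pN) + sum err pN"
        using fin by (subst sum.subset_diff[of pN p]) (auto simp: pN_def)
      finally have split: "(\<Sum>(x, k)\<in>p. measure lborel k *\<^sub>R h x) - (z b - z a) = sum err (p - pN) + sum err pN" .
      have "norm (sum err (p - pN)) \<le> (\<Sum>(x, k)\<in>p - pN. c * measure lborel k)"
      proof (rule sum_norm_le, clarify)
        fix x k assume xk: "(x, k) \<in> p" "(x, k) \<notin> pN"
        obtain u v where uv: "k = {u..v}" "u \<le> x" "x \<le> v" "a \<le> u" "v \<le> b" "Inf k = u" "Sup k = v" "measure lborel k = v - u"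
          using iv[OF xk(1)] by blast
        show "norm (err (x, k)) \<le> c * measure lborel k"
        proof (cases "x \<in> N")
          case True
          then have "u = v" using xk uv by (auto simp: pN_def)
          then show ?thesis using uv by (simp add: err_def)
        next
          case False
          have "k \<subseteq> ball x (r x)" using fine xk(1) by (auto simp: fine_def)
          moreover have "u \<in> k" "v \<in> k" using uv by auto
          ultimately have "u \<in> ball x (r x)" "v \<in> ball x (r x)" by blast+
          then have "\<bar>u - x\<bar> < r x" "\<bar>v - x\<bar> < r x" by (auto simp: dist_real_def abs_minus_commute)
          then have 1: "norm (z u - z x - (u - x) *\<^sub>R g x) \<le> c * \<bar>u - x\<bar>" "norm (z v - z x - (v - x) *\<^sub>R g x) \<le> c * \<bar>v - x\<bar>"
            using False uv \<open>\<bar>u - x\<bar> < r x\<close> \<open>\<bar>v - x\<bar> < r x\<close> by (intro r(3); simp)+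
          \<comment> \<open>The tag lies between the endpoints, so the first-order errors at
            \<open>u\<close> and at \<open>v\<close> add up to \<open>c\<close> times the length of
            the interval.\<close>
          have "err (x, k) = (z u - z x - (u - x) *\<^sub>R g x) - (z v - z x - (v - x) *\<^sub>R g x)"
            using False uv by (simp add: err_def h_def algebra_simps)
          also have "norm \<dots> \<le> c * \<bar>u - x\<bar> + c * \<bar>v - x\<bar>"
            using 1 by (rule norm_triangle_le_diff[OF add_mono])
          also have "\<dots> = c * measure lborel k" using uv by (simp add: algebra_simps)
          finally show ?thesis .
        qed
      qed
      also have "\<dots> \<le> (\<Sum>(x, k)\<in>p. c * measure lborel k)"
        using c fin by (intro sum_mono2) auto
      also have "\<dots> = c * (b - a)"
        using additive_content_tagged_division[of p a b] p ab
        by (simp add: case_prod_beta flip: sum_distrib_left)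
      also have "\<dots> < e / 2"
        using e ab by (simp add: c_def field_simps)
      finally have O: "norm (sum err (p - pN)) < e / 2" .
      have pNp: "pN \<subseteq> p" by (auto simp: pN_def)
      have disj: "{Inf k<..<Sup k} \<inter> {Inf l<..<Sup l} = {}" if "(x, k) \<in> pN" "(y, l) \<in> pN" "(x, k) \<noteq> (y, l)" for x k y l
      proof -
        have "interior k \<inter> interior l = {}" using pD(5)[of x k y l] that pNp by auto
        moreover have "interior k = {Inf k<..<Sup k}" "interior l = {Inf l<..<Sup l}"
          using iv[of x k] iv[of y l] that(1,2) pNp by (metis interior_atLeastAtMost_real subsetD)+
        ultimately show ?thesis by simp
      qed
      have inj: "inj_on (\<lambda>(x, k). (Inf k, Sup k)) pN"
      proof (rule inj_onI, clarify)
        fix x k y l assume xy: "(x, k) \<in> pN" "(y, l) \<in> pN" "Inf k = Inf l" "Sup k = Sup l"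
        have "Inf k < Sup k" using iv[of x k] xy(1) by (auto simp: pN_def)
        then have "{Inf k<..<Sup k} \<inter> {Inf l<..<Sup l} \<noteq> {}" using xy(3,4) by simp
        then show "x = y \<and> k = l" using disj xy by blast
      qed
      let ?D = "(\<lambda>(x, k). (Inf k, Sup k)) ` pN"
      have finN: "finite pN" using fin pNp finite_subset by blast
      have "(\<Sum>(u, v)\<in>?D. norm (z v - z u)) < e / 2"
      proof (rule d(2), intro conjI)
        show "finite ?D" using finN by simp
        show "\<forall>(u, v)\<in>?D. u \<le> v \<and> {u..v} \<subseteq> {a..b}"
          using iv pNp by fastforce
        show "pairwise (\<lambda>(u, v) (u', v'). {u<..<v} \<inter> {u'<..<v'} = {}) ?D"
          using disj by (fastforce simp: pairwise_def)
        have "(\<Sum>(u, v)\<in>?D. v - u) = (\<Sum>(x, k)\<in>pN. Sup k - Inf k)"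
          by (subst sum.reindex[OF inj]) (auto intro!: sum.cong)
        also have "\<dots> = (\<Sum>xk\<in>pN. measure lebesgue (snd xk))"
        proof (intro sum.cong refl)
          fix xk assume "xk \<in> pN"
          then have "(fst xk, snd xk) \<in> p" using pNp by auto
          from iv[OF this] obtain u v where "snd xk = {u..v}" "u \<le> v" "Inf (snd xk) = u" "Sup (snd xk) = v" by auto
          then show "(case xk of (x, k) \<Rightarrow> Sup k - Inf k) = measure lebesgue (snd xk)"
            by (simp add: case_prod_beta)
        qed
        also have "\<dots> = measure lebesgue (\<Union>(snd ` pN))"
        proof (rule measure_negligible_finite_Union_image[symmetric, OF finN])
          show "snd xk \<in> lmeasurable" if "xk \<in> pN" for xk
          proof -
            have "(fst xk, snd xk) \<in> p" using pNp that by auto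
            from iv[OF this] obtain u v where "snd xk = {u..v}" by auto
            then show ?thesis by simp
          qed
          show "pairwise (\<lambda>x y. negligible (snd x \<inter> snd y)) pN"
          proof (rule pairwiseI)
            fix xk yl assume xy: "xk \<in> pN" "yl \<in> pN" "xk \<noteq> yl"
            have "(fst xk, snd xk) \<in> p" "(fst yl, snd yl) \<in> p" using pNp xy by auto
            from iv[OF this(1)] iv[OF this(2)] obtain u v u' v' where
              uv: "snd xk = {u..v}" "Inf (snd xk) = u" "Sup (snd xk) = v"
                "snd yl = {u'..v'}" "Inf (snd yl) = u'" "Sup (snd yl) = v'" by auto
            have "{Inf (snd xk)<..<Sup (snd xk)} \<inter> {Inf (snd yl)<..<Sup (snd yl)} = {}"
              by (rule disj[of "fst xk" _ "fst yl"]) (use xy in \<open>auto simp: prod_eq_iff\<close>)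
            then have "{u<..<v} \<inter> {u'<..<v'} = {}" by (simp only: uv(2,3,5,6))
            then have "snd xk \<inter> snd yl \<subseteq> {u, v, u', v'}"
              unfolding uv by (fastforce simp: set_eq_iff less_le)
            then show "negligible (snd xk \<inter> snd yl)"
              by (rule negligible_subset[rotated]) (auto intro: negligible_finite)
          qed
        qed
        also have "\<dots> \<le> measure lebesgue U"
        proof (rule measure_mono_fmeasurable[OF _ _ U'(1)])
          show "\<Union>(snd ` pN) \<subseteq> U"
            using fine r(2) unfolding pN_def fine_def by fastforce
          show "\<Union>(snd ` pN) \<in> sets lebesgue"
          proof (intro sets.finite_Union)
            show "snd ` pN \<subseteq> sets lebesgue"
            proof clarify
              fix x k assume "(x, k) \<in> pN"
              then have "(x, k) \<in> p" using pNp by auto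
              from iv[OF this] obtain u v where "k = {u..v}" by auto
              then show "snd (x, k) \<in> sets lebesgue" by simp
            qed
          qed (use finN in simp)
        qed
        also have "\<dots> < d" by (rule U')
        finally show "(\<Sum>(u, v)\<in>?D. v - u) < d" .
      qed
      moreover have "(\<Sum>(u, v)\<in>?D. norm (z v - z u)) = (\<Sum>(x, k)\<in>pN. norm (z (Sup k) - z (Inf k)))"
        by (subst sum.reindex[OF inj]) (auto intro!: sum.cong)
      moreover have "norm (sum err pN) \<le> (\<Sum>(x, k)\<in>pN. norm (z (Sup k) - z (Inf k)))"
        by (rule sum_norm_le) (auto simp: err_def h_def pN_def norm_minus_commute)
      ultimately have "norm (sum err pN) < e / 2" by linarith
      then show ?thesis
        unfolding split using O norm_triangle_ineq[of "sum err (p - pN)" "sum err pN"] by linarith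
    qed
    moreover have "gauge (\<lambda>t. ball t (r t))" using r(1) by (simp add: gauge_def)
    ultimately show "\<exists>\<gamma>. gauge \<gamma> \<and> (\<forall>\<D>. \<D> tagged_division_of {a..b} \<and> \<gamma> fine \<D> \<longrightarrow>
        norm ((\<Sum>(x, k)\<in>\<D>. measure lborel k *\<^sub>R h x) - (z b - z a)) < e)" by blast
  qed
  then show ?thesis by (rule has_integral_spike[OF N, rotated]) (auto simp: h_def)
qed

text \<open>Lebesgue's differentiation theorem enters through averages over
  \<open>[x, x + s]\<close>. For the function it yields the right difference quotient, for its
  mirror image the left one, and the second exceptional set is mirrored back. Extension by 0 outside
  \<open>{a..b}\<close> gives the averages a meaning near the endpoints.\<close>

lemma indefinite_integral_has_vector_derivative_AE:
  fixes h :: "real \<Rightarrow> 'a::euclidean_space"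
  assumes h: "h integrable_on {a..b}"
  obtains N where "negligible N"
    "\<And>t. t \<in> {a..b} - N \<Longrightarrow> ((\<lambda>t. integral {a..t} h) has_vector_derivative h t) (at t within {a..b})"
proof -
  define H where "H t = (if t \<in> {a..b} then h t else 0)" for t
  have HU: "H integrable_on UNIV" unfolding H_def using h integrable_restrict_UNIV by blast
  have Hi: "H integrable_on cbox u v" for u v by (rule integrable_on_subcbox[OF HU]) simp
  have Hi': "(\<lambda>t. H (- t)) integrable_on cbox u v" for u v
    using integrable_reflect[of H "- u" "- v"] Hi by simp
  obtain N1 where N1: "negligible N1" "\<And>x e. \<lbrakk>x \<notin> N1; 0 < e\<rbrakk> \<Longrightarrow> \<exists>d>0. \<forall>s. 0 < s \<and> s < d \<longrightarrow>
      norm (integral (cbox x (x + s *\<^sub>R One)) H /\<^sub>R s ^ DIM(real) - H x) < e"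
    using integrable_ccontinuous_explicit[OF Hi] by blast
  obtain N2 where N2: "negligible N2" "\<And>x e. \<lbrakk>x \<notin> N2; 0 < e\<rbrakk> \<Longrightarrow> \<exists>d>0. \<forall>s. 0 < s \<and> s < d \<longrightarrow>
      norm (integral (cbox x (x + s *\<^sub>R One)) (\<lambda>t. H (- t)) /\<^sub>R s ^ DIM(real) - H (- x)) < e"
    using integrable_ccontinuous_explicit[OF Hi'] by blast
  define N where "N = N1 \<union> uminus ` N2"
  have "negligible (uminus ` N2)"
    using negligible_differentiable_image_negligible[OF order_refl N2(1), of uminus] by (auto intro!: derivative_intros simp: differentiable_on_def)
  then have N: "negligible N" using N1(1) by (simp add: N_def)
  moreover have "((\<lambda>t. integral {a..t} h) has_vector_derivative h t) (at t within {a..b})"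
    if t: "t \<in> {a..b} - N" for t
    unfolding has_vector_derivative_def has_derivative_within_alt
  proof (intro conjI allI impI)
    show "bounded_linear (\<lambda>s. s *\<^sub>R h t)" by (rule bounded_linear_scaleR_left)
    fix e :: real assume e: "e > 0"
    have nt: "t \<notin> N1" "- t \<notin> N2" using t by (force simp: N_def)+
    have Ht: "H t = h t" using t by (simp add: H_def)
    obtain d1 where d1: "d1 > 0" "\<And>s. 0 < s \<Longrightarrow> s < d1 \<Longrightarrow> norm (integral {t..t + s} H /\<^sub>R s - h t) < e"
      using N1(2)[OF nt(1) e] Ht by auto
    obtain d2 where d2: "d2 > 0" "\<And>s. 0 < s \<Longrightarrow> s < d2 \<Longrightarrow> norm (integral {- t..- t + s} (\<lambda>t. H (- t)) /\<^sub>R s - h t) < e"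
      using N2(2)[OF nt(2) e] Ht by auto
    have "norm (integral {a..y} h - integral {a..t} h - (y - t) *\<^sub>R h t) \<le> e * norm (y - t)"
      if y: "y \<in> {a..b}" "norm (y - t) < min d1 d2" for y
    proof -
      have IH: "integral {u..v} H = integral {u..v} h" if "u \<in> {a..b}" "v \<in> {a..b}" for u v
        using that by (intro integral_cong) (auto simp: H_def)
      have scale: "norm (I - s *\<^sub>R w) \<le> e * s" if "s > 0" "norm (I /\<^sub>R s - w) < e" for I w :: 'a and s :: real
      proof -
        have "I - s *\<^sub>R w = s *\<^sub>R (I /\<^sub>R s - w)" using that(1) by (simp add: scaleR_diff_right)
        then have "norm (I - s *\<^sub>R w) = s * norm (I /\<^sub>R s - w)" using that(1) by simp
        also have "\<dots> \<le> s * e" using that by (intro mult_left_mono) auto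
        finally show ?thesis by (simp add: mult.commute)
      qed
      consider "y = t" | "y > t" | "y < t" by linarith
      then show ?thesis
      proof cases
        case 2
        have "integral {a..t} h + integral {t..y} h = integral {a..y} h"
          using t y 2 by (intro Henstock_Kurzweil_Integration.integral_combine integrable_on_subinterval[OF h]) auto
        then have eq: "integral {a..y} h - integral {a..t} h = integral {t..y} h" by (simp flip: \<open>integral {a..t} h + integral {t..y} h = integral {a..y} h\<close>)
        have "norm (integral {t..t + (y - t)} H /\<^sub>R (y - t) - h t) < e" using d1(2)[of "y - t"] y 2 by simp
        then have "norm (integral {t..y} h - (y - t) *\<^sub>R h t) \<le> e * (y - t)"
          using IH[of t y] t y 2 by (intro scale) auto
        then show ?thesis unfolding eq using 2 by simp
      next
        case 3
        have "integral {a..y} h + integral {y..t} h = integral {a..t} h"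
          using t y 3 by (intro Henstock_Kurzweil_Integration.integral_combine integrable_on_subinterval[OF h]) auto
        then have eq: "integral {a..y} h - integral {a..t} h = - integral {y..t} h" by (simp flip: \<open>integral {a..y} h + integral {y..t} h = integral {a..t} h\<close>)
        have refl: "integral {- t..- t + (t - y)} (\<lambda>t. H (- t)) = integral {y..t} H"
          using integral_reflect_real[of t y H] by simp
        have "norm (integral {- t..- t + (t - y)} (\<lambda>t. H (- t)) /\<^sub>R (t - y) - h t) < e"
          using d2(2)[of "t - y"] y 3 by simp
        then have sc: "norm (integral {y..t} h - (t - y) *\<^sub>R h t) \<le> e * (t - y)"
          unfolding refl using IH[of y t] t y 3 by (intro scale) auto
        have "- integral {y..t} h - (y - t) *\<^sub>R h t = - (integral {y..t} h - (t - y) *\<^sub>R h t)"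
          by (simp add: algebra_simps)
        then show ?thesis unfolding eq using sc 3 by (simp only: norm_minus_cancel) simp
      qed simp
    qed
    then show "\<exists>d>0. \<forall>y\<in>{a..b}. norm (y - t) < d \<longrightarrow>
      norm (integral {a..y} h - integral {a..t} h - (y - t) *\<^sub>R h t) \<le> e * norm (y - t)"
      using d1(1) d2(1) by (intro exI[of _ "min d1 d2"]) auto
  qed
  ultimately show ?thesis using that by blast
qed

text \<open>A weighted supremum replaces the usual Gronwall iteration: with \<open>D = sup exp(-2Lt) \<phi>(t)\<close>
  the hypothesis gives \<open>D \<le> \<epsilon> + D / 2\<close>.\<close>

lemma gronwall_weighted:
  fixes \<phi> :: "real \<Rightarrow> real"
  assumes cont: "continuous_on {0..T} \<phi>" and L: "L > 0" and \<epsilon>: "\<epsilon> \<ge> 0"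
    and le: "\<And>t. t \<in> {0..T} \<Longrightarrow> \<phi> t \<le> \<epsilon> + L * integral {0..t} \<phi>"
    and t: "t \<in> {0..T}"
  shows "\<phi> t \<le> 2 * \<epsilon> * exp (2 * L * t)"
proof -
  have "continuous_on {0..T} (\<lambda>t. exp (- (2 * L * t)) * \<phi> t)" by (intro continuous_intros cont)
  then obtain s where s: "s \<in> {0..T}" "\<And>t. t \<in> {0..T} \<Longrightarrow> exp (- (2 * L * t)) * \<phi> t \<le> exp (- (2 * L * s)) * \<phi> s"
    using continuous_attains_sup[of "{0..T}" "\<lambda>t. exp (- (2 * L * t)) * \<phi> t"] t by auto
  define D where "D = exp (- (2 * L * s)) * \<phi> s"
  have up: "\<phi> t \<le> D * exp (2 * L * t)" if "t \<in> {0..T}" for t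
  proof -
    have "exp (- (2 * L * t)) * \<phi> t * exp (2 * L * t) \<le> D * exp (2 * L * t)"
      using s(2)[OF that] by (intro mult_right_mono) (auto simp: D_def)
    then show ?thesis by (simp add: exp_minus field_simps)
  qed
  have "D \<le> 2 * \<epsilon>"
  proof (cases "D \<ge> 0")
    case True
    have hi: "((\<lambda>t. D * exp (2 * L * t)) has_integral (D * exp (2 * L * s) / (2 * L) - D * exp (2 * L * 0) / (2 * L))) {0..s}"
      using s(1) L by (intro fundamental_theorem_of_calculus)
        (auto intro!: derivative_eq_intros simp flip: has_real_derivative_iff_has_vector_derivative)
    have "integral {0..s} \<phi> \<le> integral {0..s} (\<lambda>t. D * exp (2 * L * t))"
      using s(1) up by (intro integral_le integrable_continuous_interval continuous_intros continuous_on_subset[OF cont]) auto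
    also have "\<dots> \<le> D * exp (2 * L * s) / (2 * L)"
      using integral_unique[OF hi] True L by simp
    finally have "L * integral {0..s} \<phi> \<le> L * (D * exp (2 * L * s) / (2 * L))" using L by (intro mult_left_mono) auto
    also have "\<dots> = D * exp (2 * L * s) / 2" using L by simp
    finally have "\<phi> s \<le> \<epsilon> + D * exp (2 * L * s) / 2" using le[OF s(1)] by linarith
    then have "D \<le> exp (- (2 * L * s)) * (\<epsilon> + D * exp (2 * L * s) / 2)"
      unfolding D_def by (intro mult_left_mono) auto
    also have "\<dots> = exp (- (2 * L * s)) * \<epsilon> + D / 2" by (simp add: exp_minus field_simps)
    also have "\<dots> \<le> 1 * \<epsilon> + D / 2"
      using s(1) L \<epsilon> by (intro add_right_mono mult_right_mono) auto
    finally show ?thesis by simp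
  qed (use \<epsilon> in linarith)
  then show ?thesis using up[OF t] by (smt (verit) exp_gt_zero mult_right_mono)
qed

section \<open>Differential equations with measurable right-hand side\<close>

text \<open>A Caratheodory field. Measurability in time is encoded as integrability along every
  continuous curve, which is what the Picard operator and the integral equation consume.\<close>

definition carath :: "real \<Rightarrow> real \<Rightarrow> real \<Rightarrow> ('a::euclidean_space \<Rightarrow> real \<Rightarrow> 'a) \<Rightarrow> bool" where
  "carath T L B F \<longleftrightarrow> 0 < L \<and>
     (\<forall>t\<in>{0..T}. \<forall>x y. norm (F x t - F y t) \<le> L * norm (x - y)) \<and>
     (\<forall>t\<in>{0..T}. norm (F 0 t) \<le> B) \<and>
     (\<forall>z. continuous_on {0..T} z \<longrightarrow> (\<lambda>t. F (z t) t) integrable_on {0..T})"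

lemma carathD:
  assumes "carath T L B F"
  shows "0 < L" "\<And>t x y. t \<in> {0..T} \<Longrightarrow> norm (F x t - F y t) \<le> L * norm (x - y)"
    "\<And>t. t \<in> {0..T} \<Longrightarrow> norm (F 0 t) \<le> B"
    "\<And>z s t. continuous_on {0..T} z \<Longrightarrow> {s..t} \<subseteq> {0..T} \<Longrightarrow> (\<lambda>t. F (z t) t) integrable_on {s..t}"
proof -
  show "0 < L" and "\<And>t x y. t \<in> {0..T} \<Longrightarrow> norm (F x t - F y t) \<le> L * norm (x - y)"
    and "\<And>t. t \<in> {0..T} \<Longrightarrow> norm (F 0 t) \<le> B"
    using assms unfolding carath_def by blast+
  show "(\<lambda>t. F (z t) t) integrable_on {s..t}" if "continuous_on {0..T} z" "{s..t} \<subseteq> {0..T}" for z s t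
  proof -
    have "(\<lambda>t. F (z t) t) integrable_on {0..T}" using assms that(1) unfolding carath_def by blast
    then show ?thesis by (rule integrable_on_subinterval[OF _ that(2)])
  qed
qed

lemma carath_growth:
  assumes "carath T L B F" and t: "t \<in> {0..T}"
  shows "norm (F x t) \<le> B + L * norm x"
proof -
  have "norm (F x t) \<le> norm (F x t - F 0 t) + norm (F 0 t)"
    using norm_triangle_ineq[of "F x t - F 0 t" "F 0 t"] by simp
  also have "\<dots> \<le> L * norm (x - 0) + B" by (intro add_mono carathD(2,3)[OF assms])
  finally show ?thesis by simp
qed

lemma abs_continuous_on_mono:
  assumes ac: "abs_continuous_on S z" and sub: "S' \<subseteq> S" and eq: "\<And>t. t \<in> S' \<Longrightarrow> z' t = z t"
  shows "abs_continuous_on S' z'"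
  unfolding abs_continuous_on_def
proof (intro allI impI)
  fix e :: real assume e: "e > 0"
  obtain d where d: "d > 0" "\<And>D. finite D \<and> (\<forall>(a, b)\<in>D. a \<le> b \<and> {a..b} \<subseteq> S) \<and>
        pairwise (\<lambda>(a, b) (a', b'). {a<..<b} \<inter> {a'<..<b'} = {}) D \<and> (\<Sum>(a, b)\<in>D. b - a) < d
        \<Longrightarrow> (\<Sum>(a, b)\<in>D. norm (z b - z a)) < e"
    by (rule abs_continuous_onE[OF ac e]) (rule that)
  have "(\<Sum>(a, b)\<in>D. norm (z' b - z' a)) < e"
    if D: "finite D \<and> (\<forall>(a, b)\<in>D. a \<le> b \<and> {a..b} \<subseteq> S') \<and>
        pairwise (\<lambda>(a, b) (a', b'). {a<..<b} \<inter> {a'<..<b'} = {}) D \<and> (\<Sum>(a, b)\<in>D. b - a) < d" for D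
  proof -
    have "a \<in> S' \<and> b \<in> S' \<and> {a..b} \<subseteq> S" if "(a, b) \<in> D" for a b
    proof -
      have "a \<le> b" "{a..b} \<subseteq> S'" using that D by auto
      then show ?thesis using sub by auto
    qed
    note * = this
    have "(\<Sum>(a, b)\<in>D. norm (z' b - z' a)) = (\<Sum>(a, b)\<in>D. norm (z b - z a))"
      using * by (intro sum.cong) (auto simp: eq)
    also have "\<dots> < e"
      by (rule d(2)) (use D * in auto)
    finally show ?thesis .
  qed
  then show "\<exists>\<delta>>0. \<forall>D. finite D \<and> (\<forall>(a, b)\<in>D. a \<le> b \<and> {a..b} \<subseteq> S') \<and>
        pairwise (\<lambda>(a, b) (a', b'). {a<..<b} \<inter> {a'<..<b'} = {}) D \<and> (\<Sum>(a, b)\<in>D. b - a) < \<delta> \<longrightarrow>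
        (\<Sum>(a, b)\<in>D. norm (z' b - z' a)) < e"
    using d(1) by blast
qed

lemma abs_continuous_on_integral_bounded:
  fixes h :: "real \<Rightarrow> 'a::euclidean_space"
  assumes h: "h integrable_on {0..T}" and B: "\<And>t. t \<in> {0..T} \<Longrightarrow> norm (h t) \<le> B"
  shows "abs_continuous_on {0..T} (\<lambda>t. z0 + integral {0..t} h)"
  unfolding abs_continuous_on_def
proof (intro allI impI)
  fix e :: real assume e: "e > 0"
  define C where "C = \<bar>B\<bar> + 1"
  have C: "C > 0" by (simp add: C_def)
  have inc: "norm (integral {0..v} h - integral {0..u} h) \<le> C * (v - u)" if "u \<le> v" "{u..v} \<subseteq> {0..T}" for u v
  proof -
    have uv: "0 \<le> u" "v \<le> T" using that by auto
    then have sub: "h integrable_on {u..v}" "h integrable_on {0..v}"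
      using that by (auto intro: integrable_on_subinterval[OF h])
    have "integral {0..u} h + integral {u..v} h = integral {0..v} h"
      using that uv sub by (intro Henstock_Kurzweil_Integration.integral_combine) auto
    then have "integral {0..v} h - integral {0..u} h = integral {u..v} h"
      by (metis add_diff_cancel_left')
    moreover have "norm (integral {u..v} h) \<le> integral {u..v} (\<lambda>_. C)"
      using sub(1)
    proof (intro integral_norm_bound_integral)
      show "norm (h x) \<le> C" if "x \<in> {u..v}" for x using B[of x] that uv by (auto simp: C_def)
    qed auto
    ultimately show ?thesis using that by (simp add: mult.commute)
  qed
  have "(\<Sum>(a, b)\<in>D. norm ((z0 + integral {0..b} h) - (z0 + integral {0..a} h))) < e"
    if D: "\<forall>(a, b)\<in>D. a \<le> b \<and> {a..b} \<subseteq> {0..T}" "(\<Sum>(a, b)\<in>D. b - a) < e / C" for D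
  proof -
    have "(\<Sum>(a, b)\<in>D. norm ((z0 + integral {0..b} h) - (z0 + integral {0..a} h))) \<le> (\<Sum>(a, b)\<in>D. C * (b - a))"
      using D(1) inc by (intro sum_mono) fastforce
    also have "\<dots> = C * (\<Sum>(a, b)\<in>D. b - a)" by (simp add: sum_distrib_left case_prod_beta)
    also have "\<dots> < C * (e / C)" using D(2) C by (intro mult_strict_left_mono)
    finally show ?thesis using C by simp
  qed
  then show "\<exists>\<delta>>0. \<forall>D. finite D \<and> (\<forall>(a, b)\<in>D. a \<le> b \<and> {a..b} \<subseteq> {0..T}) \<and>
        pairwise (\<lambda>(a, b) (a', b'). {a<..<b} \<inter> {a'<..<b'} = {}) D \<and> (\<Sum>(a, b)\<in>D. b - a) < \<delta> \<longrightarrow>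
        (\<Sum>(a, b)\<in>D. norm ((z0 + integral {0..b} h) - (z0 + integral {0..a} h))) < e"
    using e C by (intro exI[of _ "e / C"]) simp
qed

text \<open>Absolute continuity lets the almost everywhere derivative be integrated over every
  \<open>[0, t]\<close>. Conversely, the field is bounded along a continuous curve, so its
  indefinite integral is Lipschitz and has the right derivative almost everywhere. Existence,
  uniqueness and comparison all work with the integral form.\<close>

lemma solves_iff_integral_equation:
  assumes F: "carath T L B F"
  shows "solves T F z0 z \<longleftrightarrow> continuous_on {0..T} z \<and> z 0 = z0 \<and>
    (\<forall>t\<in>{0..T}. z t = z0 + integral {0..t} (\<lambda>s. F (z s) s))" (is "?lhs = ?rhs")
proof
  assume z: ?lhs
  then have cont: "continuous_on {0..T} z" and z0: "z 0 = z0" and ac: "abs_continuous_on {0..T} z"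
    by (auto simp: solves_def intro: abs_continuous_on_imp_continuous_on)
  have "AE t in lebesgue_on {0..T}. (z has_vector_derivative F (z t) t) (at t within {0..T})"
    using z by (simp add: solves_def)
  then have "AE t in lebesgue. t \<in> {0..T} \<longrightarrow> (z has_vector_derivative F (z t) t) (at t within {0..T})"
    by (subst (asm) AE_restrict_space_iff) auto
  then obtain N where N: "negligible N"
    "{t. \<not> (t \<in> {0..T} \<longrightarrow> (z has_vector_derivative F (z t) t) (at t within {0..T}))} \<subseteq> N"
    unfolding eventually_ae_filter_negligible by blast
  then have deriv: "(z has_vector_derivative F (z t) t) (at t within {0..T})" if "t \<in> {0..T} - N" for t
    using that by auto
  have "z t = z0 + integral {0..t} (\<lambda>s. F (z s) s)" if t: "t \<in> {0..T}" for t
  proof -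
    have "abs_continuous_on {0..t} z"
      by (rule abs_continuous_on_mono[OF ac]) (use t in auto)
    then have "((\<lambda>s. F (z s) s) has_integral (z t - z 0)) {0..t}"
      using t by (intro abs_continuous_on_has_integral[OF _ _ N(1)] has_vector_derivative_within_subset[OF deriv]) auto
    then show ?thesis using z0 by (simp add: integral_unique)
  qed
  then show ?rhs using cont z0 by blast
next
  assume z: ?rhs
  define h where "h s = F (z s) s" for s
  have hi: "h integrable_on {0..T}" unfolding h_def using carathD(4)[OF F] z by blast
  obtain b where b: "\<And>t. t \<in> {0..T} \<Longrightarrow> norm (z t) \<le> b"
  proof -
    have "bounded (z ` {0..T})"
      using z by (intro compact_imp_bounded compact_continuous_image) auto
    then show thesis using that unfolding bounded_iff by blast
  qed
  have hb: "norm (h t) \<le> B + L * b" if "t \<in> {0..T}" for t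
  proof -
    have "norm (h t) \<le> B + L * norm (z t)" unfolding h_def by (rule carath_growth[OF F that])
    also have "\<dots> \<le> B + L * b" using b[OF that] carathD(1)[OF F] by (intro add_left_mono mult_left_mono) auto
    finally show ?thesis .
  qed
  have eq: "z t = z0 + integral {0..t} h" if "t \<in> {0..T}" for t
    using z that by (auto simp: h_def[abs_def])
  have "abs_continuous_on {0..T} z"
  proof -
    have *: "abs_continuous_on {0..T} (\<lambda>t. z0 + integral {0..t} h)"
      by (rule abs_continuous_on_integral_bounded[OF hi hb])
    show ?thesis by (rule abs_continuous_on_mono[OF *]) (use eq in auto)
  qed
  moreover have "AE t in lebesgue_on {0..T}. (z has_vector_derivative F (z t) t) (at t within {0..T})"
  proof -
    obtain N where N: "negligible N"
      "\<And>t. t \<in> {0..T} - N \<Longrightarrow> ((\<lambda>t. integral {0..t} h) has_vector_derivative h t) (at t within {0..T})"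
      using indefinite_integral_has_vector_derivative_AE[OF hi] by metis
    have "(z has_vector_derivative F (z t) t) (at t within {0..T})" if t: "t \<in> {0..T} - N" for t
    proof -
      have "((\<lambda>t. z0 + integral {0..t} h) has_vector_derivative 0 + h t) (at t within {0..T})"
        by (intro has_vector_derivative_add has_vector_derivative_const N(2) t)
      then show ?thesis
        unfolding h_def[of t, symmetric]
        by (intro has_vector_derivative_transform[OF _ eq]) (use t in auto)
    qed
    then have "AE t in lebesgue. t \<in> {0..T} \<longrightarrow> (z has_vector_derivative F (z t) t) (at t within {0..T})"
      using N(1) by (intro AE_I'[of N]) (auto simp: negligible_iff_null_sets)
    then show ?thesis by (subst AE_restrict_space_iff) auto
  qed
  ultimately show ?lhs using z by (simp add: solves_def)
qed

text \<open>Stated for two integrands and not for two fields, so that it serves uniqueness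
  (\<open>\<epsilon> = 0\<close>), the a priori bound (\<open>y\<close> constant and
  \<open>g = 0\<close>) and the comparison of the system with its network.\<close>

lemma carath_gronwall:
  fixes z y :: "real \<Rightarrow> 'a::euclidean_space"
  assumes "continuous_on {0..T} z" "continuous_on {0..T} y" and L: "L > 0" and \<epsilon>: "\<epsilon> \<ge> 0"
    and hi: "h integrable_on {0..T}" and gi: "g integrable_on {0..T}"
    and z: "\<And>t. t \<in> {0..T} \<Longrightarrow> z t = z0 + integral {0..t} h"
    and y: "\<And>t. t \<in> {0..T} \<Longrightarrow> y t = z0 + integral {0..t} g"
    and le: "\<And>t. t \<in> {0..T} \<Longrightarrow> norm (h t - g t) \<le> \<epsilon> + L * norm (z t - y t)"
    and t: "t \<in> {0..T}"
  shows "norm (z t - y t) \<le> 2 * (T * \<epsilon>) * exp (2 * L * T)"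
proof -
  have T: "0 \<le> T" using t by auto
  have c: "continuous_on {0..T} (\<lambda>t. norm (z t - y t))" by (intro continuous_intros assms)
  have "norm (z t - y t) \<le> T * \<epsilon> + L * integral {0..t} (\<lambda>t. norm (z t - y t))" if t: "t \<in> {0..T}" for t
  proof -
    have i: "h integrable_on {0..t}" "g integrable_on {0..t}" using t
      by (auto intro: integrable_on_subinterval[OF hi] integrable_on_subinterval[OF gi])
    have ci: "(\<lambda>t. norm (z t - y t)) integrable_on {0..t}"
      using t by (intro integrable_continuous_interval continuous_on_subset[OF c]) auto
    have "norm (z t - y t) = norm (integral {0..t} (\<lambda>s. h s - g s))"
      using z[OF t] y[OF t] i by (simp add: integral_diff)
    also have "\<dots> \<le> integral {0..t} (\<lambda>s. \<epsilon> + L * norm (z s - y s))"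
      using le t i ci by (intro integral_norm_bound_integral integrable_diff integrable_add integrable_on_mult_right) auto
    also have "\<dots> = t * \<epsilon> + L * integral {0..t} (\<lambda>s. norm (z s - y s))"
      using t ci by (subst integral_add) (auto intro: integrable_on_mult_right)
    also have "\<dots> \<le> T * \<epsilon> + L * integral {0..t} (\<lambda>s. norm (z s - y s))"
      using t \<epsilon> by (intro add_right_mono mult_right_mono) auto
    finally show ?thesis .
  qed
  then have "norm (z t - y t) \<le> 2 * (T * \<epsilon>) * exp (2 * L * t)"
    using c L \<epsilon> t T by (intro gronwall_weighted[where \<phi> = "\<lambda>t. norm (z t - y t)" and T = T]) auto
  also have "\<dots> \<le> 2 * (T * \<epsilon>) * exp (2 * L * T)"
    using t L \<epsilon> T by (intro mult_left_mono) auto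
  finally show ?thesis .
qed

lemma carath_unique:
  assumes F: "carath T L B F" and "solves T F z0 z" "solves T F z0 y" "t \<in> {0..T}"
  shows "z t = y t"
proof -
  have z: "continuous_on {0..T} z" "\<And>t. t \<in> {0..T} \<Longrightarrow> z t = z0 + integral {0..t} (\<lambda>s. F (z s) s)"
    and y: "continuous_on {0..T} y" "\<And>t. t \<in> {0..T} \<Longrightarrow> y t = z0 + integral {0..t} (\<lambda>s. F (y s) s)"
    using assms(2,3) unfolding solves_iff_integral_equation[OF F] by auto
  have "norm (z t - y t) \<le> 2 * (T * 0) * exp (2 * L * T)"
  proof (rule carath_gronwall[where h = "\<lambda>s. F (z s) s" and g = "\<lambda>s. F (y s) s"])
    show "norm (F (z t) t - F (y t) t) \<le> 0 + L * norm (z t - y t)" if "t \<in> {0..T}" for t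
      using carathD(2)[OF F that] by simp
  qed (use z y assms(4) carathD(1)[OF F] in \<open>auto intro: carathD(4)[OF F]\<close>)
  then show ?thesis by simp
qed

text \<open>Picard iteration in the norm weighted by \<open>exp(-2Lt)\<close>, in which the integral operator contracts
  with factor \<open>1/2\<close> on the whole interval.\<close>

lemma carath_exists:
  fixes F :: "'a::euclidean_space \<Rightarrow> real \<Rightarrow> 'a"
  assumes F: "carath T L B F" and T: "T \<ge> 0"
  shows "\<exists>z. solves T F z0 z"
proof -
  have L: "L > 0" by (rule carathD(1)[OF F])
  \<comment> \<open>Clamping the time to \<open>[0, T]\<close> turns the image of the Picard
    operator into a bounded continuous function on the whole line, an element of the complete space
    in which the fixed point is sought.\<close>
  define cl where "cl t = max 0 (min T t)" for t :: real
  have cl: "cl t \<in> {0..T}" "t \<in> {0..T} \<Longrightarrow> cl t = t" for t using T by (auto simp: cl_def)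
  have cont_cl: "continuous_on UNIV cl" unfolding cl_def[abs_def] by (intro continuous_intros)
  \<comment> \<open>The unknown \<open>w\<close> stands for exp(-2Lt) z(t), so the ordinary supremum
    distance of the \<open>w\<close> is the weighted distance of the curves.\<close>
  define E where "E w s = F (exp (2 * L * s) *\<^sub>R apply_bcontfun w s) s" for w :: "real \<Rightarrow>\<^sub>C 'a" and s
  have Ei: "E w integrable_on {0..T}" for w
    unfolding E_def[abs_def] by (rule carathD(4)[OF F]) (auto intro!: continuous_intros)
  define \<Psi> where "\<Psi> w t = exp (- (2 * L * cl t)) *\<^sub>R (z0 + integral {0..cl t} (E w))" for w t
  have Psi_in: "\<Psi> w \<in> bcontfun" for w
  proof -
    have c0: "continuous_on {0..T} (\<lambda>t. exp (- (2 * L * t)) *\<^sub>R (z0 + integral {0..t} (E w)))"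
      by (intro continuous_intros indefinite_integral_continuous_1 Ei)
    have eq: "\<Psi> w = (\<lambda>t. exp (- (2 * L * t)) *\<^sub>R (z0 + integral {0..t} (E w))) \<circ> cl"
      by (simp add: \<Psi>_def fun_eq_iff)
    have "continuous_on UNIV (\<Psi> w)"
      unfolding eq by (rule continuous_on_compose[OF cont_cl continuous_on_subset[OF c0]]) (use cl in auto)
    moreover have "bounded (range (\<Psi> w))"
      by (rule bounded_subset[OF compact_imp_bounded[OF compact_continuous_image[OF c0 compact_Icc]]])
        (use cl in \<open>auto simp: eq\<close>)
    ultimately show ?thesis by (simp add: bcontfun_def)
  qed
  have "dist (Bcontfun (\<Psi> w)) (Bcontfun (\<Psi> w')) \<le> 1 / 2 * dist w w'" for w w'
  proof (rule dist_bound)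
    fix t
    let ?d = "dist w w'" and ?s = "cl t"
    have s: "?s \<in> {0..T}" by (rule cl)
    have i: "E w integrable_on {0..?s}" "E w' integrable_on {0..?s}"
      using s by (auto intro: integrable_on_subinterval[OF Ei])
    have hi: "((\<lambda>t. L * ?d * exp (2 * L * t)) has_integral (?d / 2 * exp (2 * L * ?s) - ?d / 2 * exp (2 * L * 0))) {0..?s}"
      using s L by (intro fundamental_theorem_of_calculus)
        (auto intro!: derivative_eq_intros simp flip: has_real_derivative_iff_has_vector_derivative)
    have "norm (integral {0..?s} (\<lambda>r. E w r - E w' r)) \<le> integral {0..?s} (\<lambda>r. L * ?d * exp (2 * L * r))"
    proof (intro integral_norm_bound_integral integrable_diff i)
      show "(\<lambda>r. L * ?d * exp (2 * L * r)) integrable_on {0..?s}" using hi by blast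
      fix r assume r: "r \<in> {0..?s}"
      have "norm (E w r - E w' r) \<le> L * norm (exp (2 * L * r) *\<^sub>R apply_bcontfun w r - exp (2 * L * r) *\<^sub>R apply_bcontfun w' r)"
        unfolding E_def using r s by (intro carathD(2)[OF F]) auto
      also have "\<dots> = L * (exp (2 * L * r) * dist (apply_bcontfun w r) (apply_bcontfun w' r))"
        by (simp add: dist_norm flip: scaleR_diff_right)
      also have "\<dots> \<le> L * (exp (2 * L * r) * ?d)"
        using L by (intro mult_left_mono dist_bounded) auto
      finally show "norm (E w r - E w' r) \<le> L * ?d * exp (2 * L * r)" by (simp add: mult_ac)
    qed
    also have "\<dots> \<le> ?d / 2 * exp (2 * L * ?s)" using integral_unique[OF hi] by simp
    finally have *: "norm (integral {0..?s} (E w) - integral {0..?s} (E w')) \<le> ?d / 2 * exp (2 * L * ?s)"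
      using i by (simp add: integral_diff)
    have "\<Psi> w t - \<Psi> w' t = exp (- (2 * L * ?s)) *\<^sub>R (integral {0..?s} (E w) - integral {0..?s} (E w'))"
      by (simp add: \<Psi>_def scaleR_diff_right[symmetric] del: scaleR_diff_right)
    then have "dist (\<Psi> w t) (\<Psi> w' t) = exp (- (2 * L * ?s)) * norm (integral {0..?s} (E w) - integral {0..?s} (E w'))"
      by (simp add: dist_norm)
    also have "\<dots> \<le> exp (- (2 * L * ?s)) * (?d / 2 * exp (2 * L * ?s))"
      using * by (intro mult_left_mono) auto
    also have "\<dots> = 1 / 2 * ?d" by (simp add: exp_minus field_simps)
    finally show "dist (apply_bcontfun (Bcontfun (\<Psi> w)) t) (apply_bcontfun (Bcontfun (\<Psi> w')) t) \<le> 1 / 2 * ?d"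
      by (simp add: Bcontfun_inverse[OF Psi_in])
  qed
  then obtain w where w: "Bcontfun (\<Psi> w) = w"
    using banach_fix_type[of "1 / 2" "\<lambda>w. Bcontfun (\<Psi> w)"] by auto
  have wt: "apply_bcontfun w t = \<Psi> w t" for t using w Bcontfun_inverse[OF Psi_in[of w]] by metis
  define z where "z t = exp (2 * L * t) *\<^sub>R apply_bcontfun w t" for t
  have "continuous_on {0..T} z" unfolding z_def[abs_def] by (intro continuous_intros) auto
  moreover have zt: "z t = z0 + integral {0..t} (\<lambda>s. F (z s) s)" if "t \<in> {0..T}" for t
  proof -
    have "E w = (\<lambda>s. F (z s) s)" by (simp add: E_def z_def fun_eq_iff)
    then show ?thesis using cl(2)[OF that] by (simp add: z_def[of t] wt \<Psi>_def exp_minus)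
  qed
  moreover have "z 0 = z0" using zt[of 0] T by simp
  ultimately show ?thesis using solves_iff_integral_equation[OF F] by blast
qed

lemma carath_is_the_solution:
  assumes F: "carath T L B F" and T: "T \<ge> 0"
  obtains z where "is_the_solution T F z0 z" "continuous_on {0..T} z" "z 0 = z0"
    "\<And>t. t \<in> {0..T} \<Longrightarrow> z t = z0 + integral {0..t} (\<lambda>s. F (z s) s)"
proof -
  obtain z where z: "solves T F z0 z" using carath_exists[OF F T] by blast
  then have "is_the_solution T F z0 z"
    unfolding is_the_solution_def using carath_unique[OF F] by blast
  then show ?thesis using that z unfolding solves_iff_integral_equation[OF F] by blast
qed

text \<open>Lets a control be changed on a null set of times, in particular replaced by a
  representative that is bounded everywhere.\<close>

lemma is_the_solution_cong_AE:
  assumes "AE t in lebesgue_on {0..T}. \<forall>x. F x t = H x t"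
  shows "is_the_solution T F z0 z \<longleftrightarrow> is_the_solution T H z0 z"
proof -
  have "solves T F z0 z \<longleftrightarrow> solves T H z0 z" for z
  proof -
    have "(AE t in lebesgue_on {0..T}. (z has_vector_derivative F (z t) t) (at t within {0..T})) \<longleftrightarrow>
      (AE t in lebesgue_on {0..T}. (z has_vector_derivative H (z t) t) (at t within {0..T}))"
    proof
      assume "AE t in lebesgue_on {0..T}. (z has_vector_derivative F (z t) t) (at t within {0..T})"
      with assms show "AE t in lebesgue_on {0..T}. (z has_vector_derivative H (z t) t) (at t within {0..T})"
        by eventually_elim simp
    next
      assume "AE t in lebesgue_on {0..T}. (z has_vector_derivative H (z t) t) (at t within {0..T})"
      with assms show "AE t in lebesgue_on {0..T}. (z has_vector_derivative F (z t) t) (at t within {0..T})"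
        by eventually_elim simp
    qed
    then show ?thesis by (simp add: solves_def)
  qed
  then show ?thesis by (simp add: is_the_solution_def)
qed

section \<open>Sparse approximation of combinations of ReLU ridge functions\<close>

text \<open>The expectation over independent random signs, written as a recursion on their number so
  that proofs can treat one sign at a time.\<close>

primrec sign_avg :: "nat \<Rightarrow> (real list \<Rightarrow> real) \<Rightarrow> real" where
  "sign_avg 0 F = F []"
| "sign_avg (Suc n) F = (sign_avg n (\<lambda>e. F (1 # e)) + sign_avg n (\<lambda>e. F (- 1 # e))) / 2"

lemma sign_avg_mono:
  assumes "\<And>e. length e = n \<Longrightarrow> set e \<subseteq> {1, - 1} \<Longrightarrow> F e \<le> H e"
  shows "sign_avg n F \<le> sign_avg n H"
  using assms
proof (induction n arbitrary: F H)
  case (Suc n)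
  have "sign_avg n (\<lambda>e. F (1 # e)) \<le> sign_avg n (\<lambda>e. H (1 # e))"
    "sign_avg n (\<lambda>e. F (- 1 # e)) \<le> sign_avg n (\<lambda>e. H (- 1 # e))"
    by (intro Suc.IH Suc.prems; simp)+
  then show ?case by simp
qed simp

lemma sign_avg_add: "sign_avg n (\<lambda>e. F e + H e) = sign_avg n F + sign_avg n H"
  by (induction n arbitrary: F H) (simp_all add: field_simps)

lemma sign_avg_cmult: "sign_avg n (\<lambda>e. c * F e) = c * sign_avg n F"
  by (induction n arbitrary: F) (simp_all add: field_simps)

lemma sign_avg_const: "sign_avg n (\<lambda>_. c) = c"
  by (induction n) simp_all

lemma sign_avg_witness: "\<exists>e. length e = n \<and> set e \<subseteq> {1, - 1} \<and> F e \<le> sign_avg n F"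
proof (induction n arbitrary: F)
  case (Suc n)
  obtain e1 e2 where e1: "length e1 = n" "set e1 \<subseteq> {1, - 1}" "F (1 # e1) \<le> sign_avg n (\<lambda>e. F (1 # e))"
    and e2: "length e2 = n" "set e2 \<subseteq> {1, - 1}" "F (- 1 # e2) \<le> sign_avg n (\<lambda>e. F (- 1 # e))"
    using Suc.IH by meson
  show ?case
  proof (cases "F (1 # e1) \<le> F (- 1 # e2)")
    case True
    then show ?thesis using e1 e2 by (intro exI[of _ "1 # e1"]) auto
  next
    case False
    then show ?thesis using e1 e2 by (intro exI[of _ "- 1 # e2"]) auto
  qed
qed simp

definition sign_sum :: "real list \<Rightarrow> ('b \<Rightarrow> real) list \<Rightarrow> 'b \<Rightarrow> real" where
  "sign_sum e gs t = (\<Sum>(\<epsilon>, g)\<leftarrow>zip e gs. \<epsilon> * g t)"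

lemma sign_sum_Cons [simp]: "sign_sum (a # e) (g # gs) t = a * g t + sign_sum e gs t"
  by (simp add: sign_sum_def)

lemma sign_sum_Nil [simp]: "sign_sum [] gs t = 0" "sign_sum e [] t = 0"
  by (simp_all add: sign_sum_def)

lemma sign_sum_bounded:
  assumes "\<And>g. g \<in> set gs \<Longrightarrow> bounded (g ` S)"
  shows "bounded (sign_sum e gs ` S)"
  using assms
proof (induction gs arbitrary: e)
  case (Cons g gs)
  show ?case
  proof (cases e)
    case (Cons a e')
    have "bounded ((\<lambda>t. a *\<^sub>R g t + sign_sum e' gs t) ` S)"
      using Cons.IH Cons.prems by (intro bounded_plus_comp bounded_scaleR_comp) auto
    then show ?thesis by (simp add: Cons cong: image_cong)
  qed (auto simp: bounded_iff)
qed (auto simp: bounded_iff)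

text \<open>With the two suprema taken at points \<open>t\<close> and \<open>t'\<close>, the left
  side contains \<open>g\<close> only through \<open>g t - g t'\<close>. This is at most
  \<open>\<bar>h t - h t'\<bar>\<close>, which is a difference allowed on the right side, after
  exchanging the two points if necessary.\<close>

lemma sup_pair_contraction:
  fixes A g h :: "'b \<Rightarrow> real"
  assumes bdd: "bounded (A ` S)" "bounded (g ` S)" "bounded (h ` S)" and "S \<noteq> {}"
    and lip: "\<And>t t'. t \<in> S \<Longrightarrow> t' \<in> S \<Longrightarrow> \<bar>g t - g t'\<bar> \<le> \<bar>h t - h t'\<bar>"
  shows "(SUP t\<in>S. A t + g t) + (SUP t\<in>S. A t - g t) \<le> (SUP t\<in>S. A t + h t) + (SUP t\<in>S. A t - h t)"
proof -
  have b: "bdd_above ((\<lambda>t. A t + h t) ` S)" "bdd_above ((\<lambda>t. A t - h t) ` S)"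
    using bdd by (auto intro!: bounded_imp_bdd_above bounded_plus_comp bounded_minus_comp)
  have *: "A t + g t + (A t' - g t') \<le> (SUP t\<in>S. A t + h t) + (SUP t\<in>S. A t - h t)"
    if "t \<in> S" "t' \<in> S" for t t'
  proof -
    have u: "A s + h s \<le> (SUP t\<in>S. A t + h t)" "A s - h s \<le> (SUP t\<in>S. A t - h t)" if "s \<in> S" for s
      by (rule cSUP_upper[OF that] b)+
    show ?thesis using u[OF that(1)] u[OF that(2)] lip[OF that] by linarith
  qed
  have "A t + g t \<le> (SUP t\<in>S. A t + h t) + (SUP t\<in>S. A t - h t) - (SUP t\<in>S. A t - g t)" if "t \<in> S" for t
  proof -
    have "(SUP t\<in>S. A t - g t) \<le> (SUP t\<in>S. A t + h t) + (SUP t\<in>S. A t - h t) - (A t + g t)"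
      using *[OF that] by (intro cSUP_least \<open>S \<noteq> {}\<close>) (simp add: algebra_simps)
    then show ?thesis by simp
  qed
  then have "(SUP t\<in>S. A t + g t) \<le> (SUP t\<in>S. A t + h t) + (SUP t\<in>S. A t - h t) - (SUP t\<in>S. A t - g t)"
    by (intro cSUP_least \<open>S \<noteq> {}\<close>)
  then show ?thesis by simp
qed

text \<open>The Ledoux--Talagrand contraction principle: the signs are treated one at a time.\<close>

lemma sign_avg_contraction:
  fixes L :: "(('b \<Rightarrow> real) \<times> ('b \<Rightarrow> real)) list"
  assumes "S \<noteq> {}" and "bounded (u ` S)"
    and "\<And>g h. (g, h) \<in> set L \<Longrightarrow> bounded (g ` S) \<and> bounded (h ` S)"
    and "\<And>g h t t'. (g, h) \<in> set L \<Longrightarrow> t \<in> S \<Longrightarrow> t' \<in> S \<Longrightarrow> \<bar>g t - g t'\<bar> \<le> \<bar>h t - h t'\<bar>"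
  shows "sign_avg (length L) (\<lambda>e. SUP t\<in>S. u t + sign_sum e (map fst L) t)
    \<le> sign_avg (length L) (\<lambda>e. SUP t\<in>S. u t + sign_sum e (map snd L) t)"
  using assms
proof (induction L arbitrary: u)
  case (Cons gh L)
  obtain g h where gh: "gh = (g, h)" by force
  let ?n = "length L"
  let ?G = "\<lambda>e. sign_sum e (map fst L)"
  let ?H = "\<lambda>e. sign_sum e (map snd L)"
  have bg: "bounded (g ` S)" "bounded (h ` S)" using Cons.prems(3)[of g h] gh by auto
  have bH: "bounded (?H e ` S)" for e
    using Cons.prems(3) by (intro sign_sum_bounded) fastforce
  have IH: "sign_avg ?n (\<lambda>e. SUP t\<in>S. w t + ?G e t) \<le> sign_avg ?n (\<lambda>e. SUP t\<in>S. w t + ?H e t)"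
    if "bounded (w ` S)" for w
    using Cons.prems that by (intro Cons.IH) auto
  have "sign_avg (length (gh # L)) (\<lambda>e. SUP t\<in>S. u t + sign_sum e (map fst (gh # L)) t)
    = (sign_avg ?n (\<lambda>e. SUP t\<in>S. (u t + g t) + ?G e t) + sign_avg ?n (\<lambda>e. SUP t\<in>S. (u t - g t) + ?G e t)) / 2"
    by (simp add: gh algebra_simps)
  \<comment> \<open>The other signs are contracted by the induction hypothesis, with the current
    summand absorbed into \<open>u\<close>; afterwards the current sign is contracted while the
    others are held fixed.\<close>
  also have "\<dots> \<le> (sign_avg ?n (\<lambda>e. SUP t\<in>S. (u t + g t) + ?H e t) + sign_avg ?n (\<lambda>e. SUP t\<in>S. (u t - g t) + ?H e t)) / 2"
    using bg Cons.prems(2) by (intro divide_right_mono add_mono IH bounded_plus_comp bounded_minus_comp) auto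
  also have "\<dots> = sign_avg ?n (\<lambda>e. (SUP t\<in>S. (u t + ?H e t) + g t) + (SUP t\<in>S. (u t + ?H e t) - g t)) / 2"
    by (simp add: sign_avg_add algebra_simps)
  also have "\<dots> \<le> sign_avg ?n (\<lambda>e. (SUP t\<in>S. (u t + ?H e t) + h t) + (SUP t\<in>S. (u t + ?H e t) - h t)) / 2"
    using bg bH Cons.prems(1,2,4) gh
    by (intro divide_right_mono sign_avg_mono sup_pair_contraction bounded_plus_comp) auto
  also have "\<dots> = sign_avg (length (gh # L)) (\<lambda>e. SUP t\<in>S. u t + sign_sum e (map snd (gh # L)) t)"
    by (simp add: gh sign_avg_add algebra_simps)
  finally show ?case .
qed simp

lemma abs_bound_add: "\<bar>x\<bar> \<le> a \<Longrightarrow> \<bar>y\<bar> \<le> b \<Longrightarrow> \<bar>x + y\<bar> \<le> a + b" for x y :: real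
  by linarith

lemma abs_bound_add2: "\<bar>x\<bar> \<le> a \<Longrightarrow> \<bar>y\<bar> \<le> b \<Longrightarrow> \<bar>x + 2 * y\<bar> \<le> a + 2 * b" for x y :: real
  by linarith

text \<open>Independence of the signs in the form of the parallelogram law: each sign cancels its
  cross terms with everything accumulated in \<open>v\<close>.\<close>

lemma sign_avg_norm_square:
  fixes vs :: "'a::real_inner list"
  shows "sign_avg (length vs) (\<lambda>e. (norm (v + (\<Sum>(\<epsilon>, w)\<leftarrow>zip e vs. \<epsilon> *\<^sub>R w)))\<^sup>2)
    = (norm v)\<^sup>2 + (\<Sum>w\<leftarrow>vs. (norm w)\<^sup>2)"
proof (induction vs arbitrary: v)
  case (Cons a vs)
  have par: "(norm (v + a))\<^sup>2 + (norm (v - a))\<^sup>2 = 2 * (norm v)\<^sup>2 + 2 * (norm a)\<^sup>2"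
    by (simp add: power2_norm_eq_inner inner_simps)
  have "sign_avg (length (a # vs)) (\<lambda>e. (norm (v + (\<Sum>(\<epsilon>, w)\<leftarrow>zip e (a # vs). \<epsilon> *\<^sub>R w)))\<^sup>2)
    = (sign_avg (length vs) (\<lambda>e. (norm ((v + a) + (\<Sum>(\<epsilon>, w)\<leftarrow>zip e vs. \<epsilon> *\<^sub>R w)))\<^sup>2)
      + sign_avg (length vs) (\<lambda>e. (norm ((v - a) + (\<Sum>(\<epsilon>, w)\<leftarrow>zip e vs. \<epsilon> *\<^sub>R w)))\<^sup>2)) / 2"
    by (simp add: algebra_simps)
  then show ?case using par unfolding Cons.IH by simp
qed simp

lemma sign_avg_norm_le:
  fixes vs :: "'a::real_inner list"
  assumes "\<And>w. w \<in> set vs \<Longrightarrow> norm w \<le> 1"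
  shows "sign_avg (length vs) (\<lambda>e. norm (\<Sum>(\<epsilon>, w)\<leftarrow>zip e vs. \<epsilon> *\<^sub>R w)) \<le> sqrt (length vs)"
proof (cases "vs = []")
  case False
  let ?n = "length vs" and ?V = "\<lambda>e. \<Sum>(\<epsilon>, w)\<leftarrow>zip e vs. \<epsilon> *\<^sub>R w"
  have n: "sqrt ?n > 0" using False by simp
  have "(\<Sum>w\<leftarrow>vs. (norm w)\<^sup>2) \<le> (\<Sum>w\<leftarrow>vs. 1)"
    using assms by (intro sum_list_mono) (simp add: power_le_one)
  then have sq: "sign_avg ?n (\<lambda>e. (norm (?V e))\<^sup>2) \<le> ?n"
    using sign_avg_norm_square[of vs 0] by (simp add: sum_list_triv)
  \<comment> \<open>The inequality of arithmetic and geometric means, balanced at the expected size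
    \<open>sqrt n\<close>, takes the place of Jensen's inequality.\<close>
  have "norm (?V e) \<le> 1 / (2 * sqrt ?n) * (norm (?V e))\<^sup>2 + sqrt ?n / 2" for e
  proof -
    have "0 \<le> (norm (?V e) - sqrt ?n)\<^sup>2" by simp
    then have "2 * sqrt ?n * norm (?V e) \<le> (norm (?V e))\<^sup>2 + sqrt ?n * sqrt ?n"
      by (simp add: power2_eq_square algebra_simps)
    then show ?thesis using n by (simp add: field_simps)
  qed
  then have "sign_avg ?n (\<lambda>e. norm (?V e)) \<le> sign_avg ?n (\<lambda>e. 1 / (2 * sqrt ?n) * (norm (?V e))\<^sup>2 + sqrt ?n / 2)"
    by (intro sign_avg_mono)
  also have "\<dots> = 1 / (2 * sqrt ?n) * sign_avg ?n (\<lambda>e. (norm (?V e))\<^sup>2) + sqrt ?n / 2"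
    by (simp only: sign_avg_add sign_avg_cmult sign_avg_const)
  also have "\<dots> \<le> 1 / (2 * sqrt ?n) * ?n + sqrt ?n / 2"
    using sq n by (intro add_right_mono mult_left_mono) auto
  also have "\<dots> = sqrt ?n" using n by (simp add: field_simps real_sqrt_mult_self)
  finally show ?thesis .
qed simp

section \<open>Selection of few units: random halving\<close>

text \<open>A unit \<open>(s, v)\<close> stands for the function \<open>p \<mapsto> s max(v \<bullet> p, 0)\<close>; biases are absorbed by
  evaluating at \<open>p = (x, 1)\<close>.\<close>

definition unit_sum :: "(real \<times> 'a::real_inner) list \<Rightarrow> 'a \<Rightarrow> real" where
  "unit_sum xs p = (\<Sum>(s, v)\<leftarrow>xs. s * max (v \<bullet> p) 0)"

lemma unit_sum_simps [simp]:
  "unit_sum [] p = 0" "unit_sum (x # xs) p = fst x * max (snd x \<bullet> p) 0 + unit_sum xs p"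
  "unit_sum (xs @ ys) p = unit_sum xs p + unit_sum ys p"
  by (simp_all add: unit_sum_def split: prod.split)

text \<open>After contraction the ReLU is gone: the signed sum is a linear function
  \<open>V \<bullet> p\<close>, whose supremum over the ball is at most \<open>R * norm V\<close>
  and has mean at most \<open>R * sqrt n\<close>. No covering of the ball is involved, hence no
  logarithm. The factor 2 comes from controlling the sum and its negative with the same
  signs.\<close>

lemma sign_choice:
  fixes xs :: "(real \<times> 'a::euclidean_space) list"
  assumes R: "R \<ge> 0" and xs: "\<And>s v. (s, v) \<in> set xs \<Longrightarrow> \<bar>s\<bar> \<le> 1 \<and> norm v \<le> 1"
  shows "\<exists>e. length e = length xs \<and> set e \<subseteq> {1, - 1} \<and>
    (\<forall>p\<in>cball 0 R. \<bar>sign_sum e (map (\<lambda>(s, v) p. s * max (v \<bullet> p) 0) xs) p\<bar> \<le> 2 * R * sqrt (length xs))"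
proof -
  let ?S = "cball (0::'a) R" and ?n = "length xs"
  have main: "sign_avg ?n (\<lambda>e. SUP p\<in>?S. sign_sum e (map (\<lambda>(s, v) p. c * s * max (v \<bullet> p) 0) xs) p) \<le> R * sqrt ?n"
    if c: "\<bar>c\<bar> \<le> 1" for c :: real
  proof -
    define L where "L = map (\<lambda>(s, v). (\<lambda>p. c * s * max (v \<bullet> p) 0, \<lambda>p::'a. v \<bullet> p)) xs"
    have len: "length L = ?n" by (simp add: L_def)
    have fst_L: "map fst L = map (\<lambda>(s, v) p. c * s * max (v \<bullet> p) 0) xs"
      by (simp add: L_def split: prod.splits)
    have snd_L: "sign_sum e (map snd L) p = (\<Sum>(\<epsilon>, v)\<leftarrow>zip e (map snd xs). \<epsilon> *\<^sub>R v) \<bullet> p" for e p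
      unfolding L_def
    proof (induction xs arbitrary: e)
      case (Cons x xs)
      then show ?case by (cases e; cases x) (auto simp: inner_simps)
    qed simp
    have bd: "bounded ((\<lambda>p. v \<bullet> p) ` ?S)" for v :: 'a
      by (intro compact_imp_bounded compact_continuous_image continuous_intros) simp
    have bd': "bounded ((\<lambda>p. c * s * max (v \<bullet> p) 0) ` ?S)" for v :: 'a and s
      by (intro compact_imp_bounded compact_continuous_image continuous_intros) simp
    have "sign_avg (length L) (\<lambda>e. SUP p\<in>?S. 0 + sign_sum e (map fst L) p)
      \<le> sign_avg (length L) (\<lambda>e. SUP p\<in>?S. 0 + sign_sum e (map snd L) p)"
    proof (rule sign_avg_contraction)
      show "?S \<noteq> {}" using R by simp
      show "bounded ((\<lambda>_. 0::real) ` ?S)" by (auto simp: bounded_iff)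
      show "bounded (g ` ?S) \<and> bounded (h ` ?S)" if "(g, h) \<in> set L" for g h
        using that bd bd' by (auto simp: L_def)
      show "\<bar>g t - g t'\<bar> \<le> \<bar>h t - h t'\<bar>" if gh: "(g, h) \<in> set L" for g h t t'
      proof -
        obtain s v where sv: "(s, v) \<in> set xs" "g = (\<lambda>p. c * s * max (v \<bullet> p) 0)" "h = (\<lambda>p. v \<bullet> p)"
          using gh by (auto simp: L_def)
        have "\<bar>g t - g t'\<bar> = \<bar>c * s\<bar> * \<bar>max (v \<bullet> t) 0 - max (v \<bullet> t') 0\<bar>"
          unfolding sv(2) by (simp flip: abs_mult add: algebra_simps)
        also have "\<dots> \<le> 1 * \<bar>v \<bullet> t - v \<bullet> t'\<bar>"
          using c xs[OF sv(1)] by (intro mult_mono) (auto simp: abs_mult intro: mult_le_one)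
        finally show ?thesis by (simp add: sv(3))
      qed
    qed
    also have "\<dots> \<le> sign_avg (length L) (\<lambda>e. R * norm (\<Sum>(\<epsilon>, w)\<leftarrow>zip e (map snd xs). \<epsilon> *\<^sub>R w))"
    proof (intro sign_avg_mono cSUP_least)
      fix e p assume p: "p \<in> ?S"
      show "0 + sign_sum e (map snd L) p \<le> R * norm (\<Sum>(\<epsilon>, w)\<leftarrow>zip e (map snd xs). \<epsilon> *\<^sub>R w)"
      proof -
        define V where "V = (\<Sum>(\<epsilon>, w)\<leftarrow>zip e (map snd xs). \<epsilon> *\<^sub>R w)"
        have "V \<bullet> p \<le> norm V * norm p" by (rule norm_cauchy_schwarz)
        also have "\<dots> \<le> norm V * R" using p by (intro mult_left_mono) auto
        finally show ?thesis unfolding snd_L V_def[symmetric] by (simp add: mult.commute)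
      qed
    qed (use R in simp)
    also have "\<dots> \<le> R * sqrt ?n"
      unfolding sign_avg_cmult len
    proof (intro mult_left_mono R)
      have "norm w \<le> 1" if "w \<in> set (map snd xs)" for w using that xs by auto
      then have "sign_avg (length (map snd xs)) (\<lambda>e. norm (\<Sum>(\<epsilon>, w)\<leftarrow>zip e (map snd xs). \<epsilon> *\<^sub>R w))
        \<le> sqrt (length (map snd xs))"
        by (rule sign_avg_norm_le)
      then show "sign_avg ?n (\<lambda>e. norm (\<Sum>(\<epsilon>, w)\<leftarrow>zip e (map snd xs). \<epsilon> *\<^sub>R w)) \<le> sqrt ?n" by simp
    qed
    finally show ?thesis by (simp add: fst_L len)
  qed
  let ?g = "\<lambda>c::real. map (\<lambda>(s, v) p. c * s * max (v \<bullet> p) 0) xs"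
  have "sign_avg ?n (\<lambda>e. (SUP p\<in>?S. sign_sum e (?g 1) p) + (SUP p\<in>?S. sign_sum e (?g (- 1)) p)) \<le> 2 * R * sqrt ?n"
    unfolding sign_avg_add using main[of 1] main[of "- 1"] by simp
  then obtain e where e: "length e = ?n" "set e \<subseteq> {1, - 1}"
    "(SUP p\<in>?S. sign_sum e (?g 1) p) + (SUP p\<in>?S. sign_sum e (?g (- 1)) p) \<le> 2 * R * sqrt ?n"
    using sign_avg_witness[of ?n] by (meson order_trans)
  have neg: "sign_sum e (?g c) p = c * sign_sum e (?g 1) p" for c p
  proof (induction xs arbitrary: e)
    case (Cons x xs)
    then show ?case by (cases e; cases x) (auto simp: algebra_simps)
  qed simp
  have z: "sign_sum e (?g 1) 0 = 0"
  proof (induction xs arbitrary: e)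
    case (Cons x xs)
    then show ?case by (cases e; cases x) (auto simp: algebra_simps)
  qed simp
  have bdd: "bdd_above ((\<lambda>p. sign_sum e (?g c) p) ` ?S)" for c
    by (intro bounded_imp_bdd_above sign_sum_bounded compact_imp_bounded)
       (auto intro!: compact_continuous_image continuous_intros)
  have up: "sign_sum e (?g c) p \<le> (SUP p\<in>?S. sign_sum e (?g c) p)" if "p \<in> ?S" for p c
    by (rule cSUP_upper[OF that bdd])
  \<comment> \<open>The sums vanish at \<open>p = 0\<close>, so both suprema are nonnegative and
    each of them is at most their sum.\<close>
  have pos: "0 \<le> (SUP p\<in>?S. sign_sum e (?g c) p)" for c
    using up[of 0 c] R z neg[of c 0] by simp
  have "\<bar>sign_sum e (?g 1) p\<bar> \<le> 2 * R * sqrt ?n" if p: "p \<in> ?S" for p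
    using up[OF p, of 1] up[OF p, of "- 1"] pos[of 1] pos[of "- 1"] e(3) neg[of "- 1" p] by linarith
  then show ?thesis using e(1,2) by auto
qed

text \<open>Adding the signed sum to the full sum leaves twice the units of sign 1, subtracting it
  leaves twice those of sign -1. The shorter half is kept; up to sign, its deviation from the full
  sum is the signed sum.\<close>

lemma halving:
  fixes xs :: "(real \<times> 'a::euclidean_space) list"
  assumes R: "R \<ge> 0" and xs: "\<And>s v. (s, v) \<in> set xs \<Longrightarrow> \<bar>s\<bar> \<le> 1 \<and> norm v \<le> 1"
  shows "\<exists>ys. 2 * length ys \<le> length xs \<and> set ys \<subseteq> set xs \<and>
    (\<forall>p\<in>cball 0 R. \<bar>unit_sum xs p - 2 * unit_sum ys p\<bar> \<le> 2 * R * sqrt (length xs))"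
proof -
  let ?g = "map (\<lambda>(s, v) p. s * max (v \<bullet> p) 0) xs"
  obtain e where e: "length e = length xs" "set e \<subseteq> {1, - 1}"
    "\<And>p. p \<in> cball 0 R \<Longrightarrow> \<bar>sign_sum e ?g p\<bar> \<le> 2 * R * sqrt (length xs)"
    using sign_choice[OF R xs] by blast
  define part where "part c = map snd (filter (\<lambda>(\<epsilon>, _). \<epsilon> = c) (zip e xs))" for c :: real
  have sub: "set (part c) \<subseteq> set xs" for c
    by (auto simp: part_def dest: set_zip_rightD)
  have "length (part 1) + length (part (- 1)) = length xs \<and>
    (\<forall>p. unit_sum xs p + sign_sum e ?g p = 2 * unit_sum (part 1) p) \<and>
    (\<forall>p. unit_sum xs p - sign_sum e ?g p = 2 * unit_sum (part (- 1)) p)"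
    unfolding part_def using e(1,2)
  proof (induction e xs rule: list_induct2)
    case (Cons a e x xs)
    let ?part = "\<lambda>c. map snd (filter (\<lambda>(\<epsilon>, _). \<epsilon> = c) (zip e xs))"
    have IH: "length (?part 1) + length (?part (- 1)) = length xs"
      "unit_sum xs p + sign_sum e (map (\<lambda>(s, v) p. s * max (v \<bullet> p) 0) xs) p = 2 * unit_sum (?part 1) p"
      "unit_sum xs p - sign_sum e (map (\<lambda>(s, v) p. s * max (v \<bullet> p) 0) xs) p = 2 * unit_sum (?part (- 1)) p" for p
      using Cons.IH Cons.prems by auto
    have "a = 1 \<or> a = - 1" using Cons.prems by auto
    then show ?case
    proof
      assume a: "a = 1"
      show ?thesis unfolding a
      proof (intro conjI allI)
        fix p
        show "unit_sum (x # xs) p + sign_sum (1 # e) (map (\<lambda>(s, v) p. s * max (v \<bullet> p) 0) (x # xs)) p =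
          2 * unit_sum (map snd (filter (\<lambda>(\<epsilon>, _). \<epsilon> = 1) (zip (1 # e) (x # xs)))) p"
          using IH(2)[of p] by (simp add: case_prod_beta)
        show "unit_sum (x # xs) p - sign_sum (1 # e) (map (\<lambda>(s, v) p. s * max (v \<bullet> p) 0) (x # xs)) p =
          2 * unit_sum (map snd (filter (\<lambda>(\<epsilon>, _). \<epsilon> = - 1) (zip (1 # e) (x # xs)))) p"
          using IH(3)[of p] by (simp add: case_prod_beta)
      qed (use IH(1) in simp)
    next
      assume a: "a = - 1"
      show ?thesis unfolding a
      proof (intro conjI allI)
        fix p
        show "unit_sum (x # xs) p + sign_sum (- 1 # e) (map (\<lambda>(s, v) p. s * max (v \<bullet> p) 0) (x # xs)) p =
          2 * unit_sum (map snd (filter (\<lambda>(\<epsilon>, _). \<epsilon> = 1) (zip (- 1 # e) (x # xs)))) p"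
          using IH(2)[of p] by (simp add: case_prod_beta)
        show "unit_sum (x # xs) p - sign_sum (- 1 # e) (map (\<lambda>(s, v) p. s * max (v \<bullet> p) 0) (x # xs)) p =
          2 * unit_sum (map snd (filter (\<lambda>(\<epsilon>, _). \<epsilon> = - 1) (zip (- 1 # e) (x # xs)))) p"
          using IH(3)[of p] by (simp add: case_prod_beta)
      qed (use IH(1) in simp)
    qed
  qed simp
  then have len: "length (part 1) + length (part (- 1)) = length xs"
    and 1: "\<And>p. unit_sum xs p - 2 * unit_sum (part 1) p = - sign_sum e ?g p"
    and 2: "\<And>p. unit_sum xs p - 2 * unit_sum (part (- 1)) p = sign_sum e ?g p"
    by (smt (verit))+
  show ?thesis
  proof (cases "2 * length (part 1) \<le> length xs")
    case True
    then show ?thesis using sub e(3) 1 by (intro exI[of _ "part 1"]) auto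
  next
    case False
    then show ?thesis using sub e(3) 2 len by (intro exI[of _ "part (- 1)"]) auto
  qed
qed

text \<open>The error of a halving is multiplied by 2 for every halving before it, so the last ones
  dominate and the total is of order \<open>2 ^ r\<close>. The subtracted term
  \<open>4 * sqrt 2 ^ r\<close> closes the induction: it absorbs the error of the new
  halving.\<close>

lemma iterated_halving:
  fixes xs :: "(real \<times> 'a::euclidean_space) list"
  assumes R: "R \<ge> 0" and xs: "\<And>s v. (s, v) \<in> set xs \<Longrightarrow> \<bar>s\<bar> \<le> 1 \<and> norm v \<le> 1"
    and "length xs \<le> 2 ^ r * N"
  shows "\<exists>ys. length ys \<le> N \<and> set ys \<subseteq> set xs \<and>
    (\<forall>p\<in>cball 0 R. \<bar>unit_sum xs p - 2 ^ r * unit_sum ys p\<bar> \<le> 2 * R * sqrt N * (4 * 2 ^ r - 4 * sqrt 2 ^ r))"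
  using xs assms(3)
proof (induction r arbitrary: xs)
  case 0
  then show ?case by auto
next
  case (Suc r)
  obtain ys where ys: "2 * length ys \<le> length xs" "set ys \<subseteq> set xs"
    "\<And>p. p \<in> cball 0 R \<Longrightarrow> \<bar>unit_sum xs p - 2 * unit_sum ys p\<bar> \<le> 2 * R * sqrt (length xs)"
    using halving[OF R Suc.prems(1)] by blast
  have "length ys \<le> 2 ^ r * N" using ys(1) Suc.prems(2) by simp
  then obtain zs where zs: "length zs \<le> N" "set zs \<subseteq> set ys"
    "\<And>p. p \<in> cball 0 R \<Longrightarrow> \<bar>unit_sum ys p - 2 ^ r * unit_sum zs p\<bar> \<le> 2 * R * sqrt N * (4 * 2 ^ r - 4 * sqrt 2 ^ r)"
    using Suc.IH[of ys] Suc.prems(1) ys(2) by blast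
  have "\<bar>unit_sum xs p - 2 ^ Suc r * unit_sum zs p\<bar> \<le> 2 * R * sqrt N * (4 * 2 ^ Suc r - 4 * sqrt 2 ^ Suc r)"
    if p: "p \<in> cball 0 R" for p
  proof -
    have "real (length xs) \<le> 2 ^ Suc r * real N"
      using Suc.prems(2) by (metis of_nat_le_iff of_nat_mult of_nat_numeral of_nat_power)
    then have "sqrt (length xs) \<le> sqrt 2 ^ Suc r * sqrt N"
      by (metis real_sqrt_le_mono real_sqrt_mult real_sqrt_power)
    then have 1: "2 * R * sqrt (length xs) \<le> 2 * R * (sqrt 2 ^ Suc r * sqrt N)"
      using R by (intro mult_left_mono) auto
    have "unit_sum xs p - 2 ^ Suc r * unit_sum zs p
      = (unit_sum xs p - 2 * unit_sum ys p) + 2 * (unit_sum ys p - 2 ^ r * unit_sum zs p)" by simp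
    then have "\<bar>unit_sum xs p - 2 ^ Suc r * unit_sum zs p\<bar>
      \<le> 2 * R * (sqrt 2 ^ Suc r * sqrt N) + 2 * (2 * R * sqrt N * (4 * 2 ^ r - 4 * sqrt 2 ^ r))"
      using abs_bound_add2[OF order_trans[OF ys(3)[OF p] 1] zs(3)[OF p]] by simp
    also have "\<dots> = 2 * R * sqrt N * (4 * 2 ^ Suc r - (8 - sqrt 2) * sqrt 2 ^ r)"
      by (simp add: algebra_simps)
    also have "\<dots> \<le> 2 * R * sqrt N * (4 * 2 ^ Suc r - 4 * sqrt 2 * sqrt 2 ^ r)"
    proof -
      \<comment> \<open>This is \<open>4 * sqrt 2 \<le> 8 - sqrt 2\<close>: the constant 4 of the
        bound leaves enough room for one more halving.\<close>
      have "sqrt 2 \<le> 8 / 5" by (rule real_le_lsqrt) (auto simp: power2_eq_square)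
      then have "4 * sqrt 2 * sqrt 2 ^ r \<le> (8 - sqrt 2) * sqrt 2 ^ r"
        by (intro mult_right_mono) auto
      then show ?thesis using R by (intro mult_left_mono) auto
    qed
    finally show ?thesis by (simp add: algebra_simps)
  qed
  then show ?case using zs ys(2) by (intro exI[of _ zs]) auto
qed

text \<open>Every weight is rounded down to a multiple of \<open>C / M\<close> and its unit repeated
  accordingly. All units then carry the same weight and may be halved as a list; rounding costs at
  most \<open>R * C / M\<close> for each entry of \<open>cs\<close>.\<close>

lemma round_weights:
  fixes cs :: "(real \<times> 'a::euclidean_space) list"
  assumes R: "R \<ge> 0" and C: "C > 0" and M: "M > (0::real)"
  shows "\<exists>xs. (\<forall>(s, v)\<in>set xs. \<bar>s\<bar> \<le> 1 \<and> norm v \<le> 1) \<and>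
    real (length xs) * C \<le> M * (\<Sum>(c, v)\<leftarrow>cs. \<bar>c\<bar> * norm v) \<and>
    (\<forall>p\<in>cball 0 R. \<bar>unit_sum cs p - C / M * unit_sum xs p\<bar> \<le> length cs * (R * C / M))"
proof (induction cs)
  case Nil
  show ?case by (rule exI[of _ "[]"]) simp
next
  case (Cons cv cs)
  obtain c v where cv: "cv = (c, v)" by force
  obtain xs where xs: "\<And>s v. (s, v) \<in> set xs \<Longrightarrow> \<bar>s\<bar> \<le> 1 \<and> norm v \<le> 1"
    "real (length xs) * C \<le> M * (\<Sum>(c, v)\<leftarrow>cs. \<bar>c\<bar> * norm v)"
    "\<And>p. p \<in> cball 0 R \<Longrightarrow> \<bar>unit_sum cs p - C / M * unit_sum xs p\<bar> \<le> length cs * (R * C / M)"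
    using Cons.IH by fastforce
  define w where "w = \<bar>c\<bar> * norm v"
  define q where "q = nat \<lfloor>w * M / C\<rfloor>"
  have w0: "w * M / C \<ge> 0" using C M by (simp add: w_def)
  have q: "real q \<le> w * M / C" "w * M / C \<le> real q + 1"
    unfolding q_def using w0 by (auto simp: of_nat_nat)
  define ys where "ys = replicate q (sgn c, v /\<^sub>R norm v) @ xs"
  have us: "unit_sum (replicate n x) p = n * (fst x * max (snd x \<bullet> p) 0)" for n x and p :: 'a
    by (induction n) (auto simp: algebra_simps)
  \<comment> \<open>Positive homogeneity of the ReLU moves the length of \<open>v\<close> into the
    weight.\<close>
  have hom: "c * max (v \<bullet> p) 0 = w * (sgn c * max ((v /\<^sub>R norm v) \<bullet> p) 0)" for p
  proof (cases "v = 0")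
    case False
    then have "norm v * max ((v /\<^sub>R norm v) \<bullet> p) 0 = max (v \<bullet> p) 0"
      by (simp add: max_mult_distrib_left flip: mult.assoc)
    moreover have "c = \<bar>c\<bar> * sgn c" by (simp add: abs_mult_sgn)
    ultimately show ?thesis unfolding w_def by (metis mult.assoc mult.left_commute)
  qed (simp add: w_def)
  have err: "\<bar>w - C / M * q\<bar> \<le> C / M"
  proof -
    have "C / M * q \<le> C / M * (w * M / C)" "C / M * (w * M / C) \<le> C / M * (q + 1)"
      using q C M by (intro mult_left_mono; simp)+
    moreover have "C / M * (w * M / C) = w" "C / M * (q + 1) = C / M * q + C / M" using C M by (simp_all add: field_simps)
    ultimately show ?thesis by linarith
  qed
  have "\<bar>unit_sum (cv # cs) p - C / M * unit_sum ys p\<bar> \<le> length (cv # cs) * (R * C / M)"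
    if p: "p \<in> cball 0 R" for p
  proof -
    let ?h = "sgn c * max ((v /\<^sub>R norm v) \<bullet> p) 0"
    have "\<bar>(v /\<^sub>R norm v) \<bullet> p\<bar> \<le> norm (v /\<^sub>R norm v) * norm p" by (rule Cauchy_Schwarz_ineq2)
    also have "\<dots> \<le> 1 * R" using p by (intro mult_mono) (cases "v = 0"; simp)+
    finally have "\<bar>max ((v /\<^sub>R norm v) \<bullet> p) 0\<bar> \<le> R" by linarith
    then have "\<bar>sgn c\<bar> * \<bar>max ((v /\<^sub>R norm v) \<bullet> p) 0\<bar> \<le> 1 * R"
      by (intro mult_mono) (auto simp: sgn_if)
    then have h: "\<bar>?h\<bar> \<le> R" by (simp only: abs_mult mult_1_left)
    have "unit_sum (cv # cs) p - C / M * unit_sum ys p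
      = (w - C / M * q) * ?h + (unit_sum cs p - C / M * unit_sum xs p)"
      using hom[of p] by (simp add: cv ys_def us algebra_simps)
    also have "\<bar>\<dots>\<bar> \<le> C / M * R + length cs * (R * C / M)"
    proof (rule abs_bound_add[OF _ xs(3)[OF p]])
      show "\<bar>(w - C / M * q) * ?h\<bar> \<le> C / M * R"
        unfolding abs_mult[of "w - C / M * q"] using C M by (intro mult_mono err h) auto
    qed
    finally show ?thesis by (simp add: algebra_simps add_divide_distrib)
  qed
  moreover have "real (length ys) * C \<le> M * (\<Sum>(c, v)\<leftarrow>cv # cs. \<bar>c\<bar> * norm v)"
  proof -
    have "real q * C \<le> M * w" using q(1) C by (simp add: field_simps)
    then show ?thesis using xs(2) by (simp add: ys_def cv w_def algebra_simps)
  qed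
  moreover have "\<forall>(s, v)\<in>set ys. \<bar>s\<bar> \<le> 1 \<and> norm v \<le> 1"
  proof -
    have "norm (v /\<^sub>R norm v) \<le> 1" by (cases "v = 0") auto
    then show ?thesis using xs(1) by (auto simp: ys_def sgn_if simp del: norm_scaleR)
  qed
  ultimately show ?case by (intro exI[of _ ys]) simp
qed

text \<open>The combination is refined to at most \<open>2 ^ r * N\<close> equal units, which are
  halved \<open>r\<close> times. For \<open>r = length cs\<close> the rounding error stays below
  \<open>R * C / N\<close> since \<open>length cs < 2 ^ r\<close>; it accounts for 1 in the constant
  9 and the halvings for 8. The length of \<open>cs\<close> does not enter the bound, which
  therefore survives passing to limits of combinations.\<close>

theorem maurey_uniform:
  fixes cs :: "(real \<times> 'a::euclidean_space) list"
  assumes R: "R \<ge> 0" and C: "C > 0" and N: "N > 0" and cs: "(\<Sum>(c, v)\<leftarrow>cs. \<bar>c\<bar> * norm v) \<le> C"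
  shows "\<exists>xs. length xs = N \<and> (\<forall>(s, v)\<in>set xs. \<bar>s\<bar> \<le> 1 \<and> norm v \<le> 1) \<and>
    (\<forall>p\<in>cball 0 R. \<bar>unit_sum cs p - C / N * unit_sum xs p\<bar> \<le> 9 * R * C / sqrt N)"
proof -
  define r where "r = length cs"
  define M where "M = 2 ^ r * real N"
  have M: "M > 0" using N by (simp add: M_def)
  obtain xs where xs: "\<And>s v. (s, v) \<in> set xs \<Longrightarrow> \<bar>s\<bar> \<le> 1 \<and> norm v \<le> 1"
    "real (length xs) * C \<le> M * (\<Sum>(c, v)\<leftarrow>cs. \<bar>c\<bar> * norm v)"
    "\<And>p. p \<in> cball 0 R \<Longrightarrow> \<bar>unit_sum cs p - C / M * unit_sum xs p\<bar> \<le> length cs * (R * C / M)"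
    using round_weights[OF R C M, of cs] by fastforce
  have "real (length xs) * C \<le> M * C" using xs(2) mult_left_mono[OF cs, of M] M by linarith
  then have "real (length xs) \<le> real (2 ^ r * N)" using C by (simp add: M_def)
  then have "length xs \<le> 2 ^ r * N" by (simp only: of_nat_le_iff)
  then obtain ys where ys: "length ys \<le> N" "set ys \<subseteq> set xs"
    "\<And>p. p \<in> cball 0 R \<Longrightarrow> \<bar>unit_sum xs p - 2 ^ r * unit_sum ys p\<bar> \<le> 2 * R * sqrt N * (4 * 2 ^ r - 4 * sqrt 2 ^ r)"
    using iterated_halving[OF R xs(1)] by blast
  define zs where "zs = ys @ replicate (N - length ys) (0, 0)"
  have "unit_sum (replicate n (0, 0)) p = 0" for n and p :: 'a by (induction n) auto
  then have zs_ys: "unit_sum zs p = unit_sum ys p" for p by (simp add: zs_def)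
  have "\<bar>unit_sum cs p - C / N * unit_sum zs p\<bar> \<le> 9 * R * C / sqrt N" if p: "p \<in> cball 0 R" for p
  proof -
    have sN: "sqrt N > 0" "sqrt N * sqrt N = N" "sqrt N \<ge> 1" using N by auto
    have "\<bar>unit_sum xs p - 2 ^ r * unit_sum ys p\<bar> \<le> 2 * R * sqrt N * (4 * 2 ^ r)"
      by (rule order_trans[OF ys(3)[OF p]]) (use R in \<open>intro mult_left_mono; simp\<close>)
    then have "C / M * \<bar>unit_sum xs p - 2 ^ r * unit_sum ys p\<bar> \<le> C / M * (2 * R * sqrt N * (4 * 2 ^ r))"
      using C M by (intro mult_left_mono) auto
    also have "\<dots> = 8 * R * C / sqrt N"
      using sN N by (simp add: M_def field_simps)
    finally have 1: "\<bar>C / M * (unit_sum xs p - 2 ^ r * unit_sum ys p)\<bar> \<le> 8 * R * C / sqrt N"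
      using C M by (simp add: abs_mult)
    have "real (length cs) < 2 ^ r" unfolding r_def by (rule of_nat_less_two_power)
    then have "length cs * (R * C / M) \<le> 2 ^ r * (R * C / M)"
      using R C M by (intro mult_right_mono) auto
    also have "\<dots> = R * C / N" using N by (simp add: M_def)
    also have "\<dots> \<le> R * C / sqrt N"
      using sN R C N by (intro divide_left_mono) (auto simp: real_le_lsqrt power2_eq_square)
    finally have 2: "\<bar>unit_sum cs p - C / M * unit_sum xs p\<bar> \<le> R * C / sqrt N"
      using xs(3)[OF p] by linarith
    have 3: "C / M * 2 ^ r = C / N" by (simp add: M_def)
    have "unit_sum cs p - C / N * unit_sum zs p
      = (unit_sum cs p - C / M * unit_sum xs p) + C / M * (unit_sum xs p - 2 ^ r * unit_sum ys p)"
      unfolding zs_ys 3[symmetric] by (simp add: algebra_simps)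
    then have "\<bar>unit_sum cs p - C / N * unit_sum zs p\<bar> \<le> R * C / sqrt N + 8 * R * C / sqrt N"
      using abs_bound_add[OF 2 1] by simp
    also have "\<dots> = 9 * R * C / sqrt N" by (simp add: add_divide_distrib[symmetric])
    finally show ?thesis .
  qed
  moreover have "length zs = N" using ys(1) by (simp add: zs_def)
  moreover have "\<forall>(s, v)\<in>set zs. \<bar>s\<bar> \<le> 1 \<and> norm v \<le> 1" using xs(1) ys(2) by (auto simp: zs_def)
  ultimately show ?thesis by blast
qed

section \<open>Uniform limits of combinations of ReLU ridge functions\<close>

text \<open>A bound on the variation norm of \<open>g\<close> over \<open>X\<close> with respect to
  ReLU ridge functions. Uniform limits are built in and the number of terms is free, because only
  the total weight enters the rate.\<close>

definition relu_hull :: "'a::euclidean_space set \<Rightarrow> real \<Rightarrow> ('a \<Rightarrow> real) \<Rightarrow> bool" where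
  "relu_hull X C g \<longleftrightarrow> (\<forall>\<epsilon>>0. \<exists>cs. (\<Sum>(c, v)\<leftarrow>cs. \<bar>c\<bar> * norm v) \<le> C \<and> (\<forall>p\<in>X. \<bar>g p - unit_sum cs p\<bar> \<le> \<epsilon>))"

lemma relu_hullD:
  assumes "relu_hull X C g" "\<epsilon> > 0"
  obtains cs where "(\<Sum>(c, v)\<leftarrow>cs. \<bar>c\<bar> * norm v) \<le> C" "\<And>p. p \<in> X \<Longrightarrow> \<bar>g p - unit_sum cs p\<bar> \<le> \<epsilon>"
  using assms unfolding relu_hull_def by blast

lemma relu_hull_mono: "relu_hull X C g \<Longrightarrow> C \<le> D \<Longrightarrow> relu_hull X D g"
  unfolding relu_hull_def by (meson order_trans)

lemma relu_hull_cong: "relu_hull X C g \<Longrightarrow> (\<And>p. p \<in> X \<Longrightarrow> h p = g p) \<Longrightarrow> relu_hull X C h"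
  unfolding relu_hull_def by simp

lemma relu_hull_zero: "relu_hull X 0 (\<lambda>_. 0)"
  unfolding relu_hull_def by (auto intro!: exI[of _ "[]"])

lemma relu_hull_add:
  assumes "relu_hull X C g" "relu_hull X D h"
  shows "relu_hull X (C + D) (\<lambda>p. g p + h p)"
  unfolding relu_hull_def
proof (intro allI impI)
  fix e :: real assume e: "e > 0"
  obtain cs where cs: "(\<Sum>(c, v)\<leftarrow>cs. \<bar>c\<bar> * norm v) \<le> C" "\<And>p. p \<in> X \<Longrightarrow> \<bar>g p - unit_sum cs p\<bar> \<le> e / 2"
    using relu_hullD[OF assms(1), of "e / 2"] e by auto
  obtain ds where ds: "(\<Sum>(c, v)\<leftarrow>ds. \<bar>c\<bar> * norm v) \<le> D" "\<And>p. p \<in> X \<Longrightarrow> \<bar>h p - unit_sum ds p\<bar> \<le> e / 2"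
    using relu_hullD[OF assms(2), of "e / 2"] e by auto
  have "\<bar>g p + h p - unit_sum (cs @ ds) p\<bar> \<le> e" if "p \<in> X" for p
    using abs_bound_add[OF cs(2)[OF that] ds(2)[OF that]] by (simp add: algebra_simps)
  then show "\<exists>cs. (\<Sum>(c, v)\<leftarrow>cs. \<bar>c\<bar> * norm v) \<le> C + D \<and> (\<forall>p\<in>X. \<bar>g p + h p - unit_sum cs p\<bar> \<le> e)"
    using cs(1) ds(1) by (intro exI[of _ "cs @ ds"]) simp
qed

lemma relu_hull_scale:
  assumes "relu_hull X C g"
  shows "relu_hull X (\<bar>a\<bar> * C) (\<lambda>p. a * g p)"
  unfolding relu_hull_def
proof (intro allI impI)
  fix e :: real assume e: "e > 0"
  define \<epsilon> where "\<epsilon> = e / (\<bar>a\<bar> + 1)"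
  have \<epsilon>: "\<epsilon> > 0" "\<bar>a\<bar> * \<epsilon> \<le> e" using e by (auto simp: \<epsilon>_def field_simps)
  obtain cs where cs: "(\<Sum>(c, v)\<leftarrow>cs. \<bar>c\<bar> * norm v) \<le> C" "\<And>p. p \<in> X \<Longrightarrow> \<bar>g p - unit_sum cs p\<bar> \<le> \<epsilon>"
    using relu_hullD[OF assms \<epsilon>(1)] by auto
  let ?ds = "map (\<lambda>(c, v). (a * c, v)) cs"
  have us: "unit_sum ?ds p = a * unit_sum cs p" for p
    by (induction cs) (auto simp: algebra_simps)
  have "(\<Sum>(c, v)\<leftarrow>?ds. \<bar>c\<bar> * norm v) = \<bar>a\<bar> * (\<Sum>(c, v)\<leftarrow>cs. \<bar>c\<bar> * norm v)"
    by (induction cs) (auto simp: algebra_simps abs_mult)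
  also have "\<dots> \<le> \<bar>a\<bar> * C" using cs(1) by (intro mult_left_mono) auto
  finally have 1: "(\<Sum>(c, v)\<leftarrow>?ds. \<bar>c\<bar> * norm v) \<le> \<bar>a\<bar> * C" .
  have "\<bar>a * g p - unit_sum ?ds p\<bar> \<le> e" if "p \<in> X" for p
  proof -
    have "\<bar>a * g p - unit_sum ?ds p\<bar> = \<bar>a\<bar> * \<bar>g p - unit_sum cs p\<bar>"
      unfolding us by (simp flip: abs_mult add: algebra_simps)
    also have "\<dots> \<le> \<bar>a\<bar> * \<epsilon>" using cs(2)[OF that] by (intro mult_left_mono) auto
    finally show ?thesis using \<epsilon>(2) by simp
  qed
  then show "\<exists>cs. (\<Sum>(c, v)\<leftarrow>cs. \<bar>c\<bar> * norm v) \<le> \<bar>a\<bar> * C \<and> (\<forall>p\<in>X. \<bar>a * g p - unit_sum cs p\<bar> \<le> e)"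
    using 1 by blast
qed

lemma relu_hull_sum:
  assumes "finite I" "\<And>i. i \<in> I \<Longrightarrow> relu_hull X (C i) (g i)"
  shows "relu_hull X (\<Sum>i\<in>I. C i) (\<lambda>p. \<Sum>i\<in>I. g i p)"
  using assms by (induction I rule: finite_induct) (auto intro: relu_hull_add relu_hull_zero)

lemma relu_hull_limit:
  assumes "\<And>\<epsilon>. \<epsilon> > 0 \<Longrightarrow> \<exists>h. relu_hull X C h \<and> (\<forall>p\<in>X. \<bar>g p - h p\<bar> \<le> \<epsilon>)"
  shows "relu_hull X C g"
  unfolding relu_hull_def
proof (intro allI impI)
  fix e :: real assume e: "e > 0"
  obtain h where h: "relu_hull X C h" "\<And>p. p \<in> X \<Longrightarrow> \<bar>g p - h p\<bar> \<le> e / 2"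
    using assms[of "e / 2"] e by auto
  obtain cs where cs: "(\<Sum>(c, v)\<leftarrow>cs. \<bar>c\<bar> * norm v) \<le> C" "\<And>p. p \<in> X \<Longrightarrow> \<bar>h p - unit_sum cs p\<bar> \<le> e / 2"
    using relu_hullD[OF h(1), of "e / 2"] e by auto
  have "\<bar>g p - unit_sum cs p\<bar> \<le> e" if "p \<in> X" for p
    using h(2)[OF that] cs(2)[OF that] by linarith
  then show "\<exists>cs. (\<Sum>(c, v)\<leftarrow>cs. \<bar>c\<bar> * norm v) \<le> C \<and> (\<forall>p\<in>X. \<bar>g p - unit_sum cs p\<bar> \<le> e)"
    using cs(1) by blast
qed

lemma relu_hull_ridge: "relu_hull X (\<bar>c\<bar> * norm v) (\<lambda>p. c * max (v \<bullet> p) 0)"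
  unfolding relu_hull_def by (auto intro!: exI[of _ "[(c, v)]"])

lemma sin_lipschitz: "\<bar>sin x - sin y\<bar> \<le> \<bar>x - y\<bar>" for x y :: real
proof -
  have "norm (sin x - sin y) \<le> 1 * norm (x - y)"
    by (rule field_differentiable_bound[of UNIV sin cos]) (auto intro!: derivative_eq_intros)
  then show ?thesis by simp
qed

lemma cos_tangent_error:
  fixes x y z :: real
  assumes "\<And>c. c \<in> {min x y..max x y} \<Longrightarrow> \<bar>c - z\<bar> \<le> h"
  shows "\<bar>cos (x + \<theta>) - cos (y + \<theta>) + (x - y) * sin (z + \<theta>)\<bar> \<le> h * \<bar>x - y\<bar>"
proof -
  have "norm ((cos (x + \<theta>) + x * sin (z + \<theta>)) - (cos (y + \<theta>) + y * sin (z + \<theta>))) \<le> h * norm (x - y)"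
  proof (rule field_differentiable_bound[of "{min x y..max x y}" _ "\<lambda>c. - sin (c + \<theta>) + sin (z + \<theta>)"])
    show "norm (- sin (c + \<theta>) + sin (z + \<theta>)) \<le> h" if "c \<in> {min x y..max x y}" for c
      using sin_lipschitz[of "z + \<theta>" "c + \<theta>"] assms[OF that] by simp
  qed (auto intro!: derivative_eq_intros)
  then show ?thesis by (simp add: algebra_simps)
qed

text \<open>Taylor's formula with integral remainder writes \<open>cos\<close> on \<open>[-a, a]\<close> as a superposition of the
  functions \<open>s \<mapsto> max(s - b, 0)\<close>; the Riemann sums of that integral are estimated through the explicit
  antiderivative \<open>\<Phi>\<close>.\<close>

lemma cos_relu_riemann:
  fixes a :: real
  assumes a: "a \<ge> 0" and N: "N > 0" and s: "\<bar>s\<bar> \<le> a"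
  defines "h \<equiv> 2 * a / N" and "b \<equiv> \<lambda>i::nat. - a + i * (2 * a / N)"
  shows "\<bar>cos (s + \<theta>) - (cos (\<theta> - a) - sin (\<theta> - a) * (s + a)
    + (\<Sum>i<N. (sin (b i + \<theta>) - sin (b (Suc i) + \<theta>)) * max (s - b i) 0))\<bar> \<le> N * h\<^sup>2"
proof -
  \<comment> \<open>Its derivative in \<open>x\<close> is
    \<open>- cos (x + \<theta>) * max (s - x) 0\<close>, the integrand of Taylor's remainder; the
    minimum keeps it constant beyond \<open>s\<close>.\<close>
  define \<Phi> where "\<Phi> x = - sin (x + \<theta>) * max (s - x) 0 + cos (min x s + \<theta>)" for x
  let ?w = "\<lambda>i. sin (b i + \<theta>) - sin (b (Suc i) + \<theta>)"
  have h: "h \<ge> 0" using a by (simp add: h_def)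
  have bS: "b (Suc i) = b i + h" for i by (simp add: b_def h_def algebra_simps add_divide_distrib)
  have b0: "b 0 = - a" "b N = a" using N by (auto simp: b_def)
  have step: "\<bar>(\<Phi> (b (Suc i)) - \<Phi> (b i)) - ?w i * max (s - b i) 0\<bar> \<le> h\<^sup>2" for i
  proof -
    consider "b (Suc i) \<le> s" | "b i \<le> s" "s < b (Suc i)" | "s < b i" by linarith
    then show ?thesis
    proof cases
      case 1
      then have "b i \<le> s" using h bS[of i] by linarith
      then have "(\<Phi> (b (Suc i)) - \<Phi> (b i)) - ?w i * max (s - b i) 0
        = cos (b (Suc i) + \<theta>) - cos (b i + \<theta>) + (b (Suc i) - b i) * sin (b (Suc i) + \<theta>)"
        using 1 by (simp add: \<Phi>_def algebra_simps)
      also have "\<bar>\<dots>\<bar> \<le> h * \<bar>b (Suc i) - b i\<bar>"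
        using h by (intro cos_tangent_error) (auto simp: bS)
      finally show ?thesis using h by (simp add: bS power2_eq_square)
    next
      case 2
      then have "(\<Phi> (b (Suc i)) - \<Phi> (b i)) - ?w i * max (s - b i) 0
        = cos (s + \<theta>) - cos (b i + \<theta>) + (s - b i) * sin (b (Suc i) + \<theta>)"
        by (simp add: \<Phi>_def algebra_simps)
      also have "\<bar>\<dots>\<bar> \<le> h * \<bar>s - b i\<bar>"
        using h 2 by (intro cos_tangent_error) (auto simp: bS)
      also have "\<dots> \<le> h * h" using h 2 by (intro mult_left_mono) (auto simp: bS)
      finally show ?thesis by (simp add: power2_eq_square)
    next
      case 3
      then have "s < b (Suc i)" using h bS[of i] by linarith
      then show ?thesis using 3 by (simp add: \<Phi>_def)
    qed
  qed
  have "cos (s + \<theta>) - (cos (\<theta> - a) - sin (\<theta> - a) * (s + a)) = \<Phi> (b N) - \<Phi> (b 0)"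
    using s by (simp add: \<Phi>_def b0 algebra_simps)
  also have "\<dots> = (\<Sum>i<N. \<Phi> (b (Suc i)) - \<Phi> (b i))"
    by (rule sum_lessThan_telescope[of "\<lambda>i. \<Phi> (b i)" N, symmetric])
  finally have "cos (s + \<theta>) - (cos (\<theta> - a) - sin (\<theta> - a) * (s + a) + (\<Sum>i<N. ?w i * max (s - b i) 0))
    = (\<Sum>i<N. (\<Phi> (b (Suc i)) - \<Phi> (b i)) - ?w i * max (s - b i) 0)"
    by (simp add: sum_subtractf)
  also have "\<bar>\<dots>\<bar> \<le> (\<Sum>i<N. h\<^sup>2)"
    using step by (intro order_trans[OF sum_abs] sum_mono)
  finally show ?thesis by simp
qed

text \<open>On the ball the argument \<open>\<xi> \<bullet> x\<close> stays in [-a, a] with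
  \<open>a = R * norm \<xi>\<close>. The constant costs weight 1, the linear part
  \<open>2 * a\<close>, and the \<open>N\<close> hinges of weight at most \<open>h\<close> together
  \<open>N * h * (2 * a) = 4 * a\<^sup>2\<close>, whatever their number. This is where the square of
  the frequency, and with it the 2 in the condition on \<open>k\<close>, comes from.\<close>

lemma relu_hull_cos:
  fixes \<xi> :: "'a::euclidean_space"
  assumes R: "R \<ge> 1"
  shows "relu_hull (cball 0 R \<times> {1}) ((1 + 2 * R + 4 * R\<^sup>2) * (1 + (norm \<xi>)\<^sup>2))
    (\<lambda>p :: 'a \<times> real. cos (\<xi> \<bullet> fst p + \<theta>))"
proof (rule relu_hull_limit)
  fix e :: real assume e: "e > 0"
  define a where "a = R * norm \<xi>"
  have a: "a \<ge> 0" "norm \<xi> \<le> a" using R mult_right_mono[of 1 R "norm \<xi>"] by (auto simp: a_def)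
  obtain N :: nat where N: "N > 4 * a\<^sup>2 / e" by (meson reals_Archimedean2)
  have N0: "N > 0" using N e a by (metis divide_nonneg_pos linorder_not_less mult_nonneg_nonneg of_nat_0_less_iff order_le_less_trans zero_le_numeral zero_le_power2)
  define h where "h = 2 * a / N"
  define b where "b i = - a + i * (2 * a / N)" for i :: nat
  \<comment> \<open>Constants are ridge functions in the direction \<open>(0, 1)\<close>, as the
    last coordinate of \<open>p\<close> is 1; the linear part is one too, because
    \<open>s + a\<close> equals its own positive part.\<close>
  define g where "g p = (cos (\<theta> - a) * max ((0, 1) \<bullet> p) 0 + - sin (\<theta> - a) * max ((\<xi>, a) \<bullet> p) 0)
    + (\<Sum>i<N. (sin (b i + \<theta>) - sin (b (Suc i) + \<theta>)) * max ((\<xi>, - b i) \<bullet> p) 0)" for p :: "'a \<times> real"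
  have nrm: "norm (\<xi>, c) \<le> 2 * a" if "\<bar>c\<bar> \<le> a" for c :: real
    using norm_Pair_le[of \<xi> c] a that by simp
  have bi: "\<bar>b i\<bar> \<le> a" if "i \<le> N" for i
  proof -
    have "i * (2 * a / N) \<le> N * (2 * a / N)" using that a by (intro mult_right_mono) auto
    then show ?thesis using a N0 by (auto simp: b_def abs_le_iff)
  qed
  have h: "h \<ge> 0" "N * h = 2 * a" using a N0 by (auto simp: h_def)
  have "relu_hull (cball 0 R \<times> {1}) ((\<bar>cos (\<theta> - a)\<bar> * norm (0 :: 'a, 1::real) + \<bar>- sin (\<theta> - a)\<bar> * norm (\<xi>, a))
    + (\<Sum>i<N. \<bar>sin (b i + \<theta>) - sin (b (Suc i) + \<theta>)\<bar> * norm (\<xi>, - b i))) g"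
    unfolding g_def[abs_def] by (intro relu_hull_add relu_hull_sum relu_hull_ridge) auto
  moreover have "(\<bar>cos (\<theta> - a)\<bar> * norm (0 :: 'a, 1::real) + \<bar>- sin (\<theta> - a)\<bar> * norm (\<xi>, a))
    + (\<Sum>i<N. \<bar>sin (b i + \<theta>) - sin (b (Suc i) + \<theta>)\<bar> * norm (\<xi>, - b i)) \<le> (1 * 1 + 1 * (2 * a)) + (\<Sum>i<N. h * (2 * a))"
  proof (intro add_mono mult_mono sum_mono)
    fix i assume "i \<in> {..<N}"
    then show "norm (\<xi>, - b i) \<le> 2 * a" using bi[of i] by (intro nrm) auto
    show "\<bar>sin (b i + \<theta>) - sin (b (Suc i) + \<theta>)\<bar> \<le> h"
      using sin_lipschitz[of "b i + \<theta>" "b (Suc i) + \<theta>"] h by (simp add: b_def h_def algebra_simps add_divide_distrib)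
  qed (use a h nrm[of a] in auto)
  moreover have "(1 * 1 + 1 * (2 * a)) + (\<Sum>i<N. h * (2 * a)) \<le> (1 + 2 * R + 4 * R\<^sup>2) * (1 + (norm \<xi>)\<^sup>2)"
  proof -
    have "(\<Sum>i<N. h * (2 * a)) = 4 * R\<^sup>2 * (norm \<xi>)\<^sup>2"
    proof -
      have "(\<Sum>i<N. h * (2 * a)) = (N * h) * (2 * a)" by simp
      also have "\<dots> = 4 * R\<^sup>2 * (norm \<xi>)\<^sup>2"
        unfolding h(2) by (simp add: a_def power2_eq_square)
      finally show ?thesis .
    qed
    moreover have "norm \<xi> \<le> 1 + (norm \<xi>)\<^sup>2"
    proof -
      have "0 \<le> (norm \<xi> - 1 / 2)\<^sup>2" by simp
      also have "\<dots> = (norm \<xi>)\<^sup>2 - norm \<xi> + 1 / 4" by (simp add: power2_eq_square algebra_simps)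
      finally show ?thesis by linarith
    qed
    then have "2 * a \<le> 2 * R * (1 + (norm \<xi>)\<^sup>2)"
      unfolding a_def using R by simp
    moreover have "4 * R\<^sup>2 * (norm \<xi>)\<^sup>2 \<le> 4 * R\<^sup>2 * (1 + (norm \<xi>)\<^sup>2)" by (intro mult_left_mono) auto
    moreover have "(1 + 2 * R + 4 * R\<^sup>2) * (1 + (norm \<xi>)\<^sup>2) = (1 + (norm \<xi>)\<^sup>2) + 2 * R * (1 + (norm \<xi>)\<^sup>2) + 4 * R\<^sup>2 * (1 + (norm \<xi>)\<^sup>2)"
      by (simp add: distrib_right)
    ultimately show ?thesis using zero_le_power2[of "norm \<xi>"] by linarith
  qed
  ultimately have "relu_hull (cball 0 R \<times> {1}) ((1 + 2 * R + 4 * R\<^sup>2) * (1 + (norm \<xi>)\<^sup>2)) g"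
    by (rule relu_hull_mono[OF _ order_trans])
  moreover have "\<bar>cos (\<xi> \<bullet> fst p + \<theta>) - g p\<bar> \<le> e" if p: "p \<in> cball 0 R \<times> {1}" for p
  proof -
    define s where "s = \<xi> \<bullet> fst p"
    have "\<bar>s\<bar> \<le> norm \<xi> * norm (fst p)" unfolding s_def by (rule Cauchy_Schwarz_ineq2)
    also have "\<dots> \<le> a" unfolding a_def mult.commute[of R] using p by (intro mult_left_mono) auto
    finally have s: "\<bar>s\<bar> \<le> a" .
    have p1: "snd p = 1" using p by auto
    have "g p = cos (\<theta> - a) - sin (\<theta> - a) * (s + a) + (\<Sum>i<N. (sin (b i + \<theta>) - sin (b (Suc i) + \<theta>)) * max (s - b i) 0)"
    proof -
      have "(0, 1) \<bullet> p = 1" "(\<xi>, c) \<bullet> p = s + c" for c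
        using p1 by (cases p; simp add: s_def)+
      moreover have "max (s + a) 0 = s + a" using s by (simp add: max_def abs_le_iff)
      ultimately show ?thesis by (simp add: g_def)
    qed
    then have "\<bar>cos (s + \<theta>) - g p\<bar> \<le> N * h\<^sup>2"
      using cos_relu_riemann[OF a(1) N0 s, of \<theta>] by (simp add: h_def b_def)
    also have "\<dots> = 4 * a\<^sup>2 / N" using N0 by (simp add: h_def power2_eq_square)
    also have "\<dots> \<le> e" using N e N0 by (simp add: field_simps)
    finally show ?thesis by (simp add: s_def)
  qed
  ultimately show "\<exists>h. relu_hull (cball 0 R \<times> {1}) ((1 + 2 * R + 4 * R\<^sup>2) * (1 + (norm \<xi>)\<^sup>2)) h \<and>
    (\<forall>p\<in>cball 0 R \<times> {1::real}. \<bar>cos (\<xi> \<bullet> fst p + \<theta>) - h p\<bar> \<le> e)"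
    by (intro exI[of _ g] conjI ballI)
qed

section \<open>Fourier series on cubes\<close>

lemma lborel_prod_integral:
  fixes f :: "'a::euclidean_space \<Rightarrow> real \<Rightarrow> complex"
  assumes f: "\<And>b. b \<in> Basis \<Longrightarrow> integrable lborel (f b)"
  shows "integrable lborel (\<lambda>x::'a. \<Prod>b\<in>Basis. f b (x \<bullet> b))"
    and "(LINT x|lborel. (\<Prod>b\<in>Basis. f b (x \<bullet> b))) = (\<Prod>b\<in>Basis. LINT s|lborel. f b s)"
proof -
  interpret product_sigma_finite "\<lambda>_::'a. lborel :: real measure" ..
  let ?M = "\<Pi>\<^sub>M b\<in>Basis. (lborel :: real measure)"
  let ?T = "\<lambda>g. \<Sum>b\<in>Basis. g b *\<^sub>R b :: 'a"
  have L: "(lborel :: 'a measure) = distr ?M borel ?T" by (rule lborel_eq)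
  have [measurable]: "?T \<in> measurable ?M borel"
    by (auto intro!: borel_measurable_sum borel_measurable_scaleR measurable_component_singleton[THEN measurable_compose])
  have fm: "f b \<in> borel_measurable borel" if "b \<in> Basis" for b
    using f[OF that] by (simp add: borel_measurable_integrable)
  have meas: "(\<lambda>x::'a. \<Prod>b\<in>Basis. f b (x \<bullet> b)) \<in> borel_measurable borel"
    by (intro borel_measurable_prod measurable_compose[OF _ fm] borel_measurable_inner) auto
  have comp: "(\<lambda>g. \<Prod>b\<in>Basis. f b (?T g \<bullet> b)) = (\<lambda>g. \<Prod>b\<in>Basis. f b (g b))"
    by (intro ext prod.cong) (auto simp: inner_sum_left inner_Basis if_distrib cong: if_cong)
  have int: "integrable ?M (\<lambda>g. \<Prod>b\<in>Basis. f b (g b))"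
    using f by (intro product_integrable_prod) auto
  show "integrable lborel (\<lambda>x::'a. \<Prod>b\<in>Basis. f b (x \<bullet> b))"
    unfolding L by (subst integrable_distr_eq) (use meas int comp in auto)
  have "(LINT x|lborel. (\<Prod>b\<in>Basis. f b ((x::'a) \<bullet> b))) = (LINT g|?M. (\<Prod>b\<in>Basis. f b (?T g \<bullet> b)))"
    unfolding L by (subst integral_distr) (use meas in auto)
  also have "\<dots> = (\<Prod>b\<in>Basis. LINT s|lborel. f b s)"
    unfolding comp using f by (intro product_integral_prod) auto
  finally show "(LINT x|lborel. (\<Prod>b\<in>Basis. f b ((x::'a) \<bullet> b))) = (\<Prod>b\<in>Basis. LINT s|lborel. f b s)" .
qed

definition cube :: "real \<Rightarrow> 'a::euclidean_space set" where
  "cube L = {x. \<forall>b\<in>Basis. \<bar>x \<bullet> b\<bar> \<le> L}"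

lemma cube_eq_cbox: "cube L = cbox (- L *\<^sub>R One) (L *\<^sub>R One)"
  by (auto simp: cube_def mem_box abs_le_iff) force+

lemma cube_measurable [measurable]: "cube L \<in> sets borel"
  unfolding cube_eq_cbox by simp

lemma indicator_cube: "indicator (cube L) x = (\<Prod>b\<in>Basis. indicator {- L..L} (x \<bullet> b) :: 'b::{comm_semiring_1})"
proof (cases "x \<in> cube L")
  case True
  have "(\<Prod>b\<in>Basis. indicator {- L..L} (x \<bullet> b) :: 'b) = 1"
    using True by (intro prod.neutral ballI) (auto simp: cube_def indicator_def)
  then show ?thesis using True by simp
next
  case False
  then obtain b where b: "b \<in> Basis" "x \<bullet> b \<notin> {- L..L}" by (auto simp: cube_def abs_le_iff)
  then have "(\<Prod>b\<in>Basis. indicator {- L..L} (x \<bullet> b) :: 'b) = 0"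
    by (intro prod_zero) (auto intro!: bexI[of _ b])
  then show ?thesis using False by simp
qed

definition wave :: "('a::euclidean_space \<Rightarrow> real) \<Rightarrow> 'a \<Rightarrow> complex" where
  "wave \<tau> x = cis (\<Sum>b\<in>Basis. \<tau> b * (x \<bullet> b))"

lemma cis_sum: "finite I \<Longrightarrow> cis (\<Sum>i\<in>I. f i) = (\<Prod>i\<in>I. cis (f i))"
  by (induction I rule: finite_induct) (auto simp flip: cis_mult)

lemma wave_prod: "wave \<tau> x = (\<Prod>b\<in>Basis. cis (\<tau> b * (x \<bullet> b)))"
  by (simp add: wave_def cis_sum)

lemma wave_mult: "wave \<tau> x * wave \<sigma> x = wave (\<lambda>b. \<tau> b + \<sigma> b) x"
  by (simp add: wave_def cis_mult sum.distrib distrib_right)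

lemma cnj_wave: "cnj (wave \<tau> x) = wave (\<lambda>b. - \<tau> b) x"
  by (simp add: wave_def cis_cnj sum_negf)

lemma norm_wave [simp]: "norm (wave \<tau> x) = 1"
  by (simp add: wave_def)

lemma continuous_on_wave [continuous_intros]: "continuous_on A (wave \<tau>)"
  unfolding wave_def[abs_def] by (intro continuous_intros)

lemma wave_measurable [measurable]: "wave \<tau> \<in> borel_measurable borel"
  by (intro borel_measurable_continuous_onI continuous_intros)

text \<open>The normalisation \<open>\<omega> * L = pi\<close> makes the integer multiples of
  \<open>\<omega>\<close> the frequencies of period \<open>2 * L\<close>, the side of
  \<open>cube L\<close>. It is kept throughout.\<close>

lemma integral_cis_period:
  fixes \<omega> L :: real and j :: int
  assumes \<omega>: "\<omega> > 0" and L: "\<omega> * L = pi"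
  shows "integrable lborel (\<lambda>s. indicator {- L..L} s * cis (\<omega> * j * s))"
    and "(LINT s|lborel. indicator {- L..L} s * cis (\<omega> * j * s)) = (if j = 0 then 2 * L else 0)"
proof -
  have L0: "L > 0" using assms pi_gt_zero by (metis zero_less_mult_pos)
  have cont: "continuous_on {- L..L} (\<lambda>s. cis (\<omega> * j * s))" by (intro continuous_intros)
  have eq: "(\<lambda>s. indicator {- L..L} s * cis (\<omega> * j * s)) = (\<lambda>s. indicator {- L..L} s *\<^sub>R cis (\<omega> * j * s))"
    by (auto simp: indicator_def)
  have si: "set_integrable lborel {- L..L} (\<lambda>s. cis (\<omega> * j * s))"
    by (rule borel_integrable_atLeastAtMost'[OF cont])
  then show "integrable lborel (\<lambda>s. indicator {- L..L} s * cis (\<omega> * j * s))"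
    unfolding eq set_integrable_def .
  have "(LINT s|lborel. indicator {- L..L} s * cis (\<omega> * j * s)) = integral {- L..L} (\<lambda>s. cis (\<omega> * j * s))"
    unfolding eq using set_borel_integral_eq_integral(2)[OF si] by (simp add: set_lebesgue_integral_def)
  also have "\<dots> = (if j = 0 then 2 * L else 0)"
  proof (cases "j = 0")
    case False
    define c where "c = \<omega> * j"
    have c: "c \<noteq> 0" using False \<omega> by (simp add: c_def)
    have "((\<lambda>s. cis (c * s)) has_integral (cis (c * L) / (\<i> * c) - cis (c * - L) / (\<i> * c))) {- L..L}"
    proof (rule fundamental_theorem_of_calculus)
      fix s assume "s \<in> {- L..L}"
      have "((\<lambda>s. cis (c * s) / (\<i> * c)) has_vector_derivative (c *\<^sub>R (\<i> * cis (c * s))) / (\<i> * c)) (at s within {- L..L})"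
        by (auto intro!: derivative_eq_intros has_vector_derivative_divide simp: has_vector_derivative_def scaleR_conv_of_real c field_simps)
      then show "((\<lambda>s. cis (c * s) / (\<i> * c)) has_vector_derivative cis (c * s)) (at s within {- L..L})"
        using c by (simp add: scaleR_conv_of_real field_simps)
    qed (use L0 in simp)
    moreover have "cis (c * L) = cis (c * - L)"
    proof -
      have cL: "c * L = pi * j" using L by (simp add: c_def mult_ac)
      have "cis (c * L) / cis (c * - L) = cis (2 * pi * j)"
      proof -
        have "c * L - c * - L = 2 * (c * L)" by simp
        then show ?thesis unfolding cis_divide cL by (simp add: mult.assoc)
      qed
      also have "\<dots> = 1" by (simp add: cis_multiple_2pi)
      finally show ?thesis by simp
    qed
    ultimately show ?thesis using False by (simp add: integral_unique c_def)
  qed (use L0 in \<open>simp add: scaleR_conv_of_real\<close>)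
  finally show "(LINT s|lborel. indicator {- L..L} s * cis (\<omega> * j * s)) = (if j = 0 then 2 * L else 0)" .
qed

lemma wave_orthogonal:
  fixes m :: "'a::euclidean_space \<Rightarrow> int" and \<omega> L :: real
  assumes \<omega>: "\<omega> > 0" and L: "\<omega> * L = pi"
  shows "integrable lborel (\<lambda>x::'a. indicator (cube L) x * wave (\<lambda>b. \<omega> * m b) x)"
    and "(LINT x|lborel. indicator (cube L) x * wave (\<lambda>b. \<omega> * m b) (x::'a))
      = (if \<forall>b\<in>Basis. m b = 0 then (2 * L) ^ DIM('a) else 0)"
proof -
  have eq: "(\<lambda>x::'a. indicator (cube L) x * wave (\<lambda>b. \<omega> * m b) x)
    = (\<lambda>x. \<Prod>b\<in>Basis. indicator {- L..L} (x \<bullet> b) * cis (\<omega> * m b * (x \<bullet> b)))"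
    by (simp add: indicator_cube wave_prod prod.distrib)
  show "integrable lborel (\<lambda>x::'a. indicator (cube L) x * wave (\<lambda>b. \<omega> * m b) x)"
    unfolding eq by (intro lborel_prod_integral integral_cis_period assms)
  have "(LINT x|lborel. indicator (cube L) x * wave (\<lambda>b. \<omega> * m b) (x::'a))
    = (\<Prod>b\<in>Basis. LINT s|lborel. indicator {- L..L} s * cis (\<omega> * m b * s))"
    unfolding eq by (intro lborel_prod_integral integral_cis_period assms)
  also have "\<dots> = (\<Prod>b\<in>(Basis::'a set). if m b = 0 then of_real (2 * L) else 0)"
    by (intro prod.cong refl) (simp add: integral_cis_period[OF assms])
  also have "\<dots> = (if \<forall>b\<in>Basis. m b = 0 then (2 * L) ^ DIM('a) else 0)"
    by (auto intro: prod_zero)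
  finally show "(LINT x|lborel. indicator (cube L) x * wave (\<lambda>b. \<omega> * m b) (x::'a))
      = (if \<forall>b\<in>Basis. m b = 0 then (2 * L) ^ DIM('a) else 0)" by simp
qed

lemma trig_poly_norm:
  fixes \<phi> :: "'i \<Rightarrow> 'a::euclidean_space \<Rightarrow> int" and a :: "'i \<Rightarrow> complex" and \<omega> L :: real
  assumes \<omega>: "\<omega> > 0" and L: "\<omega> * L = pi" and F: "finite F"
    and inj: "\<And>i j. i \<in> F \<Longrightarrow> j \<in> F \<Longrightarrow> (\<forall>b\<in>Basis. \<phi> i b = \<phi> j b) \<Longrightarrow> i = j"
  defines "S \<equiv> \<lambda>x. \<Sum>i\<in>F. a i * wave (\<lambda>b. \<omega> * \<phi> i b) x"
  shows "integrable lborel (\<lambda>x. indicator (cube L) x * (cmod (S x))\<^sup>2)"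
    and "(LINT x|lborel. indicator (cube L) x * (cmod (S x))\<^sup>2) = (2 * L) ^ DIM('a) * (\<Sum>i\<in>F. (cmod (a i))\<^sup>2)"
proof -
  let ?e = "\<lambda>i j x. indicator (cube L) x * wave (\<lambda>b. \<omega> * (\<phi> i b - \<phi> j b)) (x::'a)"
  have S2: "of_real (indicator (cube L) x * (cmod (S x))\<^sup>2) = (\<Sum>i\<in>F. \<Sum>j\<in>F. a i * cnj (a j) * ?e i j x)" for x
  proof -
    have "of_real ((cmod (S x))\<^sup>2) = S x * cnj (S x)" by (rule complex_norm_square)
    also have "\<dots> = (\<Sum>i\<in>F. \<Sum>j\<in>F. (a i * wave (\<lambda>b. \<omega> * \<phi> i b) x) * (cnj (a j) * wave (\<lambda>b. - (\<omega> * \<phi> j b)) x))"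
      unfolding S_def by (simp add: sum_product cnj_wave)
    also have "\<dots> = (\<Sum>i\<in>F. \<Sum>j\<in>F. a i * cnj (a j) * wave (\<lambda>b. \<omega> * (\<phi> i b - \<phi> j b)) x)"
    proof (intro sum.cong refl)
      fix i j
      have "wave (\<lambda>b. \<omega> * \<phi> i b) x * wave (\<lambda>b. - (\<omega> * \<phi> j b)) x = wave (\<lambda>b. \<omega> * (\<phi> i b - \<phi> j b)) x"
        unfolding wave_mult by (simp add: algebra_simps)
      then show "(a i * wave (\<lambda>b. \<omega> * \<phi> i b) x) * (cnj (a j) * wave (\<lambda>b. - (\<omega> * \<phi> j b)) x)
        = a i * cnj (a j) * wave (\<lambda>b. \<omega> * (\<phi> i b - \<phi> j b)) x"
        by (metis (no_types, lifting) mult.assoc mult.left_commute)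
    qed
    finally show ?thesis by (simp add: sum_distrib_left indicator_def)
  qed
  have ii: "integrable lborel (\<lambda>x. a i * cnj (a j) * ?e i j x)" for i j
    using wave_orthogonal(1)[OF \<omega> L, of "\<lambda>b. \<phi> i b - \<phi> j b"] by (intro integrable_mult_right) simp
  have int: "integrable lborel (\<lambda>x. of_real (indicator (cube L) x * (cmod (S x))\<^sup>2) :: complex)"
    unfolding S2 by (intro Bochner_Integration.integrable_sum ii)
  then show 1: "integrable lborel (\<lambda>x. indicator (cube L) x * (cmod (S x))\<^sup>2)"
    by (simp only: complex_of_real_integrable_eq)
  have "of_real (LINT x|lborel. indicator (cube L) x * (cmod (S x))\<^sup>2)
    = (LINT x|lborel. of_real (indicator (cube L) x * (cmod (S x))\<^sup>2) :: complex)"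
    by (rule integral_complex_of_real[symmetric])
  also have "\<dots> = (\<Sum>i\<in>F. \<Sum>j\<in>F. a i * cnj (a j) * (LINT x|lborel. ?e i j x))"
  proof -
    have "(LINT x|lborel. a i * cnj (a j) * ?e i j x) = a i * cnj (a j) * (LINT x|lborel. ?e i j x)" for i j
      by (rule integral_mult_right_zero)
    moreover have "(LINT x|lborel. (\<Sum>i\<in>F. \<Sum>j\<in>F. a i * cnj (a j) * ?e i j x))
      = (\<Sum>i\<in>F. (LINT x|lborel. (\<Sum>j\<in>F. a i * cnj (a j) * ?e i j x)))"
      by (rule Bochner_Integration.integral_sum) (intro Bochner_Integration.integrable_sum ii)
    moreover have "(LINT x|lborel. (\<Sum>j\<in>F. a i * cnj (a j) * ?e i j x)) = (\<Sum>j\<in>F. LINT x|lborel. a i * cnj (a j) * ?e i j x)" for i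
      by (rule Bochner_Integration.integral_sum) (rule ii)
    ultimately show ?thesis unfolding S2 by simp
  qed
  also have "\<dots> = (\<Sum>i\<in>F. \<Sum>j\<in>F. if i = j then of_real ((2 * L) ^ DIM('a) * (cmod (a i))\<^sup>2) else (0::complex))"
  proof (intro sum.cong refl)
    fix i j assume ij: "i \<in> F" "j \<in> F"
    have "(LINT x|lborel. ?e i j x) = (if \<forall>b\<in>Basis. \<phi> i b - \<phi> j b = 0 then (2 * L) ^ DIM('a) else 0)"
      using wave_orthogonal(2)[OF \<omega> L, of "\<lambda>b. \<phi> i b - \<phi> j b"] by simp
    also have "\<dots> = (if i = j then (2 * L) ^ DIM('a) else 0)"
      using inj[OF ij] by auto
    finally show "a i * cnj (a j) * (LINT x|lborel. ?e i j x) = (if i = j then of_real ((2 * L) ^ DIM('a) * (cmod (a i))\<^sup>2) else (0::complex))"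
      using complex_norm_square[of "a i"] by auto
  qed
  also have "\<dots> = of_real ((2 * L) ^ DIM('a) * (\<Sum>i\<in>F. (cmod (a i))\<^sup>2))"
    using F by (simp add: sum_distrib_left)
  finally show "(LINT x|lborel. indicator (cube L) x * (cmod (S x))\<^sup>2) = (2 * L) ^ DIM('a) * (\<Sum>i\<in>F. (cmod (a i))\<^sup>2)"
    by (simp only: of_real_eq_iff)
qed

section \<open>Bessel's inequality\<close>

lemma integrable_times_bounded:
  fixes f g :: "'a::euclidean_space \<Rightarrow> complex"
  assumes "integrable lborel f" "g \<in> borel_measurable borel" "\<And>x. norm (g x) \<le> B"
  shows "integrable lborel (\<lambda>x. f x * g x)"
proof (rule Bochner_Integration.integrable_bound)
  show "integrable lborel (\<lambda>x. B * norm (f x))" using assms(1) by (intro integrable_mult_right integrable_norm)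
  show "(\<lambda>x. f x * g x) \<in> borel_measurable lborel"
    using assms by (intro borel_measurable_times) (auto simp: borel_measurable_integrable)
  show "AE x in lborel. norm (f x * g x) \<le> norm (B * norm (f x))"
    using assms(3) by (intro AE_I2) (smt (verit) abs_ge_self mult.commute mult_right_mono norm_ge_zero norm_mult real_norm_def)
qed

lemma square_integrable_imp_integrable:
  fixes w :: "'a::euclidean_space \<Rightarrow> real"
  assumes w: "w \<in> borel_measurable borel" "integrable lborel (\<lambda>x. (w x)\<^sup>2)" "\<And>x. x \<notin> cube L \<Longrightarrow> w x = 0"
  shows "integrable lborel w"
proof (rule Bochner_Integration.integrable_bound)
  have "integrable lborel (indicator (cube L :: 'a set) :: 'a \<Rightarrow> real)"
    unfolding cube_eq_cbox using emeasure_lborel_cbox_finite[of "- L *\<^sub>R One :: 'a" "L *\<^sub>R One"]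
    by (intro integrable_real_indicator) auto
  then show "integrable lborel (\<lambda>x. indicator (cube L) x + (w x)\<^sup>2)" using w(2) by (intro Bochner_Integration.integrable_add)
  show "w \<in> borel_measurable lborel" using w(1) by simp
  have "\<bar>w x\<bar> \<le> indicator (cube L) x + (w x)\<^sup>2" for x
  proof (cases "x \<in> cube L")
    case True
    have "0 \<le> (\<bar>w x\<bar> - 1 / 2)\<^sup>2" by simp
    then have "\<bar>w x\<bar> \<le> (w x)\<^sup>2 + 1" by (simp add: power2_eq_square algebra_simps flip: abs_mult)
    then show ?thesis using True by simp
  qed (simp add: w(3))
  then show "AE x in lborel. norm (w x) \<le> norm (indicator (cube L) x + (w x)\<^sup>2)"
    by (intro AE_I2) (smt (verit) real_norm_def)
qed

lemma bessel:
  fixes \<phi> :: "'i \<Rightarrow> 'a::euclidean_space \<Rightarrow> int" and w :: "'a \<Rightarrow> real" and \<omega> L :: real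
  assumes \<omega>: "\<omega> > 0" and L: "\<omega> * L = pi" and F: "finite F"
    and inj: "\<And>i j. i \<in> F \<Longrightarrow> j \<in> F \<Longrightarrow> (\<forall>b\<in>Basis. \<phi> i b = \<phi> j b) \<Longrightarrow> i = j"
    and w: "w \<in> borel_measurable borel" "integrable lborel (\<lambda>x. (w x)\<^sup>2)" "\<And>x. x \<notin> cube L \<Longrightarrow> w x = 0"
  shows "(\<Sum>i\<in>F. (cmod (LINT x|lborel. w x * wave (\<lambda>b. \<omega> * \<phi> i b) x))\<^sup>2)
    \<le> (2 * L) ^ DIM('a) * (LINT x|lborel. (w x)\<^sup>2)"
proof -
  have L0: "L > 0" using \<omega> L pi_gt_zero by (metis zero_less_mult_pos)
  define V where "V = (2 * L) ^ DIM('a)"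
  have V: "V > 0" using L0 by (simp add: V_def)
  define d where "d i = (LINT x|lborel. w x * wave (\<lambda>b. \<omega> * \<phi> i b) x)" for i
  define S where "S x = (\<Sum>i\<in>F. cnj (d i) * wave (\<lambda>b. \<omega> * \<phi> i b) x)" for x
  define D where "D = (\<Sum>i\<in>F. (cmod (d i))\<^sup>2)"
  have wi: "integrable lborel w" by (rule square_integrable_imp_integrable[OF w])
  have wi': "integrable lborel (\<lambda>x. of_real (w x) * wave \<tau> x)" for \<tau>
    using wi by (intro integrable_times_bounded[where B = 1] complex_of_real_integrable_eq[THEN iffD2]) auto
  have S2i: "integrable lborel (\<lambda>x. indicator (cube L) x * (cmod (S x))\<^sup>2)"
    unfolding S_def by (rule trig_poly_norm(1)[OF \<omega> L F]) (rule inj)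
  have "(LINT x|lborel. indicator (cube L) x * (cmod (S x))\<^sup>2) = V * (\<Sum>i\<in>F. (cmod (cnj (d i)))\<^sup>2)"
    unfolding S_def V_def by (rule trig_poly_norm(2)[OF \<omega> L F]) (rule inj)
  then have S2e: "(LINT x|lborel. indicator (cube L) x * (cmod (S x))\<^sup>2) = V * D" by (simp add: D_def)
  have wS_eq: "of_real (w x) * S x = (\<Sum>i\<in>F. cnj (d i) * (of_real (w x) * wave (\<lambda>b. \<omega> * \<phi> i b) x))" for x
    by (simp add: S_def sum_distrib_left mult_ac)
  have wSi: "integrable lborel (\<lambda>x. of_real (w x) * S x)"
    unfolding wS_eq by (intro Bochner_Integration.integrable_sum integrable_mult_right wi')
  have "(LINT x|lborel. of_real (w x) * S x) = (\<Sum>i\<in>F. cnj (d i) * d i)"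
    unfolding wS_eq d_def     by (subst Bochner_Integration.integral_sum) (auto intro!: integrable_mult_right wi')
  also have "\<dots> = of_real D" unfolding D_def of_real_sum complex_norm_square by (simp add: mult.commute)
  finally have wSe: "(LINT x|lborel. w x * Re (S x)) = D"
    using integral_Re[OF wSi] by simp
  have wSRi: "integrable lborel (\<lambda>x. w x * Re (S x))" using integrable_Re[OF wSi] by simp
  have "0 \<le> (LINT x|lborel. (w x)\<^sup>2 - 2 / V * (w x * Re (S x)) + 1 / V\<^sup>2 * (indicator (cube L) x * (cmod (S x))\<^sup>2))"
  proof (rule Bochner_Integration.integral_nonneg)
    fix x
    show "0 \<le> (w x)\<^sup>2 - 2 / V * (w x * Re (S x)) + 1 / V\<^sup>2 * (indicator (cube L) x * (cmod (S x))\<^sup>2)"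
    proof (cases "x \<in> cube L")
      case True
      have "(w x)\<^sup>2 - 2 / V * (w x * Re (S x)) + 1 / V\<^sup>2 * (cmod (S x))\<^sup>2 = (w x - Re (S x) / V)\<^sup>2 + (Im (S x) / V)\<^sup>2"
        unfolding cmod_power2 using V by (simp add: power2_eq_square field_simps)
      then show ?thesis using True by simp
    qed (simp add: w(3))
  qed
  also have "\<dots> = (LINT x|lborel. (w x)\<^sup>2 - 2 / V * (w x * Re (S x))) + (LINT x|lborel. 1 / V\<^sup>2 * (indicator (cube L) x * (cmod (S x))\<^sup>2))"
    by (intro Bochner_Integration.integral_add Bochner_Integration.integrable_diff integrable_mult_right w(2) wSRi S2i)
  also have "(LINT x|lborel. (w x)\<^sup>2 - 2 / V * (w x * Re (S x))) = (LINT x|lborel. (w x)\<^sup>2) - (LINT x|lborel. 2 / V * (w x * Re (S x)))"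
    by (intro Bochner_Integration.integral_diff integrable_mult_right w(2) wSRi)
  also have "\<dots> + (LINT x|lborel. 1 / V\<^sup>2 * (indicator (cube L) x * (cmod (S x))\<^sup>2)) = (LINT x|lborel. (w x)\<^sup>2) - 2 / V * D + 1 / V\<^sup>2 * (V * D)"
    by (simp only: integral_mult_right_zero S2e wSe)
  also have "\<dots> = (LINT x|lborel. (w x)\<^sup>2) - D / V" using V by (simp add: field_simps power2_eq_square)
  finally have "D \<le> V * (LINT x|lborel. (w x)\<^sup>2)" using V by (simp add: field_simps)
  then show ?thesis by (simp add: D_def d_def V_def)
qed

section \<open>A nonnegative kernel for Fourier means\<close>

definition fej :: "nat \<Rightarrow> int \<Rightarrow> real" where
  "fej N j = real ((2 * N) choose nat (int N + j)) / real ((2 * N) choose N)"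

text \<open>This is the de la Vallee Poussin kernel, with Fourier coefficients
  \<open>fej N j\<close>. It is nonnegative as an even power, its coefficients lie between 0 and 1,
  the one at 0 is 1, and the one at -1 is N / (N + 1) and tends to 1; a Korovkin argument needs
  nothing else. For j < -N the number \<open>fej N j\<close> is not a coefficient, because
  \<open>nat\<close> stops at 0; the expansion runs over |j| \<le> N only.\<close>

definition fejer :: "real \<Rightarrow> nat \<Rightarrow> real \<Rightarrow> real" where
  "fejer \<omega> N s = (2 * cos (\<omega> * s / 2)) ^ (2 * N) / real ((2 * N) choose N)"

lemma central_binomial_pos: "real ((2 * N) choose N) > 0"
  by simp

lemma fejer_nonneg: "fejer \<omega> N s \<ge> 0"
  by (simp add: fejer_def power_mult)

lemma fej_bounds: "0 \<le> fej N j" "fej N j \<le> 1"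
  using binomial_maximum[of "2 * N" "nat (int N + j)"] central_binomial_pos[of N]
  by (auto simp: fej_def)

lemma fej_0: "fej N 0 = 1"
  using central_binomial_pos[of N] by (simp add: fej_def)

lemma fej_1: "N > 0 \<Longrightarrow> fej N (- 1) = real N / (real N + 1)"
proof -
  assume "N > 0"
  then obtain a where a: "N = Suc a" by (cases N) auto
  have "Suc a * (Suc (a + N) choose Suc a) = Suc N * (Suc (a + N) choose a)"
    by (rule Suc_times_binomial_add)
  moreover have "Suc (a + N) = 2 * N" using a by simp
  ultimately have "N * ((2 * N) choose N) = (N + 1) * ((2 * N) choose a)"
    unfolding a[symmetric] by simp
  then have "real N * real ((2 * N) choose N) = (real N + 1) * real ((2 * N) choose a)"
    by (metis of_nat_1 of_nat_add of_nat_mult)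
  then show ?thesis
    using central_binomial_pos[of N] by (simp add: fej_def a nat_diff_distrib field_simps)
qed

lemma fejer_expansion:
  "of_real (fejer \<omega> N s) = (\<Sum>j\<in>{- int N..int N}. of_real (fej N j) * cis (\<omega> * j * s))"
proof -
  let ?x = "\<omega> * s / 2"
  have "of_real (2 * cos ?x) = cis ?x + cis (- ?x)"
    by (simp add: complex_eq_iff)
  then have "of_real ((2 * cos ?x) ^ (2 * N)) = (cis ?x + cis (- ?x)) ^ (2 * N)"
    by (metis of_real_power)
  also have "\<dots> = (\<Sum>l\<le>2 * N. of_nat ((2 * N) choose l) * cis ?x ^ l * cis (- ?x) ^ (2 * N - l))"
    by (rule binomial_ring)
  also have "\<dots> = (\<Sum>l\<le>2 * N. of_nat ((2 * N) choose l) * cis (\<omega> * (int l - int N) * s))"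
  proof (intro sum.cong refl)
    fix l assume l: "l \<in> {..2 * N}"
    have "cis ?x ^ l * cis (- ?x) ^ (2 * N - l) = cis (real l * ?x + real (2 * N - l) * (- ?x))"
      by (simp only: Complex.DeMoivre cis_mult)
    also have "real l * ?x + real (2 * N - l) * (- ?x) = \<omega> * (int l - int N) * s"
      using l by (simp add: of_nat_diff field_simps)
    finally show "of_nat ((2 * N) choose l) * cis ?x ^ l * cis (- ?x) ^ (2 * N - l)
      = of_nat ((2 * N) choose l) * cis (\<omega> * (int l - int N) * s)" by (simp only: mult.assoc)
  qed
  also have "\<dots> = (\<Sum>j\<in>{- int N..int N}. of_nat ((2 * N) choose nat (int N + j)) * cis (\<omega> * j * s))"
    by (rule sum.reindex_bij_witness[of _ "\<lambda>j. nat (int N + j)" "\<lambda>l. int l - int N"]) auto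
  finally have "of_real (fejer \<omega> N s)
    = (\<Sum>j\<in>{- int N..int N}. of_nat ((2 * N) choose nat (int N + j)) * cis (\<omega> * j * s)) / of_nat ((2 * N) choose N)"
    by (simp add: fejer_def)
  then show ?thesis by (simp add: fej_def sum_divide_distrib)
qed

lemma fejer_integral:
  fixes \<omega> L :: real
  assumes \<omega>: "\<omega> > 0" and L: "\<omega> * L = pi"
  shows "integrable lborel (\<lambda>s. indicator {- L..L} s * of_real (fejer \<omega> N s) * cis (\<omega> * of_int i * s))"
    and "\<bar>i\<bar> \<le> int N \<Longrightarrow> (LINT s|lborel. indicator {- L..L} s * of_real (fejer \<omega> N s) * cis (\<omega> * of_int i * s)) = 2 * L * fej N (- i)"
proof -
  have eq: "indicator {- L..L} s * of_real (fejer \<omega> N s) * cis (\<omega> * of_int i * s)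
    = (\<Sum>j\<in>{- int N..int N}. of_real (fej N j) * (indicator {- L..L} s * cis (\<omega> * of_int (j + i) * s)))" for s
  proof -
    have "cis (\<omega> * of_int j * s) * cis (\<omega> * of_int i * s) = cis (\<omega> * of_int (j + i) * s)" for j
      unfolding cis_mult by (simp add: algebra_simps)
    then show ?thesis unfolding fejer_expansion
      by (simp add: sum_distrib_left sum_distrib_right mult_ac)
  qed
  show "integrable lborel (\<lambda>s. indicator {- L..L} s * of_real (fejer \<omega> N s) * cis (\<omega> * of_int i * s))"
    unfolding eq by (intro Bochner_Integration.integrable_sum integrable_mult_right integral_cis_period(1)[OF assms])
  assume i: "\<bar>i\<bar> \<le> int N"
  have "(LINT s|lborel. indicator {- L..L} s * of_real (fejer \<omega> N s) * cis (\<omega> * of_int i * s))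
    = (\<Sum>j\<in>{- int N..int N}. LINT s|lborel. of_real (fej N j) * (indicator {- L..L} s * cis (\<omega> * of_int (j + i) * s)))"
    unfolding eq by (rule Bochner_Integration.integral_sum) (intro integrable_mult_right integral_cis_period(1)[OF assms])
  also have "\<dots> = (\<Sum>j\<in>{- int N..int N}. of_real (if j = - i then 2 * L * fej N (- i) else 0))"
  proof -
    have "(LINT s|lborel. of_real (fej N j) * (indicator {- L..L} s * cis (\<omega> * of_int (j + i) * s)))
      = of_real (if j = - i then 2 * L * fej N (- i) else 0)" for j
    proof (cases "j = - i")
      case True
      then have "j + i = 0" by simp
      then show ?thesis using integral_cis_period(2)[OF assms, of "j + i"] True
        by (simp only: integral_mult_right_zero) simp
    next
      case False
      then have "j + i \<noteq> 0" by presburger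
      then show ?thesis using integral_cis_period(2)[OF assms, of "j + i"] False
        by (simp only: integral_mult_right_zero) simp
    qed
    then show ?thesis by simp
  qed
  also have "\<dots> = of_real (2 * L * fej N (- i))"
    unfolding of_real_sum[symmetric] using i by (simp add: abs_le_iff)
  finally show "(LINT s|lborel. indicator {- L..L} s * of_real (fejer \<omega> N s) * cis (\<omega> * of_int i * s)) = 2 * L * fej N (- i)" by simp
qed

definition fejer_prod :: "real \<Rightarrow> nat \<Rightarrow> 'a::euclidean_space \<Rightarrow> real" where
  "fejer_prod \<omega> N x = (\<Prod>b\<in>Basis. fejer \<omega> N (x \<bullet> b))"

lemma fejer_prod_nonneg: "fejer_prod \<omega> N x \<ge> 0"
  by (simp add: fejer_prod_def fejer_nonneg prod_nonneg)

lemma fejer_prod_continuous: "continuous_on A (fejer_prod \<omega> N)"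
  unfolding fejer_prod_def[abs_def] fejer_def[abs_def]
  using central_binomial_pos[of N] by (intro continuous_intros ballI) (simp, metis less_irrefl)

lemma fejer_prod_expansion:
  "of_real (fejer_prod \<omega> N x) = (\<Sum>m\<in>PiE Basis (\<lambda>_. {- int N..int N}).
    of_real (\<Prod>b\<in>Basis. fej N (m b)) * wave (\<lambda>b. \<omega> * m b) (x :: 'a::euclidean_space))"
proof -
  have "of_real (fejer_prod \<omega> N x) = (\<Prod>b\<in>Basis. \<Sum>j\<in>{- int N..int N}. of_real (fej N j) * cis (\<omega> * j * (x \<bullet> b)))"
    by (simp add: fejer_prod_def fejer_expansion)
  also have "\<dots> = (\<Sum>m\<in>PiE Basis (\<lambda>_. {- int N..int N}). \<Prod>b\<in>Basis. of_real (fej N (m b)) * cis (\<omega> * m b * (x \<bullet> b)))"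
    by (rule prod_sum_PiE) auto
  finally show ?thesis by (simp add: wave_prod prod.distrib)
qed

lemma fejer_prod_integral:
  fixes \<omega> L :: real
  assumes \<omega>: "\<omega> > 0" and L: "\<omega> * L = pi"
  shows "integrable lborel (\<lambda>x::'a::euclidean_space. indicator (cube L) x * fejer_prod \<omega> N x)"
    and "(LINT x|lborel. indicator (cube L) x * fejer_prod \<omega> N (x::'a)) = (2 * L) ^ DIM('a)"
    and "c \<in> Basis \<Longrightarrow> integrable lborel (\<lambda>x::'a. indicator (cube L) x * fejer_prod \<omega> N x * cos (\<omega> * (x \<bullet> c)))"
    and "c \<in> Basis \<Longrightarrow> N > 0 \<Longrightarrow> (LINT x|lborel. indicator (cube L) x * fejer_prod \<omega> N (x::'a) * cos (\<omega> * (x \<bullet> c))) = (2 * L) ^ DIM('a) * (real N / (real N + 1))"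
proof -
  define f where "f k b s = indicator {- L..L} s * of_real (fejer \<omega> N s) * cis (\<omega> * of_int (k b) * s)" for k :: "'a \<Rightarrow> int" and b s
  have fi: "integrable lborel (f k b)" for k b
    unfolding f_def[abs_def] by (rule fejer_integral(1)[OF assms])
  have prod_f: "(\<Prod>b\<in>Basis. f k b (x \<bullet> b)) = of_real (indicator (cube L) x * fejer_prod \<omega> N x) * wave (\<lambda>b. \<omega> * real_of_int (k b)) x" for k and x :: 'a
  proof -
    have "(\<Prod>b\<in>Basis. indicator {- L..L} (x \<bullet> b)) = (of_real (indicator (cube L) x) :: complex)"
      unfolding indicator_cube[symmetric] by (simp add: indicator_def)
    then show ?thesis by (simp add: f_def prod.distrib wave_prod fejer_prod_def)
  qed
  have i: "integrable lborel (\<lambda>x::'a. of_real (indicator (cube L) x * fejer_prod \<omega> N x) * wave (\<lambda>b. \<omega> * real_of_int (k b)) x)" for k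
    using lborel_prod_integral(1)[of "f k", OF fi] unfolding prod_f .
  have e: "(LINT x|lborel. of_real (indicator (cube L) x * fejer_prod \<omega> N (x::'a)) * wave (\<lambda>b. \<omega> * real_of_int (k b)) x)
    = (\<Prod>b\<in>Basis. of_real (2 * L * fej N (- k b)))" if "\<And>b. \<bar>k b\<bar> \<le> int N" for k
    using lborel_prod_integral(2)[of "f k", OF fi] fejer_integral(2)[OF assms that]
    unfolding prod_f by (simp add: f_def[abs_def])
  have w0: "wave (\<lambda>b. \<omega> * of_int 0) x = 1" for x :: 'a by (simp add: wave_def)
  have i0: "integrable lborel (\<lambda>x::'a. of_real (indicator (cube L) x * fejer_prod \<omega> N x) :: complex)"
    using i[of "\<lambda>_. 0"] unfolding w0 by simp
  then show "integrable lborel (\<lambda>x::'a. indicator (cube L) x * fejer_prod \<omega> N x)"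
    by (simp only: complex_of_real_integrable_eq)
  have "of_real (LINT x|lborel. indicator (cube L) x * fejer_prod \<omega> N (x::'a))
    = (LINT x|lborel. of_real (indicator (cube L) x * fejer_prod \<omega> N (x::'a)) :: complex)"
    by (rule integral_complex_of_real[symmetric])
  also have "\<dots> = of_real ((2 * L) ^ DIM('a))"
    using e[of "\<lambda>_. 0"] unfolding w0 by (simp add: fej_0)
  finally show "(LINT x|lborel. indicator (cube L) x * fejer_prod \<omega> N (x::'a)) = (2 * L) ^ DIM('a)"
    by (simp only: of_real_eq_iff)
  assume c: "c \<in> Basis"
  let ?k = "\<lambda>b. if b = c then 1 else 0 :: int"
  have wc: "Re (of_real r * wave (\<lambda>b. \<omega> * ?k b) x) = r * cos (\<omega> * (x \<bullet> c))" for x :: 'a and r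
    using c by (simp add: wave_def if_distrib if_distribR cong: if_cong)
  show "integrable lborel (\<lambda>x::'a. indicator (cube L) x * fejer_prod \<omega> N x * cos (\<omega> * (x \<bullet> c)))"
    using integrable_Re[OF i[of ?k]] unfolding wc .
  assume N: "N > 0"
  have "(LINT x|lborel. indicator (cube L) x * fejer_prod \<omega> N (x::'a) * cos (\<omega> * (x \<bullet> c)))
    = Re (LINT x|lborel. of_real (indicator (cube L) x * fejer_prod \<omega> N (x::'a)) * wave (\<lambda>b. \<omega> * ?k b) x)"
    using integral_Re[OF i[of ?k]] unfolding wc .
  also have "\<dots> = Re (of_real (\<Prod>b\<in>(Basis::'a set). 2 * L * fej N (- ?k b)))"
  proof -
    have kb: "\<And>b. \<bar>?k b\<bar> \<le> int N" using N by auto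
    show ?thesis by (simp only: e[of ?k, OF kb] of_real_prod)
  qed
  also have "\<dots> = (\<Prod>b\<in>(Basis::'a set). 2 * L * fej N (- ?k b))" by (rule Re_complex_of_real)
  also have "\<dots> = (2 * L) ^ DIM('a) * (\<Prod>b\<in>(Basis::'a set). fej N (- ?k b))" by (simp add: prod.distrib)
  also have "(\<Prod>b\<in>(Basis::'a set). fej N (- ?k b)) = (\<Prod>b\<in>(Basis::'a set). if b = c then fej N (- 1) else 1)"
    by (intro prod.cong) (auto simp: fej_0)
  also have "\<dots> = real N / (real N + 1)" using c fej_1[OF N] by simp
  finally show "(LINT x|lborel. indicator (cube L) x * fejer_prod \<omega> N (x::'a) * cos (\<omega> * (x \<bullet> c))) = (2 * L) ^ DIM('a) * (real N / (real N + 1))" .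
qed

section \<open>Uniform convergence of the kernel means\<close>

lemma lborel_integral_minus:
  fixes f :: "'a::euclidean_space \<Rightarrow> 'b::{banach, second_countable_topology}"
  assumes "f \<in> borel_measurable borel"
  shows "(LINT y|lborel. f (x - y)) = (LINT y|lborel. f y)"
proof -
  have "lborel = distr lborel borel (\<lambda>y. x - y)" using lborel_affine[of "- 1" x] by (simp add: density_1)
  then have "(LINT y|lborel. f y) = (LINT y|distr lborel borel (\<lambda>y. x - y). f y)" by simp
  also have "\<dots> = (LINT y|lborel. f (x - y))" using assms by (intro integral_distr) auto
  finally show ?thesis by simp
qed

text \<open>Korovkin's estimate. Where all coordinates of \<open>u\<close> are small, uniform
  continuity gives \<open>e\<close>. Elsewhere some \<open>1 - cos\<close> is at least
  \<open>\<eta>\<close>, and the multiple \<open>2 * M / \<eta>\<close> of it exceeds any difference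
  of values of \<open>H\<close>.\<close>

lemma korovkin_modulus:
  fixes H :: "'a::euclidean_space \<Rightarrow> real"
  assumes \<omega>: "\<omega> > 0" and L: "\<omega> * L = pi" and H: "continuous_on UNIV H" and e: "e > 0"
  shows "\<exists>D\<ge>0. \<forall>x\<in>cube L. \<forall>u\<in>cube L. \<bar>H (x - u) - H x\<bar> \<le> e + D * (\<Sum>b\<in>Basis. 1 - cos (\<omega> * (u \<bullet> b)))"
proof -
  have L0: "L > 0" using \<omega> L pi_gt_zero by (metis zero_less_mult_pos)
  have cH: "continuous_on (cube (2 * L)) H" using H continuous_on_subset by blast
  have comp: "compact (cube (2 * L) :: 'a set)" unfolding cube_eq_cbox by simp
  obtain d where d: "d > 0" "\<And>x x'. x \<in> cube (2 * L) \<Longrightarrow> x' \<in> cube (2 * L) \<Longrightarrow> dist x' x < d \<Longrightarrow> dist (H x') (H x) < e"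
    using compact_uniformly_continuous[OF cH comp] e unfolding uniformly_continuous_on_def by metis
  obtain M where M: "\<And>x. x \<in> cube (2 * L) \<Longrightarrow> \<bar>H x\<bar> \<le> M"
    using compact_imp_bounded[OF compact_continuous_image[OF cH comp]] by (auto simp: bounded_iff)
  have "0 \<in> cube (2 * L)" using L0 by (simp add: cube_def)
  then have M0: "M \<ge> 0" using M[of 0] by force
  \<comment> \<open>The first bound makes the norm of \<open>u\<close> smaller than
    \<open>d\<close>; \<open>r \<le> L\<close> keeps \<open>\<omega> * r\<close> in the interval (0,
    pi], on which the cosine decreases.\<close>
  define r where "r = min (d / (2 * DIM('a))) L"
  have r: "r > 0" "r \<le> L" using d(1) L0 by (auto simp: r_def)
  define \<eta> where "\<eta> = 1 - cos (\<omega> * r)"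
  have "\<omega> * r > 0" "\<omega> * r \<le> pi" using r \<omega> L mult_left_mono[of r L \<omega>] by auto
  then have \<eta>: "\<eta> > 0" using cos_monotone_0_pi[of 0 "\<omega> * r"] by (simp add: \<eta>_def)
  have "\<bar>H (x - u) - H x\<bar> \<le> e + 2 * M / \<eta> * (\<Sum>b\<in>Basis. 1 - cos (\<omega> * (u \<bullet> b)))"
    if x: "x \<in> cube L" and u: "u \<in> cube L" for x u
  proof -
    have in2: "x - u \<in> cube (2 * L)" "x \<in> cube (2 * L)"
      using x u L0 unfolding cube_def by (auto simp: inner_diff_left) (smt (verit))+
    have s0: "0 \<le> (\<Sum>b\<in>Basis. 1 - cos (\<omega> * (u \<bullet> b)))" by (intro sum_nonneg) simp
    show ?thesis
    proof (cases "\<forall>b\<in>Basis. \<bar>u \<bullet> b\<bar> \<le> r")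
      case True
      have "norm u \<le> (\<Sum>b\<in>Basis. \<bar>u \<bullet> b\<bar>)" by (rule norm_le_l1)
      also have "\<dots> \<le> (\<Sum>b\<in>(Basis::'a set). r)" using True by (intro sum_mono) auto
      also have "\<dots> = DIM('a) * r" by simp
      also have "\<dots> \<le> DIM('a) * (d / (2 * DIM('a)))" by (intro mult_left_mono) (auto simp: r_def)
      also have "\<dots> < d" using d(1) by simp
      finally have "dist (x - u) x < d" by (simp add: dist_norm)
      then have "\<bar>H (x - u) - H x\<bar> \<le> e" using d(2)[OF in2(2,1)] by (simp add: dist_real_def)
      moreover have "0 \<le> 2 * M / \<eta> * (\<Sum>b\<in>Basis. 1 - cos (\<omega> * (u \<bullet> b)))"
        using M0 \<eta> s0 by (intro mult_nonneg_nonneg divide_nonneg_pos) auto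
      ultimately show ?thesis by linarith
    next
      case False
      then obtain b where b: "b \<in> Basis" "\<bar>u \<bullet> b\<bar> > r" by force
      have "\<bar>u \<bullet> b\<bar> \<le> L" using u b(1) by (auto simp: cube_def)
      then have "\<omega> * \<bar>u \<bullet> b\<bar> \<le> pi" using mult_left_mono[of "\<bar>u \<bullet> b\<bar>" L \<omega>] \<omega> L by simp
      then have "cos (\<omega> * \<bar>u \<bullet> b\<bar>) \<le> cos (\<omega> * r)"
        using b \<omega> r by (intro cos_monotone_0_pi_le mult_left_mono) auto
      moreover have "cos (\<omega> * \<bar>u \<bullet> b\<bar>) = cos (\<omega> * (u \<bullet> b))"
        using cos_abs_real[of "\<omega> * (u \<bullet> b)"] \<omega> by (simp add: abs_mult)
      ultimately have "\<eta> \<le> 1 - cos (\<omega> * (u \<bullet> b))" by (simp add: \<eta>_def)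
      also have "\<dots> \<le> (\<Sum>b\<in>Basis. 1 - cos (\<omega> * (u \<bullet> b)))"
        using b(1) by (intro member_le_sum) auto
      finally have "2 * M / \<eta> * \<eta> \<le> 2 * M / \<eta> * (\<Sum>b\<in>Basis. 1 - cos (\<omega> * (u \<bullet> b)))"
        using M0 \<eta> by (intro mult_left_mono divide_nonneg_pos) auto
      then show ?thesis using M[OF in2(1)] M[OF in2(2)] \<eta> e by simp
    qed
  qed
  then show ?thesis using M0 \<eta> by (intro exI[of _ "2 * M / \<eta>"]) auto
qed

lemma fejer_convergence:
  fixes H :: "'a::euclidean_space \<Rightarrow> real"
  assumes \<omega>: "\<omega> > 0" and L: "\<omega> * L = pi" and H: "continuous_on UNIV H"
    and supp: "\<And>x. x \<notin> cube (L / 2) \<Longrightarrow> H x = 0" and e: "e > 0"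
  shows "\<exists>N. \<forall>x\<in>cube (L / 2). \<bar>(LINT y|lborel. H y * fejer_prod \<omega> N (x - y)) / (2 * L) ^ DIM('a) - H x\<bar> \<le> e"
proof -
  have L0: "L > 0" using \<omega> L pi_gt_zero by (metis zero_less_mult_pos)
  define V where "V = (2 * L) ^ DIM('a)"
  have V: "V > 0" using L0 by (simp add: V_def)
  obtain D where D: "D \<ge> 0" "\<And>x u. x \<in> cube L \<Longrightarrow> u \<in> cube L \<Longrightarrow>
      \<bar>H (x - u) - H x\<bar> \<le> e / 2 + D * (\<Sum>b\<in>Basis. 1 - cos (\<omega> * (u \<bullet> b)))"
    using korovkin_modulus[OF \<omega> L H, of "e / 2"] e by auto
  obtain N :: nat where N: "real N > 2 * D * DIM('a) / e" by (meson reals_Archimedean2)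
  have N0: "N > 0" using N D(1) e by (metis divide_nonneg_pos linorder_not_less mult_nonneg_nonneg of_nat_0_le_iff of_nat_0_less_iff order_le_less_trans zero_le_numeral)
  let ?K = "\<lambda>u::'a. indicator (cube L) u * fejer_prod \<omega> N u"
  have K: "integrable lborel ?K" "(LINT x|lborel. ?K x) = V"
    "\<And>c. c \<in> Basis \<Longrightarrow> integrable lborel (\<lambda>x. ?K x * cos (\<omega> * (x \<bullet> c)))"
    "\<And>c. c \<in> Basis \<Longrightarrow> (LINT x|lborel. ?K x * cos (\<omega> * (x \<bullet> c))) = V * (real N / (real N + 1))"
    unfolding V_def
  proof -
    show "integrable lborel ?K" by (rule fejer_prod_integral(1)[OF \<omega> L])
    show "(LINT x|lborel. ?K x) = (2 * L) ^ DIM('a)" by (rule fejer_prod_integral(2)[OF \<omega> L])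
    fix c :: 'a assume c: "c \<in> Basis"
    show "integrable lborel (\<lambda>x. ?K x * cos (\<omega> * (x \<bullet> c)))" by (rule fejer_prod_integral(3)[OF \<omega> L c])
    show "(LINT x|lborel. ?K x * cos (\<omega> * (x \<bullet> c))) = (2 * L) ^ DIM('a) * (real N / (real N + 1))"
      by (rule fejer_prod_integral(4)[OF \<omega> L c N0])
  qed
  have Hm: "H \<in> borel_measurable borel" using H by (rule borel_measurable_continuous_onI)
  have Km: "fejer_prod \<omega> N \<in> borel_measurable (borel :: 'a measure)"
    by (rule borel_measurable_continuous_onI[OF fejer_prod_continuous])
  have "\<bar>(LINT y|lborel. H y * fejer_prod \<omega> N (x - y)) / V - H x\<bar> \<le> e" if x: "x \<in> cube (L / 2)" for x
  proof -
    have xL: "x \<in> cube L" using x L0 by (fastforce simp: cube_def)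
    have "(LINT y|lborel. H y * fejer_prod \<omega> N (x - y)) = (LINT y|lborel. H (x - (x - y)) * fejer_prod \<omega> N (x - y))"
      by simp
    also have "\<dots> = (LINT u|lborel. H (x - u) * fejer_prod \<omega> N u)"
      by (rule lborel_integral_minus[where f = "\<lambda>u. H (x - u) * fejer_prod \<omega> N u"])
         (intro borel_measurable_times Km measurable_compose[OF _ Hm]; simp)
    also have "\<dots> = (LINT u|lborel. H (x - u) * ?K u)"
    proof (intro Bochner_Integration.integral_cong refl)
      fix u :: 'a
      have "H (x - u) = 0" if "u \<notin> cube L"
      proof (rule supp)
        obtain b where b: "b \<in> Basis" "\<bar>u \<bullet> b\<bar> > L" using \<open>u \<notin> cube L\<close> by (auto simp: cube_def)
        have "\<bar>x \<bullet> b\<bar> \<le> L / 2" using x b(1) by (auto simp: cube_def)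
        then have "\<bar>(x - u) \<bullet> b\<bar> > L / 2" using b(2) unfolding inner_diff_left by linarith
        then show "x - u \<notin> cube (L / 2)" using b(1) by (force simp: cube_def)
      qed
      then show "H (x - u) * fejer_prod \<omega> N u = H (x - u) * ?K u" by (auto simp: indicator_def)
    qed
    finally have 1: "(LINT y|lborel. H y * fejer_prod \<omega> N (x - y)) = (LINT u|lborel. H (x - u) * ?K u)" .
    \<comment> \<open>The modulus of continuity times the kernel, arranged as a combination of
      functions whose integrals are known.\<close>
    define G where "G u = (e / 2 + D * real DIM('a)) * ?K u - D * (\<Sum>b\<in>Basis. ?K u * cos (\<omega> * (u \<bullet> b)))" for u
    have Gi: "integrable lborel G"
      unfolding G_def[abs_def] by (intro Bochner_Integration.integrable_diff Bochner_Integration.integrable_sum integrable_mult_right K)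
    have "(LINT u|lborel. G u) = (e / 2 + D * real DIM('a)) * V - D * (\<Sum>b\<in>(Basis::'a set). V * (real N / (real N + 1)))"
      unfolding G_def
    proof -
      have "(LINT u|lborel. (\<Sum>b\<in>Basis. ?K u * cos (\<omega> * (u \<bullet> b)))) = (\<Sum>b\<in>Basis. LINT u|lborel. ?K u * cos (\<omega> * (u \<bullet> b)))"
        by (rule Bochner_Integration.integral_sum) (rule K)
      then have s: "(LINT u|lborel. (\<Sum>b\<in>Basis. ?K u * cos (\<omega> * (u \<bullet> b)))) = (\<Sum>b\<in>(Basis::'a set). V * (real N / (real N + 1)))"
        by (simp add: K)
      have "(LINT u|lborel. (e / 2 + D * real DIM('a)) * ?K u - D * (\<Sum>b\<in>Basis. ?K u * cos (\<omega> * (u \<bullet> b))))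
        = (LINT u|lborel. (e / 2 + D * real DIM('a)) * ?K u) - (LINT u|lborel. D * (\<Sum>b\<in>Basis. ?K u * cos (\<omega> * (u \<bullet> b))))"
        by (intro Bochner_Integration.integral_diff Bochner_Integration.integrable_sum integrable_mult_right K)
      then show "(LINT u|lborel. (e / 2 + D * real DIM('a)) * ?K u - D * (\<Sum>b\<in>Basis. ?K u * cos (\<omega> * (u \<bullet> b))))
        = (e / 2 + D * real DIM('a)) * V - D * (\<Sum>b\<in>(Basis::'a set). V * (real N / (real N + 1)))"
        by (simp only: integral_mult_right_zero K(2) s)
    qed
    also have "\<dots> = V * (e / 2 + D * DIM('a) / (real N + 1))" by (simp add: field_simps)
    finally have Ge: "(LINT u|lborel. G u) = V * (e / 2 + D * DIM('a) / (real N + 1))" .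
    have bd: "\<bar>(H (x - u) - H x) * ?K u\<bar> \<le> G u" for u
    proof (cases "u \<in> cube L")
      case True
      have "\<bar>(H (x - u) - H x) * ?K u\<bar> = \<bar>H (x - u) - H x\<bar> * ?K u"
        by (simp add: abs_mult fejer_prod_nonneg)
      also have "\<dots> \<le> (e / 2 + D * (\<Sum>b\<in>Basis. 1 - cos (\<omega> * (u \<bullet> b)))) * ?K u"
        using D(2)[OF xL True] by (intro mult_right_mono) (auto simp: fejer_prod_nonneg)
      also have "\<dots> = G u"
        by (simp add: G_def sum_subtractf algebra_simps flip: sum_distrib_left)
      finally show ?thesis .
    qed (simp add: G_def)
    have dm: "(\<lambda>u. (H (x - u) - H x) * ?K u) \<in> borel_measurable lborel"
      using Km by (auto intro!: borel_measurable_times borel_measurable_diff measurable_compose[OF _ Hm])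
    have di: "integrable lborel (\<lambda>u. (H (x - u) - H x) * ?K u)"
      by (rule Bochner_Integration.integrable_bound[OF Gi dm]) (use bd in \<open>auto intro!: AE_I2 order_trans[OF bd]\<close>)
    have "(LINT u|lborel. H (x - u) * ?K u) = (LINT u|lborel. (H (x - u) - H x) * ?K u + H x * ?K u)"
      by (simp add: algebra_simps)
    also have "\<dots> = (LINT u|lborel. (H (x - u) - H x) * ?K u) + H x * V"
      by (subst Bochner_Integration.integral_add[OF di]) (auto intro!: integrable_mult_right K simp: K)
    finally have 2: "(LINT u|lborel. H (x - u) * ?K u) / V - H x = (LINT u|lborel. (H (x - u) - H x) * ?K u) / V"
      using V by (simp add: field_simps)
    have "\<bar>LINT u|lborel. (H (x - u) - H x) * ?K u\<bar> \<le> (LINT u|lborel. \<bar>(H (x - u) - H x) * ?K u\<bar>)"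
      by (rule integral_abs_bound)
    also have "\<dots> \<le> (LINT u|lborel. G u)"
      using bd by (intro integral_mono integrable_abs di Gi) auto
    also have "\<dots> \<le> V * (e / 2 + e / 2)"
      unfolding Ge using V N e N0 by (intro mult_left_mono add_left_mono) (auto simp: field_simps)
    finally have "\<bar>LINT u|lborel. (H (x - u) - H x) * ?K u\<bar> / V \<le> e" using V by (simp add: field_simps)
    then show ?thesis unfolding 1 2 using V by simp
  qed
  then show ?thesis unfolding V_def by blast
qed

text \<open>As \<open>H\<close> and the kernel are real, real parts turn each exponential into a
  cosine with phase \<open>Arg (c m)\<close>, for which a hull weight is available.\<close>

lemma fejer_fourier:
  fixes H :: "'a::euclidean_space \<Rightarrow> real" and \<omega> :: real
  assumes H: "integrable lborel H"
  defines "c \<equiv> \<lambda>m::'a \<Rightarrow> int. LINT y|lborel. of_real (H y) * wave (\<lambda>b. - (\<omega> * m b)) y"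
  shows "(LINT y|lborel. H y * fejer_prod \<omega> N (x - y))
    = (\<Sum>m\<in>PiE Basis (\<lambda>_. {- int N..int N}). (\<Prod>b\<in>Basis. fej N (m b)) * cmod (c m) *
        cos ((\<Sum>b\<in>Basis. (\<omega> * m b) *\<^sub>R b) \<bullet> x + Arg (c m)))"
proof -
  let ?F = "PiE Basis (\<lambda>_. {- int N..int N}) :: ('a \<Rightarrow> int) set"
  have wi: "integrable lborel (\<lambda>y. of_real (H y) * wave \<tau> y)" for \<tau>
    using H by (intro integrable_times_bounded[where B = 1] complex_of_real_integrable_eq[THEN iffD2]) auto
  have split: "wave (\<lambda>b. \<omega> * m b) (x - y) = wave (\<lambda>b. \<omega> * m b) x * wave (\<lambda>b. - (\<omega> * m b)) y" for m :: "'a \<Rightarrow> int" and y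
    by (simp add: wave_def cis_mult inner_diff_left right_diff_distrib sum_subtractf sum_negf)
  have eq: "of_real (H y * fejer_prod \<omega> N (x - y)) = (\<Sum>m\<in>?F. of_real (\<Prod>b\<in>Basis. fej N (m b)) * wave (\<lambda>b. \<omega> * m b) x
    * (of_real (H y) * wave (\<lambda>b. - (\<omega> * m b)) y))" for y
    by (simp add: fejer_prod_expansion split sum_distrib_left mult_ac)
  have "of_real (LINT y|lborel. H y * fejer_prod \<omega> N (x - y)) = (LINT y|lborel. of_real (H y * fejer_prod \<omega> N (x - y)) :: complex)"
    by (rule integral_complex_of_real[symmetric])
  also have "\<dots> = (\<Sum>m\<in>?F. of_real (\<Prod>b\<in>Basis. fej N (m b)) * wave (\<lambda>b. \<omega> * m b) x * c m)"
    unfolding eq c_def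
    by (subst Bochner_Integration.integral_sum) (auto intro!: integrable_mult_right wi sum.cong)
  finally have "(LINT y|lborel. H y * fejer_prod \<omega> N (x - y))
    = Re (\<Sum>m\<in>?F. of_real (\<Prod>b\<in>Basis. fej N (m b)) * wave (\<lambda>b. \<omega> * m b) x * c m)"
    by (metis Re_complex_of_real)
  also have "\<dots> = (\<Sum>m\<in>?F. (\<Prod>b\<in>Basis. fej N (m b)) * cmod (c m) * cos ((\<Sum>b\<in>Basis. (\<omega> * m b) *\<^sub>R b) \<bullet> x + Arg (c m)))"
  proof (subst Re_sum, intro sum.cong refl)
    fix m :: "'a \<Rightarrow> int"
    have "c m = of_real (cmod (c m)) * cis (Arg (c m))" by (metis rcis_cmod_Arg rcis_def)
    then have "wave (\<lambda>b. \<omega> * m b) x * c m = of_real (cmod (c m)) * cis ((\<Sum>b\<in>Basis. \<omega> * m b * (x \<bullet> b)) + Arg (c m))"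
      unfolding wave_def by (metis (no_types, lifting) cis_mult mult.left_commute)
    moreover have "(\<Sum>b\<in>Basis. \<omega> * m b * (x \<bullet> b)) = (\<Sum>b\<in>Basis. (\<omega> * m b) *\<^sub>R b) \<bullet> x"
      by (simp only: inner_sum_left inner_scaleR_left inner_commute[of x])
    moreover have "Re (of_real r * z) = r * Re z" for r z by simp
    ultimately show "Re (of_real (\<Prod>b\<in>Basis. fej N (m b)) * wave (\<lambda>b. \<omega> * m b) x * c m)
      = (\<Prod>b\<in>Basis. fej N (m b)) * cmod (c m) * cos ((\<Sum>b\<in>Basis. (\<omega> * m b) *\<^sub>R b) \<bullet> x + Arg (c m))"
      by (simp only: mult.assoc) simp
  qed
  finally show ?thesis .
qed

text \<open>The means of \<open>H\<close> are finite cosine sums whose coefficients do not exceed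
  the Fourier coefficients of \<open>H\<close> in size, because \<open>fej\<close> is at most 1.
  Their hull weights are thus bounded through \<open>B\<close> uniformly in \<open>N\<close>, and
  the uniform limit inherits the bound.\<close>

theorem relu_hull_fourier:
  fixes H :: "'a::euclidean_space \<Rightarrow> real" and \<omega> :: real
  assumes \<omega>: "\<omega> > 0" and L: "\<omega> * L = pi" and R: "R \<ge> 1" "R \<le> L / 2" and H: "continuous_on UNIV H"
    and supp: "\<And>x. x \<notin> cube (L / 2) \<Longrightarrow> H x = 0"
  defines "c \<equiv> \<lambda>m::'a \<Rightarrow> int. LINT y|lborel. of_real (H y) * wave (\<lambda>b. - (\<omega> * m b)) y"
  assumes B: "\<And>N. (\<Sum>m\<in>PiE Basis (\<lambda>_. {- int N..int N}). (1 + (\<Sum>b\<in>Basis. (\<omega> * m b)\<^sup>2)) * cmod (c m)) \<le> B"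
  shows "relu_hull (cball 0 R \<times> {1}) ((1 + 2 * R + 4 * R\<^sup>2) * B / (2 * L) ^ DIM('a)) (\<lambda>p :: 'a \<times> real. H (fst p))"
proof (rule relu_hull_limit)
  fix e :: real assume e: "e > 0"
  have L0: "L > 0" using \<omega> L pi_gt_zero by (metis zero_less_mult_pos)
  define V where "V = (2 * L) ^ DIM('a)"
  have V: "V > 0" using L0 by (simp add: V_def)
  obtain N where N: "\<And>x. x \<in> cube (L / 2) \<Longrightarrow> \<bar>(LINT y|lborel. H y * fejer_prod \<omega> N (x - y)) / V - H x\<bar> \<le> e"
    using fejer_convergence[OF \<omega> L H supp e] unfolding V_def by blast
  have "integrable lborel (\<lambda>x. indicator (cube (L / 2)) x *\<^sub>R H x)"
    unfolding cube_eq_cbox by (rule borel_integrable_compact) (auto intro: continuous_on_subset[OF H])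
  moreover have "(\<lambda>x. indicator (cube (L / 2)) x *\<^sub>R H x) = H"
  proof
    show "indicator (cube (L / 2)) x *\<^sub>R H x = H x" for x using supp[of x] by (cases "x \<in> cube (L / 2)") auto
  qed
  ultimately have Hi: "integrable lborel H" by (simp only:)
  let ?F = "PiE Basis (\<lambda>_. {- int N..int N}) :: ('a \<Rightarrow> int) set"
  let ?\<xi> = "\<lambda>m::'a \<Rightarrow> int. \<Sum>b\<in>Basis. (\<omega> * m b) *\<^sub>R b"
  let ?C = "1 + 2 * R + 4 * R\<^sup>2"
  define a where "a m = (\<Prod>b\<in>Basis. fej N (m b)) * cmod (c m) / V" for m :: "'a \<Rightarrow> int"
  define g where "g p = (\<Sum>m\<in>?F. a m * cos (?\<xi> m \<bullet> fst p + Arg (c m)))" for p :: "'a \<times> real"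
  have nx: "(norm (?\<xi> m))\<^sup>2 = (\<Sum>b\<in>Basis. (\<omega> * m b)\<^sup>2)" for m
    by (subst norm_eq_sqrt_inner, subst euclidean_inner)
       (auto simp: sum_nonneg power2_eq_square inner_sum_left inner_Basis if_distrib cong: if_cong)
  have "relu_hull (cball 0 R \<times> {1}) (\<Sum>m\<in>?F. \<bar>a m\<bar> * (?C * (1 + (norm (?\<xi> m))\<^sup>2))) g"
    unfolding g_def[abs_def] by (intro relu_hull_sum relu_hull_scale relu_hull_cos R finite_PiE) auto
  moreover have "(\<Sum>m\<in>?F. \<bar>a m\<bar> * (?C * (1 + (norm (?\<xi> m))\<^sup>2))) \<le> ?C * B / V"
  proof -
    have "\<bar>a m\<bar> \<le> cmod (c m) / V" for m
    proof -
      have "0 \<le> (\<Prod>b\<in>Basis. fej N (m b))" "(\<Prod>b\<in>Basis. fej N (m b)) \<le> 1"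
        by (auto intro!: prod_nonneg prod_le_1 simp: fej_bounds)
      then have "(\<Prod>b\<in>Basis. fej N (m b)) * (cmod (c m) / V) \<le> 1 * (cmod (c m) / V)"
        using V by (intro mult_right_mono) auto
      then show ?thesis using V \<open>0 \<le> _\<close> by (simp add: a_def abs_mult)
    qed
    then have "(\<Sum>m\<in>?F. \<bar>a m\<bar> * (?C * (1 + (norm (?\<xi> m))\<^sup>2))) \<le> (\<Sum>m\<in>?F. cmod (c m) / V * (?C * (1 + (norm (?\<xi> m))\<^sup>2)))"
      using R by (intro sum_mono mult_right_mono) auto
    also have "\<dots> = ?C / V * (\<Sum>m\<in>?F. (1 + (\<Sum>b\<in>Basis. (\<omega> * m b)\<^sup>2)) * cmod (c m))"
      unfolding nx by (simp add: sum_distrib_left mult_ac)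
    also have "\<dots> \<le> ?C / V * B" using R V by (intro mult_left_mono B) auto
    finally show ?thesis by simp
  qed
  ultimately have "relu_hull (cball 0 R \<times> {1}) (?C * B / V) g" by (rule relu_hull_mono)
  moreover have "\<bar>H (fst p) - g p\<bar> \<le> e" if p: "p \<in> cball 0 R \<times> {1}" for p
  proof -
    have "fst p \<in> cube (L / 2)"
      using p R(2) Basis_le_norm[of _ "fst p"] by (fastforce simp: cube_def)
    moreover have "(LINT y|lborel. H y * fejer_prod \<omega> N (fst p - y)) / V = g p"
      unfolding fejer_fourier[OF Hi] g_def a_def c_def by (simp add: sum_divide_distrib mult_ac)
    ultimately show ?thesis using N[of "fst p"] by (simp add: abs_minus_commute)
  qed
  ultimately show "\<exists>h. relu_hull (cball 0 R \<times> {1}) (?C * B / (2 * L) ^ DIM('a)) h \<and>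
      (\<forall>p\<in>cball 0 R \<times> {1::real}. \<bar>H (fst p) - h p\<bar> \<le> e)"
    unfolding V_def by (intro exI[of _ g] conjI ballI)
qed

section \<open>Sequences of derivatives\<close>

text \<open>A smooth function of one real variable is represented by the sequence of its derivatives.\<close>

definition deriv_seq :: "(nat \<Rightarrow> real \<Rightarrow> 'b::real_normed_vector) \<Rightarrow> bool" where
  "deriv_seq P \<longleftrightarrow> (\<forall>i s. (P i has_vector_derivative P (Suc i) s) (at s))"

lemma deriv_seqD: "deriv_seq P \<Longrightarrow> (P i has_vector_derivative P (Suc i) s) (at s)"
  by (simp add: deriv_seq_def)

lemma deriv_seq_continuous: "deriv_seq P \<Longrightarrow> continuous_on A (P i)"
  by (intro continuous_at_imp_continuous_on ballI has_vector_derivative_continuous[OF deriv_seqD])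

definition seq_mult :: "(nat \<Rightarrow> real \<Rightarrow> 'b::real_normed_algebra_1) \<Rightarrow> (nat \<Rightarrow> real \<Rightarrow> 'b) \<Rightarrow> nat \<Rightarrow> real \<Rightarrow> 'b" where
  "seq_mult P Q i s = (\<Sum>a\<le>i. of_nat (i choose a) * (P a s * Q (i - a) s))"

lemma seq_mult_0 [simp]: "seq_mult P Q 0 s = P 0 s * Q 0 s"
  by (simp add: seq_mult_def)

text \<open>Pascal's rule for arbitrary sequences: it yields the product rule and, with a constant
  second sequence, the induction step for alternating binomial sums.\<close>

lemma leibniz_sum:
  fixes p q :: "nat \<Rightarrow> 'b::comm_ring_1"
  shows "(\<Sum>a\<le>Suc i. of_nat (Suc i choose a) * (p a * q (Suc i - a)))
    = (\<Sum>a\<le>i. of_nat (i choose a) * (p (Suc a) * q (i - a) + p a * q (Suc (i - a))))"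
proof -
  have "(\<Sum>a\<le>Suc i. of_nat (Suc i choose a) * (p a * q (Suc i - a)))
    = p 0 * q (Suc i) + (\<Sum>a\<le>i. of_nat (Suc i choose Suc a) * (p (Suc a) * q (i - a)))"
    by (subst sum.atMost_Suc_shift) simp
  also have "(\<Sum>a\<le>i. of_nat (Suc i choose Suc a) * (p (Suc a) * q (i - a)))
    = (\<Sum>a\<le>i. of_nat (i choose a) * (p (Suc a) * q (i - a))) + (\<Sum>a\<le>i. of_nat (i choose Suc a) * (p (Suc a) * q (i - a)))"
    by (simp add: sum.distrib[symmetric] distrib_right)
  also have "p 0 * q (Suc i) + (\<dots>) = (\<Sum>a\<le>i. of_nat (i choose a) * (p (Suc a) * q (i - a)))
    + (p 0 * q (Suc i) + (\<Sum>a\<le>i. of_nat (i choose Suc a) * (p (Suc a) * q (i - a))))"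
    by (simp add: add_ac)
  also have "p 0 * q (Suc i) + (\<Sum>a\<le>i. of_nat (i choose Suc a) * (p (Suc a) * q (i - a)))
    = (\<Sum>a\<le>Suc i. of_nat (i choose a) * (p a * q (Suc i - a)))"
    by (subst sum.atMost_Suc_shift) simp
  also have "\<dots> = (\<Sum>a\<le>i. of_nat (i choose a) * (p a * q (Suc (i - a))))"
    by (simp add: Suc_diff_le binomial_eq_0)
  finally show ?thesis by (simp add: sum.distrib distrib_left)
qed

lemma deriv_seq_mult:
  fixes P Q :: "nat \<Rightarrow> real \<Rightarrow> 'b::real_normed_field"
  assumes "deriv_seq P" "deriv_seq Q"
  shows "deriv_seq (seq_mult P Q)"
  unfolding deriv_seq_def
proof (intro allI)
  fix i s
  have "(seq_mult P Q i has_vector_derivative (\<Sum>a\<le>i. of_nat (i choose a) * (P a s * Q (Suc (i - a)) s + P (Suc a) s * Q (i - a) s))) (at s)"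
    unfolding seq_mult_def[abs_def]
    by (intro has_vector_derivative_sum has_vector_derivative_mult_right has_vector_derivative_mult deriv_seqD assms)
  moreover have "(\<Sum>a\<le>i. of_nat (i choose a) * (P a s * Q (Suc (i - a)) s + P (Suc a) s * Q (i - a) s)) = seq_mult P Q (Suc i) s"
    unfolding seq_mult_def using leibniz_sum[of i "\<lambda>a. P a s" "\<lambda>a. Q a s"] by (simp add: add.commute)
  ultimately show "(seq_mult P Q i has_vector_derivative seq_mult P Q (Suc i) s) (at s)" by simp
qed

lemma deriv_seq_affine:
  fixes P :: "nat \<Rightarrow> real \<Rightarrow> 'b::real_normed_vector"
  assumes "deriv_seq P"
  shows "deriv_seq (\<lambda>i s. c ^ i *\<^sub>R P i (c * s + d))"
  unfolding deriv_seq_def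
proof (intro allI)
  fix i s
  have "((\<lambda>s. P i (c * s + d)) has_vector_derivative c *\<^sub>R P (Suc i) (c * s + d)) (at s)"
  proof -
    have "((\<lambda>s. c * s + d) has_vector_derivative c) (at s)"
      by (auto intro!: derivative_eq_intros simp flip: has_real_derivative_iff_has_vector_derivative)
    from vector_diff_chain_at[OF this deriv_seqD[OF assms]] show ?thesis by (simp add: o_def)
  qed
  then have "((\<lambda>s. c ^ i *\<^sub>R P i (c * s + d)) has_vector_derivative c ^ i *\<^sub>R c *\<^sub>R P (Suc i) (c * s + d)) (at s)"
    by (rule bounded_linear.has_vector_derivative[OF bounded_linear_scaleR_right])
  then show "((\<lambda>s. c ^ i *\<^sub>R P i (c * s + d)) has_vector_derivative c ^ Suc i *\<^sub>R P (Suc i) (c * s + d)) (at s)"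
    by (simp add: mult.commute)
qed

lemma deriv_seq_of_real:
  assumes "deriv_seq P"
  shows "deriv_seq (\<lambda>i s. of_real (P i s) :: complex)"
  using assms has_vector_derivative_of_real unfolding deriv_seq_def has_real_derivative_iff_has_vector_derivative by blast

lemma deriv_seq_cmult:
  fixes P :: "nat \<Rightarrow> real \<Rightarrow> 'b::real_normed_algebra"
  assumes "deriv_seq P"
  shows "deriv_seq (\<lambda>i s. c * P i s)"
  using assms unfolding deriv_seq_def by (intro allI has_vector_derivative_mult_right) simp

lemma deriv_seq_sum:
  assumes "\<And>j. j \<in> J \<Longrightarrow> deriv_seq (P j)"
  shows "deriv_seq (\<lambda>i s. \<Sum>j\<in>J. P j i s)"
  using assms unfolding deriv_seq_def by (intro allI has_vector_derivative_sum) auto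

lemma deriv_seq_shift: "deriv_seq P \<Longrightarrow> deriv_seq (\<lambda>i. P (i + a))"
  unfolding deriv_seq_def by simp

lemma deriv_seq_zero_outside:
  fixes P :: "nat \<Rightarrow> real \<Rightarrow> 'b::real_normed_vector"
  assumes P: "deriv_seq P" and U: "open U" and z: "\<And>s. s \<in> U \<Longrightarrow> P 0 s = 0" and s: "s \<in> U"
  shows "P i s = 0"
  using s
proof (induction i arbitrary: s)
  case (Suc i)
  have "(P i has_vector_derivative 0) (at s)"
    by (rule has_vector_derivative_transform_within_open[OF has_vector_derivative_const U Suc.prems, of 0])
       (simp add: Suc.IH)
  then show ?case using deriv_seqD[OF P, of i s] vector_derivative_unique_at by blast
qed (rule z)

section \<open>Smooth cutoff functions\<close>

text \<open>The functions p(1/s) exp(-1/s) are closed under differentiation, which replaces p by x^2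
  (p - p'). This is the recursion of \<open>flat_poly\<close>, so all derivatives of exp(-1/s) come
  with the same proof at 0.\<close>

definition flat :: "real poly \<Rightarrow> real \<Rightarrow> real" where
  "flat p s = (if s > 0 then poly p (1 / s) * exp (- (1 / s)) else 0)"

primrec flat_poly :: "nat \<Rightarrow> real poly" where
  "flat_poly 0 = 1"
| "flat_poly (Suc i) = [:0, 0, 1:] * (flat_poly i - pderiv (flat_poly i))"

lemma poly_exp_tendsto_0: "((\<lambda>x. poly p x * exp (- x)) \<longlongrightarrow> (0::real)) at_top"
proof -
  have split: "poly p x * exp (- x) = (\<Sum>i\<le>degree p. coeff p i * (x ^ i / exp x))" for x :: real
    by (simp add: poly_altdef sum_distrib_right exp_minus divide_inverse mult.assoc)
  have "((\<lambda>x. \<Sum>i\<le>degree p. coeff p i * (x ^ i / exp x)) \<longlongrightarrow> (\<Sum>i\<le>degree p. coeff p i * 0)) at_top"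
    by (intro tendsto_sum tendsto_mult tendsto_const tendsto_power_div_exp_0)
  then show ?thesis unfolding split by simp
qed

lemma flat_deriv: "(flat p has_real_derivative flat ([:0, 0, 1:] * (p - pderiv p)) s) (at s)"
proof -
  consider "s > 0" | "s < 0" | "s = 0" by linarith
  then show ?thesis
  proof cases
    case 1
    have "((\<lambda>s. poly p (1 / s) * exp (- (1 / s))) has_real_derivative
      poly ([:0, 0, 1:] * (p - pderiv p)) (1 / s) * exp (- (1 / s))) (at s)"
      using 1 by (auto intro!: derivative_eq_intros poly_DERIV[THEN DERIV_chain2] simp: field_simps power2_eq_square)
    then have "((\<lambda>s. poly p (1 / s) * exp (- (1 / s))) has_real_derivative flat ([:0, 0, 1:] * (p - pderiv p)) s) (at s)"
      using 1 by (simp add: flat_def)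
    then show ?thesis
      by (rule has_field_derivative_transform_within_open[of _ _ _ "{0<..}"]) (use 1 in \<open>auto simp: flat_def\<close>)
  next
    case 2
    have "((\<lambda>_. 0) has_real_derivative flat ([:0, 0, 1:] * (p - pderiv p)) s) (at s)"
      using 2 by (simp add: flat_def)
    then show ?thesis
      by (rule has_field_derivative_transform_within_open[of _ _ _ "{..<0}"]) (use 2 in \<open>auto simp: flat_def\<close>)
  next
    case 3
    have "((\<lambda>h. flat p h / h) \<longlongrightarrow> 0) (at 0)"
    proof -
      have "((\<lambda>h. flat p h / h) \<longlongrightarrow> 0) (at_right 0)"
      proof -
        have inv: "filterlim (\<lambda>h::real. 1 / h) at_top (at_right 0)"
          using filterlim_inverse_at_top_right by (simp add: inverse_eq_divide)
        have "((\<lambda>h. poly ([:0, 1:] * p) (1 / h) * exp (- (1 / h))) \<longlongrightarrow> 0) (at_right (0::real))"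
          using filterlim_compose[OF poly_exp_tendsto_0[of "[:0, 1:] * p"] inv] by simp
        then show ?thesis
          by (rule Lim_transform_eventually) (auto simp: eventually_at_filter flat_def)
      qed
      moreover have "((\<lambda>h. flat p h / h) \<longlongrightarrow> 0) (at_left 0)"
        by (rule Lim_transform_eventually[OF tendsto_const]) (auto simp: eventually_at_filter flat_def)
      ultimately show ?thesis by (simp add: filterlim_at_split)
    qed
    then show ?thesis using 3 by (simp add: has_field_derivative_iff flat_def)
  qed
qed

lemma deriv_seq_flat: "deriv_seq (\<lambda>i. flat (flat_poly i))"
  unfolding deriv_seq_def flat_poly.simps(2)
  using flat_deriv by (simp add: has_real_derivative_iff_has_vector_derivative[symmetric])

text \<open>The normalised antiderivative of the bump
  \<open>flat 1 (s - a) * flat 1 (b - s)\<close>.\<close>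

lemma smooth_step_exists:
  fixes a b :: real
  assumes ab: "a < b"
  shows "\<exists>\<theta>. deriv_seq \<theta> \<and> (\<forall>s\<le>a. \<theta> 0 s = (0::real)) \<and> (\<forall>s\<ge>b. \<theta> 0 s = 1) \<and> (\<forall>s. 0 \<le> \<theta> 0 s \<and> \<theta> 0 s \<le> 1)"
proof -
  let ?f = "\<lambda>i. flat (flat_poly i)"
  define \<beta> where "\<beta> = seq_mult (\<lambda>i s. 1 ^ i *\<^sub>R ?f i (1 * s + - a)) (\<lambda>i s. (- 1) ^ i *\<^sub>R ?f i (- 1 * s + b))"
  have \<beta>: "deriv_seq \<beta>" unfolding \<beta>_def by (intro deriv_seq_mult deriv_seq_affine deriv_seq_flat)
  have \<beta>0: "\<beta> 0 s = flat 1 (s - a) * flat 1 (b - s)" for s by (simp add: \<beta>_def)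
  have pos: "\<beta> 0 s \<ge> 0" "s \<le> a \<Longrightarrow> \<beta> 0 s = 0" "b \<le> s \<Longrightarrow> \<beta> 0 s = 0" for s
    by (auto simp: \<beta>0 flat_def)
  \<comment> \<open>The integral starts at \<open>a - 1\<close> and not at \<open>a\<close>, so that
    every \<open>s \<ge> a\<close> is interior to the interval on which \<open>J\<close> is
    differentiated.\<close>
  define J where "J s = integral {a - 1..s} (\<beta> 0)" for s
  have int: "\<beta> 0 integrable_on {x..y}" for x y
    by (intro integrable_continuous_interval deriv_seq_continuous \<beta>)
  have J0: "J s = 0" if "s \<le> a" for s
  proof -
    have "J s = integral {a - 1..s} (\<lambda>_. 0)" unfolding J_def
      using that pos(2) by (intro integral_cong) auto
    then show ?thesis by simp
  qed
  have J_add: "J y = J x + integral {x..y} (\<beta> 0)" if "a - 1 \<le> x" "x \<le> y" for x y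
    unfolding J_def using that int by (simp add: Henstock_Kurzweil_Integration.integral_combine)
  have J_mono: "J x \<le> J y" if "x \<le> y" for x y
  proof (cases "x \<le> a - 1")
    case True
    then show ?thesis using J0[of x] integral_nonneg[OF int, of "a - 1" y] pos(1) by (simp add: J_def)
  next
    case False
    then show ?thesis using J_add[of x y] that integral_nonneg[OF int, of x y] pos(1) by simp
  qed
  have Jb: "J s = J b" if "b \<le> s" for s
  proof -
    have "integral {b..s} (\<beta> 0) = integral {b..s} (\<lambda>_. 0)"
      using pos(3) by (intro integral_cong) auto
    then show ?thesis using J_add[of b s] that ab by simp
  qed
  have Jpos: "J b > 0"
  proof (rule ccontr)
    assume "\<not> J b > 0"
    then have "J b = 0" using J_mono[of a b] J0[of a] ab by simp
    then have "(\<beta> 0 has_integral 0) (cbox (a - 1) b)"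
      using integrable_integral[OF int, of "a - 1" b] by (simp add: J_def)
    then have "\<beta> 0 ((a + b) / 2) = 0"
      using ab pos(1) by (intro has_integral_0_cbox_imp_0[of "a - 1" b "\<beta> 0"] deriv_seq_continuous \<beta>) auto
    then show False using ab by (simp add: \<beta>0 flat_def)
  qed
  have J_deriv: "(J has_real_derivative \<beta> 0 s) (at s)" for s
  proof (cases "s < a")
    case True
    have "((\<lambda>_. 0) has_real_derivative \<beta> 0 s) (at s)" using True pos(2)[of s] by simp
    then show ?thesis
      by (rule has_field_derivative_transform_within_open[of _ _ _ "{..<a}"]) (use True J0 in auto)
  next
    case False
    have "(J has_vector_derivative \<beta> 0 s) (at s within {a - 1..s + 1})"
      unfolding J_def[abs_def] using False by (intro integral_has_vector_derivative deriv_seq_continuous \<beta>) auto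
    then have "(J has_vector_derivative \<beta> 0 s) (at s)"
      using False by (subst (asm) at_within_interior) auto
    then show ?thesis by (simp add: has_real_derivative_iff_has_vector_derivative)
  qed
  define \<theta> where "\<theta> i s = (case i of 0 \<Rightarrow> J s | Suc i \<Rightarrow> \<beta> i s) / J b" for i s
  have "deriv_seq \<theta>"
    unfolding deriv_seq_def
  proof (intro allI)
    fix i s
    show "(\<theta> i has_vector_derivative \<theta> (Suc i) s) (at s)"
      unfolding has_real_derivative_iff_has_vector_derivative[symmetric]
    proof (cases i)
      case 0
      show "(\<theta> i has_real_derivative \<theta> (Suc i) s) (at s)"
        unfolding 0 \<theta>_def[abs_def] using J_deriv by (auto intro!: DERIV_cdivide)
    next
      case (Suc j)
      have "(\<beta> j has_real_derivative \<beta> (Suc j) s) (at s)"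
        using deriv_seqD[OF \<beta>] by (simp add: has_real_derivative_iff_has_vector_derivative)
      then show "(\<theta> i has_real_derivative \<theta> (Suc i) s) (at s)"
        unfolding Suc \<theta>_def[abs_def] by (auto intro!: DERIV_cdivide)
    qed
  qed
  moreover have th0: "\<theta> 0 s = J s / J b" for s by (simp add: \<theta>_def)
  have "\<forall>s\<le>a. \<theta> 0 s = 0" by (simp add: th0 J0)
  moreover have "\<forall>s\<ge>b. \<theta> 0 s = 1"
  proof (intro allI impI)
    fix s assume "b \<le> s"
    from Jb[OF this] show "\<theta> 0 s = 1" using Jpos by (simp add: th0)
  qed
  moreover have "0 \<le> \<theta> 0 s \<and> \<theta> 0 s \<le> 1" for s
  proof -
    have "J s \<le> J b" using J_mono[of s b] Jb[of s] by (cases "s \<le> b") auto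
    moreover have "0 \<le> J s" using J_mono[of a s] J0[of s] J0[of a] by (cases "s \<le> a") auto
    ultimately show ?thesis using Jpos by (simp add: th0)
  qed
  ultimately show ?thesis by blast
qed

section \<open>Product test functions\<close>

text \<open>The partial derivative with multi-index \<open>n\<close> of the product of the functions
  \<open>P b 0\<close>. Differentiation in direction \<open>c\<close> increments \<open>n c\<close>,
  so products never leave this form.\<close>

definition tensor :: "('a::euclidean_space \<Rightarrow> nat \<Rightarrow> real \<Rightarrow> complex) \<Rightarrow> ('a \<Rightarrow> nat) \<Rightarrow> 'a \<Rightarrow> complex" where
  "tensor P n x = (\<Prod>b\<in>Basis. P b (n b) (x \<bullet> b))"

lemma tensor_deriv:
  assumes P: "\<forall>b\<in>Basis. deriv_seq (P b)"
  shows "((\<lambda>x. tensor P n x) has_derivative (\<lambda>h. \<Sum>c\<in>Basis. (h \<bullet> c) *\<^sub>R tensor P (n(c := Suc (n c))) x)) (at (x::'a::euclidean_space))"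
proof -
  have d: "((\<lambda>x. P b (n b) (x \<bullet> b)) has_derivative (\<lambda>h. (h \<bullet> b) *\<^sub>R P b (Suc (n b)) (x \<bullet> b))) (at x)" if "b \<in> Basis" for b
  proof -
    have "(P b (n b) has_derivative (\<lambda>h. h *\<^sub>R P b (Suc (n b)) (x \<bullet> b))) (at (x \<bullet> b))"
      using deriv_seqD[OF P[rule_format, OF that]] by (simp add: has_vector_derivative_def)
    from has_derivative_compose[OF has_derivative_inner_left[OF has_derivative_ident] this] show ?thesis by simp
  qed
  have "((\<lambda>x. \<Prod>b\<in>Basis. P b (n b) (x \<bullet> b)) has_derivative
    (\<lambda>h. \<Sum>c\<in>Basis. ((h \<bullet> c) *\<^sub>R P c (Suc (n c)) (x \<bullet> c)) * (\<Prod>b\<in>Basis - {c}. P b (n b) (x \<bullet> b)))) (at x)"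
    by (rule has_derivative_prod) (rule d)
  moreover have "((h \<bullet> c) *\<^sub>R P c (Suc (n c)) (x \<bullet> c)) * (\<Prod>b\<in>Basis - {c}. P b (n b) (x \<bullet> b)) = (h \<bullet> c) *\<^sub>R tensor P (n(c := Suc (n c))) x"
    if c: "c \<in> Basis" for h c
  proof -
    have "tensor P (n(c := Suc (n c))) x = P c (Suc (n c)) (x \<bullet> c) * (\<Prod>b\<in>Basis - {c}. P b ((n(c := Suc (n c))) b) (x \<bullet> b))"
      unfolding tensor_def using c by (subst prod.remove[of _ c]) auto
    also have "(\<Prod>b\<in>Basis - {c}. P b ((n(c := Suc (n c))) b) (x \<bullet> b)) = (\<Prod>b\<in>Basis - {c}. P b (n b) (x \<bullet> b))"
      by (intro prod.cong) auto
    finally have eq: "tensor P (n(c := Suc (n c))) x = P c (Suc (n c)) (x \<bullet> c) * (\<Prod>b\<in>Basis - {c}. P b (n b) (x \<bullet> b))" .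
    show ?thesis unfolding eq by simp
  qed
  note fac = this
  have "(\<Sum>c\<in>Basis. ((h \<bullet> c) *\<^sub>R P c (Suc (n c)) (x \<bullet> c)) * (\<Prod>b\<in>Basis - {c}. P b (n b) (x \<bullet> b)))
    = (\<Sum>c\<in>Basis. (h \<bullet> c) *\<^sub>R tensor P (n(c := Suc (n c))) x)" for h
    by (intro sum.cong refl fac)
  ultimately show ?thesis unfolding tensor_def[symmetric, abs_def] by simp
qed

lemma tensor_continuous:
  assumes P: "\<forall>b\<in>Basis. deriv_seq (P b)"
  shows "continuous_on A (tensor P n)"
  by (intro continuous_at_imp_continuous_on ballI has_derivative_continuous[OF tensor_deriv[OF P]])

lemma partial_deriv_Re_tensor:
  assumes P: "\<forall>b\<in>Basis. deriv_seq (P b)" and c: "c \<in> Basis"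
  shows "partial_deriv c (\<lambda>x. Re (tensor P n x)) = (\<lambda>x. Re (tensor P (n(c := Suc (n c))) x))"
proof
  fix x
  have d: "((\<lambda>x. Re (tensor P n x)) has_derivative (\<lambda>h. Re (\<Sum>c\<in>Basis. (h \<bullet> c) *\<^sub>R tensor P (n(c := Suc (n c))) x))) (at x)"
    by (rule bounded_linear.has_derivative[OF bounded_linear_Re tensor_deriv[OF P]])
  have "frechet_derivative (\<lambda>x. Re (tensor P n x)) (at x) = (\<lambda>h. Re (\<Sum>c\<in>Basis. (h \<bullet> c) *\<^sub>R tensor P (n(c := Suc (n c))) x))"
    using frechet_derivative_at[OF d] by simp
  then show "partial_deriv c (\<lambda>x. Re (tensor P n x)) x = Re (tensor P (n(c := Suc (n c))) x)"
    using c by (simp add: partial_deriv_def inner_Basis if_distrib if_distribR cong: if_cong)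
qed

lemma iter_partial_Re_tensor:
  assumes P: "\<forall>b\<in>Basis. deriv_seq (P b)" and "set bs \<subseteq> Basis"
  shows "iter_partial bs (\<lambda>x. Re (tensor P (\<lambda>_. 0) x)) = (\<lambda>x. Re (tensor P (count_list bs) x))"
  using assms(2)
proof (induction bs)
  case (Cons c bs)
  have "(count_list bs)(c := Suc (count_list bs c)) = count_list (c # bs)" by auto
  then show ?case using Cons partial_deriv_Re_tensor[OF P, of c "count_list bs"]
    by (simp del: count_list.simps)
next
  case Nil
  have "count_list [] = (\<lambda>_::'a. 0)" by auto
  then show ?case by simp
qed

lemma smooth_Re_tensor:
  assumes P: "\<forall>b\<in>Basis. deriv_seq (P b)"
  shows "smooth (\<lambda>x. Re (tensor P (\<lambda>_. 0) x))"
  unfolding smooth_def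
proof (intro allI impI)
  fix bs :: "'a list" and x assume "set bs \<subseteq> Basis"
  then show "iter_partial bs (\<lambda>x. Re (tensor P (\<lambda>_. 0) x)) differentiable (at x)"
    using bounded_linear.has_derivative[OF bounded_linear_Re tensor_deriv[OF P]]
    by (auto simp: iter_partial_Re_tensor[OF P] differentiable_def)
qed

definition single :: "'a \<Rightarrow> nat \<Rightarrow> 'a \<Rightarrow> nat" where
  "single c l = (\<lambda>b. if b = c then l else 0)"

lemma count_list_replicate_single: "count_list (replicate l c) = single c l"
  by (induction l) (auto simp: single_def fun_eq_iff)

definition test_seqs :: "('a::euclidean_space \<Rightarrow> nat \<Rightarrow> real \<Rightarrow> complex) \<Rightarrow> 'a \<Rightarrow> 'a \<Rightarrow> bool" where
  "test_seqs P lo hi \<longleftrightarrow> (\<forall>b\<in>Basis. deriv_seq (P b) \<and> lo \<bullet> b < hi \<bullet> b \<and> (\<forall>s. P b 0 s \<noteq> 0 \<longrightarrow> lo \<bullet> b \<le> s \<and> s \<le> hi \<bullet> b))"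

lemma Re_tensor_test_function:
  assumes P: "test_seqs P lo hi" and sub: "cbox lo hi \<subseteq> \<Omega>"
  shows "(\<lambda>x. Re (tensor P (\<lambda>_. 0) x)) \<in> test_functions \<Omega>"
proof -
  have "x \<in> cbox lo hi" if "tensor P (\<lambda>_. 0) x \<noteq> 0" for x
  proof -
    have "P b 0 (x \<bullet> b) \<noteq> 0" if "b \<in> Basis" for b
      using \<open>tensor P (\<lambda>_. 0) x \<noteq> 0\<close> that by (auto simp: tensor_def)
    then show ?thesis using P by (auto simp: mem_box test_seqs_def)
  qed
  then have "{x. Re (tensor P (\<lambda>_. 0) x) \<noteq> 0} \<subseteq> cbox lo hi" by force
  then have cl: "closure {x. Re (tensor P (\<lambda>_. 0) x) \<noteq> 0} \<subseteq> cbox lo hi" by (rule closure_minimal[OF _ closed_cbox])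
  then have "compact (closure {x. Re (tensor P (\<lambda>_. 0) x) \<noteq> 0})"
    by (meson bounded_cbox bounded_subset closed_closure compact_eq_bounded_closed)
  then show ?thesis using cl sub smooth_Re_tensor[of P] P by (auto simp: test_functions_def test_seqs_def)
qed

section \<open>Weak derivatives tested against products\<close>

text \<open>The open space-time box, with time as a distinguished basis direction \<open>b0\<close>
  of an arbitrary Euclidean space; space and time are then handled by the same coordinatewise
  arguments.\<close>

definition tbox :: "'a::euclidean_space \<Rightarrow> real \<Rightarrow> real \<Rightarrow> 'a set" where
  "tbox b0 R T = {x. \<forall>b\<in>Basis. (if b = b0 then 0 else - R) < x \<bullet> b \<and> x \<bullet> b < (if b = b0 then T else R)}"

lemma tbox_eq_box:
  "tbox b0 R T = box (\<Sum>b\<in>Basis. (if b = b0 then 0 else - R) *\<^sub>R b) (\<Sum>b\<in>Basis. (if b = b0 then T else R) *\<^sub>R b)"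
  unfolding tbox_def box_def by auto

lemma tbox_measurable [measurable]: "tbox b0 R T \<in> sets borel"
  unfolding tbox_eq_box by simp

lemma open_tbox: "open (tbox b0 R T)"
  unfolding tbox_eq_box by (rule open_box)

lemma integrable_times_continuous:
  fixes F :: "'a::euclidean_space \<Rightarrow> complex"
  assumes u: "integrable lborel u" "\<And>x. x \<notin> cube L \<Longrightarrow> u x = 0" and F: "continuous_on UNIV F"
  shows "integrable lborel (\<lambda>x. of_real (u x) * F x)"
proof -
  have "compact (cube L :: 'a set)" unfolding cube_eq_cbox by simp
  then have "bounded (F ` cube L)"
    by (intro compact_imp_bounded compact_continuous_image continuous_on_subset[OF F]) auto
  then obtain B where B: "\<And>x. x \<in> cube L \<Longrightarrow> norm (F x) \<le> B" unfolding bounded_iff by blast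
  have Fm: "F \<in> borel_measurable borel" using F by (rule borel_measurable_continuous_onI)
  have "integrable lborel (\<lambda>x. of_real (u x) * (indicator (cube L) x * F x))"
  proof (rule integrable_times_bounded)
    show "integrable lborel (\<lambda>x. of_real (u x) :: complex)" using u(1) by simp
    show "(\<lambda>x. indicator (cube L) x * F x) \<in> borel_measurable borel" using Fm by simp
    show "norm (indicator (cube L) x * F x) \<le> \<bar>B\<bar>" for x
      using B[of x] by (cases "x \<in> cube L") auto
  qed
  moreover have "of_real (u x) * (indicator (cube L) x * F x) = of_real (u x) * F x" for x
    using u(2)[of x] by (cases "x \<in> cube L") auto
  ultimately show ?thesis by simp
qed

text \<open>A Borel representative that vanishes outside \<open>\<Omega>\<close> turns integrals
  over \<open>\<Omega>\<close> into integrals over the whole space, where substitutions and products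
  with exponentials are carried out.\<close>

definition l2fun :: "'a::euclidean_space set \<Rightarrow> ('a \<Rightarrow> real) \<Rightarrow> bool" where
  "l2fun \<Omega> w \<longleftrightarrow> w \<in> borel_measurable borel \<and> integrable lborel (\<lambda>x. (w x)\<^sup>2) \<and> (\<forall>x. x \<notin> \<Omega> \<longrightarrow> w x = 0)"

lemma l2fun_integrable:
  assumes "l2fun \<Omega> w" "\<Omega> \<subseteq> cube L"
  shows "integrable lborel w"
  using assms by (intro square_integrable_imp_integrable[of w L]) (auto simp: l2fun_def)

lemma l2fun_integrable_times:
  fixes F :: "'a::euclidean_space \<Rightarrow> complex"
  assumes "l2fun \<Omega> w" "\<Omega> \<subseteq> cube L" "continuous_on UNIV F"
  shows "integrable lborel (\<lambda>x. of_real (w x) * F x)"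
  using assms by (intro integrable_times_continuous[of w L] l2fun_integrable) (auto simp: l2fun_def)

lemma l2fun_times:
  assumes w: "l2fun \<Omega> w" and sub: "\<Omega> \<subseteq> cube L" and f: "continuous_on UNIV f"
  shows "l2fun \<Omega> (\<lambda>x. w x * f x)"
proof -
  have "compact (cube L :: 'a set)" unfolding cube_eq_cbox by simp
  then have "bounded (f ` cube L)"
    by (intro compact_imp_bounded compact_continuous_image continuous_on_subset[OF f]) auto
  then obtain B where B: "\<And>x. x \<in> cube L \<Longrightarrow> \<bar>f x\<bar> \<le> B" unfolding bounded_iff by auto
  have fm: "f \<in> borel_measurable borel" using f by (rule borel_measurable_continuous_onI)
  have wm: "w \<in> borel_measurable borel" using w by (simp add: l2fun_def)
  have "integrable lborel (\<lambda>x. (w x * f x)\<^sup>2)"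
  proof (rule Bochner_Integration.integrable_bound)
    show "integrable lborel (\<lambda>x. B\<^sup>2 * (w x)\<^sup>2)" using w by (auto simp: l2fun_def)
    show "(\<lambda>x. (w x * f x)\<^sup>2) \<in> borel_measurable lborel" using wm fm by simp
    have "(w x * f x)\<^sup>2 \<le> B\<^sup>2 * (w x)\<^sup>2" for x
    proof (cases "x \<in> \<Omega>")
      case True
      then have "\<bar>f x\<bar> \<le> B" using sub B by auto
      then have "(f x)\<^sup>2 \<le> B\<^sup>2" by (metis abs_ge_zero power2_abs power_mono)
      then have "(f x)\<^sup>2 * (w x)\<^sup>2 \<le> B\<^sup>2 * (w x)\<^sup>2" by (intro mult_right_mono) auto
      then show ?thesis by (simp add: power_mult_distrib mult.commute)
    qed (use w in \<open>simp add: l2fun_def\<close>)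
    then show "AE x in lborel. norm ((w x * f x)\<^sup>2) \<le> norm (B\<^sup>2 * (w x)\<^sup>2)" by (intro AE_I2) simp
  qed
  then show ?thesis using w wm fm by (auto simp: l2fun_def)
qed

text \<open>The weak derivative of order \<open>l\<close> in the single direction \<open>c\<close>,
  tested with complex products. Cut-off exponentials are of this form, and pure derivatives suffice
  for the decay of the coefficients.\<close>

definition weak_identity :: "'a::euclidean_space set \<Rightarrow> ('a \<Rightarrow> real) \<Rightarrow> 'a \<Rightarrow> nat \<Rightarrow> ('a \<Rightarrow> real) \<Rightarrow> bool" where
  "weak_identity \<Omega> u c l v \<longleftrightarrow> (\<forall>P lo hi. test_seqs P lo hi \<and> cbox lo hi \<subseteq> \<Omega> \<longrightarrow>
     (LINT x|lborel. of_real (u x) * tensor P (single c l) x) = (- 1) ^ l * (LINT x|lborel. of_real (v x) * tensor P (\<lambda>_. 0) x))"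

definition pure_weak :: "nat \<Rightarrow> 'a::euclidean_space set \<Rightarrow> ('a \<Rightarrow> real) \<Rightarrow> bool" where
  "pure_weak k \<Omega> u \<longleftrightarrow> l2fun \<Omega> u \<and> (\<forall>c\<in>Basis. \<forall>l\<le>k. \<exists>v. l2fun \<Omega> v \<and> weak_identity \<Omega> u c l v)"

lemma lebesgue_on_integral_eq_lborel:
  fixes f :: "'a::euclidean_space \<Rightarrow> real"
  assumes \<Omega>: "\<Omega> \<in> sets borel" and f: "g \<in> borel_measurable borel"
    and AE: "AE x in lebesgue. indicator \<Omega> x * f x = g x" and fm: "f \<in> borel_measurable (lebesgue_on \<Omega>)"
  shows "(LINT x|lebesgue_on \<Omega>. f x) = (LINT x|lborel. g x)"
    and "integrable (lebesgue_on \<Omega>) f \<longleftrightarrow> integrable lborel g"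
proof -
  have \<Omega>': "\<Omega> \<inter> space lebesgue \<in> sets lebesgue" using \<Omega> by simp
  have fm': "(\<lambda>x. indicator \<Omega> x * f x) \<in> borel_measurable lebesgue"
    using fm borel_measurable_restrict_space_iff[OF \<Omega>', of f] by (simp add: mult.commute)
  have gm: "g \<in> borel_measurable lebesgue" using f by (simp add: measurable_completion)
  have "(LINT x|lebesgue_on \<Omega>. f x) = (LINT x|lebesgue. indicator \<Omega> x * f x)"
    using integral_restrict_space[OF \<Omega>', of f] by simp
  also have "\<dots> = (LINT x|lebesgue. g x)" by (rule integral_cong_AE[OF fm' gm AE])
  also have "\<dots> = (LINT x|lborel. g x)" using f by (intro integral_completion) simp
  finally show "(LINT x|lebesgue_on \<Omega>. f x) = (LINT x|lborel. g x)" .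
  have "integrable (lebesgue_on \<Omega>) f \<longleftrightarrow> integrable lebesgue (\<lambda>x. indicator \<Omega> x * f x)"
    using integrable_restrict_space[OF \<Omega>', of f] by simp
  also have "\<dots> \<longleftrightarrow> integrable lebesgue g" by (rule integrable_cong_AE[OF fm' gm AE])
  also have "\<dots> \<longleftrightarrow> integrable lborel g" using f by (intro integrable_completion) simp
  finally show "integrable (lebesgue_on \<Omega>) f \<longleftrightarrow> integrable lborel g" .
qed

lemma square_integrable_borel_version:
  fixes v :: "'a::euclidean_space \<Rightarrow> real"
  assumes \<Omega>: "\<Omega> \<in> sets borel" and v: "v square_integrable_on \<Omega>"
  obtains v' where "l2fun \<Omega> v'" "AE x in lebesgue. indicator \<Omega> x * v x = v' x"
proof -
  have \<Omega>': "\<Omega> \<inter> space lebesgue \<in> sets lebesgue" using \<Omega> by simp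
  have vm: "v \<in> borel_measurable (lebesgue_on \<Omega>)" and v2: "integrable (lebesgue_on \<Omega>) (\<lambda>x. (v x)\<^sup>2)"
    using v by (auto simp: square_integrable_on_def)
  have "(\<lambda>x. indicator \<Omega> x * v x) \<in> borel_measurable lebesgue"
    using vm borel_measurable_restrict_space_iff[OF \<Omega>', of v] by (simp add: mult.commute)
  then obtain v0 where v0: "v0 \<in> borel_measurable lborel" "AE x in lborel. indicator \<Omega> x * v x = v0 x"
    using completion_ex_borel_measurable_real by blast
  define v' where "v' x = indicator \<Omega> x * v0 x" for x
  have v'm: "v' \<in> borel_measurable borel" using v0(1) \<Omega> by (simp add: v'_def[abs_def])
  have "AE x in lebesgue. indicator \<Omega> x * v x = v0 x" using v0(2) by (rule AE_completion)
  then have AE: "AE x in lebesgue. indicator \<Omega> x * v x = v' x"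
    by eventually_elim (auto simp: v'_def indicator_def)
  then have "AE x in lebesgue. indicator \<Omega> x * (v x)\<^sup>2 = (v' x)\<^sup>2"
    by eventually_elim (auto simp: power2_eq_square indicator_def split: if_splits)
  then have "integrable lborel (\<lambda>x. (v' x)\<^sup>2)"
    using lebesgue_on_integral_eq_lborel(2)[OF \<Omega>, of "\<lambda>x. (v' x)\<^sup>2" "\<lambda>x. (v x)\<^sup>2"] v'm vm v2 by simp
  then show ?thesis using v'm AE by (intro that) (auto simp: l2fun_def v'_def)
qed

text \<open>Weak derivatives are defined through real test functions. The real part of a tensor is
  one, and the imaginary part of the identity follows on multiplying one factor by -i. Continuity of
  \<open>g\<close> makes its extension by 0 Borel measurable.\<close>

lemma sobolev_H_pure_weak:
  fixes g :: "'a::euclidean_space \<Rightarrow> real"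
  assumes g: "g \<in> sobolev_H k \<Omega>" and \<Omega>: "open \<Omega>" "\<Omega> \<subseteq> cube L" and cont: "continuous_on \<Omega> g"
  shows "pure_weak k \<Omega> (\<lambda>x. indicator \<Omega> x * g x)"
proof -
  have \<Omega>b: "\<Omega> \<in> sets borel" using \<Omega>(1) by simp
  define u where "u x = indicator \<Omega> x * g x" for x
  have um: "u \<in> borel_measurable borel"
    using borel_measurable_continuous_on_indicator[OF \<Omega>b cont] by (simp add: u_def[abs_def])
  have gs: "g square_integrable_on \<Omega>" using g by (simp add: sobolev_H_def)
  then have gm: "g \<in> borel_measurable (lebesgue_on \<Omega>)" and g2: "integrable (lebesgue_on \<Omega>) (\<lambda>x. (g x)\<^sup>2)"
    by (auto simp: square_integrable_on_def)
  have "indicator \<Omega> x * (g x)\<^sup>2 = (u x)\<^sup>2" for x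
    by (cases "x \<in> \<Omega>") (simp_all add: u_def)
  then have AEu: "AE x in lebesgue. indicator \<Omega> x * (g x)\<^sup>2 = (u x)\<^sup>2" by simp
  have sqm: "(\<lambda>x. (u x)\<^sup>2) \<in> borel_measurable borel" "(\<lambda>x. (g x)\<^sup>2) \<in> borel_measurable (lebesgue_on \<Omega>)"
    using um gm by simp_all
  have "integrable lborel (\<lambda>x. (u x)\<^sup>2)"
    by (rule lebesgue_on_integral_eq_lborel(2)[THEN iffD1, OF \<Omega>b sqm(1) AEu sqm(2) g2])
  moreover have "u x = 0" if "x \<notin> \<Omega>" for x using that by (simp add: u_def)
  ultimately have ul: "l2fun \<Omega> u" using um by (simp add: l2fun_def)
  have "\<exists>v. l2fun \<Omega> v \<and> weak_identity \<Omega> u c l v" if c: "c \<in> Basis" and l: "l \<le> k" for c l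
  proof -
    have "set (replicate l c) \<subseteq> Basis \<and> length (replicate l c) \<le> k" using c l by auto
    then obtain v where v: "v square_integrable_on \<Omega>" "has_weak_deriv g (replicate l c) v \<Omega>"
      using g unfolding sobolev_H_def by blast
    obtain v' where v': "l2fun \<Omega> v'" "AE x in lebesgue. indicator \<Omega> x * v x = v' x"
      using square_integrable_borel_version[OF \<Omega>b v(1)] by blast
    have vm: "v \<in> borel_measurable (lebesgue_on \<Omega>)" using v(1) by (simp add: square_integrable_on_def)
    have v'm: "v' \<in> borel_measurable borel" using v'(1) by (simp add: l2fun_def)
    have ti: "integrable lborel (\<lambda>x. of_real (w x) * tensor P n x)" if "test_seqs P lo hi" "l2fun \<Omega> w" for P lo hi n w
      using that by (intro l2fun_integrable_times[OF that(2) \<Omega>(2)] tensor_continuous) (auto simp: test_seqs_def)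
    have re: "Re (LINT x|lborel. of_real (u x) * tensor P (single c l) x)
      = Re ((- 1) ^ l * (LINT x|lborel. of_real (v' x) * tensor P (\<lambda>_. 0) x))"
      if P: "test_seqs P lo hi" and sub: "cbox lo hi \<subseteq> \<Omega>" for P lo hi
    proof -
      have Pd: "\<forall>b\<in>Basis. deriv_seq (P b)" using P by (simp add: test_seqs_def)
      have tm: "(\<lambda>x. Re (tensor P n x)) \<in> borel_measurable borel" for n
        by (intro borel_measurable_continuous_onI continuous_on_Re tensor_continuous Pd)
      then have tm': "(\<lambda>x. Re (tensor P n x)) \<in> borel_measurable (lebesgue_on \<Omega>)" for n
        by (intro measurable_restrict_space1 measurable_completion) simp
      have "(LINT x|lebesgue_on \<Omega>. g x * iter_partial (replicate l c) (\<lambda>x. Re (tensor P (\<lambda>_. 0) x)) x)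
        = (- 1) ^ l * (LINT x|lebesgue_on \<Omega>. v x * Re (tensor P (\<lambda>_. 0) x))"
        using v(2) Re_tensor_test_function[OF P sub] unfolding has_weak_deriv_def by auto
      moreover have "iter_partial (replicate l c) (\<lambda>x. Re (tensor P (\<lambda>_. 0) x)) = (\<lambda>x. Re (tensor P (single c l) x))"
        using c by (subst iter_partial_Re_tensor[OF Pd]) (auto simp: count_list_replicate_single)
      moreover have "(LINT x|lebesgue_on \<Omega>. g x * Re (tensor P (single c l) x)) = (LINT x|lborel. u x * Re (tensor P (single c l) x))"
      proof (rule lebesgue_on_integral_eq_lborel(1)[OF \<Omega>b])
        show "AE x in lebesgue. indicator \<Omega> x * (g x * Re (tensor P (single c l) x)) = u x * Re (tensor P (single c l) x)"
          by (intro AE_I2) (simp add: u_def)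
      qed (use um tm gm tm' in auto)
      moreover have "(LINT x|lebesgue_on \<Omega>. v x * Re (tensor P (\<lambda>_. 0) x)) = (LINT x|lborel. v' x * Re (tensor P (\<lambda>_. 0) x))"
      proof (rule lebesgue_on_integral_eq_lborel(1)[OF \<Omega>b])
        show "AE x in lebesgue. indicator \<Omega> x * (v x * Re (tensor P (\<lambda>_. 0) x)) = v' x * Re (tensor P (\<lambda>_. 0) x)"
          using v'(2) by eventually_elim (simp add: mult.assoc[symmetric])
      qed (use v'm tm vm tm' in auto)
      ultimately have "(LINT x|lborel. u x * Re (tensor P (single c l) x)) = (- 1) ^ l * (LINT x|lborel. v' x * Re (tensor P (\<lambda>_. 0) x))"
        by simp
      moreover have "Re (LINT x|lborel. of_real (u x) * tensor P (single c l) x) = (LINT x|lborel. u x * Re (tensor P (single c l) x))"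
        using integral_Re[OF ti[OF P ul]] by simp
      moreover have "Re (LINT x|lborel. of_real (v' x) * tensor P (\<lambda>_. 0) x) = (LINT x|lborel. v' x * Re (tensor P (\<lambda>_. 0) x))"
        using integral_Re[OF ti[OF P v'(1)]] by simp
      moreover have "Re ((- 1) ^ l * z) = (- 1) ^ l * Re z" for z by (cases "even l") auto
      ultimately show ?thesis by simp
    qed
    have "weak_identity \<Omega> u c l v'"
      unfolding weak_identity_def
    proof (intro allI impI, elim conjE)
      fix P lo hi assume P: "test_seqs P lo hi" and sub: "cbox lo hi \<subseteq> \<Omega>"
      \<comment> \<open>Only the factor in direction \<open>c\<close> is changed, so the product
        picks up \<open>- \<i>\<close> exactly once, and
        \<open>Re (- \<i> * z) = Im z\<close>.\<close>
      define P' where "P' b = (if b = c then (\<lambda>i s. - \<i> * P b i s) else P b)" for b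
      have tP': "tensor P' n x = - \<i> * tensor P n x" for n x
      proof -
        have "tensor P' n x = (\<Prod>b\<in>Basis. (if b = c then - \<i> else 1) * P b (n b) (x \<bullet> b))"
          unfolding tensor_def P'_def by (intro prod.cong) auto
        then show ?thesis using c by (simp add: prod.distrib tensor_def)
      qed
      have P': "test_seqs P' lo hi"
      proof -
        have "deriv_seq (P' b)" if "b \<in> Basis" for b
        proof -
          have "deriv_seq (P b)" using P that by (simp add: test_seqs_def)
          then show ?thesis using deriv_seq_cmult[of "P b" "- \<i>"] by (cases "b = c") (simp_all add: P'_def)
        qed
        moreover have "P' b 0 s \<noteq> 0 \<longleftrightarrow> P b 0 s \<noteq> 0" for b s by (simp add: P'_def)
        ultimately show ?thesis using P by (simp add: test_seqs_def)
      qed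
      have m: "(LINT x|lborel. of_real (w x) * tensor P' n x) = - \<i> * (LINT x|lborel. of_real (w x) * tensor P n x)" for w n
      proof -
        have "(\<lambda>x. of_real (w x) * tensor P' n x) = (\<lambda>x. - \<i> * (of_real (w x) * tensor P n x))" by (simp add: tP' mult_ac)
        then show ?thesis by (simp only: integral_mult_right_zero)
      qed
      show "(LINT x|lborel. of_real (u x) * tensor P (single c l) x) = (- 1) ^ l * (LINT x|lborel. of_real (v' x) * tensor P (\<lambda>_. 0) x)"
      proof (rule complex_eqI[OF re[OF P sub]])
        show "Im (LINT x|lborel. of_real (u x) * tensor P (single c l) x)
          = Im ((- 1) ^ l * (LINT x|lborel. of_real (v' x) * tensor P (\<lambda>_. 0) x))"
          using re[OF P' sub] unfolding m by (cases "even l") auto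
      qed
    qed
    then show ?thesis using v'(1) by blast
  qed
  then show ?thesis unfolding pure_weak_def using ul by (simp add: u_def[abs_def])
qed

lemma tensor_upd_other:
  assumes "c \<in> Basis"
  shows "tensor P (single c l) x = P c l (x \<bullet> c) * (\<Prod>b\<in>Basis - {c}. P b 0 (x \<bullet> b))"
proof -
  have "tensor P (single c l) x = P c (single c l c) (x \<bullet> c) * (\<Prod>b\<in>Basis - {c}. P b (single c l b) (x \<bullet> b))"
    unfolding tensor_def using assms by (subst prod.remove[of _ c]) auto
  also have "(\<Prod>b\<in>Basis - {c}. P b (single c l b) (x \<bullet> b)) = (\<Prod>b\<in>Basis - {c}. P b 0 (x \<bullet> b))"
    by (intro prod.cong) (auto simp: single_def)
  finally show ?thesis by (simp add: single_def)
qed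

lemma deriv_seq_bounded:
  assumes "deriv_seq P"
  shows "\<exists>B\<ge>0. \<forall>s\<in>{a..b}. norm (P i s) \<le> B"
proof -
  have "bounded (P i ` {a..b})"
    by (intro compact_imp_bounded compact_continuous_image deriv_seq_continuous assms) simp
  then obtain B where "\<And>s. s \<in> {a..b} \<Longrightarrow> norm (P i s) \<le> B" unfolding bounded_iff by blast
  then show ?thesis by (intro exI[of _ "\<bar>B\<bar>"]) force
qed

text \<open>Taylor's estimate by repeated use of the mean value inequality. All orders
  \<open>l - i\<close> are covered at once, because a Leibniz sum needs each of them with its own
  power of \<open>s\<close>.\<close>

lemma deriv_seq_vanishing_bound:
  fixes P :: "nat \<Rightarrow> real \<Rightarrow> 'b::real_normed_vector"
  assumes P: "deriv_seq P" and z: "\<And>i. i < l \<Longrightarrow> P i 0 = 0"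
  shows "\<exists>C\<ge>0. \<forall>i\<le>l. \<forall>s\<in>{0..T}. norm (P (l - i) s) \<le> C * s ^ i"
proof -
  obtain C where C: "C \<ge> 0" "\<And>s. s \<in> {0..T} \<Longrightarrow> norm (P l s) \<le> C"
    using deriv_seq_bounded[OF P, of 0 T l] by blast
  have "norm (P (l - i) s) \<le> C * s ^ i" if "i \<le> l" "s \<in> {0..T}" for i s
    using that
  proof (induction i arbitrary: s)
    case (Suc i)
    have eq: "Suc (l - Suc i) = l - i" using Suc.prems by simp
    have "norm (P (l - Suc i) s - P (l - Suc i) 0) \<le> C * s ^ i * norm (s - 0)"
    proof (rule differentiable_bound[of "{0..s}" "P (l - Suc i)" "\<lambda>r h. h *\<^sub>R P (l - i) r"])
      show "convex {0..s}" by simp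
      show "(P (l - Suc i) has_derivative (\<lambda>h. h *\<^sub>R P (l - i) r)) (at r within {0..s})" for r
        using has_vector_derivative_at_within[OF deriv_seqD[OF P, of "l - Suc i" r]]
        by (simp add: has_vector_derivative_def eq)
      show "onorm (\<lambda>h. h *\<^sub>R P (l - i) r) \<le> C * s ^ i" if r: "r \<in> {0..s}" for r
      proof (rule onorm_le)
        fix h
        have "norm (P (l - i) r) \<le> C * r ^ i" using Suc r by (intro Suc.IH) auto
        also have "\<dots> \<le> C * s ^ i" using C r by (intro mult_left_mono power_mono) auto
        finally show "norm (h *\<^sub>R P (l - i) r) \<le> C * s ^ i * norm h"
          by (simp add: mult.commute mult_left_mono)
      qed
    qed (use Suc.prems in auto)
    then show ?case using z[of "l - Suc i"] Suc.prems by (simp add: mult_ac)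
  qed (use C in simp)
  then show ?thesis using C(1) by blast
qed

text \<open>The test functions may be nonzero on the face \<open>x \<bullet> b0 = 0\<close>: they are multiplied by
  \<open>\<theta>(n (x \<bullet> b0))\<close> and \<open>n \<rightarrow> \<infinity>\<close>. The derivatives of this factor grow like \<open>n ^ i\<close>
  on \<open>x \<bullet> b0 \<le> 2 / n\<close>, which the vanishing of \<open>P b0\<close> compensates.\<close>

lemma weak_identity_boundary:
  fixes P :: "'a::euclidean_space \<Rightarrow> nat \<Rightarrow> real \<Rightarrow> complex"
  assumes wi: "weak_identity (tbox b0 R T) u c l v" and u: "l2fun (tbox b0 R T) u" and v: "l2fun (tbox b0 R T) v"
    and sub: "tbox b0 R T \<subseteq> cube L" and b0: "b0 \<in> Basis" and c: "c \<in> Basis"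
    and P: "\<forall>b\<in>Basis. deriv_seq (P b)"
    and R1: "0 < R1" "R1 < R" "\<And>b s. b \<in> Basis \<Longrightarrow> b \<noteq> b0 \<Longrightarrow> P b 0 s \<noteq> 0 \<Longrightarrow> \<bar>s\<bar> \<le> R1"
    and T1: "0 < T1" "T1 < T" "\<And>s. P b0 0 s \<noteq> 0 \<Longrightarrow> s \<le> T1"
    and van: "c = b0 \<Longrightarrow> \<exists>C\<ge>0. \<forall>i\<le>l. \<forall>s\<in>{0..T}. norm (P b0 (l - i) s) \<le> C * s ^ i"
  shows "(LINT x|lborel. of_real (u x) * tensor P (single c l) x) = (- 1) ^ l * (LINT x|lborel. of_real (v x) * tensor P (\<lambda>_. 0) x)"
proof -
  let ?\<Omega> = "tbox b0 R T"
  obtain \<theta> where \<theta>: "deriv_seq \<theta>" "\<And>s. s \<le> 1 \<Longrightarrow> \<theta> 0 s = (0::real)" "\<And>s. s \<ge> 2 \<Longrightarrow> \<theta> 0 s = 1" "\<And>s. 0 \<le> \<theta> 0 s \<and> \<theta> 0 s \<le> 1"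
    using smooth_step_exists[of 1 2] by auto
  have th2: "\<theta> i s = (if i = 0 then 1 else 0)" if "s > 2" for i s
  proof -
    have "deriv_seq (\<lambda>i s. \<theta> i s - (if i = 0 then 1 else 0))"
      unfolding deriv_seq_def
    proof (intro allI)
      fix i s
      have "((\<lambda>s. \<theta> i s - (if i = 0 then 1 else 0)) has_vector_derivative \<theta> (Suc i) s - 0) (at s)"
        by (intro has_vector_derivative_diff deriv_seqD \<theta>(1) has_vector_derivative_const)
      then show "((\<lambda>s. \<theta> i s - (if i = 0 then 1 else 0)) has_vector_derivative \<theta> (Suc i) s - (if Suc i = 0 then 1 else 0)) (at s)"
        by simp
    qed
    from deriv_seq_zero_outside[OF this, of "{2<..}" s i] show ?thesis using \<theta>(3) that by auto
  qed
  \<comment> \<open>With \<open>y = n * s\<close> this bounds \<open>s ^ i\<close> times the i-th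
    derivative of the rescaled step independently of \<open>n\<close>. Beyond 2 the step is
    constant, so only \<open>i = 0\<close> contributes there.\<close>
  have "\<exists>B\<ge>1. \<forall>y\<ge>0. \<bar>y ^ i * \<theta> i y\<bar> \<le> B" for i
  proof -
    obtain B where B: "B \<ge> 0" "\<And>y. y \<in> {0..2} \<Longrightarrow> \<bar>\<theta> i y\<bar> \<le> B"
      using deriv_seq_bounded[OF \<theta>(1), of 0 2 i] by auto
    have "\<bar>y ^ i * \<theta> i y\<bar> \<le> 2 ^ i * B + 1" if y: "y \<ge> 0" for y
    proof (cases "y \<le> 2")
      case True
      then have "\<bar>y ^ i * \<theta> i y\<bar> \<le> 2 ^ i * B"
        unfolding abs_mult using y B by (intro mult_mono) (auto simp: power_mono)
      then show ?thesis by simp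
    next
      case False
      then show ?thesis using th2[of y i] B by auto
    qed
    then show ?thesis using B(1) by (intro exI[of _ "2 ^ i * B + 1"]) auto
  qed
  then obtain Bt where Bt: "\<And>i. Bt i \<ge> 1" "\<And>i y. y \<ge> 0 \<Longrightarrow> \<bar>y ^ i * \<theta> i y\<bar> \<le> Bt i" by metis
  define E where "E n = (\<lambda>i s. of_real (n ^ i *\<^sub>R \<theta> i (n * s + 0)) :: complex)" for n :: real
  have E: "deriv_seq (E n)" for n unfolding E_def by (intro deriv_seq_of_real deriv_seq_affine \<theta>(1))
  define Q where "Q n b = (if b = b0 then seq_mult (P b0) (E n) else P b)" for n b
  have Q: "\<forall>b\<in>Basis. deriv_seq (Q n b)" for n
    using P E b0 by (auto simp: Q_def intro!: deriv_seq_mult)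
  have lim: "E n i s = (if i = 0 then 1 else 0)" if "s > 0" "n > 2 / s" for n i s
  proof -
    have "n * s > 2" using that by (simp add: field_simps)
    then show ?thesis using th2[of "n * s" i] by (auto simp: E_def)
  qed
  have Qlim: "Q n b i s = P b i s" if "b = b0 \<Longrightarrow> s > 0 \<and> n > 2 / s" for n b i s
  proof (cases "b = b0")
    case True
    have "Q n b i s = (\<Sum>a\<le>i. of_nat (i choose a) * (P b0 a s * (if a = i then 1 else 0)))"
      unfolding Q_def True seq_mult_def using that[OF True] lim by (simp cong: sum.cong) (intro sum.cong, auto)
    also have "\<dots> = P b i s" by (simp add: True if_distrib cong: if_cong)
    finally show ?thesis .
  qed (simp add: Q_def)
  \<comment> \<open>At a point of positive time the factor is 1 and its derivatives vanish once
    \<open>n\<close> is large, so the tensors become equal to the limit.\<close>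
  have tlim: "eventually (\<lambda>n. tensor (Q (real n)) m x = tensor P m x) sequentially" if x: "x \<in> ?\<Omega>" for x m
  proof -
    have s: "x \<bullet> b0 > 0" using x b0 by (auto simp: tbox_def)
    obtain n0 :: nat where "real n0 > 2 / (x \<bullet> b0)" using reals_Archimedean2 by blast
    then have "tensor (Q (real n)) m x = tensor P m x" if "n \<ge> n0" for n
      unfolding tensor_def using that s by (intro prod.cong refl Qlim) (auto intro: less_le_trans)
    then show ?thesis by (auto simp: eventually_sequentially)
  qed
  \<comment> \<open>The identity involves order 0 in all directions and order \<open>l\<close> in
    direction \<open>c\<close>. In direction \<open>b0\<close> every Leibniz term pairs the growth
    \<open>n ^ i\<close> of the factor with the decay \<open>s ^ i\<close> of the corresponding
    derivative of \<open>P b0\<close>.\<close>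
  have bnd: "\<exists>B\<ge>0. \<forall>n>0. \<forall>s\<in>{(if b = b0 then 0 else - R)..(if b = b0 then T else R)}. norm (Q n b j s) \<le> B"
    if b: "b \<in> Basis" and j: "j = 0 \<or> (b = c \<and> j = l)" for b j
  proof (cases "b = b0")
    case False
    then show ?thesis using deriv_seq_bounded[of "P b" "- R" R j] P b by (auto simp: Q_def)
  next
    case True
    have "\<exists>C\<ge>0. \<forall>i\<le>j. \<forall>s\<in>{0..T}. norm (P b0 (j - i) s) \<le> C * s ^ i"
    proof (cases "j = 0")
      case True
      then show ?thesis using deriv_seq_bounded[of "P b0" 0 T 0] P b0 by auto
    qed (use j van True in auto)
    then obtain C where C: "C \<ge> 0" "\<And>i s. i \<le> j \<Longrightarrow> s \<in> {0..T} \<Longrightarrow> norm (P b0 (j - i) s) \<le> C * s ^ i" by blast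
    have "norm (Q n b j s) \<le> (\<Sum>a\<le>j. (j choose a) * (C * Bt (j - a)))" if n: "n > 0" and s: "s \<in> {0..T}" for n s
    proof -
      have "norm (Q n b j s) \<le> (\<Sum>a\<le>j. norm (of_nat (j choose a) * (P b0 a s * E n (j - a) s)))"
        unfolding Q_def seq_mult_def using True by (simp add: norm_sum)
      also have "\<dots> \<le> (\<Sum>a\<le>j. (j choose a) * (C * Bt (j - a)))"
      proof (intro sum_mono)
        fix a assume a: "a \<in> {..j}"
        have 1: "norm (P b0 a s) \<le> C * s ^ (j - a)" using C(2)[of "j - a" s] a s by simp
        have 2: "s ^ (j - a) * norm (E n (j - a) s) = \<bar>(n * s) ^ (j - a) * \<theta> (j - a) (n * s)\<bar>"
          using n s by (simp add: E_def abs_mult power_mult_distrib norm_mult norm_power)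
        have "norm (P b0 a s) * norm (E n (j - a) s) \<le> C * s ^ (j - a) * norm (E n (j - a) s)"
          using 1 by (intro mult_right_mono) auto
        also have "\<dots> = C * (s ^ (j - a) * norm (E n (j - a) s))" by simp
        also have "\<dots> \<le> C * Bt (j - a)"
          unfolding 2 using C n s by (intro mult_left_mono Bt(2)) auto
        finally have "real (j choose a) * (norm (P b0 a s) * norm (E n (j - a) s)) \<le> real (j choose a) * (C * Bt (j - a))"
          by (intro mult_left_mono) auto
        then show "norm (of_nat (j choose a) * (P b0 a s * E n (j - a) s)) \<le> (j choose a) * (C * Bt (j - a))"
          by (simp add: norm_mult)
      qed
      finally show ?thesis .
    qed
    moreover have "0 \<le> (\<Sum>a\<le>j. (j choose a) * (C * Bt (j - a)))"
      using C Bt(1) by (intro sum_nonneg mult_nonneg_nonneg) (auto intro: order_trans[OF zero_le_one])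
    ultimately show ?thesis using True by auto
  qed
  have tbnd: "\<exists>B\<ge>0. \<forall>n>0. \<forall>x\<in>?\<Omega>. norm (tensor (Q n) m x) \<le> B" if m: "m = (\<lambda>_. 0) \<or> m = single c l" for m
  proof -
    have "\<exists>B\<ge>0. \<forall>n>0. \<forall>s\<in>{(if b = b0 then 0 else - R)..(if b = b0 then T else R)}. norm (Q n b (m b) s) \<le> B" if "b \<in> Basis" for b
    proof (rule bnd[OF that])
      show "m b = 0 \<or> (b = c \<and> m b = l)" using m by (auto simp: single_def split: if_splits)
    qed
    then have "\<exists>B. \<forall>b\<in>Basis. 0 \<le> B b \<and> (\<forall>n>0. \<forall>s\<in>{(if b = b0 then 0 else - R)..(if b = b0 then T else R)}. norm (Q n b (m b) s) \<le> B b)"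
      by (intro bchoice ballI)
    then obtain B where B: "\<And>b. b \<in> Basis \<Longrightarrow> B b \<ge> 0"
      "\<And>b n s. b \<in> Basis \<Longrightarrow> n > 0 \<Longrightarrow> s \<in> {(if b = b0 then 0 else - R)..(if b = b0 then T else R)} \<Longrightarrow> norm (Q n b (m b) s) \<le> B b"
      by blast
    have "norm (tensor (Q n) m x) \<le> (\<Prod>b\<in>Basis. B b)" if "n > 0" "x \<in> ?\<Omega>" for n x
      unfolding tensor_def prod_norm[symmetric]
    proof (intro prod_mono conjI norm_ge_zero)
      fix b :: 'a assume b: "b \<in> Basis"
      show "norm (Q n b (m b) (x \<bullet> b)) \<le> B b"
        by (rule B(2)[OF b that(1)]) (use that(2) b in \<open>auto simp: tbox_def\<close>)
    qed
    moreover have "0 \<le> (\<Prod>b\<in>(Basis::'a set). B b)" using B(1) by (intro prod_nonneg) auto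
    ultimately show ?thesis by blast
  qed
  have conv: "(\<lambda>n. LINT x|lborel. of_real (w x) * tensor (Q (real (Suc n))) m x) \<longlonglongrightarrow> (LINT x|lborel. of_real (w x) * tensor P m x)"
    if w: "l2fun ?\<Omega> w" and m: "m = (\<lambda>_. 0) \<or> m = single c l" for w m
  proof -
    obtain B where B: "B \<ge> 0" "\<And>n x. n > 0 \<Longrightarrow> x \<in> ?\<Omega> \<Longrightarrow> norm (tensor (Q n) m x) \<le> B" using tbnd[OF m] by blast
    have wm: "w \<in> borel_measurable borel" using w by (simp add: l2fun_def)
    have w0: "w x = 0" if "x \<notin> ?\<Omega>" for x using w that by (simp add: l2fun_def)
    show ?thesis
    proof (rule integral_dominated_convergence[where w = "\<lambda>x. B * \<bar>w x\<bar>"])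
      have "(\<lambda>x. tensor P m x) \<in> borel_measurable borel" "(\<lambda>x. tensor (Q n) m x) \<in> borel_measurable borel" for n
        by (intro borel_measurable_continuous_onI tensor_continuous P Q)+
      then show "(\<lambda>x. of_real (w x) * tensor P m x) \<in> borel_measurable lborel"
        "\<And>n. (\<lambda>x. of_real (w x) * tensor (Q (real (Suc n))) m x) \<in> borel_measurable lborel"
        using wm by simp_all
      show "integrable lborel (\<lambda>x. B * \<bar>w x\<bar>)" using l2fun_integrable[OF w sub] by simp
      show "AE x in lborel. (\<lambda>n. of_real (w x) * tensor (Q (real (Suc n))) m x) \<longlonglongrightarrow> of_real (w x) * tensor P m x"
      proof (intro AE_I2)
        fix x
        show "(\<lambda>n. of_real (w x) * tensor (Q (real (Suc n))) m x) \<longlonglongrightarrow> of_real (w x) * tensor P m x"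
        proof (cases "x \<in> ?\<Omega>")
          case True
          have "eventually (\<lambda>n. of_real (w x) * tensor (Q (real (Suc n))) m x = of_real (w x) * tensor P m x) sequentially"
            using eventually_sequentially_Suc[THEN iffD2, OF tlim[OF True, of m]] by eventually_elim simp
          then show ?thesis by (rule tendsto_eventually)
        qed (simp add: w0)
      qed
      show "\<And>n. AE x in lborel. norm (of_real (w x) * tensor (Q (real (Suc n))) m x) \<le> B * \<bar>w x\<bar>"
      proof (intro AE_I2)
        fix n x
        show "norm (of_real (w x) * tensor (Q (real (Suc n))) m x) \<le> B * \<bar>w x\<bar>"
          using B(2)[of "real (Suc n)" x] w0[of x]
          by (cases "x \<in> ?\<Omega>") (auto simp: norm_mult mult.commute[of B] intro!: mult_left_mono)
      qed
    qed
  qed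
  \<comment> \<open>From here on the interval \<open>[1 / N, T1]\<close>, which carries the test
    function in direction \<open>b0\<close>, is nondegenerate.\<close>
  obtain n0 :: nat where n0: "real n0 > 1 / T1" using reals_Archimedean2 by blast
  have "eventually (\<lambda>n. (LINT x|lborel. of_real (u x) * tensor (Q (real (Suc n))) (single c l) x)
    = (- 1) ^ l * (LINT x|lborel. of_real (v x) * tensor (Q (real (Suc n))) (\<lambda>_. 0) x)) sequentially"
    unfolding eventually_sequentially
  proof (intro exI allI impI)
    fix n assume n: "n0 \<le> n"
    define N where "N = real (Suc n)"
    have N: "N > 0" "1 / N < T1" 
    proof -
      show "N > 0" by (simp add: N_def)
      have "N > 1 / T1" using n n0 by (simp add: N_def)
      then show "1 / N < T1" using \<open>N > 0\<close> T1(1) by (simp add: field_simps)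
    qed
    define lo hi :: 'a where "lo = (\<Sum>b\<in>Basis. (if b = b0 then 1 / N else - R1) *\<^sub>R b)"
      and "hi = (\<Sum>b\<in>Basis. (if b = b0 then T1 else R1) *\<^sub>R b)"
    have lh: "lo \<bullet> b = (if b = b0 then 1 / N else - R1)" "hi \<bullet> b = (if b = b0 then T1 else R1)" if "b \<in> Basis" for b
      using that by (simp_all add: lo_def hi_def)
    have ts: "test_seqs (Q N) lo hi"
      unfolding test_seqs_def
    proof (intro ballI conjI allI impI)
      fix b :: 'a assume b: "b \<in> Basis"
      show "deriv_seq (Q N b)" using Q b by blast
      show "lo \<bullet> b < hi \<bullet> b" using N R1(1) by (simp add: lh[OF b])
      fix s assume nz: "Q N b 0 s \<noteq> 0"
      have "(if b = b0 then 1 / N else - R1) \<le> s \<and> s \<le> (if b = b0 then T1 else R1)"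
      proof (cases "b = b0")
        case True
        then have "P b0 0 s \<noteq> 0" "\<theta> 0 (N * s) \<noteq> 0" using nz by (auto simp: Q_def E_def)
        then have "s \<le> T1" "N * s > 1" using T1(3) \<theta>(2)[of "N * s"] by force+
        then show ?thesis using True N by (simp add: field_simps)
      next
        case False
        then show ?thesis using nz R1(3)[OF b False, of s] by (auto simp: Q_def abs_le_iff)
      qed
      then show "lo \<bullet> b \<le> s" "s \<le> hi \<bullet> b" by (simp_all add: lh[OF b])
    qed
    have cb: "cbox lo hi \<subseteq> ?\<Omega>"
    proof
      fix x assume x: "x \<in> cbox lo hi"
      have "0 < 1 / N" using N by simp
      show "x \<in> ?\<Omega>"
        unfolding tbox_def
      proof (intro CollectI ballI)
        fix b :: 'a assume b: "b \<in> Basis"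
        have "lo \<bullet> b \<le> x \<bullet> b" "x \<bullet> b \<le> hi \<bullet> b" using x b by (auto simp: mem_box)
        then have *: "(if b = b0 then 1 / N else - R1) \<le> x \<bullet> b" "x \<bullet> b \<le> (if b = b0 then T1 else R1)"
          by (simp_all only: lh[OF b])
        show "(if b = b0 then 0 else - R) < x \<bullet> b \<and> x \<bullet> b < (if b = b0 then T else R)"
        proof (cases "b = b0")
          case True
          then have "1 / N \<le> x \<bullet> b" "x \<bullet> b \<le> T1" using * by simp_all
          then show ?thesis using less_le_trans[OF \<open>0 < 1 / N\<close>] True T1(2) by simp
        next
          case False
          then show ?thesis using * R1(2) by simp
        qed
      qed
    qed
    show "(LINT x|lborel. of_real (u x) * tensor (Q (real (Suc n))) (single c l) x)
      = (- 1) ^ l * (LINT x|lborel. of_real (v x) * tensor (Q (real (Suc n))) (\<lambda>_. 0) x)"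
      unfolding N_def[symmetric]
      by (rule mp[OF spec[OF spec[OF spec[OF wi[unfolded weak_identity_def]]]] conjI[OF ts cb]])
  qed
  then have "(\<lambda>n. (- 1) ^ l * (LINT x|lborel. of_real (v x) * tensor (Q (real (Suc n))) (\<lambda>_. 0) x))
    \<longlonglongrightarrow> (LINT x|lborel. of_real (u x) * tensor P (single c l) x)"
    by (intro Lim_transform_eventually[OF conv[OF u, of "single c l"]]) auto
  moreover have "(\<lambda>n. (- 1) ^ l * (LINT x|lborel. of_real (v x) * tensor (Q (real (Suc n))) (\<lambda>_. 0) x))
    \<longlonglongrightarrow> (- 1) ^ l * (LINT x|lborel. of_real (v x) * tensor P (\<lambda>_. 0) x)"
    by (intro tendsto_mult_left conv v) auto
  ultimately show ?thesis by (rule LIMSEQ_unique)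
qed

section \<open>Square-summable coefficients and cutoffs\<close>

definition l2bounded :: "'m set \<Rightarrow> ('m \<Rightarrow> complex) \<Rightarrow> bool" where
  "l2bounded S f \<longleftrightarrow> (\<exists>B. \<forall>F. finite F \<and> F \<subseteq> S \<longrightarrow> (\<Sum>m\<in>F. (cmod (f m))\<^sup>2) \<le> B)"

lemma l2bounded_cong:
  assumes "\<And>m. m \<in> S \<Longrightarrow> f m = g m" "l2bounded S f"
  shows "l2bounded S g"
proof -
  obtain B where B: "\<And>F. finite F \<Longrightarrow> F \<subseteq> S \<Longrightarrow> (\<Sum>m\<in>F. (cmod (f m))\<^sup>2) \<le> B"
    using assms(2) unfolding l2bounded_def by blast
  have "(\<Sum>m\<in>F. (cmod (g m))\<^sup>2) \<le> B" if F: "finite F" "F \<subseteq> S" for F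
  proof -
    have "(\<Sum>m\<in>F. (cmod (g m))\<^sup>2) = (\<Sum>m\<in>F. (cmod (f m))\<^sup>2)"
      using assms(1) F(2) by (intro sum.cong) auto
    then show ?thesis using B[OF F] by simp
  qed
  then show ?thesis unfolding l2bounded_def by blast
qed

lemma l2bounded_add:
  assumes "l2bounded S f" "l2bounded S g"
  shows "l2bounded S (\<lambda>m. f m + g m)"
proof -
  obtain A where A: "\<And>F. finite F \<Longrightarrow> F \<subseteq> S \<Longrightarrow> (\<Sum>m\<in>F. (cmod (f m))\<^sup>2) \<le> A"
    using assms(1) unfolding l2bounded_def by blast
  obtain B where B: "\<And>F. finite F \<Longrightarrow> F \<subseteq> S \<Longrightarrow> (\<Sum>m\<in>F. (cmod (g m))\<^sup>2) \<le> B"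
    using assms(2) unfolding l2bounded_def by blast
  have "(\<Sum>m\<in>F. (cmod (f m + g m))\<^sup>2) \<le> 2 * A + 2 * B" if F: "finite F" "F \<subseteq> S" for F
  proof -
    have "(cmod (f m + g m))\<^sup>2 \<le> 2 * (cmod (f m))\<^sup>2 + 2 * (cmod (g m))\<^sup>2" for m
    proof -
      have "(cmod (f m + g m))\<^sup>2 \<le> (cmod (f m) + cmod (g m))\<^sup>2"
        by (intro power_mono norm_triangle_ineq) simp
      also have "\<dots> \<le> 2 * (cmod (f m))\<^sup>2 + 2 * (cmod (g m))\<^sup>2"
        using sum_squares_bound[of "cmod (f m)" "cmod (g m)"] by (simp add: power2_sum)
      finally show ?thesis .
    qed
    then have "(\<Sum>m\<in>F. (cmod (f m + g m))\<^sup>2) \<le> (\<Sum>m\<in>F. 2 * (cmod (f m))\<^sup>2 + 2 * (cmod (g m))\<^sup>2)"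
      by (intro sum_mono)
    also have "\<dots> \<le> 2 * A + 2 * B"
      using A[OF F] B[OF F] by (simp add: sum.distrib flip: sum_distrib_left)
    finally show ?thesis .
  qed
  then show ?thesis unfolding l2bounded_def by blast
qed

lemma l2bounded_cmult:
  assumes "l2bounded S f"
  shows "l2bounded S (\<lambda>m. c * f m)"
proof -
  obtain A where A: "\<And>F. finite F \<Longrightarrow> F \<subseteq> S \<Longrightarrow> (\<Sum>m\<in>F. (cmod (f m))\<^sup>2) \<le> A"
    using assms unfolding l2bounded_def by blast
  have "(\<Sum>m\<in>F. (cmod (c * f m))\<^sup>2) \<le> (cmod c)\<^sup>2 * A" if "finite F" "F \<subseteq> S" for F
    using mult_left_mono[OF A[OF that], of "(cmod c)\<^sup>2"]
    by (simp add: norm_mult power_mult_distrib sum_distrib_left)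
  then show ?thesis unfolding l2bounded_def by blast
qed

lemma l2bounded_zero: "l2bounded S (\<lambda>_. 0)"
  unfolding l2bounded_def by auto

lemma l2bounded_sum:
  assumes "finite J" "\<And>j. j \<in> J \<Longrightarrow> l2bounded S (f j)"
  shows "l2bounded S (\<lambda>m. \<Sum>j\<in>J. f j m)"
  using assms
proof (induction J rule: finite_induct)
  case (insert j J)
  have "l2bounded S (\<lambda>m. f j m + (\<Sum>j\<in>J. f j m))"
    by (intro l2bounded_add insert.IH insert.prems) auto
  then show ?case using insert.hyps by simp
qed (simp add: l2bounded_zero)

text \<open>In direction \<open>b0\<close> the support is bounded from above only: the cutoff may be
  nonzero at time 0, where the reflection takes over.\<close>

definition cutoffs :: "'a::euclidean_space \<Rightarrow> real \<Rightarrow> real \<Rightarrow> ('a \<Rightarrow> nat \<Rightarrow> real \<Rightarrow> real) \<Rightarrow> bool" where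
  "cutoffs b0 R1 T1 X \<longleftrightarrow> (\<forall>b\<in>Basis. deriv_seq (X b) \<and>
     (\<forall>s. X b 0 s \<noteq> 0 \<longrightarrow> (if b = b0 then s \<le> T1 else \<bar>s\<bar> \<le> R1)))"

definition cut :: "('a::euclidean_space \<Rightarrow> nat \<Rightarrow> real \<Rightarrow> real) \<Rightarrow> 'a \<Rightarrow> real" where
  "cut X x = (\<Prod>b\<in>Basis. X b 0 (x \<bullet> b))"

lemma cut_continuous:
  assumes "cutoffs b0 R1 T1 X"
  shows "continuous_on A (cut X)"
  unfolding cut_def[abs_def]
proof (intro continuous_on_prod)
  fix b :: 'a assume "b \<in> Basis"
  then have "continuous_on UNIV (X b 0)" using assms by (intro deriv_seq_continuous) (simp add: cutoffs_def)
  then show "continuous_on A (\<lambda>x. X b 0 (x \<bullet> b))"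
    by (rule continuous_on_compose2) (auto intro!: continuous_intros)
qed

text \<open>Derivatives of a cutoff factor vanish wherever the factor vanishes on an open set, so a
  recursion by Leibniz' rule stays in this class.\<close>

lemma cutoffs_shift:
  assumes X: "cutoffs b0 R1 T1 X"
  shows "cutoffs b0 R1 T1 (X(c := (\<lambda>i. X c (i + a))))"
  unfolding cutoffs_def
proof (intro ballI conjI allI impI)
  fix b :: 'a assume b: "b \<in> Basis"
  have Xb: "deriv_seq (X b)" using X b by (simp add: cutoffs_def)
  then show "deriv_seq ((X(c := (\<lambda>i. X c (i + a)))) b)" by (auto intro: deriv_seq_shift)
  fix s assume nz: "(X(c := (\<lambda>i. X c (i + a)))) b 0 s \<noteq> 0"
  let ?U = "if b = b0 then {T1<..} else - {- R1..R1}"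
  have "X b i s = 0" if "s \<in> ?U" for i
  proof (rule deriv_seq_zero_outside[OF Xb, of ?U])
    show "open ?U" by (auto intro: open_Compl)
    show "X b 0 s = 0" if "s \<in> ?U" for s
    proof -
      have "X b 0 s \<noteq> 0 \<longrightarrow> (if b = b0 then s \<le> T1 else \<bar>s\<bar> \<le> R1)"
        using X b by (simp add: cutoffs_def)
      then show ?thesis using that by (auto split: if_splits)
    qed
  qed fact
  note zero = this
  show "if b = b0 then s \<le> T1 else \<bar>s\<bar> \<le> R1"
  proof (rule ccontr)
    assume "\<not> (if b = b0 then s \<le> T1 else \<bar>s\<bar> \<le> R1)"
    then have "s \<in> ?U" by (auto split: if_splits)
    then have "X b i s = 0" for i by (rule zero)
    then show False using nz by (auto split: if_splits)
  qed
qed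

text \<open>Leibniz' rule turns the weak identity for the product of the cutoff with \<open>Q m\<close> into a recursion on the
  order \<open>l\<close>: all other terms carry fewer derivatives of \<open>Q m\<close> and another cutoff.\<close>

lemma fourier_l2bounded:
  fixes Q :: "'m \<Rightarrow> 'a::euclidean_space \<Rightarrow> nat \<Rightarrow> real \<Rightarrow> complex"
  assumes u: "pure_weak k (tbox b0 R T) u" and sub: "tbox b0 R T \<subseteq> cube L" and b0: "b0 \<in> Basis" and c: "c \<in> Basis"
    and R1: "0 < R1" "R1 < R" and T1: "0 < T1" "T1 < T"
    and Q: "\<And>m. \<forall>b\<in>Basis. deriv_seq (Q m b)"
    and bessel: "\<And>w. l2fun (tbox b0 R T) w \<Longrightarrow> l2bounded S (\<lambda>m. LINT x|lborel. of_real (w x) * tensor (Q m) (\<lambda>_. 0) x)"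
    and van: "\<And>m i. c = b0 \<Longrightarrow> m \<in> S \<Longrightarrow> i < l \<Longrightarrow> Q m b0 i 0 = 0"
    and "cutoffs b0 R1 T1 X" "l \<le> k"
  shows "l2bounded S (\<lambda>m. LINT x|lborel. of_real (u x * cut X x) * tensor (Q m) (single c l) x)"
  using van \<open>cutoffs b0 R1 T1 X\<close> \<open>l \<le> k\<close>
proof (induction l arbitrary: X rule: less_induct)
  case (less l)
  note X = less.prems(2)
  have ul: "l2fun (tbox b0 R T) u" using u by (simp add: pure_weak_def)
  obtain v where v: "l2fun (tbox b0 R T) v" "weak_identity (tbox b0 R T) u c l v"
    using u c less.prems(3) unfolding pure_weak_def by blast
  define P where "P m b = seq_mult (\<lambda>i s. of_real (X b i s)) (Q m b)" for m b
  have Xd: "deriv_seq (X b)" if "b \<in> Basis" for b using X that by (simp add: cutoffs_def)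
  have P: "\<forall>b\<in>Basis. deriv_seq (P m b)" for m
    unfolding P_def using Q Xd by (auto intro!: deriv_seq_mult deriv_seq_of_real)
  define Xa where "Xa a = X(c := (\<lambda>i. X c (i + a)))" for a
  have Xa: "cutoffs b0 R1 T1 (Xa a)" for a unfolding Xa_def by (rule cutoffs_shift[OF X])
  have P0: "tensor (P m) (\<lambda>_. 0) x = of_real (cut X x) * tensor (Q m) (\<lambda>_. 0) x" for m x
    by (simp add: tensor_def P_def cut_def prod.distrib)
  have Pl: "tensor (P m) (single c l) x = (\<Sum>a\<le>l. of_nat (l choose a) * (of_real (cut (Xa a) x) * tensor (Q m) (single c (l - a)) x))" for m x
  proof -
    have cutXa: "cut (Xa a) x = X c a (x \<bullet> c) * (\<Prod>b\<in>Basis - {c}. X b 0 (x \<bullet> b))" for a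
    proof -
      have "cut (Xa a) x = Xa a c 0 (x \<bullet> c) * (\<Prod>b\<in>Basis - {c}. Xa a b 0 (x \<bullet> b))"
        unfolding cut_def using c by (subst prod.remove[of _ c]) auto
      also have "(\<Prod>b\<in>Basis - {c}. Xa a b 0 (x \<bullet> b)) = (\<Prod>b\<in>Basis - {c}. X b 0 (x \<bullet> b))"
        by (intro prod.cong) (auto simp: Xa_def)
      also have "Xa a c 0 = X c a" by (simp add: Xa_def)
      finally show ?thesis .
    qed
    have "tensor (P m) (single c l) x = P m c l (x \<bullet> c) * (\<Prod>b\<in>Basis - {c}. of_real (X b 0 (x \<bullet> b)) * Q m b 0 (x \<bullet> b))"
      unfolding tensor_upd_other[OF c] by (simp add: P_def)
    also have "\<dots> = (\<Sum>a\<le>l. of_nat (l choose a) * (of_real (cut (Xa a) x) * tensor (Q m) (single c (l - a)) x))"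
      unfolding tensor_upd_other[OF c] cutXa P_def seq_mult_def
      by (simp add: sum_distrib_right sum_distrib_left prod.distrib mult_ac)
    finally show ?thesis .
  qed
  let ?I = "\<lambda>a m. LINT x|lborel. of_real (u x * cut (Xa a) x) * tensor (Q m) (single c (l - a)) x"
  have int: "integrable lborel (\<lambda>x. of_real (u x * cut (Xa a) x) * tensor (Q m) n x)" for a m n
    by (intro l2fun_integrable_times[OF _ sub] l2fun_times[OF ul sub] cut_continuous[OF Xa] tensor_continuous Q)
  \<comment> \<open>By Leibniz' rule, multiplication with the cutoff preserves the order of
    vanishing at 0.\<close>
  have van': "\<exists>C\<ge>0. \<forall>i\<le>l. \<forall>s\<in>{0..T}. norm (P m b0 (l - i) s) \<le> C * s ^ i" if "c = b0" "m \<in> S" for m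
  proof (rule deriv_seq_vanishing_bound)
    show "deriv_seq (P m b0)" using P b0 by blast
    show "P m b0 i 0 = 0" if "i < l" for i
      using less.prems(1)[OF \<open>c = b0\<close> \<open>m \<in> S\<close>] that by (auto simp: P_def seq_mult_def intro!: sum.neutral)
  qed
  have key: "(\<Sum>a\<le>l. of_nat (l choose a) * ?I a m) = (- 1) ^ l * (LINT x|lborel. of_real (v x * cut X x) * tensor (Q m) (\<lambda>_. 0) x)"
    if m: "m \<in> S" for m
  proof -
    have "(LINT x|lborel. of_real (u x) * tensor (P m) (single c l) x) = (- 1) ^ l * (LINT x|lborel. of_real (v x) * tensor (P m) (\<lambda>_. 0) x)"
    proof (rule weak_identity_boundary[OF v(2) ul v(1) sub b0 c P R1 _ T1])
      show "\<bar>s\<bar> \<le> R1" if "b \<in> Basis" "b \<noteq> b0" "P m b 0 s \<noteq> 0" for b s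
        using X that by (auto simp: P_def cutoffs_def)
      show "s \<le> T1" if "P m b0 0 s \<noteq> 0" for s
        using X b0 that by (auto simp: P_def cutoffs_def)
    qed (use van' m in auto)
    moreover have "(LINT x|lborel. of_real (u x) * tensor (P m) (single c l) x) = (\<Sum>a\<le>l. of_nat (l choose a) * ?I a m)"
    proof -
      have "(LINT x|lborel. of_real (u x) * tensor (P m) (single c l) x)
        = (LINT x|lborel. (\<Sum>a\<le>l. of_nat (l choose a) * (of_real (u x * cut (Xa a) x) * tensor (Q m) (single c (l - a)) x)))"
        unfolding Pl by (simp add: sum_distrib_left mult_ac)
      also have "\<dots> = (\<Sum>a\<le>l. LINT x|lborel. of_nat (l choose a) * (of_real (u x * cut (Xa a) x) * tensor (Q m) (single c (l - a)) x))"
        by (rule Bochner_Integration.integral_sum) (intro integrable_mult_right int)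
      finally show ?thesis by (simp only: integral_mult_right_zero)
    qed
    ultimately show ?thesis unfolding P0 by (simp add: mult.assoc)
  qed
  have rest: "l2bounded S (\<lambda>m. \<Sum>a\<in>{..l} - {0}. (- of_nat (l choose a)) * ?I a m)"
  proof (intro l2bounded_sum l2bounded_cmult)
    fix a assume a: "a \<in> {..l} - {0}"
    show "l2bounded S (\<lambda>m. ?I a m)"
      by (rule less.IH[OF _ _ Xa]) (use a less.prems in auto)
  qed simp
  have main: "l2bounded S (\<lambda>m. (- 1) ^ l * (LINT x|lborel. of_real (v x * cut X x) * tensor (Q m) (\<lambda>_. 0) x)
    + (\<Sum>a\<in>{..l} - {0}. (- of_nat (l choose a)) * ?I a m))"
    by (intro l2bounded_add l2bounded_cmult rest bessel l2fun_times[OF v(1) sub] cut_continuous[OF X])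
  \<comment> \<open>The term \<open>a = 0\<close> is the wanted integral. Solving the identity for
    it leaves integrals of order below \<open>l\<close> and one that Bessel's inequality
    controls.\<close>
  have eq: "(- 1) ^ l * (LINT x|lborel. of_real (v x * cut X x) * tensor (Q m) (\<lambda>_. 0) x)
    + (\<Sum>a\<in>{..l} - {0}. (- of_nat (l choose a)) * ?I a m) = ?I 0 m" if "m \<in> S" for m
    unfolding key[OF that, symmetric] by (subst sum.remove[of _ 0]) (auto simp: sum_negf)
  have "Xa 0 = X" by (simp add: Xa_def)
  then show ?case using l2bounded_cong[OF eq main] by simp
qed

section \<open>Decay of the Fourier coefficients of the extension\<close>

definition expo :: "real \<Rightarrow> nat \<Rightarrow> real \<Rightarrow> complex" where
  "expo \<tau> i s = (\<i> * of_real \<tau>) ^ i * cis (\<tau> * s)"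

lemma deriv_seq_expo: "deriv_seq (expo \<tau>)"
  unfolding deriv_seq_def
proof (intro allI)
  fix i s
  have "((\<lambda>s. cis (\<tau> * s)) has_vector_derivative (\<i> * of_real \<tau>) * cis (\<tau> * s)) (at s)"
    by (auto intro!: derivative_eq_intros simp: has_vector_derivative_def scaleR_conv_of_real)
  from has_vector_derivative_mult_right[OF this, of "(\<i> * of_real \<tau>) ^ i"]
  show "(expo \<tau> i has_vector_derivative expo \<tau> (Suc i) s) (at s)"
    unfolding expo_def[abs_def] by (simp add: mult_ac)
qed

text \<open>A k-th finite difference, here with step 2, annihilates polynomials of degree below
  \<open>k\<close>. One difference lowers the degree, since the top power cancels in (y + 2)^i -
  y^i.\<close>

lemma alternating_binomial_power:
  "i < k \<Longrightarrow> (\<Sum>j\<le>k. of_nat (k choose j) * ((- 1) ^ j * (c - 2 * of_nat j) ^ i)) = (0::real)"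
proof (induction k arbitrary: c i)
  case (Suc k)
  have "(\<Sum>j\<le>Suc k. of_nat (Suc k choose j) * ((- 1) ^ j * (c - 2 * of_nat j) ^ i))
    = (\<Sum>j\<le>k. of_nat (k choose j) * ((- 1) ^ Suc j * (c - 2 * of_nat (Suc j)) ^ i + (- 1) ^ j * (c - 2 * of_nat j) ^ i))"
    using leibniz_sum[of k "\<lambda>j. (- 1) ^ j * (c - 2 * of_nat j) ^ i" "\<lambda>_. 1"] by simp
  also have "\<dots> = (\<Sum>j\<le>k. of_nat (k choose j) * (- 1) ^ j * (\<Sum>a<i. of_nat (i choose a) * 2 ^ (i - a) * ((c - 2) - 2 * of_nat j) ^ a))"
  proof (intro sum.cong refl)
    fix j
    let ?y = "(c - 2) - 2 * of_nat j :: real"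
    have "(?y + 2) ^ i = (\<Sum>a\<le>i. of_nat (i choose a) * ?y ^ a * 2 ^ (i - a))"
      by (rule binomial_ring)
    also have "\<dots> = (\<Sum>a<i. of_nat (i choose a) * ?y ^ a * 2 ^ (i - a)) + ?y ^ i"
      by (simp add: lessThan_Suc_atMost[symmetric])
    finally have "(?y + 2) ^ i - ?y ^ i = (\<Sum>a<i. of_nat (i choose a) * 2 ^ (i - a) * ?y ^ a)"
      by (simp add: mult_ac)
    moreover have "?y + 2 = c - 2 * of_nat j" "?y = c - 2 * of_nat (Suc j)" by simp_all
    ultimately have "(c - 2 * of_nat j) ^ i - (c - 2 * of_nat (Suc j)) ^ i = (\<Sum>a<i. of_nat (i choose a) * 2 ^ (i - a) * ?y ^ a)"
      by (simp only:)
    then show "of_nat (k choose j) * ((- 1) ^ Suc j * (c - 2 * of_nat (Suc j)) ^ i + (- 1) ^ j * (c - 2 * of_nat j) ^ i)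
      = of_nat (k choose j) * (- 1) ^ j * (\<Sum>a<i. of_nat (i choose a) * 2 ^ (i - a) * ?y ^ a)"
      by (simp only: mult.assoc power_Suc) (simp add: algebra_simps)
  qed
  also have "\<dots> = (\<Sum>a<i. of_nat (i choose a) * 2 ^ (i - a) * (\<Sum>j\<le>k. of_nat (k choose j) * ((- 1) ^ j * ((c - 2) - 2 * of_nat j) ^ a)))"
    unfolding sum_distrib_left by (subst sum.swap) (simp add: mult_ac)
  also have "\<dots> = 0"
    using Suc.IH[of _ "c - 2"] Suc.prems by (intro sum.neutral) auto
  finally show ?case .
qed simp

text \<open>The dilation factors in time. Integers keep dilated exponentials on the frequency
  lattice; an arithmetic progression makes alternating binomial sums applicable; the factor is 1 for
  \<open>j = 0\<close> and negative, hence a reflection, for all other \<open>j\<close>.\<close>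

definition scale_int :: "nat \<Rightarrow> int" where "scale_int j = 1 - 2 * int j"

text \<open>The binomial weight of the j-th exponential in the combination that vanishes at time 0,
  times the power that \<open>k\<close> derivatives in time extract from it.\<close>

definition scale_coeff :: "nat \<Rightarrow> nat \<Rightarrow> real" where
  "scale_coeff k j = real (k choose j) * ((- 1) ^ j * real_of_int (scale_int j) ^ k)"

text \<open>The frequency, in units of \<omega>, that the conjugate of the wave with frequency
  \<open>m\<close> has after its time variable is multiplied by \<open>r\<close>.\<close>

definition refl_freq :: "'a \<Rightarrow> int \<Rightarrow> ('a \<Rightarrow> int) \<Rightarrow> 'a \<Rightarrow> int" where
  "refl_freq b0 r m b = (if b = b0 then - (r * m b) else - m b)"

lemma tensor_expo_0: "tensor (\<lambda>b. expo (\<tau> b)) (\<lambda>_. 0) x = wave \<tau> x"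
  by (simp add: tensor_def wave_prod expo_def)

lemma tensor_expo_single:
  assumes "c \<in> Basis"
  shows "tensor (\<lambda>b. expo (\<tau> b)) (single c l) x = (\<i> * of_real (\<tau> c)) ^ l * wave \<tau> x"
proof -
  have "wave \<tau> x = cis (\<tau> c * (x \<bullet> c)) * (\<Prod>b\<in>Basis - {c}. cis (\<tau> b * (x \<bullet> b)))"
    unfolding wave_prod using assms by (subst prod.remove[of _ c]) auto
  then show ?thesis unfolding tensor_upd_other[OF assms] by (simp add: expo_def)
qed

lemma bessel_l2bounded:
  assumes \<omega>: "\<omega> > 0" and L: "\<omega> * L = pi" and sub: "\<Omega> \<subseteq> cube L" and w: "l2fun \<Omega> w" and r: "r \<noteq> 0"
  shows "l2bounded (PiE Basis (\<lambda>_. UNIV)) (\<lambda>m. LINT x|lborel. of_real (w x) * wave (\<lambda>b. \<omega> * refl_freq b0 r m b) (x :: 'a::euclidean_space))"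
  unfolding l2bounded_def
proof (intro exI allI impI, elim conjE)
  fix F :: "('a \<Rightarrow> int) set" assume F: "finite F" "F \<subseteq> PiE Basis (\<lambda>_. UNIV)"
  show "(\<Sum>m\<in>F. (cmod (LINT x|lborel. of_real (w x) * wave (\<lambda>b. \<omega> * refl_freq b0 r m b) x))\<^sup>2)
    \<le> (2 * L) ^ DIM('a) * (LINT x|lborel. (w x)\<^sup>2)"
  proof (rule bessel[OF \<omega> L F(1)])
    show "m = m'" if "m \<in> F" "m' \<in> F" "\<forall>b\<in>Basis. refl_freq b0 r m b = refl_freq b0 r m' b" for m m'
    proof (rule PiE_ext)
      show "m \<in> PiE Basis (\<lambda>_. UNIV)" "m' \<in> PiE Basis (\<lambda>_. UNIV)" using that F by auto
      show "m b = m' b" if "b \<in> Basis" for b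
        using \<open>\<forall>b\<in>Basis. _ b = _ b\<close> that r by (auto simp: refl_freq_def split: if_splits dest!: bspec)
    qed
  qed (use w sub in \<open>auto simp: l2fun_def\<close>)
qed

text \<open>In a spatial direction each exponential is integrated by parts on its own. In time a
  single exponential would produce boundary terms at 0; the combination with binomial weights and
  alternating signs vanishes there to order \<open>k\<close>, and its k-th derivative gives
  \<open>cf\<close> times the k-th power of -i \<omega> m.\<close>

lemma coefficient_l2bounded:
  fixes b0 :: "'a::euclidean_space"
  assumes u: "pure_weak k (tbox b0 R T) u" and sub: "tbox b0 R T \<subseteq> cube L" and b0: "b0 \<in> Basis" and c: "c \<in> Basis"
    and R1: "0 < R1" "R1 < R" and T1: "0 < T1" "T1 < T" and X: "cutoffs b0 R1 T1 X"
    and \<omega>: "\<omega> > 0" and L: "\<omega> * L = pi"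
  defines "cf \<equiv> \<lambda>m. \<Sum>j\<le>k. of_real (scale_coeff k j) *
    (LINT x|lborel. of_real (u x * cut X x) * wave (\<lambda>b. \<omega> * refl_freq b0 (scale_int j) m b) x)"
  shows "l2bounded (PiE Basis (\<lambda>_. UNIV)) cf"
    and "l2bounded (PiE Basis (\<lambda>_. UNIV)) (\<lambda>m. of_int (m c) ^ k * cf m)"
proof -
  let ?S = "PiE Basis (\<lambda>_. UNIV) :: ('a \<Rightarrow> int) set"
  let ?W = "\<lambda>j m. wave (\<lambda>b. \<omega> * refl_freq b0 (scale_int j) m b)"
  have ul: "l2fun (tbox b0 R T) u" using u by (simp add: pure_weak_def)
  have uX: "l2fun (tbox b0 R T) (\<lambda>x. u x * cut X x)" by (rule l2fun_times[OF ul sub cut_continuous[OF X]])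
  have r0: "scale_int j \<noteq> 0" for j unfolding scale_int_def by presburger
  have bess: "l2bounded ?S (\<lambda>m. LINT x|lborel. of_real (w x) * ?W j m x)" if "l2fun (tbox b0 R T) w" for w j
    by (rule bessel_l2bounded[OF \<omega> L sub that r0])
  show "l2bounded ?S cf"
    unfolding cf_def by (intro l2bounded_sum l2bounded_cmult bess uX) auto
  have iw: "(\<i> * of_real \<omega>) ^ k \<noteq> (0::complex)" using \<omega> by simp
  show "l2bounded ?S (\<lambda>m. of_int (m c) ^ k * cf m)"
  proof (cases "c = b0")
    case False
    define Q where "Q j m b = expo (\<omega> * refl_freq b0 (scale_int j) m b)" for j m b
    have Q: "tensor (Q j m) (\<lambda>_. 0) x = ?W j m x"
      "tensor (Q j m) (single c k) x = (- \<i> * of_real \<omega>) ^ k * of_int (m c) ^ k * ?W j m x" for j m x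
    proof -
      show "tensor (Q j m) (\<lambda>_. 0) x = ?W j m x" unfolding Q_def by (rule tensor_expo_0)
      have "\<i> * of_real (\<omega> * refl_freq b0 (scale_int j) m c) = - \<i> * of_real \<omega> * of_int (m c)"
        using False by (simp add: refl_freq_def)
      then show "tensor (Q j m) (single c k) x = (- \<i> * of_real \<omega>) ^ k * of_int (m c) ^ k * ?W j m x"
        unfolding Q_def tensor_expo_single[OF c] by (simp only: power_mult_distrib)
    qed
    have "l2bounded ?S (\<lambda>m. LINT x|lborel. of_real (u x * cut X x) * tensor (Q j m) (single c k) x)" for j
    proof (rule fourier_l2bounded[OF u sub b0 c R1 T1 _ _ _ X order_refl])
      show "\<forall>b\<in>Basis. deriv_seq (Q j m b)" for m by (simp add: Q_def deriv_seq_expo)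
      show "l2bounded ?S (\<lambda>m. LINT x|lborel. of_real (w x) * tensor (Q j m) (\<lambda>_. 0) x)" if "l2fun (tbox b0 R T) w" for w
        unfolding Q by (rule bess[OF that])
    qed (use False in simp)
    moreover have "(LINT x|lborel. of_real (u x * cut X x) * tensor (Q j m) (single c k) x)
      = (- \<i> * of_real \<omega>) ^ k * of_int (m c) ^ k * (LINT x|lborel. of_real (u x * cut X x) * ?W j m x)" for j m
      unfolding Q(2) by (subst integral_mult_right_zero[symmetric]) (simp add: mult_ac)
    ultimately have "l2bounded ?S (\<lambda>m. (- \<i> * of_real \<omega>) ^ k * of_int (m c) ^ k * (LINT x|lborel. of_real (u x * cut X x) * ?W j m x))" for j
      by simp
    then have "l2bounded ?S (\<lambda>m. \<Sum>j\<le>k. (of_real (scale_coeff k j) / (- \<i> * of_real \<omega>) ^ k) *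
        ((- \<i> * of_real \<omega>) ^ k * of_int (m c) ^ k * (LINT x|lborel. of_real (u x * cut X x) * ?W j m x)))"
      by (intro l2bounded_sum l2bounded_cmult) auto
    moreover have "(- \<i> * of_real \<omega>) ^ k \<noteq> (0::complex)" using \<omega> by simp
    then have "(of_real (scale_coeff k j) / (- \<i> * of_real \<omega>) ^ k) * ((- \<i> * of_real \<omega>) ^ k * of_int (m c) ^ k * I)
      = of_int (m c) ^ k * (of_real (scale_coeff k j) * I)" for j m I
      by (simp only: divide_inverse) (simp add: mult_ac)
    ultimately show ?thesis unfolding cf_def sum_distrib_left by (simp only:)
  next
    case True
    define a where "a j = of_real (real (k choose j) * (- 1) ^ j) * (1::complex)" for j
    define Q where "Q m b = (if b = b0 then (\<lambda>i s. \<Sum>j\<le>k. a j * expo (\<omega> * refl_freq b0 (scale_int j) m b) i s)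
      else expo (\<omega> * refl_freq b0 1 m b))" for m b
    have fr: "refl_freq b0 r m b = refl_freq b0 1 m b" if "b \<noteq> b0" for r m b using that by (simp add: refl_freq_def)
    have QT: "tensor (Q m) (single b0 l) x = (\<Sum>j\<le>k. a j * ((\<i> * of_real (\<omega> * refl_freq b0 (scale_int j) m b0)) ^ l * ?W j m x))" for m l x
    proof -
      have "tensor (Q m) (single b0 l) x = (\<Sum>j\<le>k. a j * expo (\<omega> * refl_freq b0 (scale_int j) m b0) l (x \<bullet> b0)) *
        (\<Prod>b\<in>Basis - {b0}. expo (\<omega> * refl_freq b0 1 m b) 0 (x \<bullet> b))"
        unfolding tensor_upd_other[OF b0] by (simp add: Q_def)
      also have "\<dots> = (\<Sum>j\<le>k. a j * (expo (\<omega> * refl_freq b0 (scale_int j) m b0) l (x \<bullet> b0) *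
        (\<Prod>b\<in>Basis - {b0}. expo (\<omega> * refl_freq b0 (scale_int j) m b) 0 (x \<bullet> b))))"
        unfolding sum_distrib_right
      proof (intro sum.cong refl)
        fix j
        have "(\<Prod>b\<in>Basis - {b0}. expo (\<omega> * refl_freq b0 1 m b) 0 (x \<bullet> b)) = (\<Prod>b\<in>Basis - {b0}. expo (\<omega> * refl_freq b0 (scale_int j) m b) 0 (x \<bullet> b))"
          by (intro prod.cong refl) (simp add: fr[of _ "scale_int j"])
        then show "a j * expo (\<omega> * refl_freq b0 (scale_int j) m b0) l (x \<bullet> b0) * (\<Prod>b\<in>Basis - {b0}. expo (\<omega> * refl_freq b0 1 m b) 0 (x \<bullet> b))
          = a j * (expo (\<omega> * refl_freq b0 (scale_int j) m b0) l (x \<bullet> b0) * (\<Prod>b\<in>Basis - {b0}. expo (\<omega> * refl_freq b0 (scale_int j) m b) 0 (x \<bullet> b)))"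
          by (simp only: mult.assoc)
      qed
      also have "\<dots> = (\<Sum>j\<le>k. a j * tensor (\<lambda>b. expo (\<omega> * refl_freq b0 (scale_int j) m b)) (single b0 l) x)"
        unfolding tensor_upd_other[OF b0] ..
      finally show ?thesis unfolding tensor_expo_single[OF b0] .
    qed
    have s0: "single b0 0 = (\<lambda>_. 0)" by (simp add: single_def fun_eq_iff)
    have pw: "\<i> * of_real (\<omega> * refl_freq b0 (scale_int j) m b0) = (- \<i> * of_real \<omega> * of_int (m b0)) * of_int (scale_int j)" for j m
      by (simp add: refl_freq_def)
    have ii: "integrable lborel (\<lambda>x. of_real (w x) * ?W j m x)" if "l2fun (tbox b0 R T) w" for w j m
      by (rule l2fun_integrable_times[OF that sub]) (rule continuous_on_wave)
    have lin: "(LINT x|lborel. of_real (w x) * (\<Sum>j\<le>k. a j * (z j * ?W j m x))) = (\<Sum>j\<le>k. a j * z j * (LINT x|lborel. of_real (w x) * ?W j m x))"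
      if w: "l2fun (tbox b0 R T) w" for w z m
    proof -
      have "(LINT x|lborel. of_real (w x) * (\<Sum>j\<le>k. a j * (z j * ?W j m x))) = (LINT x|lborel. (\<Sum>j\<le>k. (a j * z j) * (of_real (w x) * ?W j m x)))"
        by (simp add: sum_distrib_left mult_ac)
      also have "\<dots> = (\<Sum>j\<le>k. LINT x|lborel. (a j * z j) * (of_real (w x) * ?W j m x))"
        by (rule Bochner_Integration.integral_sum) (intro integrable_mult_right ii w)
      finally show ?thesis by (simp only: integral_mult_right_zero)
    qed
    have "l2bounded ?S (\<lambda>m. LINT x|lborel. of_real (u x * cut X x) * tensor (Q m) (single c k) x)"
    proof (rule fourier_l2bounded[OF u sub b0 c R1 T1 _ _ _ X order_refl])
      show "\<forall>b\<in>Basis. deriv_seq (Q m b)" for m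
        by (auto simp: Q_def intro!: deriv_seq_sum deriv_seq_cmult deriv_seq_expo)
      show "l2bounded ?S (\<lambda>m. LINT x|lborel. of_real (w x) * tensor (Q m) (\<lambda>_. 0) x)" if w: "l2fun (tbox b0 R T) w" for w
        unfolding s0[symmetric] QT lin[OF w] by (intro l2bounded_sum) (auto intro: l2bounded_cmult[OF bess[OF w]])
      show "Q m b0 i 0 = 0" if "i < k" for m i
      proof -
        \<comment> \<open>At \<open>s = 0\<close> the exponentials are 1, so the i-th derivatives
          combine to a k-th difference of a polynomial of degree \<open>i < k\<close>.\<close>
        have "Q m b0 i 0 = (\<Sum>j\<le>k. a j * ((- \<i> * of_real \<omega> * of_int (m b0)) * of_int (scale_int j)) ^ i)"
        proof -
          have "Q m b0 i 0 = (\<Sum>j\<le>k. a j * (\<i> * of_real (\<omega> * refl_freq b0 (scale_int j) m b0)) ^ i)"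
            by (simp add: Q_def expo_def)
          then show ?thesis unfolding pw .
        qed
        also have "\<dots> = (- \<i> * of_real \<omega> * of_int (m b0)) ^ i * of_real (\<Sum>j\<le>k. of_nat (k choose j) * ((- 1) ^ j * (1 - 2 * of_nat j) ^ i))"
          unfolding of_real_sum sum_distrib_left power_mult_distrib
          by (intro sum.cong refl) (simp add: a_def scale_int_def mult_ac)
        also have "\<dots> = 0" using alternating_binomial_power[OF that, of 1] by simp
        finally show ?thesis .
      qed
    qed
    moreover have "(LINT x|lborel. of_real (u x * cut X x) * tensor (Q m) (single c k) x)
      = (- \<i> * of_real \<omega>) ^ k * (of_int (m c) ^ k * cf m)" for m
    proof -
      have "(LINT x|lborel. of_real (u x * cut X x) * tensor (Q m) (single c k) x)
        = (\<Sum>j\<le>k. a j * ((- \<i> * of_real \<omega> * of_int (m b0)) * of_int (scale_int j)) ^ k * (LINT x|lborel. of_real (u x * cut X x) * ?W j m x))"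
        unfolding True QT lin[OF uX] by (simp only: pw)
      also have "\<dots> = (\<Sum>j\<le>k. (- \<i> * of_real \<omega>) ^ k * (of_int (m c) ^ k * (of_real (scale_coeff k j) * (LINT x|lborel. of_real (u x * cut X x) * ?W j m x))))"
        unfolding power_mult_distrib
        by (intro sum.cong refl) (simp add: a_def scale_coeff_def True mult_ac)
      finally show ?thesis by (simp only: cf_def sum_distrib_left)
    qed
    ultimately have "l2bounded ?S (\<lambda>m. (- \<i> * of_real \<omega>) ^ k * (of_int (m c) ^ k * cf m))" by (simp only:)
    from l2bounded_cmult[OF this, of "1 / (- \<i> * of_real \<omega>) ^ k"]
    show ?thesis using \<omega> by simp
  qed
qed

section \<open>Weighted summability of the coefficients\<close>

lemma lattice_sum_1d:
  assumes "p > 1 / 2"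
  shows "\<exists>Z\<ge>0. \<forall>N. (\<Sum>j\<in>{- int N..int N}. (1 + (real_of_int j)\<^sup>2) powr - p) \<le> Z"
proof -
  let ?f = "\<lambda>j::int. (1 + (real_of_int j)\<^sup>2) powr - p"
  have sm: "summable (\<lambda>n. real n powr (- 2 * p))" using assms by (subst summable_real_powr_iff) simp
  then have sm': "summable (\<lambda>n. real (Suc n) powr (- 2 * p))"
    using summable_Suc_iff[of "\<lambda>n. real n powr (- 2 * p)"] by blast
  have step: "?f (int (Suc n)) \<le> real (Suc n) powr (- 2 * p)" for n
  proof -
    have "real (Suc n) powr (- 2 * p) = (real (Suc n) powr 2) powr - p" by (simp only: powr_powr) simp
    also have "real (Suc n) powr 2 = (real (Suc n))\<^sup>2" by (rule powr_numeral) simp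
    finally have "real (Suc n) powr (- 2 * p) = ((real (Suc n))\<^sup>2) powr - p" .
    moreover have "?f (int (Suc n)) \<le> ((real (Suc n))\<^sup>2) powr - p"
      using assms by (intro powr_mono2') auto
    ultimately show ?thesis by simp
  qed
  have bd: "(\<Sum>j\<in>{- int N..int N}. ?f j) \<le> 1 + 2 * (\<Sum>n<N. real (Suc n) powr (- 2 * p))" for N
  proof (induction N)
    case (Suc N)
    have "{- int (Suc N)..int (Suc N)} = insert (int (Suc N)) (insert (- int (Suc N)) {- int N..int N})" by auto
    then have "(\<Sum>j\<in>{- int (Suc N)..int (Suc N)}. ?f j) = ?f (int (Suc N)) + (?f (- int (Suc N)) + (\<Sum>j\<in>{- int N..int N}. ?f j))"
      by (simp only: sum.insert finite_insert finite_atLeastAtMost_int) (subst sum.insert; simp)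
    also have "?f (- int (Suc N)) = ?f (int (Suc N))" by (simp only: of_int_minus power2_minus)
    finally show ?case using step[of N] Suc.IH by simp
  qed simp
  have le: "(\<Sum>n<N. real (Suc n) powr (- 2 * p)) \<le> (\<Sum>n. real (Suc n) powr (- 2 * p))" for N
    by (rule sum_le_suminf[OF sm']) auto
  have "(\<Sum>j\<in>{- int N..int N}. ?f j) \<le> 1 + 2 * (\<Sum>n. real (Suc n) powr (- 2 * p))" for N
    using bd[of N] le[of N] by linarith
  moreover have "0 \<le> (\<Sum>n. real (Suc n) powr (- 2 * p))"
    by (rule suminf_nonneg[OF sm']) auto
  ultimately show ?thesis by (intro exI[of _ "1 + 2 * (\<Sum>n. real (Suc n) powr (- 2 * p))"]) auto
qed

text \<open>Cauchy--Schwarz in termwise form: with A = 1 + |m|^2, twice A |cf| is at most A^(2 - k)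
  + A^k |cf|^2. The first series converges by the condition on \<open>k\<close>, the second is
  bounded by the hypotheses on \<open>cf\<close> and its pure derivatives.\<close>

lemma weighted_l1_bound:
  fixes cf :: "('a::euclidean_space \<Rightarrow> int) \<Rightarrow> complex" and \<omega> :: real
  assumes k: "real k > real DIM('a) / 2 + 2"
    and cf: "l2bounded (PiE Basis (\<lambda>_. UNIV)) cf"
    and cfk: "\<And>c. c \<in> Basis \<Longrightarrow> l2bounded (PiE Basis (\<lambda>_. UNIV)) (\<lambda>m. of_int (m c) ^ k * cf m)"
  shows "\<exists>B. \<forall>N. (\<Sum>m\<in>PiE Basis (\<lambda>_. {- int N..int N}). (1 + (\<Sum>b\<in>Basis. (\<omega> * m b)\<^sup>2)) * cmod (cf m)) \<le> B"
proof -
  let ?S = "PiE Basis (\<lambda>_. UNIV) :: ('a \<Rightarrow> int) set" and ?F = "\<lambda>N. PiE Basis (\<lambda>_. {- int N..int N}) :: ('a \<Rightarrow> int) set"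
  let ?n = "DIM('a)"
  have F: "finite (?F N)" "?F N \<subseteq> ?S" for N by (auto intro!: finite_PiE)
  define A where "A m = 1 + (\<Sum>b\<in>Basis. (real_of_int (m b))\<^sup>2)" for m :: "'a \<Rightarrow> int"
  have A1: "A m \<ge> 1" for m by (simp add: A_def sum_nonneg)
  obtain B0 where B0: "\<And>N. (\<Sum>m\<in>?F N. (cmod (cf m))\<^sup>2) \<le> B0"
    using cf F unfolding l2bounded_def by meson
  have "\<exists>B. \<forall>N. (\<Sum>m\<in>?F N. (cmod (of_int (m c) ^ k * cf m))\<^sup>2) \<le> B" if "c \<in> Basis" for c
    using cfk[OF that] F unfolding l2bounded_def by meson
  then have "\<exists>Bc. \<forall>c\<in>Basis. \<forall>N. (\<Sum>m\<in>?F N. (cmod (of_int (m c) ^ k * cf m))\<^sup>2) \<le> Bc c"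
    by (intro bchoice ballI)
  then obtain Bc where Bc: "\<And>c N. c \<in> Basis \<Longrightarrow> (\<Sum>m\<in>?F N. (cmod (of_int (m c) ^ k * cf m))\<^sup>2) \<le> Bc c" by blast
  define D where "D = (real ?n + 1) ^ k * (B0 + (\<Sum>c\<in>Basis. Bc c))"
  have Ak: "A m ^ k \<le> (real ?n + 1) ^ k * (1 + (\<Sum>c\<in>Basis. (real_of_int (m c)) ^ (2 * k)))" for m
  proof -
    \<comment> \<open>The largest square dominates \<open>A m\<close> up to a dimensional factor,
      and its k-th power is one of the summands on the right.\<close>
    define M where "M = Max (insert 1 ((\<lambda>b. (real_of_int (m b))\<^sup>2) ` Basis))"
    have M: "1 \<le> M" "\<And>b. b \<in> Basis \<Longrightarrow> (real_of_int (m b))\<^sup>2 \<le> M"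
      unfolding M_def by (rule Max_ge; simp)+
    have "A m \<le> 1 + (\<Sum>b\<in>(Basis::'a set). M)" unfolding A_def using M by (intro add_left_mono sum_mono) auto
    also have "\<dots> \<le> (real ?n + 1) * M" using M by (simp add: algebra_simps)
    finally have "A m ^ k \<le> ((real ?n + 1) * M) ^ k" using A1[of m] by (intro power_mono) auto
    also have "\<dots> = (real ?n + 1) ^ k * M ^ k" by (rule power_mult_distrib)
    also have "M ^ k \<le> 1 + (\<Sum>c\<in>Basis. (real_of_int (m c)) ^ (2 * k))"
    proof -
      have nn: "0 \<le> (real_of_int (m c)) ^ (2 * k)" for c by (simp add: power_mult)
      have "M \<in> insert 1 ((\<lambda>b. (real_of_int (m b))\<^sup>2) ` Basis)" unfolding M_def by (rule Max_in) auto
      then consider "M = 1" | b where "b \<in> Basis" "M = (real_of_int (m b))\<^sup>2" by auto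
      then show ?thesis
      proof cases
        case 1
        then show ?thesis using nn by (simp add: sum_nonneg)
      next
        case (2 b)
        then have "M ^ k = (real_of_int (m b)) ^ (2 * k)" by (simp add: power_mult)
        also have "\<dots> \<le> (\<Sum>c\<in>Basis. (real_of_int (m c)) ^ (2 * k))"
          using 2 nn by (intro member_le_sum) auto
        finally show ?thesis by simp
      qed
    qed
    finally show ?thesis by (simp add: mult_left_mono)
  qed
  have S2: "(\<Sum>m\<in>?F N. A m ^ k * (cmod (cf m))\<^sup>2) \<le> D" for N
  proof -
    have "(\<Sum>m\<in>?F N. A m ^ k * (cmod (cf m))\<^sup>2)
      \<le> (\<Sum>m\<in>?F N. (real ?n + 1) ^ k * (1 + (\<Sum>c\<in>Basis. (real_of_int (m c)) ^ (2 * k))) * (cmod (cf m))\<^sup>2)"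
      using Ak by (intro sum_mono mult_right_mono) auto
    also have "\<dots> = (real ?n + 1) ^ k * ((\<Sum>m\<in>?F N. (cmod (cf m))\<^sup>2) + (\<Sum>c\<in>Basis. \<Sum>m\<in>?F N. (cmod (of_int (m c) ^ k * cf m))\<^sup>2))"
    proof -
      have sq: "(cmod (of_int (m c) ^ k * cf m))\<^sup>2 = (real_of_int (m c)) ^ (2 * k) * (cmod (cf m))\<^sup>2" for m c
        by (simp add: norm_mult norm_power power_mult_distrib flip: power_mult) (simp add: power_mult mult.commute[of k] power2_abs)
      show ?thesis unfolding sq
        by (subst sum.swap) (simp add: sum_distrib_left sum_distrib_right sum.distrib algebra_simps)
    qed
    also have "\<dots> \<le> D"
      unfolding D_def using B0 Bc by (intro mult_left_mono add_mono sum_mono) auto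
    finally show ?thesis .
  qed
  \<comment> \<open>The exponent is distributed evenly over the coordinates, so that the lattice sum
    factors into one-dimensional ones; \<open>p > 1 / 2\<close> is the hypothesis on
    \<open>k\<close>.\<close>
  define p where "p = (real k - 2) / ?n"
  have p: "p > 1 / 2" using k by (simp add: p_def field_simps)
  obtain Z where Z: "Z \<ge> 0" "\<And>N. (\<Sum>j\<in>{- int N..int N}. (1 + (real_of_int j)\<^sup>2) powr - p) \<le> Z"
    using lattice_sum_1d[OF p] by blast
  have "real ?n / 2 \<ge> 0" by simp
  then have "real k > 2" using k by linarith
  then have k2: "k \<ge> 2" by simp
  have S1: "(\<Sum>m\<in>?F N. 1 / A m ^ (k - 2)) \<le> Z ^ ?n" for N
  proof -
    have "1 / A m ^ (k - 2) \<le> (\<Prod>b\<in>Basis. (1 + (real_of_int (m b))\<^sup>2) powr - p)" for m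
    proof -
      have A0: "A m > 0" using A1[of m] by simp
      have "1 / A m ^ (k - 2) = A m powr - real (k - 2)"
        using A0 by (simp add: powr_minus powr_realpow divide_inverse)
      also have "real (k - 2) = real ?n * p" using k2 by (simp add: p_def of_nat_diff)
      also have "A m powr - (real ?n * p) = (\<Prod>b\<in>(Basis::'a set). A m powr - p)"
        using A0 by (simp add: powr_realpow[symmetric] powr_powr mult.commute)
      also have "\<dots> \<le> (\<Prod>b\<in>Basis. (1 + (real_of_int (m b))\<^sup>2) powr - p)"
      proof (intro prod_mono conjI powr_ge_zero)
        fix b :: 'a assume b: "b \<in> Basis"
        have "1 + (real_of_int (m b))\<^sup>2 \<le> A m" unfolding A_def using b by (intro add_left_mono member_le_sum) auto
        moreover have "0 < 1 + (real_of_int (m b))\<^sup>2" by (simp add: add_pos_nonneg)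
        ultimately show "A m powr - p \<le> (1 + (real_of_int (m b))\<^sup>2) powr - p"
          using p by (intro powr_mono2') auto
      qed
      finally show ?thesis .
    qed
    then have "(\<Sum>m\<in>?F N. 1 / A m ^ (k - 2)) \<le> (\<Sum>m\<in>?F N. \<Prod>b\<in>Basis. (1 + (real_of_int (m b))\<^sup>2) powr - p)"
      by (intro sum_mono)
    also have "\<dots> = (\<Prod>b\<in>(Basis::'a set). \<Sum>j\<in>{- int N..int N}. (1 + (real_of_int j)\<^sup>2) powr - p)"
      by (rule prod_sum_PiE[symmetric]) auto
    also have "\<dots> \<le> (\<Prod>b\<in>(Basis::'a set). Z)"
      using Z by (intro prod_mono) (auto intro: sum_nonneg)
    finally show ?thesis by simp
  qed
  have "(\<Sum>m\<in>?F N. (1 + (\<Sum>b\<in>Basis. (\<omega> * m b)\<^sup>2)) * cmod (cf m)) \<le> (1 + \<omega>\<^sup>2) * ((Z ^ ?n + D) / 2)" for N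
  proof -
    have "(1 + (\<Sum>b\<in>Basis. (\<omega> * m b)\<^sup>2)) * cmod (cf m) \<le> (1 + \<omega>\<^sup>2) * ((1 / A m ^ (k - 2) + A m ^ k * (cmod (cf m))\<^sup>2) / 2)" for m
    proof -
      have "1 + (\<Sum>b\<in>Basis. (\<omega> * m b)\<^sup>2) = 1 + \<omega>\<^sup>2 * (A m - 1)"
        by (simp add: A_def power_mult_distrib sum_distrib_left)
      also have "\<dots> \<le> (1 + \<omega>\<^sup>2) * A m" using A1[of m] zero_le_power2[of \<omega>] by (simp add: algebra_simps add_increasing2)
      finally have "(1 + (\<Sum>b\<in>Basis. (\<omega> * m b)\<^sup>2)) * cmod (cf m) \<le> (1 + \<omega>\<^sup>2) * A m * cmod (cf m)"
        by (intro mult_right_mono) auto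
      also have "\<dots> = (1 + \<omega>\<^sup>2) * (A m * cmod (cf m))" by simp
      also have "A m * cmod (cf m) \<le> (1 / A m ^ (k - 2) + A m ^ k * (cmod (cf m))\<^sup>2) / 2"
      proof -
        have Ap: "A m ^ k = A m ^ (k - 2) * (A m)\<^sup>2"
          using power_add[of "A m" "k - 2" 2] k2 by (simp only: le_add_diff_inverse2)
        have Ap2: "A m ^ (k - 2) > 0" using A1[of m] by simp
        have amgm: "x \<le> (1 / q + q * x\<^sup>2) / 2" if "q > 0" for q x :: real
        proof -
          have "(1 / q + q * x\<^sup>2) / 2 - x = (q * x - 1)\<^sup>2 / (2 * q)"
            using that by (simp add: field_simps power2_eq_square)
          then show ?thesis using that by (smt (verit) divide_nonneg_pos zero_le_power2)
        qed
        show ?thesis using amgm[OF Ap2, of "A m * cmod (cf m)"] by (simp add: Ap power_mult_distrib mult.assoc)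
      qed
      finally show ?thesis by (simp add: mult_left_mono)
    qed
    then have "(\<Sum>m\<in>?F N. (1 + (\<Sum>b\<in>Basis. (\<omega> * m b)\<^sup>2)) * cmod (cf m))
      \<le> (\<Sum>m\<in>?F N. (1 + \<omega>\<^sup>2) * ((1 / A m ^ (k - 2) + A m ^ k * (cmod (cf m))\<^sup>2) / 2))"
      by (intro sum_mono)
    also have "\<dots> = (1 + \<omega>\<^sup>2) * (((\<Sum>m\<in>?F N. 1 / A m ^ (k - 2)) + (\<Sum>m\<in>?F N. A m ^ k * (cmod (cf m))\<^sup>2)) / 2)"
      by (simp add: sum.distrib flip: sum_distrib_left sum_divide_distrib)
    also have "\<dots> \<le> (1 + \<omega>\<^sup>2) * ((Z ^ ?n + D) / 2)"
      using S1[of N] S2[of N] by (intro mult_left_mono divide_right_mono add_mono) auto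
    finally show ?thesis .
  qed
  then show ?thesis by blast
qed

section \<open>Extension across an end of the time interval\<close>

definition dilate :: "'a::euclidean_space \<Rightarrow> real \<Rightarrow> 'a \<Rightarrow> 'a" where
  "dilate b0 r x = x + ((r - 1) * (x \<bullet> b0)) *\<^sub>R b0"

lemma dilate_inner:
  assumes "b0 \<in> Basis" "b \<in> Basis"
  shows "dilate b0 r x \<bullet> b = (if b = b0 then r * (x \<bullet> b0) else x \<bullet> b)"
proof (cases "b = b0")
  case True
  then show ?thesis using assms by (simp add: dilate_def inner_add_left left_diff_distrib)
next
  case False
  then show ?thesis using assms by (simp add: dilate_def inner_add_left inner_Basis)
qed

lemma dilate_inverse:
  assumes "b0 \<in> Basis" "r \<noteq> 0"
  shows "dilate b0 (1 / r) (dilate b0 r x) = x"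
proof (rule euclidean_eqI)
  fix b :: 'a assume b: "b \<in> Basis"
  show "dilate b0 (1 / r) (dilate b0 r x) \<bullet> b = x \<bullet> b"
    using assms b by (simp add: dilate_inner[OF assms(1) b] dilate_inner[OF assms(1) assms(1)])
qed

lemma dilate_continuous: "continuous_on A (dilate b0 r)"
  unfolding dilate_def[abs_def] by (intro continuous_intros)

lemma lborel_dilate:
  assumes b0: "b0 \<in> Basis" and r: "r \<noteq> 0"
  shows "(lborel :: 'a::euclidean_space measure) =
    density (distr lborel borel (\<lambda>x. t *\<^sub>R b0 + dilate b0 r x)) (\<lambda>_. ennreal \<bar>r\<bar>)"
proof -
  define c where "c b = (if b = b0 then r else 1)" for b :: 'a
  have T: "t *\<^sub>R b0 + (\<Sum>j\<in>Basis. (c j * (x \<bullet> j)) *\<^sub>R j) = t *\<^sub>R b0 + dilate b0 r x" for x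
  proof (rule euclidean_eqI)
    fix b :: 'a assume b: "b \<in> Basis"
    show "(t *\<^sub>R b0 + (\<Sum>j\<in>Basis. (c j * (x \<bullet> j)) *\<^sub>R j)) \<bullet> b = (t *\<^sub>R b0 + dilate b0 r x) \<bullet> b"
      using b b0 by (simp add: dilate_inner c_def inner_add_left)
  qed
  have "(lborel :: 'a measure) = density (distr lborel borel (\<lambda>x. t *\<^sub>R b0 + (\<Sum>j\<in>Basis. (c j * (x \<bullet> j)) *\<^sub>R j))) (\<lambda>_. (\<Prod>j\<in>(Basis::'a set). \<bar>c j\<bar>))"
    using r by (intro lborel_affine_euclidean) (simp add: c_def)
  moreover have "(\<Prod>j\<in>(Basis::'a set). \<bar>c j\<bar>) = \<bar>r\<bar>"
    using b0 by (subst prod.remove[of _ b0]) (auto simp: c_def intro!: prod.neutral)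
  ultimately show ?thesis unfolding T by simp
qed

lemma dilate_measurable: "(\<lambda>x. t *\<^sub>R b0 + dilate b0 r x) \<in> borel_measurable borel"
  by (intro borel_measurable_continuous_onI continuous_intros dilate_continuous)

lemma lborel_integral_dilate:
  fixes f :: "'a::euclidean_space \<Rightarrow> 'b::{banach, second_countable_topology}"
  assumes b0: "b0 \<in> Basis" and r: "r \<noteq> 0" and f: "f \<in> borel_measurable borel"
  shows "(LINT x|lborel. f x) = \<bar>r\<bar> *\<^sub>R (LINT x|lborel. f (t *\<^sub>R b0 + dilate b0 r x))"
proof -
  let ?d = "\<lambda>x. t *\<^sub>R b0 + dilate b0 r x"
  have "(LINT x|lborel. f x) = (LINT x|density (distr lborel borel ?d) (\<lambda>_. ennreal \<bar>r\<bar>). f x)"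
    using lborel_dilate[OF b0 r, of t] by simp
  also have "\<dots> = (LINT x|distr lborel borel ?d. \<bar>r\<bar> *\<^sub>R f x)"
    using f by (intro integral_density) auto
  also have "\<dots> = (LINT x|lborel. \<bar>r\<bar> *\<^sub>R f (?d x))"
    using f dilate_measurable[of t b0 r] by (intro integral_distr) auto
  finally show ?thesis by simp
qed

lemma lborel_integrable_dilate:
  fixes f :: "'a::euclidean_space \<Rightarrow> 'b::{banach, second_countable_topology}"
  assumes b0: "b0 \<in> Basis" and r: "r \<noteq> 0" and f: "integrable lborel f"
  shows "integrable lborel (\<lambda>x. f (t *\<^sub>R b0 + dilate b0 r x))"
proof -
  let ?d = "\<lambda>x. t *\<^sub>R b0 + dilate b0 r x"
  have fm: "f \<in> borel_measurable borel" using f by simp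
  have "integrable (density (distr lborel borel ?d) (\<lambda>_. ennreal \<bar>r\<bar>)) f"
    using f lborel_dilate[OF b0 r, of t] by simp
  then have "integrable (distr lborel borel ?d) (\<lambda>x. \<bar>r\<bar> *\<^sub>R f x)"
    using fm by (subst (asm) integrable_density) auto
  then have "integrable lborel (\<lambda>x. \<bar>r\<bar> *\<^sub>R f (?d x))"
    using fm dilate_measurable[of t b0 r] by (subst (asm) integrable_distr_eq) auto
  then show ?thesis
    using r integrable_scaleR_right[of "1 / \<bar>r\<bar>" lborel "\<lambda>x. \<bar>r\<bar> *\<^sub>R f (?d x)"] by simp
qed

lemma scale_int_0 [simp]: "scale_int 0 = 1"
  by (simp add: scale_int_def)

lemma scale_int_neg: "j > 0 \<Longrightarrow> scale_int j < 0"
  unfolding scale_int_def by presburger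

text \<open>The higher-order reflection: for negative times the function is a combination of its dilates to
  positive times; the weights make the first \<open>k - 1\<close> derivatives match at time \<open>0\<close>.\<close>

definition ext_weight :: "nat \<Rightarrow> nat \<Rightarrow> real" where
  "ext_weight k j = - (real (k choose j) * ((- 1) ^ j * real_of_int (scale_int j) ^ (k - 1)))"

text \<open>The alternating sum with exponent \<open>k - 1\<close> vanishes, and its term for
  \<open>j = 0\<close> is 1.\<close>

lemma ext_weight_sum:
  assumes "k > 0"
  shows "(\<Sum>j=1..k. ext_weight k j) = 1"
proof -
  have "0 = (\<Sum>j\<le>k. real (k choose j) * ((- 1) ^ j * real_of_int (scale_int j) ^ (k - 1)))"
    using alternating_binomial_power[of "k - 1" k 1] assms by (simp add: scale_int_def)
  also have "\<dots> = 1 + (\<Sum>j=1..k. real (k choose j) * ((- 1) ^ j * real_of_int (scale_int j) ^ (k - 1)))"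
    by (simp add: atMost_atLeast0 sum.atLeast_Suc_atMost)
  finally show ?thesis by (simp add: ext_weight_def sum_negf)
qed

text \<open>The Jacobian of the dilation supplies the k-th power; its absolute value cancels the
  minus sign of the weight, as the factor is negative.\<close>

lemma ext_weight_scale:
  assumes "k > 0" "j > 0"
  shows "ext_weight k j * \<bar>real_of_int (scale_int j)\<bar> = scale_coeff k j"
proof -
  have "\<bar>real_of_int (scale_int j)\<bar> = - real_of_int (scale_int j)" using scale_int_neg[OF assms(2)] by simp
  moreover have "real_of_int (scale_int j) ^ k = real_of_int (scale_int j) ^ (k - 1) * real_of_int (scale_int j)"
    using power_minus_mult[OF assms(1), symmetric] .
  ultimately show ?thesis by (simp add: ext_weight_def scale_coeff_def)
qed

text \<open>The cutoff ends before the late time \<open>T1 < T\<close> and within the lateral radius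
  \<open>R1 < R\<close>, so time 0 is the only place where an extension is needed.\<close>

locale half_extension =
  fixes b0 :: "'a::euclidean_space" and k :: nat and R T R1 T1 :: real and g :: "'a \<Rightarrow> real"
    and X :: "'a \<Rightarrow> nat \<Rightarrow> real \<Rightarrow> real"
  assumes b0: "b0 \<in> Basis" and k: "real k > real DIM('a) / 2 + 2" and R1: "0 < R1" "R1 < R" and T1: "0 < T1" "T1 < T"
    and g: "continuous_on {x. 0 \<le> x \<bullet> b0 \<and> x \<bullet> b0 \<le> T} g"
    and weak: "pure_weak k (tbox b0 R T) (\<lambda>x. indicator (tbox b0 R T) x * g x)"
    and X: "cutoffs b0 R1 T1 X"
begin

definition hc :: "'a \<Rightarrow> real" where
  "hc x = (if x \<bullet> b0 \<le> T then g x * cut X x else 0)"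

text \<open>Times are divided, not multiplied, by the factors: the substitution in the Fourier
  integral then multiplies frequencies by integers. The price is a longer support.\<close>

definition H :: "'a \<Rightarrow> real" where
  "H x = (if 0 \<le> x \<bullet> b0 then hc x else (\<Sum>j=1..k. ext_weight k j * hc (dilate b0 (1 / scale_int j) x)))"

abbreviation w :: "'a \<Rightarrow> real" where
  "w x \<equiv> indicator (tbox b0 R T) x * g x * cut X x"

lemma k_pos: "k > 0"
proof -
  have "real DIM('a) / 2 \<ge> 0" by simp
  then have "real k > 0" using k by linarith
  then show ?thesis by simp
qed

lemma cut_nonzero:
  assumes "cut X x \<noteq> 0" "b \<in> Basis"
  shows "if b = b0 then x \<bullet> b \<le> T1 else \<bar>x \<bullet> b\<bar> \<le> R1"
proof -
  have "X b 0 (x \<bullet> b) \<noteq> 0" using assms by (auto simp: cut_def)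
  then show ?thesis using X assms(2) unfolding cutoffs_def by blast
qed

lemma hc_continuous: "continuous_on {x. 0 \<le> x \<bullet> b0} hc"
proof -
  have c1: "closed {x::'a. 0 \<le> x \<bullet> b0 \<and> x \<bullet> b0 \<le> T}"
    by (intro closed_Collect_conj closed_Collect_le continuous_intros)
  have c2: "closed {x::'a. T \<le> x \<bullet> b0}" by (intro closed_Collect_le continuous_intros)
  have "continuous_on ({x. 0 \<le> x \<bullet> b0 \<and> x \<bullet> b0 \<le> T} \<union> {x. T \<le> x \<bullet> b0}) (\<lambda>x. if x \<bullet> b0 \<le> T then g x * cut X x else 0)"
  proof (rule continuous_on_cases[OF c1 c2])
    show "continuous_on {x. 0 \<le> x \<bullet> b0 \<and> x \<bullet> b0 \<le> T} (\<lambda>x. g x * cut X x)"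
      by (intro continuous_on_mult g cut_continuous[OF X])
    show "\<forall>x. x \<in> {x. 0 \<le> x \<bullet> b0 \<and> x \<bullet> b0 \<le> T} \<and> \<not> x \<bullet> b0 \<le> T \<or> x \<in> {x. T \<le> x \<bullet> b0} \<and> x \<bullet> b0 \<le> T \<longrightarrow> g x * cut X x = 0"
    proof (intro allI impI)
      fix x assume "x \<in> {x. 0 \<le> x \<bullet> b0 \<and> x \<bullet> b0 \<le> T} \<and> \<not> x \<bullet> b0 \<le> T \<or> x \<in> {x. T \<le> x \<bullet> b0} \<and> x \<bullet> b0 \<le> T"
      then have "x \<bullet> b0 > T1" using T1 by auto
      then have "cut X x = 0" using cut_nonzero[of x b0] b0 by force
      then show "g x * cut X x = 0" by simp
    qed
  qed simp
  moreover have "{x. 0 \<le> x \<bullet> b0 \<and> x \<bullet> b0 \<le> T} \<union> {x. T \<le> x \<bullet> b0} = {x. 0 \<le> x \<bullet> b0}" using T1 by auto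
  ultimately show ?thesis unfolding hc_def[abs_def] by simp
qed

lemma dilate_nonneg:
  assumes "x \<bullet> b0 \<le> 0" "j \<in> {1..k}"
  shows "0 \<le> dilate b0 (1 / scale_int j) x \<bullet> b0"
proof -
  have "real_of_int (scale_int j) < 0" using scale_int_neg[of j] assms(2) by simp
  then have "0 \<le> (1 / real_of_int (scale_int j)) * (x \<bullet> b0)"
    using assms(1) by (intro mult_nonpos_nonpos) (auto simp: divide_nonpos_neg)
  then show ?thesis using b0 by (simp add: dilate_inner)
qed

text \<open>On the hyperplane of time 0 all dilations are the identity, so both formulas agree
  because the weights sum to 1. No derivative of the extension is formed; the matching of higher
  order acts only through the Fourier coefficients.\<close>

lemma H_continuous: "continuous_on UNIV H"
proof -
  have c1: "closed {x::'a. 0 \<le> x \<bullet> b0}" by (intro closed_Collect_le continuous_intros)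
  have c2: "closed {x::'a. x \<bullet> b0 \<le> 0}" by (intro closed_Collect_le continuous_intros)
  have "continuous_on ({x. 0 \<le> x \<bullet> b0} \<union> {x. x \<bullet> b0 \<le> 0})
    (\<lambda>x. if 0 \<le> x \<bullet> b0 then hc x else (\<Sum>j=1..k. ext_weight k j * hc (dilate b0 (1 / scale_int j) x)))"
  proof (rule continuous_on_cases[OF c1 c2 hc_continuous])
    show "continuous_on {x. x \<bullet> b0 \<le> 0} (\<lambda>x. \<Sum>j=1..k. ext_weight k j * hc (dilate b0 (1 / scale_int j) x))"
    proof (intro continuous_on_sum continuous_on_mult continuous_on_const)
      fix j assume "j \<in> {1..k}"
      then show "continuous_on {x. x \<bullet> b0 \<le> 0} (\<lambda>x. hc (dilate b0 (1 / scale_int j) x))"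
        by (intro continuous_on_compose2[OF hc_continuous dilate_continuous]) (auto intro: dilate_nonneg)
    qed
    show "\<forall>x. x \<in> {x. 0 \<le> x \<bullet> b0} \<and> \<not> 0 \<le> x \<bullet> b0 \<or> x \<in> {x. x \<bullet> b0 \<le> 0} \<and> 0 \<le> x \<bullet> b0 \<longrightarrow>
      hc x = (\<Sum>j=1..k. ext_weight k j * hc (dilate b0 (1 / scale_int j) x))"
    proof (intro allI impI)
      fix x assume "x \<in> {x. 0 \<le> x \<bullet> b0} \<and> \<not> 0 \<le> x \<bullet> b0 \<or> x \<in> {x. x \<bullet> b0 \<le> 0} \<and> 0 \<le> x \<bullet> b0"
      then have "dilate b0 r x = x" for r by (auto simp: dilate_def)
      then show "hc x = (\<Sum>j=1..k. ext_weight k j * hc (dilate b0 (1 / scale_int j) x))"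
        using ext_weight_sum[OF k_pos] by (simp flip: sum_distrib_right)
    qed
  qed
  moreover have "{x::'a. 0 \<le> x \<bullet> b0} \<union> {x. x \<bullet> b0 \<le> 0} = UNIV" by auto
  ultimately show ?thesis unfolding H_def[abs_def] by simp
qed

text \<open>For negative times the support is stretched by at most \<open>2 * k - 1\<close>, the
  largest modulus of a factor.\<close>

lemma H_support:
  assumes L: "(2 * real k + 1) * T \<le> L" "R \<le> L" and x: "H x \<noteq> 0"
  shows "x \<in> cube L"
proof -
  have T0: "T > 0" using T1 by simp
  have hcn: "\<bar>x \<bullet> b\<bar> \<le> R1" if "hc x \<noteq> 0" "b \<in> Basis" "b \<noteq> b0" for x b
    using that cut_nonzero[of x b] by (auto simp: hc_def split: if_splits)
  have hct: "x \<bullet> b0 \<le> T1" if "hc x \<noteq> 0" for x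
    using that cut_nonzero[of x b0] b0 by (auto simp: hc_def split: if_splits)
  have TL: "T1 \<le> L"
  proof -
    have "1 * T \<le> (2 * real k + 1) * T" using T0 by (intro mult_right_mono) auto
    then show ?thesis using L T1 by linarith
  qed
  show ?thesis
  proof (cases "0 \<le> x \<bullet> b0")
    case True
    then have h: "hc x \<noteq> 0" using x by (simp add: H_def)
    show ?thesis unfolding cube_def
    proof (intro CollectI ballI)
      fix b :: 'a assume b: "b \<in> Basis"
      show "\<bar>x \<bullet> b\<bar> \<le> L" using hcn[OF h b] hct[OF h] True TL R1 L by (cases "b = b0") auto
    qed
  next
    case False
    then have "(\<Sum>j=1..k. ext_weight k j * hc (dilate b0 (1 / scale_int j) x)) \<noteq> 0" using x by (simp add: H_def)
    then obtain j where j: "j \<in> {1..k}" "hc (dilate b0 (1 / scale_int j) x) \<noteq> 0"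
      by (metis (no_types, lifting) mult_zero_right sum.neutral)
    have neg: "real_of_int (scale_int j) < 0" using scale_int_neg[of j] j(1) by simp
    have "x \<bullet> b0 / scale_int j \<le> T1" using hct[OF j(2)] b0 by (simp add: dilate_inner)
    then have "x \<bullet> b0 \<ge> T1 * scale_int j" using neg by (simp add: neg_divide_le_eq)
    moreover have "- real_of_int (scale_int j) \<le> 2 * real k + 1" using j(1) by (simp add: scale_int_def)
    then have "T1 * (- real_of_int (scale_int j)) \<le> T * (2 * real k + 1)"
      using T1 neg by (intro mult_mono) auto
    ultimately have t: "- (x \<bullet> b0) \<le> L" using L by (simp add: mult.commute)
    show ?thesis unfolding cube_def
    proof (intro CollectI ballI)
      fix b :: 'a assume b: "b \<in> Basis"
      show "\<bar>x \<bullet> b\<bar> \<le> L"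
      proof (cases "b = b0")
        case True
        then show ?thesis using t False by simp
      next
        case False
        then have "\<bar>x \<bullet> b\<bar> \<le> R1" using hcn[OF j(2) b False] b b0 by (simp add: dilate_inner)
        then show ?thesis using R1 L by linarith
      qed
    qed
  qed
qed

lemma w_eq_hc: "w x = hc x" if "x \<bullet> b0 > 0"
proof (cases "x \<in> tbox b0 R T")
  case True
  then have "x \<bullet> b0 \<le> T" using b0 by (auto simp: tbox_def)
  then show ?thesis using True by (simp add: hc_def)
next
  case False
  have "hc x = 0"
  proof (rule ccontr)
    assume "hc x \<noteq> 0"
    then have c: "cut X x \<noteq> 0" by (auto simp: hc_def split: if_splits)
    have "x \<in> tbox b0 R T" unfolding tbox_def
    proof (intro CollectI ballI)
      fix b :: 'a assume "b \<in> Basis"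
      then show "(if b = b0 then 0 else - R) < x \<bullet> b \<and> x \<bullet> b < (if b = b0 then T else R)"
        using cut_nonzero[OF c, of b] that R1 T1 by (auto split: if_splits)
    qed
    then show False using False by simp
  qed
  then show ?thesis using False by simp
qed

lemma w_zero: "w x = 0" if "x \<bullet> b0 \<le> 0"
proof -
  have "x \<notin> tbox b0 R T" using that b0 by (force simp: tbox_def)
  then show ?thesis by simp
qed

text \<open>Substitution moves each dilation from the function to the exponential, and the Jacobian
  turns the weights of the extension into \<open>scale_coeff\<close>. Thus the coefficients of
  \<open>H\<close> involve the given function inside the box only, tested with a combination of
  exponentials.\<close>

lemma H_fourier:
  fixes \<omega> L :: real and m :: "'a \<Rightarrow> int"
  assumes sub: "tbox b0 R T \<subseteq> cube L"
  shows "(LINT y|lborel. of_real (H y) * wave (\<lambda>b. - (\<omega> * m b)) y)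
    = (\<Sum>j\<le>k. of_real (scale_coeff k j) * (LINT x|lborel. of_real (w x) * wave (\<lambda>b. \<omega> * refl_freq b0 (scale_int j) m b) x))"
proof -
  let ?E = "wave (\<lambda>b. - (\<omega> * real_of_int (m b)))"
  let ?l = "\<lambda>j. if j = 0 then 1 else ext_weight k j"
  have ul: "l2fun (tbox b0 R T) (\<lambda>x. indicator (tbox b0 R T) x * g x)" using weak by (simp add: pure_weak_def)
  have wl: "l2fun (tbox b0 R T) w" by (rule l2fun_times[OF ul sub cut_continuous[OF X]])
  define W where "W x = w x" for x
  have W: "w = W" by (simp add: W_def fun_eq_iff)
  have wm: "W \<in> borel_measurable borel" using wl by (simp add: l2fun_def W)
  have wi: "integrable lborel W" using l2fun_integrable[OF wl sub] by (simp add: W)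
  have Wz: "W x = 0" if "x \<bullet> b0 \<le> 0" for x using w_zero[OF that] by (simp add: W_def)
  have Wh: "W x = hc x" if "x \<bullet> b0 > 0" for x using w_eq_hc[OF that] by (simp add: W_def)
  have r0: "real_of_int (scale_int j) \<noteq> 0" for j
  proof -
    have "scale_int j \<noteq> 0" unfolding scale_int_def by presburger
    then show ?thesis by simp
  qed
  have dE: "?E (dilate b0 (scale_int j) x) = wave (\<lambda>b. \<omega> * refl_freq b0 (scale_int j) m b) x" for j x
    unfolding wave_def using b0 by (intro arg_cong[where f = cis] sum.cong) (auto simp: dilate_inner refl_freq_def)
  have fm: "(\<lambda>x. of_real (W (dilate b0 (1 / scale_int j) x)) * ?E x) \<in> borel_measurable borel" for j
  proof -
    have "dilate b0 (1 / scale_int j) \<in> borel_measurable borel"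
      by (intro borel_measurable_continuous_onI dilate_continuous)
    then have "(\<lambda>x. W (dilate b0 (1 / scale_int j) x)) \<in> borel_measurable borel"
      by (rule measurable_compose) (rule wm)
    then show ?thesis by simp
  qed
  have ch: "(LINT x|lborel. of_real (W (dilate b0 (1 / scale_int j) x)) * ?E x)
    = of_real \<bar>real_of_int (scale_int j)\<bar> * (LINT x|lborel. of_real (W x) * wave (\<lambda>b. \<omega> * refl_freq b0 (scale_int j) m b) x)" for j
    using lborel_integral_dilate[OF b0 r0[of j] fm[of j], of 0]
    by (simp add: dilate_inverse[OF b0 r0] dE scaleR_conv_of_real)
  have ii: "integrable lborel (\<lambda>x. of_real (W (dilate b0 (1 / scale_int j) x)) * ?E x)" for j
  proof -
    have "integrable lborel (\<lambda>x. of_real (W (0 *\<^sub>R b0 + dilate b0 (1 / scale_int j) x)) :: complex)"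
      using r0[of j] by (intro integrable_of_real lborel_integrable_dilate[OF b0 _ wi]) simp
    then have "integrable lborel (\<lambda>x. of_real (W (dilate b0 (1 / scale_int j) x)) :: complex)" by simp
    then show ?thesis by (intro integrable_times_bounded[where B = 1]) auto
  qed
  have Hw: "H x = (\<Sum>j\<le>k. ?l j * W (dilate b0 (1 / scale_int j) x))" if x0: "x \<bullet> b0 \<noteq> 0" for x
  proof -
    have split: "(\<Sum>j\<le>k. ?l j * W (dilate b0 (1 / scale_int j) x)) = W x + (\<Sum>j=1..k. ext_weight k j * W (dilate b0 (1 / scale_int j) x))"
      by (simp add: atMost_atLeast0 sum.atLeast_Suc_atMost dilate_def)
    show ?thesis
    proof (cases "x \<bullet> b0 > 0")
      case True
      have "W (dilate b0 (1 / scale_int j) x) = 0" if "j \<in> {1..k}" for j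
      proof (rule Wz)
        have "real_of_int (scale_int j) < 0" using scale_int_neg[of j] that by simp
        then show "dilate b0 (1 / scale_int j) x \<bullet> b0 \<le> 0"
          using True b0 by (simp add: dilate_inner divide_nonneg_neg)
      qed
      then show ?thesis unfolding split H_def using True Wh[OF True] by simp
    next
      case False
      then have neg: "x \<bullet> b0 < 0" using x0 by simp
      have "W (dilate b0 (1 / scale_int j) x) = hc (dilate b0 (1 / scale_int j) x)" if "j \<in> {1..k}" for j
      proof (rule Wh)
        have "real_of_int (scale_int j) < 0" using scale_int_neg[of j] that by simp
        then show "0 < dilate b0 (1 / scale_int j) x \<bullet> b0"
          using neg b0 by (simp add: dilate_inner divide_neg_neg)
      qed
      then show ?thesis unfolding split H_def using neg Wz[of x] by simp
    qed
  qed
  \<comment> \<open>At time 0 the function \<open>w\<close> vanishes although \<open>H\<close> need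
    not; this hyperplane is a null set.\<close>
  have "AE x in lborel. x \<bullet> b0 \<noteq> 0"
  proof -
    have "negligible {x::'a. b0 \<bullet> x = 0}" using b0 by (intro negligible_hyperplane) auto
    then have "{x::'a. b0 \<bullet> x = 0} \<in> null_sets lebesgue" by (simp add: negligible_iff_null_sets)
    moreover have "{x::'a. b0 \<bullet> x = 0} \<in> sets borel" by (intro borel_closed closed_hyperplane)
    ultimately have "{x::'a. b0 \<bullet> x = 0} \<in> null_sets lborel" by (simp add: null_sets_def)
    then show ?thesis by (rule AE_I') (auto simp: inner_commute)
  qed
  then have AE: "AE x in lborel. of_real (H x) * ?E x = (\<Sum>j\<le>k. of_real (?l j) * (of_real (W (dilate b0 (1 / scale_int j) x)) * ?E x))"
    by eventually_elim (simp only: Hw of_real_sum of_real_mult sum_distrib_right mult.assoc not_False_eq_True)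
  have ij: "integrable lborel (\<lambda>y. of_real (?l j) * (of_real (W (dilate b0 (1 / scale_int j) y)) * ?E y))" for j
    by (rule integrable_mult_right) (rule ii)
  have isum: "integrable lborel (\<lambda>y. \<Sum>j\<le>k. of_real (?l j) * (of_real (W (dilate b0 (1 / scale_int j) y)) * ?E y))"
    by (rule Bochner_Integration.integrable_sum) (rule ij)
  have "(LINT y|lborel. of_real (H y) * ?E y) = (LINT y|lborel. (\<Sum>j\<le>k. of_real (?l j) * (of_real (W (dilate b0 (1 / scale_int j) y)) * ?E y)))"
  proof (rule integral_cong_AE[OF _ _ AE])
    have "H \<in> borel_measurable borel" by (rule borel_measurable_continuous_onI[OF H_continuous])
    then show "(\<lambda>y. of_real (H y) * ?E y) \<in> borel_measurable lborel" by simp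
    show "(\<lambda>y. \<Sum>j\<le>k. of_real (?l j) * (of_real (W (dilate b0 (1 / scale_int j) y)) * ?E y)) \<in> borel_measurable lborel"
      by (rule borel_measurable_integrable) (rule isum)
  qed
  also have "\<dots> = (\<Sum>j\<le>k. of_real (?l j) * (LINT y|lborel. of_real (W (dilate b0 (1 / scale_int j) y)) * ?E y))"
    by (simp only: Bochner_Integration.integral_sum[OF ij] integral_mult_right_zero)
  also have "\<dots> = (\<Sum>j\<le>k. of_real (scale_coeff k j) * (LINT x|lborel. of_real (W x) * wave (\<lambda>b. \<omega> * refl_freq b0 (scale_int j) m b) x))"
  proof (intro sum.cong refl)
    fix j
    have "?l j * \<bar>real_of_int (scale_int j)\<bar> = scale_coeff k j"
    proof (cases "j = 0")
      case True
      then show ?thesis by (simp add: scale_coeff_def)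
    next
      case False
      then show ?thesis using ext_weight_scale[OF k_pos, of j] by simp
    qed
    then have "of_real (?l j) * (of_real \<bar>real_of_int (scale_int j)\<bar> * I) = of_real (scale_coeff k j) * I" for I :: complex
      by (metis mult.assoc of_real_mult)
    then show "of_real (?l j) * (LINT y|lborel. of_real (W (dilate b0 (1 / scale_int j) y)) * ?E y)
      = of_real (scale_coeff k j) * (LINT x|lborel. of_real (W x) * wave (\<lambda>b. \<omega> * refl_freq b0 (scale_int j) m b) x)"
      unfolding ch .
  qed
  finally show ?thesis by (simp only: W_def)
qed

theorem relu_hull_H:
  assumes "R' \<ge> 1"
  shows "\<exists>C. relu_hull (cball 0 R' \<times> {1}) C (\<lambda>p :: 'a \<times> real. H (fst p))"
proof -
  \<comment> \<open>The half cube has to contain the support of \<open>H\<close> and the ball of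
    radius \<open>R'\<close>.\<close>
  define L where "L = 2 * ((2 * real k + 1) * T + R + R')"
  have T0: "T > 0" "R > 0" using T1 R1 by simp_all
  have LL: "(2 * real k + 1) * T \<le> L / 2" "R \<le> L / 2" "R' \<le> L / 2" "L > 0"
  proof -
    have "(2 * real k + 1) * T > 0" using T0 by (intro mult_pos_pos) auto
    then have "0 < 2 * ((2 * real k + 1) * T) + 2 * R + 2 * R'" using T0 assms by linarith
    with \<open>(2 * real k + 1) * T > 0\<close> show "(2 * real k + 1) * T \<le> L / 2" "R \<le> L / 2" "R' \<le> L / 2" "L > 0"
      using T0 assms by (auto simp: L_def)
  qed
  define \<omega> where "\<omega> = pi / L"
  have \<omega>: "\<omega> > 0" "\<omega> * L = pi" using LL by (auto simp: \<omega>_def)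
  have sub: "tbox b0 R T \<subseteq> cube L"
  proof
    fix x assume x: "x \<in> tbox b0 R T"
    have "1 * T \<le> (2 * real k + 1) * T" using T0 by (intro mult_right_mono) auto
    then have TL: "T \<le> L" using LL by linarith
    have RL: "R \<le> L" using LL by linarith
    show "x \<in> cube L" unfolding cube_def
    proof (intro CollectI ballI)
      fix b :: 'a assume "b \<in> Basis"
      then have "(if b = b0 then 0 else - R) < x \<bullet> b \<and> x \<bullet> b < (if b = b0 then T else R)" using x unfolding tbox_def by blast
      then show "\<bar>x \<bullet> b\<bar> \<le> L" using TL RL by (auto split: if_splits)
    qed
  qed
  define cf where "cf m = (LINT y|lborel. of_real (H y) * wave (\<lambda>b. - (\<omega> * m b)) y)" for m :: "'a \<Rightarrow> int"
  have cf_eq: "cf = (\<lambda>m. \<Sum>j\<le>k. of_real (scale_coeff k j) * (LINT x|lborel. of_real (w x) * wave (\<lambda>b. \<omega> * refl_freq b0 (scale_int j) m b) x))"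
    unfolding cf_def by (rule ext) (rule H_fourier[OF sub])
  have "\<exists>B. \<forall>N. (\<Sum>m\<in>PiE Basis (\<lambda>_. {- int N..int N}). (1 + (\<Sum>b\<in>Basis. (\<omega> * m b)\<^sup>2)) * cmod (cf m)) \<le> B"
  proof (rule weighted_l1_bound[OF k])
    show "l2bounded (PiE Basis (\<lambda>_. UNIV)) cf"
      unfolding cf_eq by (rule coefficient_l2bounded(1)[OF weak sub b0 b0 R1 T1 X \<omega>])
    show "l2bounded (PiE Basis (\<lambda>_. UNIV)) (\<lambda>m. of_int (m c) ^ k * cf m)" if "c \<in> Basis" for c
      unfolding cf_eq by (rule coefficient_l2bounded(2)[OF weak sub b0 that R1 T1 X \<omega>])
  qed
  then obtain B where B: "\<And>N. (\<Sum>m\<in>PiE Basis (\<lambda>_. {- int N..int N}). (1 + (\<Sum>b\<in>Basis. (\<omega> * m b)\<^sup>2)) * cmod (cf m)) \<le> B"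
    by blast
  have supp: "H x = 0" if "x \<notin> cube (L / 2)" for x using H_support[OF LL(1,2)] that by blast
  show ?thesis
    by (rule exI) (rule relu_hull_fourier[OF \<omega> assms LL(3) H_continuous supp B[unfolded cf_def]])
qed

end

section \<open>Reversal of time\<close>

definition reflect :: "'a::euclidean_space \<Rightarrow> real \<Rightarrow> 'a \<Rightarrow> 'a" where
  "reflect b0 T x = T *\<^sub>R b0 + dilate b0 (- 1) x"

lemma reflect_inner:
  assumes "b0 \<in> Basis" "b \<in> Basis"
  shows "reflect b0 T x \<bullet> b = (if b = b0 then T - x \<bullet> b0 else x \<bullet> b)"
  using assms by (auto simp: reflect_def inner_add_left dilate_inner[OF assms] inner_Basis)

lemma reflect_reflect:
  assumes "b0 \<in> Basis"
  shows "reflect b0 T (reflect b0 T x) = x"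
proof (rule euclidean_eqI)
  fix b :: 'a assume "b \<in> Basis"
  then show "reflect b0 T (reflect b0 T x) \<bullet> b = x \<bullet> b"
    using assms by (simp add: reflect_inner)
qed

lemma reflect_continuous: "continuous_on A (reflect b0 T)"
  unfolding reflect_def[abs_def] by (intro continuous_intros dilate_continuous)

lemma reflect_measurable: "reflect b0 T \<in> borel_measurable borel"
  by (rule borel_measurable_continuous_onI[OF reflect_continuous])

lemma reflect_mem_tbox:
  assumes "b0 \<in> Basis"
  shows "reflect b0 T x \<in> tbox b0 R T \<longleftrightarrow> x \<in> tbox b0 R T"
proof -
  have "((if b = b0 then 0 else - R) < reflect b0 T x \<bullet> b \<and> reflect b0 T x \<bullet> b < (if b = b0 then T else R))
    \<longleftrightarrow> ((if b = b0 then 0 else - R) < x \<bullet> b \<and> x \<bullet> b < (if b = b0 then T else R))" if "b \<in> Basis" for b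
    using reflect_inner[OF assms that, of T x] by auto
  then show ?thesis unfolding tbox_def by blast
qed

lemma l2fun_reflect:
  assumes b0: "b0 \<in> Basis" and w: "l2fun (tbox b0 R T) w"
  shows "l2fun (tbox b0 R T) (\<lambda>x. a * w (reflect b0 T x))"
  unfolding l2fun_def
proof (intro conjI allI impI)
  have wm: "w \<in> borel_measurable borel" and w2: "integrable lborel (\<lambda>x. (w x)\<^sup>2)" using w by (auto simp: l2fun_def)
  have "(\<lambda>x. w (reflect b0 T x)) \<in> borel_measurable borel" by (rule measurable_compose[OF reflect_measurable wm])
  then show "(\<lambda>x. a * w (reflect b0 T x)) \<in> borel_measurable borel" by simp
  have "integrable lborel (\<lambda>x. (w (reflect b0 T x))\<^sup>2)"
    unfolding reflect_def using b0 w2 by (intro lborel_integrable_dilate) auto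
  then show "integrable lborel (\<lambda>x. (a * w (reflect b0 T x))\<^sup>2)" by (simp add: power_mult_distrib)
  show "a * w (reflect b0 T x) = 0" if "x \<notin> tbox b0 R T" for x
    using w that reflect_mem_tbox[OF b0, of T x R] by (simp add: l2fun_def)
qed

text \<open>A change of variables applied to the test function. Every derivative in time changes
  sign, and \<open>single c l b0\<close> counts them: it is \<open>l\<close> for
  \<open>c = b0\<close> and 0 otherwise.\<close>

lemma weak_identity_reflect:
  assumes b0: "b0 \<in> Basis" and u: "u \<in> borel_measurable borel" and v: "v \<in> borel_measurable borel"
    and w: "weak_identity (tbox b0 R T) u c l v"
  shows "weak_identity (tbox b0 R T) (\<lambda>x. u (reflect b0 T x)) c l (\<lambda>x. (- 1) ^ single c l b0 * v (reflect b0 T x))"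
  unfolding weak_identity_def
proof (intro allI impI, elim conjE)
  fix P :: "'a \<Rightarrow> nat \<Rightarrow> real \<Rightarrow> complex" and lo hi :: 'a
  assume P: "test_seqs P lo hi" and sub: "cbox lo hi \<subseteq> tbox b0 R T"
  define P' where "P' b = (if b = b0 then (\<lambda>i s. (- 1) ^ i *\<^sub>R P b i (- 1 * s + T)) else P b)" for b
  \<comment> \<open>Reversal exchanges the two time faces of the support box; this shift moves the
    corners to times \<open>T - hi \<bullet> b0\<close> and \<open>T - lo \<bullet> b0\<close> and
    keeps them ordered.\<close>
  define sh where "sh = (T - hi \<bullet> b0 - lo \<bullet> b0) *\<^sub>R b0"
  have lo': "(lo + sh) \<bullet> b = (if b = b0 then T - hi \<bullet> b0 else lo \<bullet> b)" if "b \<in> Basis" for b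
    using b0 that by (auto simp: sh_def inner_add_left inner_Basis)
  have hi': "(hi + sh) \<bullet> b = (if b = b0 then T - lo \<bullet> b0 else hi \<bullet> b)" if "b \<in> Basis" for b
    using b0 that by (auto simp: sh_def inner_add_left inner_Basis)
  have ds: "deriv_seq (P b)" and lh: "lo \<bullet> b < hi \<bullet> b"
    and nz: "P b 0 s \<noteq> 0 \<Longrightarrow> lo \<bullet> b \<le> s \<and> s \<le> hi \<bullet> b" if "b \<in> Basis" for b s
    using P that unfolding test_seqs_def by blast+
  have P': "test_seqs P' (lo + sh) (hi + sh)"
    unfolding test_seqs_def
  proof (intro ballI conjI allI impI)
    fix b :: 'a assume b: "b \<in> Basis"
    show "deriv_seq (P' b)" 
    proof (cases "b = b0")
      case True
      then show ?thesis unfolding P'_def using deriv_seq_affine[OF ds[OF b], of "- 1" T] by simp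
    next
      case False
      then show ?thesis unfolding P'_def using ds[OF b] by simp
    qed
    show "(lo + sh) \<bullet> b < (hi + sh) \<bullet> b" using lh[OF b] lh[OF b0] unfolding lo'[OF b] hi'[OF b] by auto
    fix s assume s: "P' b 0 s \<noteq> 0"
    have "(if b = b0 then T - hi \<bullet> b0 else lo \<bullet> b) \<le> s \<and> s \<le> (if b = b0 then T - lo \<bullet> b0 else hi \<bullet> b)"
    proof (cases "b = b0")
      case True
      then have "P b 0 (T - s) \<noteq> 0" using s by (simp add: P'_def)
      then show ?thesis using nz[OF b, of "T - s"] True by simp
    next
      case False
      then show ?thesis using nz[OF b, of s] s by (simp add: P'_def)
    qed
    then show "(lo + sh) \<bullet> b \<le> s" "s \<le> (hi + sh) \<bullet> b" unfolding lo'[OF b] hi'[OF b] by auto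
  qed
  have sub': "cbox (lo + sh) (hi + sh) \<subseteq> tbox b0 R T"
  proof
    fix x assume x: "x \<in> cbox (lo + sh) (hi + sh)"
    have "reflect b0 T x \<in> cbox lo hi" unfolding mem_box
    proof
      fix b :: 'a assume b: "b \<in> Basis"
      have "(lo + sh) \<bullet> b \<le> x \<bullet> b \<and> x \<bullet> b \<le> (hi + sh) \<bullet> b" using x b unfolding mem_box by blast
      then show "lo \<bullet> b \<le> reflect b0 T x \<bullet> b \<and> reflect b0 T x \<bullet> b \<le> hi \<bullet> b"
        unfolding lo'[OF b] hi'[OF b] reflect_inner[OF b0 b] by (cases "b = b0") auto
    qed
    then show "x \<in> tbox b0 R T" using sub reflect_mem_tbox[OF b0] by blast
  qed
  have tens: "tensor P n (reflect b0 T x) = (- 1) ^ n b0 * tensor P' n x" for n x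
  proof -
    have "(- 1) ^ n b0 * tensor P' n x = (- 1) ^ n b0 * (P' b0 (n b0) (x \<bullet> b0) * (\<Prod>b\<in>Basis - {b0}. P' b (n b) (x \<bullet> b)))"
      unfolding tensor_def using b0 by (simp add: prod.remove)
    also have "(\<Prod>b\<in>Basis - {b0}. P' b (n b) (x \<bullet> b)) = (\<Prod>b\<in>Basis - {b0}. P b (n b) (reflect b0 T x \<bullet> b))"
      using b0 by (intro prod.cong) (auto simp: P'_def reflect_inner)
    also have "P' b0 (n b0) (x \<bullet> b0) = (- 1) ^ n b0 * P b0 (n b0) (reflect b0 T x \<bullet> b0)"
      using b0 by (simp add: P'_def reflect_inner scaleR_conv_of_real)
    finally have "(- 1) ^ n b0 * tensor P' n x = ((- 1) ^ n b0 * (- 1) ^ n b0) *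
      (P b0 (n b0) (reflect b0 T x \<bullet> b0) * (\<Prod>b\<in>Basis - {b0}. P b (n b) (reflect b0 T x \<bullet> b)))"
      by (simp only: mult.assoc)
    also have "(- 1 :: complex) ^ n b0 * (- 1) ^ n b0 = 1" by (simp flip: power_mult_distrib)
    finally show ?thesis unfolding tensor_def using b0 by (simp add: prod.remove)
  qed
  have change: "(LINT x|lborel. of_real (q (reflect b0 T x)) * tensor P n x)
    = (- 1) ^ n b0 * (LINT x|lborel. of_real (q x) * tensor P' n x)" if q: "q \<in> borel_measurable borel" for q n
  proof -
    have "(\<lambda>x. tensor P n (reflect b0 T x)) \<in> borel_measurable borel"
      using ds by (intro borel_measurable_continuous_onI continuous_on_compose2[OF tensor_continuous reflect_continuous]) auto
    then have m: "(\<lambda>x. of_real (q x) * tensor P n (reflect b0 T x)) \<in> borel_measurable borel"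
      using q by simp
    have "(LINT x|lborel. of_real (q x) * tensor P n (reflect b0 T x))
      = (LINT x|lborel. of_real (q (reflect b0 T x)) * tensor P n (reflect b0 T (reflect b0 T x)))"
      using lborel_integral_dilate[OF b0 _ m, of "- 1" T] unfolding reflect_def by simp
    then have "(LINT x|lborel. of_real (q (reflect b0 T x)) * tensor P n x)
      = (LINT x|lborel. (- 1) ^ n b0 * (of_real (q x) * tensor P' n x))"
      unfolding reflect_reflect[OF b0] tens by (simp only: mult.left_commute)
    then show ?thesis by (simp only: integral_mult_right_zero)
  qed
  have "(LINT x|lborel. of_real (u (reflect b0 T x)) * tensor P (single c l) x)
    = (- 1) ^ single c l b0 * (LINT x|lborel. of_real (u x) * tensor P' (single c l) x)"
    by (rule change[OF u])
  also have "(LINT x|lborel. of_real (u x) * tensor P' (single c l) x)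
    = (- 1) ^ l * (LINT x|lborel. of_real (v x) * tensor P' (\<lambda>_. 0) x)"
    using w P' sub' unfolding weak_identity_def by blast
  also have "(LINT x|lborel. of_real (v x) * tensor P' (\<lambda>_. 0) x)
    = (LINT x|lborel. of_real (v (reflect b0 T x)) * tensor P (\<lambda>_. 0) x)"
    using change[OF v, of "\<lambda>_. 0"] by simp
  finally have "(LINT x|lborel. of_real (u (reflect b0 T x)) * tensor P (single c l) x)
    = (- 1) ^ l * ((- 1) ^ single c l b0 * (LINT x|lborel. of_real (v (reflect b0 T x)) * tensor P (\<lambda>_. 0) x))"
    by (simp only: mult.left_commute)
  then show "(LINT x|lborel. of_real (u (reflect b0 T x)) * tensor P (single c l) x)
    = (- 1) ^ l * (LINT x|lborel. of_real ((- 1) ^ single c l b0 * v (reflect b0 T x)) * tensor P (\<lambda>_. 0) x)"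
    by (simp add: mult.assoc)
qed

lemma pure_weak_reflect:
  assumes b0: "b0 \<in> Basis" and u: "pure_weak k (tbox b0 R T) u"
  shows "pure_weak k (tbox b0 R T) (\<lambda>x. u (reflect b0 T x))"
  unfolding pure_weak_def
proof (intro conjI ballI allI impI)
  have ul: "l2fun (tbox b0 R T) u" using u by (simp add: pure_weak_def)
  show "l2fun (tbox b0 R T) (\<lambda>x. u (reflect b0 T x))" using l2fun_reflect[OF b0 ul, of 1] by simp
  fix c :: 'a and l assume "c \<in> Basis" "l \<le> k"
  then obtain v where v: "l2fun (tbox b0 R T) v" "weak_identity (tbox b0 R T) u c l v"
    using u unfolding pure_weak_def by blast
  have "u \<in> borel_measurable borel" "v \<in> borel_measurable borel" using ul v(1) by (simp_all add: l2fun_def)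
  from weak_identity_reflect[OF b0 this v(2)] l2fun_reflect[OF b0 v(1)]
  show "\<exists>v. l2fun (tbox b0 R T) v \<and> weak_identity (tbox b0 R T) (\<lambda>x. u (reflect b0 T x)) c l v" by blast
qed

lemma smooth_bump_exists:
  fixes a :: real
  assumes "a \<ge> 0"
  shows "\<exists>\<theta>. deriv_seq \<theta> \<and> (\<forall>s. \<bar>s\<bar> \<le> a \<longrightarrow> \<theta> 0 s = (1::real)) \<and> (\<forall>s. \<theta> 0 s \<noteq> 0 \<longrightarrow> \<bar>s\<bar> \<le> a + 1)"
proof -
  obtain \<theta> where \<theta>: "deriv_seq \<theta>" "\<forall>s\<le>- a - 1. \<theta> 0 s = (0::real)" "\<forall>s\<ge>- a. \<theta> 0 s = 1"
    using smooth_step_exists[of "- a - 1" "- a"] by auto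
  define \<phi> where "\<phi> = seq_mult \<theta> (\<lambda>i s. (- 1) ^ i *\<^sub>R \<theta> i (- 1 * s + 0))"
  have "deriv_seq \<phi>" unfolding \<phi>_def by (intro deriv_seq_mult deriv_seq_affine \<theta>(1))
  moreover have "\<phi> 0 s = \<theta> 0 s * \<theta> 0 (- s)" for s by (simp add: \<phi>_def)
  moreover have "\<bar>s\<bar> \<le> a + 1" if "\<theta> 0 s * \<theta> 0 (- s) \<noteq> 0" for s
    using that \<theta>(2)[rule_format, of s] \<theta>(2)[rule_format, of "- s"] by (cases "s \<le> - a - 1"; cases "- s \<le> - a - 1") auto
  ultimately show ?thesis using \<theta>(3) by (intro exI[of _ \<phi>]) auto
qed

lemma relu_hull_subset: "relu_hull X C g \<Longrightarrow> Y \<subseteq> X \<Longrightarrow> relu_hull Y C g"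
  unfolding relu_hull_def by blast

text \<open>The margin 2 leaves room for a lateral cutoff that is 1 up to \<open>R'\<close> and 0
  beyond \<open>R' + 1 < R\<close>. On the ball only the factor \<open>Y\<close> in time remains of
  the cutoff.\<close>

lemma half_hull:
  fixes g :: "'a::euclidean_space \<Rightarrow> real"
  assumes b0: "b0 \<in> Basis" and k: "real k > real DIM('a) / 2 + 2" and T: "T > 0" and R': "R' \<ge> 1" "R = R' + 2"
    and g: "continuous_on {x. 0 \<le> x \<bullet> b0 \<and> x \<bullet> b0 \<le> T} g"
    and weak: "pure_weak k (tbox b0 R T) (\<lambda>x. indicator (tbox b0 R T) x * g x)"
    and Y: "deriv_seq Y" "\<And>s. Y 0 s \<noteq> 0 \<Longrightarrow> s \<le> T1" and T1: "0 < T1" "T1 < T"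
  shows "\<exists>C. relu_hull ((cball 0 R' \<inter> {x. 0 \<le> x \<bullet> b0 \<and> x \<bullet> b0 \<le> T}) \<times> {1}) C
    (\<lambda>p :: 'a \<times> real. g (fst p) * Y 0 (fst p \<bullet> b0))"
proof -
  obtain \<theta> where \<theta>: "deriv_seq \<theta>" "\<forall>s. \<bar>s\<bar> \<le> R' \<longrightarrow> \<theta> 0 s = (1::real)" "\<forall>s. \<theta> 0 s \<noteq> 0 \<longrightarrow> \<bar>s\<bar> \<le> R' + 1"
    using smooth_bump_exists[of R'] R' by auto
  define X where "X b = (if b = b0 then Y else \<theta>)" for b :: 'a
  have X: "cutoffs b0 (R' + 1) T1 X"
    unfolding cutoffs_def X_def using Y \<theta> by auto
  interpret half_extension b0 k R T "R' + 1" T1 g X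
    by (rule half_extension.intro) (use b0 k R' T1 g weak X in \<open>simp_all\<close>)
  obtain C where C: "relu_hull (cball 0 R' \<times> {1}) C (\<lambda>p :: 'a \<times> real. H (fst p))" using relu_hull_H[OF R'(1)] by blast
  have "relu_hull ((cball 0 R' \<inter> {x. 0 \<le> x \<bullet> b0 \<and> x \<bullet> b0 \<le> T}) \<times> {1}) C (\<lambda>p :: 'a \<times> real. H (fst p))"
    using C by (rule relu_hull_subset) auto
  then have "relu_hull ((cball 0 R' \<inter> {x. 0 \<le> x \<bullet> b0 \<and> x \<bullet> b0 \<le> T}) \<times> {1}) C (\<lambda>p :: 'a \<times> real. g (fst p) * Y 0 (fst p \<bullet> b0))"
  proof (rule relu_hull_cong)
    fix p :: "'a \<times> real" assume "p \<in> (cball 0 R' \<inter> {x. 0 \<le> x \<bullet> b0 \<and> x \<bullet> b0 \<le> T}) \<times> {1}"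
    then have p: "norm (fst p) \<le> R'" "0 \<le> fst p \<bullet> b0" "fst p \<bullet> b0 \<le> T" by auto
    have "\<theta> 0 (fst p \<bullet> b) = 1" if "b \<in> Basis" for b
      using \<theta>(2) Basis_le_norm[OF that, of "fst p"] p(1) by (meson order_trans)
    then have "cut X (fst p) = Y 0 (fst p \<bullet> b0)"
      unfolding cut_def using b0 by (simp add: prod.remove[of _ b0] X_def)
    then show "g (fst p) * Y 0 (fst p \<bullet> b0) = H (fst p)" using p by (simp add: H_def hc_def)
  qed
  then show ?thesis by blast
qed

text \<open>A linear substitution passes to the inner weights through its adjoint, which changes the
  total weight by at most its norm.\<close>

lemma relu_hull_compose:
  fixes A :: "'a::euclidean_space \<Rightarrow> 'b::euclidean_space"
  assumes h: "relu_hull X C g" and adj: "\<And>v p. v \<bullet> A p = A' v \<bullet> p" and nrm: "\<And>v. norm (A' v) \<le> \<kappa> * norm v"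
    and \<kappa>: "\<kappa> \<ge> 0" and sub: "A ` Y \<subseteq> X"
  shows "relu_hull Y (\<kappa> * C) (\<lambda>p. g (A p))"
  unfolding relu_hull_def
proof (intro allI impI)
  fix e :: real assume "e > 0"
  with h obtain cs where cs: "(\<Sum>(c, v)\<leftarrow>cs. \<bar>c\<bar> * norm v) \<le> C" "\<And>p. p \<in> X \<Longrightarrow> \<bar>g p - unit_sum cs p\<bar> \<le> e"
    by (rule relu_hullD) blast
  let ?ds = "map (\<lambda>(c, v). (c, A' v)) cs"
  have "(\<Sum>(c, v)\<leftarrow>?ds. \<bar>c\<bar> * norm v) \<le> \<kappa> * (\<Sum>(c, v)\<leftarrow>cs. \<bar>c\<bar> * norm v)"
  proof (induction cs)
    case (Cons a cs)
    have "\<bar>fst a\<bar> * norm (A' (snd a)) \<le> \<kappa> * (\<bar>fst a\<bar> * norm (snd a))"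
      using mult_left_mono[OF nrm[of "snd a"], of "\<bar>fst a\<bar>"] by (simp add: mult_ac)
    then show ?case using Cons by (simp add: case_prod_unfold distrib_left)
  qed simp
  also have "\<dots> \<le> \<kappa> * C" using cs(1) \<kappa> by (rule mult_left_mono)
  finally have "(\<Sum>(c, v)\<leftarrow>?ds. \<bar>c\<bar> * norm v) \<le> \<kappa> * C" .
  moreover have "unit_sum ?ds p = unit_sum cs (A p)" for p
    unfolding unit_sum_def by (induction cs) (auto simp: adj)
  ultimately show "\<exists>cs. (\<Sum>(c, v)\<leftarrow>cs. \<bar>c\<bar> * norm v) \<le> \<kappa> * C \<and> (\<forall>p\<in>Y. \<bar>g (A p) - unit_sum cs p\<bar> \<le> e)"
    using cs(2) sub by (intro exI[of _ ?ds]) auto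
qed

lemma dilate_adjoint: "dilate b0 r v \<bullet> x = v \<bullet> dilate b0 r x"
  by (simp add: dilate_def inner_add_left inner_add_right inner_commute[of b0] mult_ac)

lemma norm_reflect_le:
  assumes "b0 \<in> Basis"
  shows "norm (dilate b0 (- 1) x) = norm x"
proof -
  have "dilate b0 (- 1) x \<bullet> dilate b0 (- 1) x = x \<bullet> dilate b0 (1 / - 1) (dilate b0 (- 1) x)"
    by (simp add: dilate_adjoint)
  also have "\<dots> = x \<bullet> x" using dilate_inverse[OF assms, of "- 1" x] by simp
  finally show ?thesis by (simp add: norm_eq)
qed

text \<open>A partition of unity in time splits the function into two parts, each of which has to be
  extended beyond one end of the time interval only.\<close>

theorem relu_hull_sobolev:
  fixes g :: "'a::euclidean_space \<Rightarrow> real"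
  assumes b0: "b0 \<in> Basis" and k: "real k > real DIM('a) / 2 + 2" and T: "T > 0" and R': "R' \<ge> 1"
    and g: "continuous_on {x. 0 \<le> x \<bullet> b0 \<and> x \<bullet> b0 \<le> T} g"
    and weak: "\<And>R. R > 0 \<Longrightarrow> pure_weak k (tbox b0 R T) (\<lambda>x. indicator (tbox b0 R T) x * g x)"
  shows "\<exists>C. relu_hull ((cball 0 R' \<inter> {x. 0 \<le> x \<bullet> b0 \<and> x \<bullet> b0 \<le> T}) \<times> {1}) C (\<lambda>p :: 'a \<times> real. g (fst p))"
proof -
  let ?S = "\<lambda>R. (cball 0 R \<inter> {x. 0 \<le> x \<bullet> b0 \<and> x \<bullet> b0 \<le> T}) \<times> {1::real}"
  obtain \<theta> where \<theta>: "deriv_seq \<theta>" "\<forall>s\<le>T / 3. \<theta> 0 s = (0::real)" "\<forall>s\<ge>2 * T / 3. \<theta> 0 s = 1"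
    using smooth_step_exists[of "T / 3" "2 * T / 3"] T by auto
  \<comment> \<open>The two parts of the partition of unity, both vanishing after time
    \<open>2 * T / 3\<close>; \<open>Y2\<close> is \<open>\<theta>\<close> in reversed time.\<close>
  define Y1 where "Y1 = (\<lambda>i s. (if i = 0 then 1 else 0) - \<theta> i s)"
  define Y2 where "Y2 = (\<lambda>i s. (- 1) ^ i *\<^sub>R \<theta> i (- 1 * s + T))"
  have Y1: "deriv_seq Y1"
    unfolding deriv_seq_def Y1_def
    using \<theta>(1) by (auto intro!: derivative_eq_intros simp: deriv_seq_def)
  have Y1s: "s \<le> 2 * T / 3" if "Y1 0 s \<noteq> 0" for s
    using that \<theta>(3) by (cases "s \<le> 2 * T / 3") (auto simp: Y1_def)
  have Y2: "deriv_seq Y2" unfolding Y2_def by (rule deriv_seq_affine[OF \<theta>(1)])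
  have Y2s: "s \<le> 2 * T / 3" if "Y2 0 s \<noteq> 0" for s
    using that \<theta>(2)[rule_format, of "T - s"] by (cases "s \<le> 2 * T / 3") (auto simp: Y2_def)
  have T1: "0 < 2 * T / 3" "2 * T / 3 < T" using T by auto
  have "R' + 2 > 0" using R' by simp
  from half_hull[OF b0 k T R' refl g weak[OF this] Y1 Y1s T1]
  obtain C1 where C1: "relu_hull (?S R') C1 (\<lambda>p :: 'a \<times> real. g (fst p) * Y1 0 (fst p \<bullet> b0))" by blast
  \<comment> \<open>Time reversal increases the norm of a point by at most \<open>T\<close>.\<close>
  define R2 where "R2 = R' + T"
  have R2: "R2 \<ge> 1" "R2 + 2 > 0" using R' T by (auto simp: R2_def)
  define g2 where "g2 x = g (reflect b0 T x)" for x
  have g2: "continuous_on {x. 0 \<le> x \<bullet> b0 \<and> x \<bullet> b0 \<le> T} g2" unfolding g2_def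
    by (rule continuous_on_compose2[OF g reflect_continuous]) (auto simp: reflect_inner b0)
  have "(\<lambda>x. indicator (tbox b0 (R2 + 2) T) (reflect b0 T x) * g (reflect b0 T x)) = (\<lambda>x. indicator (tbox b0 (R2 + 2) T) x * g2 x)"
    by (auto simp: fun_eq_iff indicator_def reflect_mem_tbox[OF b0] g2_def)
  then have w2: "pure_weak k (tbox b0 (R2 + 2) T) (\<lambda>x. indicator (tbox b0 (R2 + 2) T) x * g2 x)"
    using pure_weak_reflect[OF b0 weak[OF R2(2)]] by simp
  from half_hull[OF b0 k T R2(1) refl g2 w2 Y2 Y2s T1]
  obtain C2 where C2: "relu_hull (?S R2) C2 (\<lambda>p :: 'a \<times> real. g2 (fst p) * Y2 0 (fst p \<bullet> b0))" by blast
  \<comment> \<open>In the coordinates (x, 1) the affine time reversal is linear: the shift by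
    \<open>T\<close> is a multiple of the last coordinate. \<open>A'\<close> is its adjoint.\<close>
  define A :: "'a \<times> real \<Rightarrow> 'a \<times> real" where "A p = (dilate b0 (- 1) (fst p) + (snd p * T) *\<^sub>R b0, snd p)" for p
  define A' :: "'a \<times> real \<Rightarrow> 'a \<times> real" where "A' v = (dilate b0 (- 1) (fst v), snd v + T * (fst v \<bullet> b0))" for v
  have A1: "fst (A p) = reflect b0 T (fst p)" if "snd p = 1" for p using that by (simp add: A_def reflect_def add.commute)
  have "relu_hull (?S R') ((2 + T) * C2) (\<lambda>p. g2 (fst (A p)) * Y2 0 (fst (A p) \<bullet> b0))"
  proof (rule relu_hull_compose[OF C2])
    show "v \<bullet> A p = A' v \<bullet> p" for v p
      by (simp add: A_def A'_def inner_prod_def inner_add_right dilate_adjoint algebra_simps)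
    show "norm (A' v) \<le> (2 + T) * norm v" for v
    proof -
      have "norm (A' v) \<le> norm (dilate b0 (- 1) (fst v)) + norm (snd v + T * (fst v \<bullet> b0))"
        unfolding A'_def by (rule norm_Pair_le)
      also have "\<dots> \<le> norm (fst v) + (norm (snd v) + T * \<bar>fst v \<bullet> b0\<bar>)"
        using T norm_triangle_ineq[of "snd v" "T * (fst v \<bullet> b0)"] by (simp add: norm_reflect_le[OF b0] abs_mult)
      also have "\<dots> \<le> norm v + (norm v + T * norm v)"
        using T Basis_le_norm[OF b0, of "fst v"] norm_fst_le[of "fst v" "snd v"] norm_snd_le[of "snd v" "fst v"]
        by (intro add_mono mult_left_mono) auto
      finally show ?thesis by (simp add: algebra_simps)
    qed
    show "A ` ?S R' \<subseteq> ?S R2"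
    proof
      fix q assume "q \<in> A ` ?S R'"
      then obtain p where p: "q = A p" "norm (fst p) \<le> R'" "0 \<le> fst p \<bullet> b0" "fst p \<bullet> b0 \<le> T" "snd p = 1" by auto
      have "norm (reflect b0 T (fst p)) \<le> R2"
        using norm_triangle_ineq[of "T *\<^sub>R b0" "dilate b0 (- 1) (fst p)"] T p(2) b0
        unfolding reflect_def R2_def by (simp add: norm_reflect_le[OF b0])
      then have "fst q \<in> cball 0 R2 \<inter> {x. 0 \<le> x \<bullet> b0 \<and> x \<bullet> b0 \<le> T}" "snd q = 1"
        unfolding p(1) A1[OF p(5)] using p b0 by (auto simp: reflect_inner A_def)
      then show "q \<in> ?S R2" by (metis insertI1 mem_Times_iff)
    qed
  qed (use T in simp)
  then have "relu_hull (?S R') ((2 + T) * C2) (\<lambda>p. g (fst p) * \<theta> 0 (fst p \<bullet> b0))"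
  proof (rule relu_hull_cong)
    fix p assume "p \<in> ?S R'"
    then have "snd p = 1" by auto
    then show "g (fst p) * \<theta> 0 (fst p \<bullet> b0) = g2 (fst (A p)) * Y2 0 (fst (A p) \<bullet> b0)"
      using b0 by (simp add: A1 g2_def reflect_reflect Y2_def reflect_inner)
  qed
  from relu_hull_add[OF C1 this]
  have "relu_hull (?S R') (C1 + (2 + T) * C2) (\<lambda>p. g (fst p))"
    by (rule relu_hull_cong) (simp add: Y1_def algebra_simps)
  then show ?thesis by blast
qed

section \<open>SA-NODE networks\<close>

lemma sobolev_box_eq_tbox: "box ((\<chi> i. - R) :: real ^ 'd, 0) ((\<chi> i. R), T) = tbox (0, 1) R T"
proof -
  have "(((\<chi> i. - R) :: real ^ 'd, 0 :: real) \<bullet> b < x \<bullet> b \<and> x \<bullet> b < ((\<chi> i. R), T) \<bullet> b)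
    \<longleftrightarrow> ((if b = (0, 1) then 0 else - R) < x \<bullet> b \<and> x \<bullet> b < (if b = (0, 1) then T else R))"
    if b: "b \<in> Basis" for b x
  proof (cases "b = (0, 1)")
    case True
    then show ?thesis by (simp add: inner_prod_def)
  next
    case False
    then obtain i where "b = (axis i 1, 0)"
      using b by (auto simp: Basis_prod_def Basis_vec_def)
    then show ?thesis by (simp add: inner_prod_def inner_axis)
  qed
  then show ?thesis unfolding box_def tbox_def by blast
qed

lemma continuous_on_lipschitz_fst:
  fixes g :: "'a::real_normed_vector \<Rightarrow> 'b::metric_space \<Rightarrow> 'c::real_normed_vector"
  assumes lip: "\<And>x y t. t \<in> S \<Longrightarrow> norm (g x t - g y t) \<le> L * norm (x - y)"
    and cont: "\<And>x. continuous_on S (g x)"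
  shows "continuous_on (UNIV \<times> S) (\<lambda>p. g (fst p) (snd p))"
  unfolding continuous_on_def
proof
  fix p :: "'a \<times> 'b" assume p: "p \<in> UNIV \<times> S"
  have "((\<lambda>q. g (fst p) (snd q)) \<longlongrightarrow> g (fst p) (snd p)) (at p within UNIV \<times> S)"
  proof -
    have "continuous_on (UNIV \<times> S) (\<lambda>q::'a \<times> 'b. g (fst p) (snd q))"
      by (rule continuous_on_compose2[OF cont continuous_on_snd[OF continuous_on_id]]) auto
    then show ?thesis using p unfolding continuous_on_def by blast
  qed
  moreover have "((\<lambda>q. g (fst q) (snd q) - g (fst p) (snd q)) \<longlongrightarrow> 0) (at p within UNIV \<times> S)"
  proof (rule Lim_null_comparison)
    show "\<forall>\<^sub>F q in at p within UNIV \<times> S. norm (g (fst q) (snd q) - g (fst p) (snd q)) \<le> L * norm (fst q - fst p)"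
      using lip unfolding eventually_at_filter by (intro always_eventually) auto
    have "((\<lambda>q. L * norm (fst q - fst p)) \<longlongrightarrow> L * norm (fst p - fst p)) (at p within UNIV \<times> S)"
      by (intro tendsto_intros)
    then show "((\<lambda>q. L * norm (fst q - fst p)) \<longlongrightarrow> 0) (at p within UNIV \<times> S)" by simp
  qed
  ultimately have "((\<lambda>q. g (fst p) (snd q) + (g (fst q) (snd q) - g (fst p) (snd q))) \<longlongrightarrow> g (fst p) (snd p) + 0) (at p within UNIV \<times> S)"
    by (rule tendsto_add)
  then show "((\<lambda>q. g (fst q) (snd q)) \<longlongrightarrow> g (fst p) (snd p)) (at p within UNIV \<times> S)" by simp
qed

lemma abs_unit_sum_diff_le: "\<bar>unit_sum xs p - unit_sum xs q\<bar> \<le> (\<Sum>(s, v)\<leftarrow>xs. \<bar>s\<bar> * norm v) * norm (p - q)"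
proof (induction xs)
  case (Cons x xs)
  have "\<bar>max (snd x \<bullet> p) 0 - max (snd x \<bullet> q) 0\<bar> \<le> \<bar>snd x \<bullet> (p - q)\<bar>" by (simp add: inner_diff_right)
  also have "\<dots> \<le> norm (snd x) * norm (p - q)" by (rule Cauchy_Schwarz_ineq2)
  finally have "\<bar>fst x\<bar> * \<bar>max (snd x \<bullet> p) 0 - max (snd x \<bullet> q) 0\<bar> \<le> \<bar>fst x\<bar> * (norm (snd x) * norm (p - q))"
    by (intro mult_left_mono) auto
  then have "\<bar>fst x * max (snd x \<bullet> p) 0 - fst x * max (snd x \<bullet> q) 0\<bar> \<le> \<bar>fst x\<bar> * norm (snd x) * norm (p - q)"
    by (simp add: mult.assoc abs_mult flip: right_diff_distrib)
  then show ?case using Cons by (auto simp: case_prod_unfold distrib_right)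
qed simp

lemma unit_sum_0 [simp]: "unit_sum xs 0 = 0"
  by (induction xs) auto

text \<open>The \<open>N\<close> units obtained have weight at most \<open>C1 / N\<close> each, so
  the total weight stays bounded by \<open>D\<close>. For \<open>N = 0\<close> the empty network is
  off by at most the size of the function on the bounded set \<open>S\<close>; the rate in N + 1
  covers this case.\<close>

lemma relu_hull_finite_approx:
  fixes g :: "'a::euclidean_space \<Rightarrow> real"
  assumes h: "relu_hull S C g" and S: "S \<subseteq> cball 0 R" and R: "R \<ge> 0"
  shows "\<exists>D>0. \<forall>N. \<exists>xs. length xs = N \<and> (\<Sum>(s, v)\<leftarrow>xs. \<bar>s\<bar> * norm v) \<le> D \<and>
    (\<forall>p\<in>S. \<bar>g p - unit_sum xs p\<bar> \<le> D / sqrt (real N + 1))"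
proof -
  define C1 where "C1 = max C 1"
  have C1: "C1 > 0" "C1 \<ge> 1" and h1: "relu_hull S C1 g" using relu_hull_mono[OF h, of C1] by (auto simp: C1_def)
  define D where "D = 2 * (1 + 9 * R * C1) + C1"
  have RC: "R * C1 \<ge> 0" using R C1 by simp
  have D: "D > 0" "C1 \<le> D" using RC C1 by (auto simp: D_def)
  have "\<exists>xs. length xs = N \<and> (\<Sum>(s, v)\<leftarrow>xs. \<bar>s\<bar> * norm v) \<le> D \<and>
    (\<forall>p\<in>S. \<bar>g p - unit_sum xs p\<bar> \<le> D / sqrt (real N + 1))" for N
  proof (cases "N = 0")
    case True
    obtain cs where cs: "(\<Sum>(c, v)\<leftarrow>cs. \<bar>c\<bar> * norm v) \<le> C1" "\<And>p. p \<in> S \<Longrightarrow> \<bar>g p - unit_sum cs p\<bar> \<le> 1"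
      using relu_hullD[OF h1, of 1] by auto
    have "\<bar>g p\<bar> \<le> D" if p: "p \<in> S" for p
    proof -
      have "norm p \<le> R" using S p by auto
      then have "\<bar>unit_sum cs p\<bar> \<le> C1 * R"
        using abs_unit_sum_diff_le[of cs p 0] mult_mono[OF cs(1), of "norm p" R] C1 by simp
      then show ?thesis using cs(2)[OF p] C1 RC by (simp add: D_def mult.commute)
    qed
    then show ?thesis using True D by (intro exI[of _ "[]"]) simp
  next
    case False
    then have N: "N > 0" by simp
    then have s0: "sqrt (real N) > 0" by simp
    then obtain cs where cs: "(\<Sum>(c, v)\<leftarrow>cs. \<bar>c\<bar> * norm v) \<le> C1" "\<And>p. p \<in> S \<Longrightarrow> \<bar>g p - unit_sum cs p\<bar> \<le> 1 / sqrt N"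
      using relu_hullD[OF h1, of "1 / sqrt N"] by auto
    obtain xs where xs: "length xs = N" "\<forall>(s, v)\<in>set xs. \<bar>s\<bar> \<le> 1 \<and> norm v \<le> 1"
      and err: "\<forall>p\<in>cball 0 R. \<bar>unit_sum cs p - C1 / N * unit_sum xs p\<bar> \<le> 9 * R * C1 / sqrt N"
      using maurey_uniform[OF R C1(1) N cs(1)] by blast
    let ?ys = "map (\<lambda>(s, v). (C1 / N * s, v)) xs"
    have us: "unit_sum ?ys p = C1 / N * unit_sum xs p" for p
      by (induction xs) (auto simp: algebra_simps)
    have "(\<Sum>(s, v)\<leftarrow>?ys. \<bar>s\<bar> * norm v) \<le> C1 / N * length xs"
      using xs(2)
    proof (induction xs)
      case (Cons x xs)
      have "\<bar>fst x\<bar> * norm (snd x) \<le> 1 * 1" using Cons.prems by (intro mult_mono) auto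
      then have "C1 / N * (\<bar>fst x\<bar> * norm (snd x)) \<le> C1 / N * 1" using C1 by (intro mult_left_mono) auto
      then have "\<bar>C1 / N * fst x\<bar> * norm (snd x) \<le> C1 / N" using C1 by (simp add: abs_mult mult.assoc)
      moreover have "(\<Sum>(s, v)\<leftarrow>map (\<lambda>(s, v). (C1 / N * s, v)) xs. \<bar>s\<bar> * norm v) \<le> C1 / N * length xs"
        using Cons by auto
      ultimately show ?case by (simp add: case_prod_unfold distrib_left)
    qed simp
    then have w: "(\<Sum>(s, v)\<leftarrow>?ys. \<bar>s\<bar> * norm v) \<le> D" using xs(1) N D by simp
    have "\<bar>g p - unit_sum ?ys p\<bar> \<le> D / sqrt (real N + 1)" if p: "p \<in> S" for p
    proof -
      have "\<bar>g p - unit_sum ?ys p\<bar> \<le> \<bar>g p - unit_sum cs p\<bar> + \<bar>unit_sum cs p - C1 / N * unit_sum xs p\<bar>"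
        unfolding us by linarith
      also have "\<dots> \<le> 1 / sqrt N + 9 * R * C1 / sqrt N" using cs(2)[OF p] err S p by (intro add_mono) auto
      also have "\<dots> = (1 + 9 * R * C1) / sqrt N" by (simp add: add_divide_distrib)
      also have "\<dots> \<le> (1 + 9 * R * C1) * (2 / sqrt (real N + 1))"
      proof -
        \<comment> \<open>For \<open>N > 0\<close> passing from N to N + 1 in the rate costs at most
          a factor 2.\<close>
        have "sqrt (real N + 1) \<le> sqrt (4 * real N)" using N by (intro real_sqrt_le_mono) simp
        then have "sqrt (real N + 1) \<le> 2 * sqrt (real N)" by (simp add: real_sqrt_mult)
        then have "1 / sqrt N \<le> 2 / sqrt (real N + 1)" using s0 by (simp add: field_simps)
        then have "(1 + 9 * R * C1) * (1 / sqrt N) \<le> (1 + 9 * R * C1) * (2 / sqrt (real N + 1))"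
          using RC by (intro mult_left_mono) auto
        then show ?thesis by simp
      qed
      also have "\<dots> = 2 * (1 + 9 * R * C1) / sqrt (real N + 1)" by simp
      also have "\<dots> \<le> D / sqrt (real N + 1)" using C1 by (intro divide_right_mono) (auto simp: D_def)
      finally show ?thesis .
    qed
    then show ?thesis using w xs(1) by (intro exI[of _ ?ys]) auto
  qed
  then show ?thesis using D(1) by blast
qed

text \<open>The last coordinate 1 of the argument carries the bias. The weight bound is global and
  serves as Lipschitz constant, while the error bound is confined to the ball of radius
  \<open>R\<close>.\<close>

definition net :: "real \<Rightarrow> real \<Rightarrow> real \<Rightarrow> nat \<Rightarrow> (real ^ 'd \<Rightarrow> real \<Rightarrow> real) \<Rightarrow>
    (real \<times> ((real ^ 'd) \<times> real) \<times> real) list \<Rightarrow> bool" where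
  "net R T D N g xs \<longleftrightarrow> length xs = N \<and> (\<Sum>(s, v)\<leftarrow>xs. \<bar>s\<bar> * norm v) \<le> D \<and>
    (\<forall>x t. norm x \<le> R \<and> t \<in> {0..T} \<longrightarrow> \<bar>g x t - unit_sum xs ((x, t), 1)\<bar> \<le> D / sqrt (real N + 1))"

lemma net_mono: "net R T D N g xs \<Longrightarrow> D \<le> D' \<Longrightarrow> net R T D' N g xs"
  unfolding net_def by (meson divide_right_mono order_trans real_sqrt_ge_zero of_nat_0_le_iff add_nonneg_nonneg zero_le_one)

lemma net_exists:
  fixes g :: "real ^ 'd \<Rightarrow> real \<Rightarrow> real"
  assumes T: "T > 0" and R: "R \<ge> 1" and k: "real k > (real CARD('d) + 1) / 2 + 2"
    and g: "g \<in> sobolev_H_loc k T" and cont: "continuous_on (UNIV \<times> {0..T}) (\<lambda>p. g (fst p) (snd p))"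
  shows "\<exists>D>0. \<forall>N. \<exists>xs. net R T D N g xs"
proof -
  let ?b = "(0, 1) :: (real ^ 'd) \<times> real"
  let ?g = "\<lambda>p. g (fst p) (snd p)"
  have b: "?b \<in> Basis" by (simp add: Basis_prod_def)
  have inner: "x \<bullet> ?b = snd x" for x by (simp add: inner_prod_def)
  have dim: "real k > real DIM((real ^ 'd) \<times> real) / 2 + 2" using k by (simp add: add.commute)
  have slab: "{x. 0 \<le> x \<bullet> ?b \<and> x \<bullet> ?b \<le> T} = UNIV \<times> {0..T}" by (auto simp: inner)
  have weak: "pure_weak k (tbox ?b R T) (\<lambda>x. indicator (tbox ?b R T) x * ?g x)" if "R > 0" for R
  proof (rule sobolev_H_pure_weak[OF _ open_tbox])
    have "(\<lambda>(x, t). g x t) \<in> sobolev_H k (tbox ?b R T)"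
      using g that unfolding sobolev_H_loc_def sobolev_box_eq_tbox by blast
    then show "?g \<in> sobolev_H k (tbox ?b R T)" by (simp add: case_prod_unfold)
    have tb: "(if b = ?b then 0 else - R) < x \<bullet> b \<and> x \<bullet> b < (if b = ?b then T else R)"
      if "x \<in> tbox ?b R T" "b \<in> Basis" for x b using that unfolding tbox_def by blast
    show "tbox ?b R T \<subseteq> cube (max R T)"
    proof
      fix x assume x: "x \<in> tbox ?b R T"
      show "x \<in> cube (max R T)" unfolding cube_def
      proof (intro CollectI ballI)
        fix b :: "(real ^ 'd) \<times> real" assume "b \<in> Basis"
        from tb[OF x this] show "\<bar>x \<bullet> b\<bar> \<le> max R T" by (auto split: if_splits)
      qed
    qed
    have "tbox ?b R T \<subseteq> UNIV \<times> {0..T}"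
    proof
      fix x assume x: "x \<in> tbox ?b R T"
      show "x \<in> UNIV \<times> {0..T}" using tb[OF x b] by (auto simp: inner mem_Times_iff)
    qed
    then show "continuous_on (tbox ?b R T) ?g" by (rule continuous_on_subset[OF cont])
  qed
  \<comment> \<open>The norm of \<open>(x, t)\<close> is at most \<open>R + T\<close>.\<close>
  define R' where "R' = R + T"
  have R': "R' \<ge> 1" using R T by (simp add: R'_def)
  obtain C where C: "relu_hull ((cball 0 R' \<inter> {x. 0 \<le> x \<bullet> ?b \<and> x \<bullet> ?b \<le> T}) \<times> {1::real}) C (\<lambda>p. ?g (fst p))"
    using relu_hull_sobolev[OF b dim T R' cont[folded slab] weak] by blast
  have "(cball 0 R' \<inter> {x. 0 \<le> x \<bullet> ?b \<and> x \<bullet> ?b \<le> T}) \<times> {1::real} \<subseteq> cball 0 (R' + 1)"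
  proof
    fix p assume p: "p \<in> (cball 0 R' \<inter> {x. 0 \<le> x \<bullet> ?b \<and> x \<bullet> ?b \<le> T}) \<times> {1::real}"
    then have "norm p \<le> norm (fst p) + norm (snd p)" using norm_Pair_le[of "fst p" "snd p"] by simp
    then show "p \<in> cball 0 (R' + 1)" using p by auto
  qed
  then obtain D where D: "D > 0" and xs: "\<And>N. \<exists>xs. length xs = N \<and> (\<Sum>(s, v)\<leftarrow>xs. \<bar>s\<bar> * norm v) \<le> D \<and>
    (\<forall>p\<in>(cball 0 R' \<inter> {x. 0 \<le> x \<bullet> ?b \<and> x \<bullet> ?b \<le> T}) \<times> {1::real}. \<bar>?g (fst p) - unit_sum xs p\<bar> \<le> D / sqrt (real N + 1))"
    using relu_hull_finite_approx[OF C, of "R' + 1"] R' by auto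
  have "\<exists>xs. net R T D N g xs" for N
  proof -
    obtain xs where l: "length xs = N" "(\<Sum>(s, v)\<leftarrow>xs. \<bar>s\<bar> * norm v) \<le> D"
      and e: "\<And>p. p \<in> (cball 0 R' \<inter> {x. 0 \<le> x \<bullet> ?b \<and> x \<bullet> ?b \<le> T}) \<times> {1::real} \<Longrightarrow> \<bar>?g (fst p) - unit_sum xs p\<bar> \<le> D / sqrt (real N + 1)"
      using xs[of N] by blast
    have "\<bar>g x t - unit_sum xs ((x, t), 1)\<bar> \<le> D / sqrt (real N + 1)" if "norm x \<le> R" "t \<in> {0..T}" for x t
    proof -
      have "norm (x, t) \<le> R'" using norm_Pair_le[of x t] that by (simp add: R'_def)
      then show ?thesis using e[of "((x, t), 1)"] that(2) by (simp add: inner_prod_def)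
    qed
    then show ?thesis using l unfolding net_def by blast
  qed
  then show ?thesis using D by blast
qed

text \<open>Row \<open>i\<close> of a neuron acts on component \<open>i\<close> only, so
  \<open>CARD('d)\<close> scalar networks of width \<open>P\<close> run in parallel in the same
  \<open>P\<close> neurons.\<close>

lemma sa_node_f_realize:
  fixes xs :: "'d \<Rightarrow> (real \<times> ((real ^ 'd) \<times> real) \<times> real) list"
  assumes "\<And>i. length (xs i) = P"
  shows "\<exists>\<Theta> :: (real ^ 'd, 'd) neuron list. length \<Theta> = P \<and> (\<forall>y t i. sa_node_f \<Theta> y t $ i = unit_sum (xs i) ((y, t), 1))"
  using assms
proof (induction P arbitrary: xs)
  case 0
  then show ?case by (intro exI[of _ "[]"]) (simp add: sa_node_f_def)
next
  case (Suc P)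
  have ne: "xs i = hd (xs i) # tl (xs i)" for i using Suc.prems[of i] by (cases "xs i") auto
  have "length (tl (xs i)) = P" for i using Suc.prems[of i] by simp
  from Suc.IH[of "\<lambda>i. tl (xs i)", OF this] obtain \<Theta> :: "(real ^ 'd, 'd) neuron list"
    where \<Theta>: "length \<Theta> = P" "\<And>y t i. sa_node_f \<Theta> y t $ i = unit_sum (tl (xs i)) ((y, t), 1)" by blast
  let ?n = "((\<chi> i. fst (hd (xs i))), (\<chi> i. fst (fst (snd (hd (xs i))))), (\<chi> i. snd (fst (snd (hd (xs i))))),
    (\<chi> i. snd (snd (hd (xs i))))) :: (real ^ 'd, 'd) neuron"
  have "sa_node_f (?n # \<Theta>) y t $ i = unit_sum (xs i) ((y, t), 1)" for y t i
  proof -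
    have "sa_node_f (?n # \<Theta>) y t $ i = fst (hd (xs i)) * max (snd (hd (xs i)) \<bullet> ((y, t), 1)) 0 + sa_node_f \<Theta> y t $ i"
      by (simp add: sa_node_f_def relu_def matrix_vector_mul_component inner_prod_def mult.commute)
    also have "\<dots> = unit_sum (hd (xs i) # tl (xs i)) ((y, t), 1)" by (simp add: \<Theta>(2))
    finally show ?thesis using ne[of i] by simp
  qed
  then show ?case using \<Theta>(1) by (intro exI[of _ "?n # \<Theta>"]) simp
qed

text \<open>Each entry in a given column gets its own block of neurons; a neuron of the block of a column has
  a weight matrix that vanishes outside this column.\<close>

lemma sa_node_G_realize_column:
  fixes xs :: "'d \<Rightarrow> (real \<times> ((real ^ 'd) \<times> real) \<times> real) list" and j :: "'m::finite"
  assumes "\<And>i. length (xs i) = q"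
  shows "\<exists>\<Phi> :: (real ^ 'm ^ 'd, 'd) neuron list. length \<Phi> = q \<and>
    (\<forall>y t i l. sa_node_G \<Phi> y t $ i $ l = (if l = j then unit_sum (xs i) ((y, t), 1) else 0))"
  using assms
proof (induction q arbitrary: xs)
  case 0
  then show ?case by (intro exI[of _ "[]"]) (simp add: sa_node_G_def)
next
  case (Suc P)
  have ne: "xs i = hd (xs i) # tl (xs i)" for i using Suc.prems[of i] by (cases "xs i") auto
  have "length (tl (xs i)) = P" for i using Suc.prems[of i] by simp
  from Suc.IH[of "\<lambda>i. tl (xs i)", OF this] obtain \<Phi> :: "(real ^ 'm ^ 'd, 'd) neuron list"
    where \<Phi>: "length \<Phi> = P"
      "\<And>y t i l. sa_node_G \<Phi> y t $ i $ l = (if l = j then unit_sum (tl (xs i)) ((y, t), 1) else 0)" by blast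
  let ?n = "((\<chi> i l. if l = j then fst (hd (xs i)) else 0), (\<chi> i. fst (fst (snd (hd (xs i))))),
    (\<chi> i. snd (fst (snd (hd (xs i))))), (\<chi> i. snd (snd (hd (xs i))))) :: (real ^ 'm ^ 'd, 'd) neuron"
  have "sa_node_G (?n # \<Phi>) y t $ i $ l = (if l = j then unit_sum (xs i) ((y, t), 1) else 0)" for y t i l
  proof -
    have "sa_node_G (?n # \<Phi>) y t $ i $ l = (if l = j then fst (hd (xs i)) else 0) * max (snd (hd (xs i)) \<bullet> ((y, t), 1)) 0 + sa_node_G \<Phi> y t $ i $ l"
      by (simp add: sa_node_G_def hadamard_rows_def relu_def matrix_vector_mul_component inner_prod_def mult.commute)
    also have "\<dots> = (if l = j then unit_sum (hd (xs i) # tl (xs i)) ((y, t), 1) else 0)" by (simp add: \<Phi>(2))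
    finally show ?thesis using ne[of i] by simp
  qed
  then show ?case using \<Phi>(1) by (intro exI[of _ "?n # \<Phi>"]) simp
qed

lemma sa_node_G_append: "sa_node_G (\<Phi> @ \<Psi>) y t = sa_node_G \<Phi> y t + sa_node_G \<Psi> y t"
  by (simp add: sa_node_G_def)

text \<open>All columns see the same activation, so their blocks are placed one after another and
  each gets a share of the width; zero neurons fill the remainder.\<close>

lemma sa_node_G_realize:
  fixes xs :: "'d \<Rightarrow> 'm::finite \<Rightarrow> (real \<times> ((real ^ 'd) \<times> real) \<times> real) list"
  assumes len: "\<And>i j. length (xs i j) = q" and Q: "CARD('m) * q \<le> Q"
  shows "\<exists>\<Phi> :: (real ^ 'm ^ 'd, 'd) neuron list. length \<Phi> = Q \<and>
    (\<forall>y t i l. sa_node_G \<Phi> y t $ i $ l = unit_sum (xs i l) ((y, t), 1))"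
proof -
  have "\<exists>\<Phi> :: (real ^ 'm ^ 'd, 'd) neuron list. length \<Phi> = card J * q \<and>
    (\<forall>y t i l. sa_node_G \<Phi> y t $ i $ l = (if l \<in> J then unit_sum (xs i l) ((y, t), 1) else 0))" if "finite J" for J
    using that
  proof (induction J rule: finite_induct)
    case empty
    then show ?case by (intro exI[of _ "[]"]) (simp add: sa_node_G_def)
  next
    case (insert j J)
    obtain \<Phi> :: "(real ^ 'm ^ 'd, 'd) neuron list" where \<Phi>: "length \<Phi> = card J * q"
      "\<And>y t i l. sa_node_G \<Phi> y t $ i $ l = (if l \<in> J then unit_sum (xs i l) ((y, t), 1) else 0)"
      using insert.IH by blast
    obtain \<Psi> :: "(real ^ 'm ^ 'd, 'd) neuron list" where \<Psi>: "length \<Psi> = q"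
      "\<And>y t i l. sa_node_G \<Psi> y t $ i $ l = (if l = j then unit_sum (xs i j) ((y, t), 1) else 0)"
      using sa_node_G_realize_column[of "\<lambda>i. xs i j" q j] len by blast
    have "sa_node_G (\<Psi> @ \<Phi>) y t $ i $ l = (if l \<in> insert j J then unit_sum (xs i l) ((y, t), 1) else 0)" for y t i l
      using insert.hyps by (auto simp: sa_node_G_append \<Phi>(2) \<Psi>(2))
    then show ?case using \<Phi>(1) \<Psi>(1) insert.hyps by (intro exI[of _ "\<Psi> @ \<Phi>"]) simp
  qed
  from this[of UNIV] obtain \<Phi> :: "(real ^ 'm ^ 'd, 'd) neuron list" where \<Phi>: "length \<Phi> = CARD('m) * q"
    "\<And>y t i l. sa_node_G \<Phi> y t $ i $ l = unit_sum (xs i l) ((y, t), 1)" by auto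
  let ?Z = "replicate (Q - CARD('m) * q) (0, 0, 0, 0) :: (real ^ 'm ^ 'd, 'd) neuron list"
  have "sa_node_G (replicate n (0, 0, 0, 0) :: (real ^ 'm ^ 'd, 'd) neuron list) y t = 0" for n y t
    by (induction n) (auto simp: sa_node_G_def hadamard_rows_def vec_eq_iff)
  then have "sa_node_G (\<Phi> @ ?Z) y t $ i $ l = unit_sum (xs i l) ((y, t), 1)" for y t i l
    by (simp add: sa_node_G_append \<Phi>(2))
  then show ?thesis using \<Phi>(1) Q by (intro exI[of _ "\<Phi> @ ?Z"]) simp
qed

section \<open>Controlled SA-NODEs\<close>

lemma norm_matrix_vector_mult_le:
  fixes A :: "real ^ 'm ^ 'd"
  assumes "\<And>i j. \<bar>A $ i $ j\<bar> \<le> b"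
  shows "norm (A *v u) \<le> real CARD('d) * real CARD('m) * b * norm u"
proof -
  have "\<bar>(A *v u) $ i\<bar> \<le> real CARD('m) * b * norm u" for i
  proof -
    have "\<bar>(A *v u) $ i\<bar> \<le> (\<Sum>j\<in>UNIV. \<bar>A $ i $ j * u $ j\<bar>)"
      unfolding matrix_vector_mult_def by (simp add: sum_abs)
    also have "\<dots> \<le> (\<Sum>j\<in>(UNIV :: 'm set). b * norm u)"
      unfolding abs_mult using assms order_trans[OF abs_ge_zero assms]
      by (intro sum_mono mult_mono component_le_norm_cart) auto
    finally show ?thesis by simp
  qed
  then have "(\<Sum>i\<in>UNIV. \<bar>(A *v u) $ i\<bar>) \<le> (\<Sum>i\<in>(UNIV :: 'd set). real CARD('m) * b * norm u)" by (intro sum_mono)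
  then show ?thesis using norm_le_l1_cart[of "A *v u"] by simp
qed

lemma abs_entry_le_op_norm: "\<bar>A $ i $ j\<bar> \<le> op_norm A"
proof -
  have "norm (A *v axis j 1) \<le> onorm ((*v) A) * norm (axis j (1::real))"
    by (rule onorm) simp
  moreover have "(A *v axis j 1) $ i = A $ i $ j" by (simp add: matrix_vector_mult_basis column_def)
  ultimately show ?thesis using component_le_norm_cart[of "A *v axis j 1" i] by (simp add: op_norm_def)
qed

lemma continuous_on_unit_sum: "continuous_on A (unit_sum xs)"
  by (induction xs) (auto intro!: continuous_intros simp: unit_sum_simps[abs_def] simp del: unit_sum_simps)

text \<open>The ReLU is 1-Lipschitz, so the total weight bounds the slope on the whole space. This
  global validity matters for trajectories of the network that leave the ball.\<close>

lemma net_lipschitz: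
  assumes "net R T D N g xs"
  shows "\<bar>unit_sum xs ((x, t), 1) - unit_sum xs ((y, t), 1)\<bar> \<le> D * norm (x - y)"
proof -
  have "\<bar>unit_sum xs ((x, t), 1) - unit_sum xs ((y, t), 1)\<bar> \<le> (\<Sum>(s, v)\<leftarrow>xs. \<bar>s\<bar> * norm v) * norm (((x, t), 1::real) - ((y, t), 1))"
    by (rule abs_unit_sum_diff_le)
  also have "norm (((x, t), 1::real) - ((y, t), 1)) = norm (x - y)" by (simp add: norm_Pair)
  also have "(\<Sum>(s, v)\<leftarrow>xs. \<bar>s\<bar> * norm v) * norm (x - y) \<le> D * norm (x - y)"
    using assms by (intro mult_right_mono) (auto simp: net_def)
  finally show ?thesis .
qed

lemma sa_node_f_approx:
  fixes f :: "real ^ 'd \<Rightarrow> real \<Rightarrow> real ^ 'd"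
  assumes D: "\<And>i. \<forall>N. \<exists>xs. net R T D N (\<lambda>x t. f x t $ i) xs"
  obtains \<Theta> :: "(real ^ 'd, 'd) neuron list" where "length \<Theta> = P"
    "\<And>x y t. norm (sa_node_f \<Theta> x t - sa_node_f \<Theta> y t) \<le> real CARD('d) * D * norm (x - y)"
    "\<And>x t. norm x \<le> R \<Longrightarrow> t \<in> {0..T} \<Longrightarrow> norm (f x t - sa_node_f \<Theta> x t) \<le> real CARD('d) * (D / sqrt (real P + 1))"
    "continuous_on UNIV (\<lambda>p. sa_node_f \<Theta> (fst p) (snd p))"
proof -
  have "\<forall>i. \<exists>xs. net R T D P (\<lambda>x t. f x t $ i) xs" using D by blast
  then obtain xs where xs: "\<And>i. net R T D P (\<lambda>x t. f x t $ i) (xs i)" using choice[of "\<lambda>i xs. net R T D P (\<lambda>x t. f x t $ i) xs"] by blast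
  then have "length (xs i) = P" for i by (simp add: net_def)
  from sa_node_f_realize[of xs P, OF this] obtain \<Theta> :: "(real ^ 'd, 'd) neuron list"
    where \<Theta>: "length \<Theta> = P" "\<And>y t i. sa_node_f \<Theta> y t $ i = unit_sum (xs i) ((y, t), 1)" by blast
  have l1: "norm v \<le> real CARD('d) * b" if "\<And>i. \<bar>v $ i\<bar> \<le> b" for v :: "real ^ 'd" and b
  proof -
    have "(\<Sum>i\<in>UNIV. \<bar>v $ i\<bar>) \<le> (\<Sum>i\<in>(UNIV :: 'd set). b)" by (intro sum_mono that)
    then show ?thesis using norm_le_l1_cart[of v] by simp
  qed
  show ?thesis
  proof (rule that[OF \<Theta>(1)])
    show "norm (sa_node_f \<Theta> x t - sa_node_f \<Theta> y t) \<le> real CARD('d) * D * norm (x - y)" for x y t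
      using l1[of "sa_node_f \<Theta> x t - sa_node_f \<Theta> y t" "D * norm (x - y)"] net_lipschitz[OF xs] by (simp add: \<Theta>(2))
    show "norm (f x t - sa_node_f \<Theta> x t) \<le> real CARD('d) * (D / sqrt (real P + 1))" if "norm x \<le> R" "t \<in> {0..T}" for x t
    proof (rule l1)
      show "\<bar>(f x t - sa_node_f \<Theta> x t) $ i\<bar> \<le> D / sqrt (real P + 1)" for i
        using xs[of i] that by (simp add: net_def \<Theta>(2))
    qed
    have "continuous_on UNIV (\<lambda>p. \<chi> i. sa_node_f \<Theta> (fst p) (snd p) $ i)"
      unfolding \<Theta>(2)
      by (intro continuous_on_vec_lambda continuous_on_compose2[OF continuous_on_unit_sum[of UNIV]] continuous_intros) auto
    then show "continuous_on UNIV (\<lambda>p. sa_node_f \<Theta> (fst p) (snd p))" by simp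
  qed
qed

lemma sa_node_G_approx:
  fixes G :: "real ^ 'd \<Rightarrow> real \<Rightarrow> real ^ 'm ^ 'd"
  assumes D: "\<And>i j. \<forall>N. \<exists>xs. net R T D N (\<lambda>x t. G x t $ i $ j) xs" and D0: "D > 0" and Q: "Q > 0"
  obtains \<Phi> :: "(real ^ 'm ^ 'd, 'd) neuron list" where "length \<Phi> = Q"
    "\<And>x y t i j. \<bar>(sa_node_G \<Phi> x t - sa_node_G \<Phi> y t) $ i $ j\<bar> \<le> D * norm (x - y)"
    "\<And>x t i j. norm x \<le> R \<Longrightarrow> t \<in> {0..T} \<Longrightarrow> \<bar>(G x t - sa_node_G \<Phi> x t) $ i $ j\<bar> \<le> real CARD('m) * D / sqrt (real Q)"
    "continuous_on UNIV (\<lambda>p. sa_node_G \<Phi> (fst p) (snd p))"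
proof -
  \<comment> \<open>The share of one column, which is 0 if \<open>Q\<close> is smaller than the
    number of columns.\<close>
  define q where "q = Q div CARD('m)"
  have "\<forall>p. \<exists>xs. net R T D q (\<lambda>x t. G x t $ fst p $ snd p) xs" using D by blast
  then obtain ys where "\<forall>p. net R T D q (\<lambda>x t. G x t $ fst p $ snd p) (ys p)"
    by (rule choice[THEN exE])
  then have xs: "net R T D q (\<lambda>x t. G x t $ i $ j) (ys (i, j))" for i j by (drule_tac spec[of _ "(i, j)"]) simp
  then have len: "length (ys (i, j)) = q" for i j by (simp add: net_def)
  have "CARD('m) * q \<le> Q" by (simp add: q_def)
  from sa_node_G_realize[of "\<lambda>i j. ys (i, j)" q, OF len this] obtain \<Phi> :: "(real ^ 'm ^ 'd, 'd) neuron list"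
    where \<Phi>: "length \<Phi> = Q" "\<And>y t i j. sa_node_G \<Phi> y t $ i $ j = unit_sum (ys (i, j)) ((y, t), 1)" by blast
  have le: "D / sqrt (real q + 1) \<le> real CARD('m) * D / sqrt (real Q)"
  proof -
    \<comment> \<open>The division loses less than one full round of columns, so the rate in
      \<open>q + 1\<close> is the rate in \<open>Q\<close> up to a factor depending on the number of
      columns.\<close>
    have "Q < CARD('m) * (q + 1)" unfolding q_def
      by (metis add.commute dividend_less_times_div mult.commute mult_Suc plus_1_eq_Suc zero_less_card_finite)
    then have "Q \<le> CARD('m) * (q + 1)" by simp
    then have "real Q \<le> real (CARD('m) * (q + 1))" by (simp only: of_nat_le_iff)
    then have "real Q \<le> real CARD('m) * (real q + 1)" by (simp add: distrib_left)
    then have "sqrt (real Q) \<le> sqrt (real CARD('m)) * sqrt (real q + 1)"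
      using real_sqrt_le_mono[of "real Q" "real CARD('m) * (real q + 1)"] by (simp only: real_sqrt_mult)
    also have "sqrt (real CARD('m)) \<le> real CARD('m)"
    proof -
      have "1 \<le> real CARD('m)" using zero_less_card_finite[where 'a = 'm] by linarith
      then have "1 * real CARD('m) \<le> real CARD('m) * real CARD('m)" by (intro mult_right_mono) auto
      then show ?thesis by (intro real_le_lsqrt) (auto simp: power2_eq_square)
    qed
    then have "sqrt (real CARD('m)) * sqrt (real q + 1) \<le> real CARD('m) * sqrt (real q + 1)" by (intro mult_right_mono) auto
    finally have "sqrt (real Q) \<le> real CARD('m) * sqrt (real q + 1)" .
    then have "D * sqrt (real Q) \<le> D * (real CARD('m) * sqrt (real q + 1))" using D0 by (intro mult_left_mono) auto
    then show ?thesis using Q by (simp add: field_simps add_pos_nonneg)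
  qed
  show ?thesis
  proof (rule that[OF \<Phi>(1)])
    show "\<bar>(sa_node_G \<Phi> x t - sa_node_G \<Phi> y t) $ i $ j\<bar> \<le> D * norm (x - y)" for x y t i j
      using net_lipschitz[OF xs] by (simp add: \<Phi>(2))
    show "\<bar>(G x t - sa_node_G \<Phi> x t) $ i $ j\<bar> \<le> real CARD('m) * D / sqrt (real Q)" if "norm x \<le> R" "t \<in> {0..T}" for x t i j
    proof -
      have "\<bar>(G x t - sa_node_G \<Phi> x t) $ i $ j\<bar> \<le> D / sqrt (real q + 1)"
        using xs[of i j] that by (simp add: net_def \<Phi>(2))
      then show ?thesis using le by linarith
    qed
    have "continuous_on UNIV (\<lambda>p. \<chi> i j. sa_node_G \<Phi> (fst p) (snd p) $ i $ j)"
      unfolding \<Phi>(2)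
      by (intro continuous_on_vec_lambda continuous_on_compose2[OF continuous_on_unit_sum[of UNIV]] continuous_intros) auto
    then show "continuous_on UNIV (\<lambda>p. sa_node_G \<Phi> (fst p) (snd p))" by simp
  qed
qed

text \<open>The bound on a control holds only almost everywhere and only on the open interval. The
  representative is set to 0 where the bound fails and at both ends, which changes it on a null
  set.\<close>

lemma truncated_control:
  fixes u :: "real \<Rightarrow> real ^ 'm"
  assumes u: "u \<in> controls T M" and M: "M > 0"
  obtains v where "v \<in> borel_measurable (lebesgue_on {0..T})" "\<And>t. norm (v t) \<le> M"
    "AE t in lebesgue_on {0..T}. v t = u t"
proof -
  define w where "w t = (if t \<in> {0<..<T} then u t else 0)" for t
  define v where "v t = (if norm (w t) \<le> M then w t else 0)" for t
  have um: "u \<in> borel_measurable (lebesgue_on {0<..<T})"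
    and es: "esssup (lebesgue_on {0<..<T}) (\<lambda>t. ereal (norm (u t))) \<le> ereal M" using u by (auto simp: controls_def)
  have "w \<in> borel_measurable lebesgue"
    unfolding w_def[abs_def] using um by (intro borel_measurable_if_I) auto
  then have "v \<in> borel_measurable lebesgue" unfolding v_def[abs_def] by measurable
  then have vm: "v \<in> borel_measurable (lebesgue_on {0..T})" by (rule measurable_restrict_space1)
  have "AE t in lebesgue_on {0<..<T}. norm (u t) \<le> M"
    using esssup_AE[of "\<lambda>t. ereal (norm (u t))" "lebesgue_on {0<..<T}"]
  proof eventually_elim
    case (elim t)
    then have "ereal (norm (u t)) \<le> ereal M" using es by (rule order_trans)
    then show ?case by simp
  qed
  then have "AE t in lebesgue. t \<in> {0<..<T} \<longrightarrow> norm (u t) \<le> M"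
    by (subst (asm) AE_restrict_space_iff) auto
  moreover have "AE t in lebesgue. t \<notin> {0, T}"
    by (intro AE_not_in) (simp add: negligible_iff_null_sets[symmetric])
  ultimately have "AE t in lebesgue. t \<in> {0..T} \<longrightarrow> v t = u t"
    by eventually_elim (auto simp: v_def w_def)
  then have "AE t in lebesgue_on {0..T}. v t = u t"
    by (subst AE_restrict_space_iff) auto
  then show ?thesis using that[OF vm] M by (auto simp: v_def)
qed

text \<open>Two fields at two points, so that one estimate gives Lipschitz constants (same field),
  bounds at 0 (second field zero) and approximation errors (same point).\<close>

lemma controlled_field_diff_le:
  fixes G H :: "(real ^ 'd) \<Rightarrow> real \<Rightarrow> real ^ 'm ^ 'd"
  assumes f: "norm (f x t - h y t) \<le> a" and G: "\<And>i j. \<bar>(G x t - H y t) $ i $ j\<bar> \<le> b" and u: "norm (u t) \<le> M"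
  shows "norm (controlled_field f G u x t - controlled_field h H u y t) \<le> a + real CARD('d) * real CARD('m) * b * M"
proof -
  have b0: "b \<ge> 0" using order_trans[OF abs_ge_zero G] .
  have "controlled_field f G u x t - controlled_field h H u y t = (f x t - h y t) + (G x t - H y t) *v u t"
    by (simp add: controlled_field_def matrix_vector_mult_diff_rdistrib)
  also have "norm \<dots> \<le> a + real CARD('d) * real CARD('m) * b * norm (u t)"
    by (rule norm_triangle_le) (intro add_mono f norm_matrix_vector_mult_le G)
  also have "\<dots> \<le> a + real CARD('d) * real CARD('m) * b * M"
    using u b0 by (intro add_left_mono mult_left_mono) auto
  finally show ?thesis .
qed

text \<open>Applied both to the given system and to its network. Along a continuous curve the
  coefficients are continuous in time and the control is measurable, so the field is measurable;
  being bounded there, it is integrable.\<close>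

lemma carath_controlled_field:
  fixes f :: "(real ^ 'd) \<Rightarrow> real \<Rightarrow> real ^ 'd" and G :: "(real ^ 'd) \<Rightarrow> real \<Rightarrow> real ^ 'm ^ 'd"
  assumes f: "continuous_on (UNIV \<times> {0..T}) (\<lambda>p. f (fst p) (snd p))"
    and G: "continuous_on (UNIV \<times> {0..T}) (\<lambda>p. G (fst p) (snd p))"
    and lf: "\<And>x y t. t \<in> {0..T} \<Longrightarrow> norm (f x t - f y t) \<le> Lf * norm (x - y)"
    and lG: "\<And>x y t i j. t \<in> {0..T} \<Longrightarrow> \<bar>(G x t - G y t) $ i $ j\<bar> \<le> Lg * norm (x - y)"
    and bf: "\<And>t. t \<in> {0..T} \<Longrightarrow> norm (f 0 t) \<le> Bf"
    and bG: "\<And>t i j. t \<in> {0..T} \<Longrightarrow> \<bar>G 0 t $ i $ j\<bar> \<le> Bg"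
    and L: "Lf > 0" "Lg > 0" and M: "M > 0"
    and u: "u \<in> borel_measurable (lebesgue_on {0..T})" "\<And>t. norm (u t) \<le> M"
  shows "carath T (Lf + real CARD('d) * real CARD('m) * Lg * M) (Bf + real CARD('d) * real CARD('m) * Bg * M) (controlled_field f G u)"
    (is "carath T ?L ?B ?F")
proof -
  have lip: "norm (?F x t - ?F y t) \<le> ?L * norm (x - y)" if "t \<in> {0..T}" for x y t
    using controlled_field_diff_le[where x = x and y = y and t = t and f = f and h = f and G = G and H = G and u = u, OF lf[OF that] lG[OF that] u(2)] by (simp add: algebra_simps)
  have bd: "norm (?F 0 t) \<le> ?B" if t: "t \<in> {0..T}" for t
    using controlled_field_diff_le[where x = 0 and y = 0 and t = t and f = f and h = "\<lambda>_ _. 0" and G = G and H = "\<lambda>_ _. 0"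
      and a = Bf and b = Bg and u = u and M = M] bf[OF t] bG[OF t] u(2)
    by (simp add: controlled_field_def)
  have L0: "?L > 0" using L M by (simp add: add_pos_nonneg)
  have "(\<lambda>t. ?F (z t) t) integrable_on {0..T}" if z: "continuous_on {0..T} z" for z
  proof -
    have zt: "continuous_on {0..T} (\<lambda>t. (z t, t))" by (intro continuous_intros z)
    have "continuous_on {0..T} (\<lambda>t. f (z t) t)" "continuous_on {0..T} (\<lambda>t. G (z t) t)"
      using continuous_on_compose2[OF f zt] continuous_on_compose2[OF G zt] by (simp_all add: image_subset_iff)
    then have m: "(\<lambda>t. f (z t) t) \<in> borel_measurable (lebesgue_on {0..T})" "(\<lambda>t. G (z t) t) \<in> borel_measurable (lebesgue_on {0..T})"
      by (auto intro: continuous_imp_measurable_on_sets_lebesgue)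
    have "continuous_on UNIV (\<lambda>x :: (real ^ 'm ^ 'd) \<times> (real ^ 'm). fst x *v snd x)"
      unfolding matrix_vector_mult_def by (intro continuous_on_vec_lambda continuous_intros)
    then have "(\<lambda>t. G (z t) t *v u t) \<in> borel_measurable (lebesgue_on {0..T})"
      by (rule borel_measurable_continuous_Pair[OF m(2) u(1)])
    with m(1) have Fm: "(\<lambda>t. ?F (z t) t) \<in> borel_measurable (lebesgue_on {0..T})"
      unfolding controlled_field_def by (rule borel_measurable_add)
    have "bounded (z ` {0..T})" by (intro compact_imp_bounded compact_continuous_image z) simp
    then obtain Z where Z: "\<And>t. t \<in> {0..T} \<Longrightarrow> norm (z t) \<le> Z" unfolding bounded_iff by blast
    have "norm (?F (z t) t) \<le> ?B + ?L * Z" if t: "t \<in> {0..T}" for t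
    proof -
      have "norm (?F (z t) t) \<le> norm (?F 0 t) + norm (?F (z t) t - ?F 0 t)" using norm_triangle_sub by blast
      also have "\<dots> \<le> ?B + ?L * norm (z t)" using bd[OF t] lip[OF t, of "z t" 0] by simp
      also have "\<dots> \<le> ?B + ?L * Z" using Z[OF t] L0 by (intro add_left_mono mult_left_mono) auto
      finally show ?thesis .
    qed
    then show ?thesis
      by (intro measurable_bounded_by_integrable_imp_integrable[OF Fm, where g = "\<lambda>_. ?B + ?L * Z"]) auto
  qed
  then show ?thesis unfolding carath_def using lip bd L0 by blast
qed

lemma bounded_at_0:
  fixes g :: "'a::real_normed_vector \<Rightarrow> real \<Rightarrow> 'b::real_normed_vector"
  assumes g: "continuous_on (UNIV \<times> {0..T}) (\<lambda>p. g (fst p) (snd p))"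
  shows "\<exists>B. \<forall>t\<in>{0..T}. norm (g 0 t) \<le> B"
proof -
  have "continuous_on {0..T} (\<lambda>t. (0 :: 'a, t))" by (intro continuous_intros)
  then have "continuous_on {0..T} (\<lambda>t. g 0 t)" using continuous_on_compose2[OF g, of _ "\<lambda>t. (0, t)"] by auto
  then have "bounded (g 0 ` {0..T})" by (intro compact_imp_bounded compact_continuous_image) auto
  then show ?thesis unfolding bounded_iff by blast
qed

lemma common_net_bound:
  fixes g :: "'i::finite \<Rightarrow> real ^ 'd \<Rightarrow> real \<Rightarrow> real"
  assumes "\<And>i. \<exists>D>0. \<forall>N. \<exists>xs. net R T D N (g i) xs"
  shows "\<exists>D>0. \<forall>i N. \<exists>xs. net R T D N (g i) xs"
proof -
  have "\<forall>i. \<exists>D>0. \<forall>N. \<exists>xs. net R T D N (g i) xs" using assms by blast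
  then obtain D where D: "\<And>i. D i > 0" "\<And>i N. \<exists>xs. net R T (D i) N (g i) xs"
    using choice[of "\<lambda>i D. D > 0 \<and> (\<forall>N. \<exists>xs. net R T D N (g i) xs)"] by blast
  have "D i \<le> (\<Sum>i\<in>UNIV. D i)" for i using D(1) by (intro member_le_sum) (auto intro: less_imp_le)
  then have "\<exists>xs. net R T (\<Sum>i\<in>UNIV. D i) N (g i) xs" for i N using D(2) net_mono by blast
  moreover have "(\<Sum>i\<in>UNIV. D i) > 0" using D(1) by (intro sum_pos) auto
  ultimately show ?thesis by blast
qed

theorem theorem4p8:
  fixes f :: "(real ^ 'd) \<Rightarrow> real \<Rightarrow> real ^ 'd"
    and G :: "(real ^ 'd) \<Rightarrow> real \<Rightarrow> real ^ 'm ^ 'd"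
    and T M L\<^sub>f L\<^sub>G :: real
    and k :: nat
    and K :: "(real ^ 'd) set"
  assumes "T > 0" and "M > 0"
    and "\<And>x. continuous_on {0..T} (\<lambda>t. f x t)"
    and "\<And>x. continuous_on {0..T} (\<lambda>t. G x t)"
    and "L\<^sub>f > 0" and "L\<^sub>G > 0"
    and "\<And>x y t. t \<in> {0..T} \<Longrightarrow> norm (f x t - f y t) \<le> L\<^sub>f * norm (x - y)"
    and "\<And>x y t. t \<in> {0..T} \<Longrightarrow> op_norm (G x t - G y t) \<le> L\<^sub>G * norm (x - y)"
    and "real k > (real CARD('d) + 1) / 2 + 2"
    and "\<And>i. (\<lambda>x t. f x t $ i) \<in> sobolev_H_loc k T"
    and "\<And>i j. (\<lambda>x t. G x t $ i $ j) \<in> sobolev_H_loc k T"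
    and "compact K"
  shows "\<exists>C>0. \<forall>P\<ge>3. \<forall>Q\<ge>3.
    \<exists>(\<Theta> :: (real ^ 'd, 'd) neuron list) (\<Phi> :: (real ^ 'm ^ 'd, 'd) neuron list).
      length \<Theta> = P \<and> length \<Phi> = Q \<and>
      (\<forall>z0\<in>K. \<forall>u\<in>controls T M. \<exists>z y.
         is_the_solution T (controlled_field f G u) z0 z \<and>
         is_the_solution T (controlled_field (sa_node_f \<Theta>) (sa_node_G \<Phi>) u) z0 y \<and>
         (SUP t\<in>{0..T}. norm (z t - y t)) \<le> C * (1 / sqrt (real P) + 1 / sqrt (real Q)))"
proof -
  note T = assms(1) and M = assms(2) and Lf = assms(5) and LG = assms(6) and lf = assms(7) and k = assms(9)
  let ?n = "real CARD('d)" and ?m = "real CARD('m)"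
  have T0: "T \<ge> 0" using T by simp
  have n: "?n > 0" and m: "?m > 0" by simp_all
  have lG: "\<bar>(G x t - G y t) $ i $ j\<bar> \<le> L\<^sub>G * norm (x - y)" if "t \<in> {0..T}" for x y t i j
    by (rule order_trans[OF abs_entry_le_op_norm assms(8)[OF that]])
  have fc: "continuous_on (UNIV \<times> {0..T}) (\<lambda>p. f (fst p) (snd p))"
    by (rule continuous_on_lipschitz_fst[OF lf assms(3)])
  have gc: "continuous_on (UNIV \<times> {0..T}) (\<lambda>p. G (fst p) (snd p) $ i $ j)" for i j
  proof (rule continuous_on_lipschitz_fst)
    show "norm (G x t $ i $ j - G y t $ i $ j) \<le> L\<^sub>G * norm (x - y)" if "t \<in> {0..T}" for x y t
      using lG[OF that, of x y i j] by simp
    show "continuous_on {0..T} (\<lambda>t. G x t $ i $ j)" for x by (intro continuous_intros assms(4))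
  qed
  have "continuous_on (UNIV \<times> {0..T}) (\<lambda>p. \<chi> i j. G (fst p) (snd p) $ i $ j)"
    by (intro continuous_on_vec_lambda gc)
  then have Gc: "continuous_on (UNIV \<times> {0..T}) (\<lambda>p. G (fst p) (snd p))" by simp
  obtain Bf where Bf: "\<And>t. t \<in> {0..T} \<Longrightarrow> norm (f 0 t) \<le> Bf" using bounded_at_0[OF fc] by blast
  obtain Bg where Bg: "\<And>t. t \<in> {0..T} \<Longrightarrow> norm (G 0 t) \<le> Bg" using bounded_at_0[OF Gc] by blast
  have Bg': "\<bar>G 0 t $ i $ j\<bar> \<le> Bg" if "t \<in> {0..T}" for t i j
    by (rule order_trans[OF component_le_norm_cart order_trans[OF Finite_Cartesian_Product.norm_nth_le Bg[OF that]]])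
  define L where "L = L\<^sub>f + ?n * ?m * L\<^sub>G * M"
  define B where "B = Bf + ?n * ?m * Bg * M"
  have F: "carath T L B (controlled_field f G v)"
    if "v \<in> borel_measurable (lebesgue_on {0..T})" "\<And>t. norm (v t) \<le> M" for v
    unfolding L_def B_def by (rule carath_controlled_field[OF fc Gc lf lG Bf Bg' Lf LG M that])
  have L: "L > 0" using carathD(1)[OF F[of "\<lambda>_. 0"]] M by simp
  obtain K0 where K0: "\<And>x. x \<in> K \<Longrightarrow> norm x \<le> K0" using compact_imp_bounded[OF assms(12)] unfolding bounded_iff by blast
  \<comment> \<open>The a priori bound for exact trajectories starting in \<open>K\<close>, uniform
    over the controls; it fixes the ball for the approximation before any network is chosen.\<close>
  define R where "R = max 1 (K0 + 2 * (T * (\<bar>B\<bar> + L * \<bar>K0\<bar>)) * exp (2 * L * T))"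
  have R: "R \<ge> 1" by (simp add: R_def)
  have growth: "norm (z t) \<le> R"
    if v: "v \<in> borel_measurable (lebesgue_on {0..T})" "\<And>t. norm (v t) \<le> M" and z0: "z0 \<in> K" and z: "continuous_on {0..T} z"
      and zi: "\<And>t. t \<in> {0..T} \<Longrightarrow> z t = z0 + integral {0..t} (\<lambda>s. controlled_field f G v (z s) s)" and t: "t \<in> {0..T}" for v z0 z t
  proof -
    let ?F = "controlled_field f G v"
    have "norm (z t - z0) \<le> 2 * (T * (\<bar>B\<bar> + L * \<bar>K0\<bar>)) * exp (2 * L * T)"
    proof (rule carath_gronwall[where y = "\<lambda>_. z0" and h = "\<lambda>s. ?F (z s) s" and g = "\<lambda>_. 0", OF z])
      show "norm (?F (z t) t - 0) \<le> \<bar>B\<bar> + L * \<bar>K0\<bar> + L * norm (z t - z0)" if t: "t \<in> {0..T}" for t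
      proof -
        have "norm (?F (z t) t) \<le> B + L * norm (z t)" by (rule carath_growth[OF F[OF v] t])
        also have "norm (z t) \<le> norm z0 + norm (z t - z0)" by (rule norm_triangle_sub)
        also have "norm z0 \<le> \<bar>K0\<bar>" using K0[OF z0] by simp
        finally show ?thesis using L by (simp add: algebra_simps)
      qed
      show "(\<lambda>s. ?F (z s) s) integrable_on {0..T}" by (rule carathD(4)[OF F[OF v] z]) simp
      show "0 \<le> \<bar>B\<bar> + L * \<bar>K0\<bar>" using L by simp
    qed (use L zi t in auto)
    moreover have "norm (z t) \<le> norm z0 + norm (z t - z0)" by (rule norm_triangle_sub)
    ultimately show ?thesis using K0[OF z0] by (simp add: R_def)
  qed
  have "\<exists>D>0. \<forall>N. \<exists>xs. net R T D N (\<lambda>x t. f x t $ i) xs" for i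
    by (rule net_exists[OF T R k assms(10)]) (intro continuous_intros fc)
  from common_net_bound[of R T "\<lambda>i x t. f x t $ i", OF this]
  obtain Df where Df: "Df > 0" "\<And>i. \<forall>N. \<exists>xs. net R T Df N (\<lambda>x t. f x t $ i) xs" by blast
  have "\<exists>D>0. \<forall>N. \<exists>xs. net R T D N (\<lambda>x t. G x t $ fst p $ snd p) xs" for p
    by (rule net_exists[OF T R k assms(11) gc])
  from common_net_bound[of R T "\<lambda>p x t. G x t $ fst p $ snd p", OF this]
  obtain Dg where Dg: "Dg > 0" "\<forall>p N. \<exists>xs. net R T Dg N (\<lambda>x t. G x t $ fst p $ snd p) xs" by blast
  have Dg': "\<forall>N. \<exists>xs. net R T Dg N (\<lambda>x t. G x t $ i $ j) xs" for i j
    using Dg(2)[THEN spec[of _ "(i, j)"]] by simp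
  \<comment> \<open>A Lipschitz constant for the field of every network, whatever its widths, so
    that the exponential in Gronwall's bound is a constant.\<close>
  define \<Lambda> where "\<Lambda> = ?n * Df + ?n * ?m * Dg * M"
  \<comment> \<open>It dominates the coefficients of both \<open>1 / sqrt P\<close> and
    \<open>1 / sqrt Q\<close>, so one constant multiplies their sum.\<close>
  define E where "E = ?n * Df + ?n * ?m * (?m * Dg) * M"
  have \<Lambda>: "\<Lambda> > 0" unfolding \<Lambda>_def using n m Df(1) Dg(1) M by (intro add_pos_pos mult_pos_pos)
  have E: "E > 0" unfolding E_def using n m Df(1) Dg(1) M by (intro add_pos_pos mult_pos_pos)
  define C where "C = 2 * (T * E) * exp (2 * \<Lambda> * T)"
  have C: "C > 0" unfolding C_def using T E by simp
  show ?thesis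
  proof (intro exI[of _ C] conjI C allI impI)
    fix P Q :: nat assume P: "P \<ge> 3" and Q: "Q \<ge> 3"
    define e where "e = 1 / sqrt (real P) + 1 / sqrt (real Q)"
    have e0: "e \<ge> 0" by (simp add: e_def)
    have Q0: "Q > 0" using Q by simp
    obtain \<Theta> :: "(real ^ 'd, 'd) neuron list" where \<Theta>: "length \<Theta> = P"
      and \<Theta>l: "\<And>x y t. norm (sa_node_f \<Theta> x t - sa_node_f \<Theta> y t) \<le> ?n * Df * norm (x - y)"
      and \<Theta>e: "\<And>x t. norm x \<le> R \<Longrightarrow> t \<in> {0..T} \<Longrightarrow> norm (f x t - sa_node_f \<Theta> x t) \<le> ?n * (Df / sqrt (real P + 1))"
      and \<Theta>c: "continuous_on UNIV (\<lambda>p. sa_node_f \<Theta> (fst p) (snd p))"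
      by (rule sa_node_f_approx[OF Df(2)]) (rule that)
    obtain \<Phi> :: "(real ^ 'm ^ 'd, 'd) neuron list" where \<Phi>: "length \<Phi> = Q"
      and \<Phi>l: "\<And>x y t i j. \<bar>(sa_node_G \<Phi> x t - sa_node_G \<Phi> y t) $ i $ j\<bar> \<le> Dg * norm (x - y)"
      and \<Phi>e: "\<And>x t i j. norm x \<le> R \<Longrightarrow> t \<in> {0..T} \<Longrightarrow> \<bar>(G x t - sa_node_G \<Phi> x t) $ i $ j\<bar> \<le> ?m * Dg / sqrt (real Q)"
      and \<Phi>c: "continuous_on UNIV (\<lambda>p. sa_node_G \<Phi> (fst p) (snd p))"
      by (rule sa_node_G_approx[OF Dg' Dg(1) Q0]) (rule that)
    have \<Theta>c': "continuous_on (UNIV \<times> {0..T}) (\<lambda>p. sa_node_f \<Theta> (fst p) (snd p))"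
      and \<Phi>c': "continuous_on (UNIV \<times> {0..T}) (\<lambda>p. sa_node_G \<Phi> (fst p) (snd p))"
      by (rule continuous_on_subset[OF \<Theta>c] continuous_on_subset[OF \<Phi>c]; simp)+
    obtain Cf where Cf: "\<And>t. t \<in> {0..T} \<Longrightarrow> norm (sa_node_f \<Theta> 0 t) \<le> Cf" using bounded_at_0[OF \<Theta>c'] by blast
    obtain Cg where Cg: "\<And>t. t \<in> {0..T} \<Longrightarrow> norm (sa_node_G \<Phi> 0 t) \<le> Cg" using bounded_at_0[OF \<Phi>c'] by blast
    have Cg': "\<bar>sa_node_G \<Phi> 0 t $ i $ j\<bar> \<le> Cg" if "t \<in> {0..T}" for t i j
      by (rule order_trans[OF component_le_norm_cart order_trans[OF Finite_Cartesian_Product.norm_nth_le Cg[OF that]]])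
    have nf: "?n * Df > 0" using n Df(1) by simp
    have H: "carath T \<Lambda> (Cf + ?n * ?m * Cg * M) (controlled_field (sa_node_f \<Theta>) (sa_node_G \<Phi>) v)"
      if "v \<in> borel_measurable (lebesgue_on {0..T})" "\<And>t. norm (v t) \<le> M" for v
      unfolding \<Lambda>_def by (rule carath_controlled_field[OF \<Theta>c' \<Phi>c' \<Theta>l \<Phi>l Cf Cg' nf Dg(1) M that])
    have sol: "\<exists>z y. is_the_solution T (controlled_field f G u) z0 z \<and>
         is_the_solution T (controlled_field (sa_node_f \<Theta>) (sa_node_G \<Phi>) u) z0 y \<and>
         (SUP t\<in>{0..T}. norm (z t - y t)) \<le> C * e" if z0: "z0 \<in> K" and u: "u \<in> controls T M" for z0 u
    proof -
      \<comment> \<open>Solutions for \<open>u\<close> and for its bounded representative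
        \<open>v\<close> coincide; all estimates are made with \<open>v\<close>.\<close>
      obtain v where v: "v \<in> borel_measurable (lebesgue_on {0..T})" "\<And>t. norm (v t) \<le> M"
        and vu: "AE t in lebesgue_on {0..T}. v t = u t" by (rule truncated_control[OF u M]) (rule that)
      let ?F = "controlled_field f G v" and ?H = "controlled_field (sa_node_f \<Theta>) (sa_node_G \<Phi>) v"
      obtain z where z: "is_the_solution T ?F z0 z" "continuous_on {0..T} z" "z 0 = z0"
        and zi: "\<And>t. t \<in> {0..T} \<Longrightarrow> z t = z0 + integral {0..t} (\<lambda>s. ?F (z s) s)"
        by (rule carath_is_the_solution[OF F[OF v] T0]) (rule that)
      obtain y where y: "is_the_solution T ?H z0 y" "continuous_on {0..T} y" "y 0 = z0"
        and yi: "\<And>t. t \<in> {0..T} \<Longrightarrow> y t = z0 + integral {0..t} (\<lambda>s. ?H (y s) s)"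
        by (rule carath_is_the_solution[OF H[OF v] T0]) (rule that)
      have cong: "is_the_solution T (controlled_field h J v) z0 w \<longleftrightarrow> is_the_solution T (controlled_field h J u) z0 w"
        for h :: "real ^ 'd \<Rightarrow> real \<Rightarrow> real ^ 'd" and J :: "real ^ 'd \<Rightarrow> real \<Rightarrow> real ^ 'm ^ 'd" and w
      proof (rule is_the_solution_cong_AE)
        show "AE t in lebesgue_on {0..T}. \<forall>x. controlled_field h J v x t = controlled_field h J u x t"
          using vu by eventually_elim (simp add: controlled_field_def)
      qed
      have err: "norm (z t - y t) \<le> C * e" if t: "t \<in> {0..T}" for t
      proof -
        have "norm (z t - y t) \<le> 2 * (T * (E * e)) * exp (2 * \<Lambda> * T)"
        proof (rule carath_gronwall[OF z(2) y(2) \<Lambda> _ _ _ zi yi _ t])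
          show "0 \<le> E * e" using E e0 by simp
          show "(\<lambda>s. ?F (z s) s) integrable_on {0..T}" by (rule carathD(4)[OF F[OF v] z(2)]) simp
          show "(\<lambda>s. ?H (y s) s) integrable_on {0..T}" by (rule carathD(4)[OF H[OF v] y(2)]) simp
          show "norm (?F (z t) t - ?H (y t) t) \<le> E * e + \<Lambda> * norm (z t - y t)" if t: "t \<in> {0..T}" for t
          proof -
            \<comment> \<open>Only the exact trajectory has to stay in the ball: the fields are
              compared at \<open>z t\<close>, and the global Lipschitz bound of the network passes
              from \<open>z t\<close> to \<open>y t\<close>.\<close>
            have zR: "norm (z t) \<le> R" by (rule growth[OF v z0 z(2) zi t])
            have "norm (?F (z t) t - ?H (z t) t) \<le> ?n * (Df / sqrt (real P + 1)) + ?n * ?m * (?m * Dg / sqrt (real Q)) * M"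
              by (rule controlled_field_diff_le) (rule \<Theta>e[OF zR t] \<Phi>e[OF zR t] v(2))+
            also have "\<dots> \<le> (?n * Df) * (1 / sqrt (real P)) + (?n * ?m * (?m * Dg) * M) * (1 / sqrt (real Q))"
            proof -
              have "Df / sqrt (real P + 1) \<le> Df / sqrt (real P)"
                using P Df(1) by (intro divide_left_mono) auto
              then have "?n * (Df / sqrt (real P + 1)) \<le> ?n * (Df / sqrt (real P))" by (intro mult_left_mono) auto
              then show ?thesis by simp
            qed
            also have "\<dots> \<le> E * (1 / sqrt (real P)) + E * (1 / sqrt (real Q))"
              unfolding E_def using n m Df(1) Dg(1) M by (intro add_mono mult_right_mono) auto
            also have "\<dots> = E * e" by (simp add: e_def distrib_left)
            finally have 1: "norm (?F (z t) t - ?H (z t) t) \<le> E * e" .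
            have 2: "norm (?H (z t) t - ?H (y t) t) \<le> \<Lambda> * norm (z t - y t)" by (rule carathD(2)[OF H[OF v] t])
            show ?thesis by (rule norm_diff_triangle_le[OF 1 2])
          qed
        qed auto
        then show ?thesis by (simp add: C_def mult_ac)
      qed
      have "(SUP t\<in>{0..T}. norm (z t - y t)) \<le> C * e"
        using T0 err by (intro cSUP_least) auto
      then show ?thesis using z(1) y(1) cong by blast
    qed
    show "\<exists>(\<Theta> :: (real ^ 'd, 'd) neuron list) (\<Phi> :: (real ^ 'm ^ 'd, 'd) neuron list).
      length \<Theta> = P \<and> length \<Phi> = Q \<and>
      (\<forall>z0\<in>K. \<forall>u\<in>controls T M. \<exists>z y.
         is_the_solution T (controlled_field f G u) z0 z \<and>
         is_the_solution T (controlled_field (sa_node_f \<Theta>) (sa_node_G \<Phi>) u) z0 y \<and>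
         (SUP t\<in>{0..T}. norm (z t - y t)) \<le> C * (1 / sqrt (real P) + 1 / sqrt (real Q)))"
      using \<Theta> \<Phi> sol unfolding e_def by (intro exI[of _ \<Theta>] exI[of _ \<Phi>] conjI ballI)
  qed
qed

end
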